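(* Let $\rho\in\mathcal{P}(\Omega_{\mathrm{input}})$ be such that, under $\rho$, $(B,W)$ is a standard two-dimensional Wiener process with respect to the filtration $\mathbb{F}^{B,W,\mu}$. Then $\mathcal{R}^+(\rho)$ is convex and compact (in the weak topology of $\mathcal{P}(\Omega)$) and equals the closure of $\mathcal{R}_0(\rho)$. Moreover $\mathcal{R}^+(\rho)=\mathcal{R}(\rho)$.
   Context: Fix $T\in(0,\infty)$, $\mathcal{C}=C([0,T])$ with the sup norm; for Polish $E$, $\mathcal{P}(E)$ is the space of Borel probability measures with the weak topology. $\Omega_{\mathrm{input}}=\mathcal{C}^2\times\mathcal{P}(\mathcal{C}\times[0,T])$ and $\Omega=\Omega_{\mathrm{input}}\times[0,T]$, with canonical projections $(B,W,\mu,\tau)$. $\mathbb{F}^B,\mathbb{F}^W$ are the raw natural filtrations; $\mathcal{F}^\tau_t=\sigma\{\tau\wedge t\}$; on $\mathcal{C}\times[0,T]$, $\mathcal{F}^{W,\tau}_t$ is generated by $(w,s)\mapsto(w_{\cdot\wedge t},s\wedge t)$; $\mathcal{F}^\mu_t=\sigma\{\mu(C):C\in\mathcal{F}^{W,\tau}_t\}$; joint filtrations use combined superscripts, and $\mathcal{F}_{t+}=\bigcap_{s>t}\mathcal{F}_s$. Three sets of measures on $\Omega$, each consisting of $P\in\mathcal{P}(\Omega)$ whose $\Omega_{\mathrm{input}}$-marginal is $\rho$, and additionally: $\mathcal{R}^+(\rho)$: $\mathcal{F}^\tau_{t+}$ is conditionally independent of $(B,W,\mu)$ given $\mathcal{F}^{B,W,\mu}_{t+}$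 for every $t\in[0,T)$; $\mathcal{R}(\rho)$: $\mathcal{F}^\tau_t$ is conditionally independent of $(B,W,\mu)$ given $\mathcal{F}^{B,W,\mu}_t$ for every $t\in[0,T)$; $\mathcal{R}_0(\rho)$: $\tau$ is a stopping time relative to the $P$-completion of $\mathbb{F}^{B,W,\mu}$ and $\tau=\hat\tau(B,W,\mu)$ $P$-a.s. for some continuous $\hat\tau:\Omega_{\mathrm{input}}\to[0,T]$. *)

theory Defs
  imports "HOL-Analysis.Analysis" "HOL-Probability.Probability"
begin

type_synonym path = "real \<Rightarrow>\<^sub>C real"
type_synonym epnt = "path \<times> real"
type_synonym inpt = "path \<times> path \<times> epnt measure"
type_synonym opnt = "inpt \<times> real"

text \<open>C([0,T]) realised as bounded continuous functions on the reals that are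
  constant outside [0,T] (f r = f (clamp r)); the sup norm over the reals equals
  the sup norm over [0,T].\<close>
definition Cpaths :: "real \<Rightarrow> path set" where
  "Cpaths T = {f. \<forall>r. apply_bcontfun f r = apply_bcontfun f (max 0 (min T r))}"

definition Ctop :: "real \<Rightarrow> path topology" where
  "Ctop T = subtopology euclidean (Cpaths T)"

definition Itop :: "real \<Rightarrow> real topology" where
  "Itop T = subtopology euclideanreal {0..T}"

definition Etop :: "real \<Rightarrow> epnt topology" where
  "Etop T = prod_topology (Ctop T) (Itop T)"

definition borel_of :: "'a topology \<Rightarrow> 'a measure" where
  "borel_of X = sigma (topspace X) {U. openin X U}"

definition Pspace :: "'a topology \<Rightarrow> 'a measure set" where
  "Pspace X = space (prob_algebra (borel_of X))"

definition weak_top :: "'a topology \<Rightarrow> 'a measure topology" where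
  "weak_top X = topology_generated_by
     {{M \<in> Pspace X. (\<integral>x. f x \<partial>M) \<in> U} | f U.
        continuous_map X euclideanreal f \<and> bounded (f ` topspace X) \<and> open U}"

definition Intop :: "real \<Rightarrow> inpt topology" where
  "Intop T = prod_topology (Ctop T) (prod_topology (Ctop T) (weak_top (Etop T)))"

definition Omtop :: "real \<Rightarrow> opnt topology" where
  "Omtop T = prod_topology (Intop T) (Itop T)"

definition stopE :: "real \<Rightarrow> epnt \<Rightarrow> epnt" where
  "stopE t = (\<lambda>(w, s). (Bcontfun (\<lambda>r. apply_bcontfun w (min r t)), min s t))"

definition FWtau :: "real \<Rightarrow> real \<Rightarrow> epnt set set" where
  "FWtau T t = {stopE t -` A \<inter> topspace (Etop T) | A. A \<in> sets (borel_of (Etop T))}"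

definition FBWmu :: "real \<Rightarrow> real \<Rightarrow> inpt set set" where
  "FBWmu T t = sigma_sets (topspace (Intop T))
     ({{x \<in> topspace (Intop T). apply_bcontfun (fst x) r \<in> U} | r U. r \<in> {0..t} \<and> U \<in> sets borel}
    \<union> {{x \<in> topspace (Intop T). apply_bcontfun (fst (snd x)) r \<in> U} | r U. r \<in> {0..t} \<and> U \<in> sets borel}
    \<union> {{x \<in> topspace (Intop T). measure (snd (snd x)) C \<in> U} | C U. C \<in> FWtau T t \<and> U \<in> sets borel})"

definition liftF :: "real \<Rightarrow> inpt set set \<Rightarrow> opnt set set" where
  "liftF T G = {fst -` A \<inter> topspace (Omtop T) | A. A \<in> G}"

definition FBWmu_plus :: "real \<Rightarrow> real \<Rightarrow> inpt set set" where
  "FBWmu_plus T t = (\<Inter>s\<in>{t<..T}. FBWmu T s)"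

definition Ftau :: "real \<Rightarrow> real \<Rightarrow> opnt set set" where
  "Ftau T t = {{\<omega> \<in> topspace (Omtop T). min (snd \<omega>) t \<in> U} | U. U \<in> sets borel}"

definition Ftau_plus :: "real \<Rightarrow> real \<Rightarrow> opnt set set" where
  "Ftau_plus T t = (\<Inter>s\<in>{t<..T}. Ftau T s)"

definition Finput :: "real \<Rightarrow> opnt set set" where
  "Finput T = liftF T (sets (borel_of (Intop T)))"

definition cond_indep :: "'a measure \<Rightarrow> 'a set set \<Rightarrow> 'a set set \<Rightarrow> 'a set set \<Rightarrow> bool" where
  "cond_indep P F1 F2 G \<longleftrightarrow>
     (\<forall>A\<in>F1. \<forall>C\<in>F2. AE \<omega> in P.
        real_cond_exp P (sigma (space P) G) (indicator (A \<inter> C)) \<omega> =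
        real_cond_exp P (sigma (space P) G) (indicator A) \<omega> *
        real_cond_exp P (sigma (space P) G) (indicator C) \<omega>)"

definition has_marginal :: "real \<Rightarrow> inpt measure \<Rightarrow> opnt measure \<Rightarrow> bool" where
  "has_marginal T \<rho> P \<longleftrightarrow> P \<in> Pspace (Omtop T) \<and> distr P (borel_of (Intop T)) fst = \<rho>"

definition Rplus :: "real \<Rightarrow> inpt measure \<Rightarrow> opnt measure set" where
  "Rplus T \<rho> = {P. has_marginal T \<rho> P \<and>
     (\<forall>t\<in>{0..<T}. cond_indep P (Ftau_plus T t) (Finput T) (liftF T (FBWmu_plus T t)))}"

definition Rset :: "real \<Rightarrow> inpt measure \<Rightarrow> opnt measure set" where
  "Rset T \<rho> = {P. has_marginal T \<rho> P \<and>
     (\<forall>t\<in>{0..<T}. cond_indep P (Ftau T t) (Finput T) (liftF T (FBWmu T t)))}"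

text \<open>tau is a stopping time of the P-augmentation of F^{B,W,mu}: each {tau <= t}
  differs from a set of F_t by a subset of a P-null set.\<close>
definition stopping_completed :: "real \<Rightarrow> opnt measure \<Rightarrow> bool" where
  "stopping_completed T P \<longleftrightarrow> (\<forall>t\<in>{0..T}. \<exists>A\<in>liftF T (FBWmu T t). \<exists>N\<in>null_sets P.
      ({\<omega> \<in> space P. snd \<omega> \<le> t} - A) \<union> (A - {\<omega> \<in> space P. snd \<omega> \<le> t}) \<subseteq> N)"

definition R0 :: "real \<Rightarrow> inpt measure \<Rightarrow> opnt measure set" where
  "R0 T \<rho> = {P. has_marginal T \<rho> P \<and> stopping_completed T P \<and>
     (\<exists>th. continuous_map (Intop T) (Itop T) th \<and> (AE \<omega> in P. snd \<omega> = th (fst \<omega>)))}"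

definition gauss :: "real \<Rightarrow> real set \<Rightarrow> real" where
  "gauss v U = measure (density lborel (normal_density 0 (sqrt v))) U"

definition wiener2 :: "real \<Rightarrow> inpt measure \<Rightarrow> bool" where
  "wiener2 T \<rho> \<longleftrightarrow>
     (AE x in \<rho>. apply_bcontfun (fst x) 0 = 0 \<and> apply_bcontfun (fst (snd x)) 0 = 0) \<and>
     (\<forall>s t. 0 \<le> s \<and> s < t \<and> t \<le> T \<longrightarrow>
       (\<forall>A\<in>FBWmu T s. \<forall>U V. U \<in> sets borel \<and> V \<in> sets borel \<longrightarrow>
          measure \<rho> (A \<inter> {x \<in> space \<rho>.
              apply_bcontfun (fst x) t - apply_bcontfun (fst x) s \<in> U \<and>
              apply_bcontfun (fst (snd x)) t - apply_bcontfun (fst (snd x)) s \<in> V})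
          = measure \<rho> A * gauss (t - s) U * gauss (t - s) V))"

definition mix :: "real \<Rightarrow> 'a measure \<Rightarrow> 'a measure \<Rightarrow> 'a measure" where
  "mix p P Q = measure_of (space P) (sets P)
      (\<lambda>A. ennreal p * emeasure P A + ennreal (1 - p) * emeasure Q A)"

definition convex_meas :: "'a measure set \<Rightarrow> bool" where
  "convex_meas S \<longleftrightarrow> (\<forall>P\<in>S. \<forall>Q\<in>S. \<forall>p\<in>{0..1}. mix p P Q \<in> S)"

end

theory Submission
  imports Defs
begin

text \<open>A measure \<open>P\<close> with first marginal \<open>\<rho>\<close> is determined by the densities \<open>k\<^sub>q\<close> with
  \<open>P (C \<times> {\<tau> < q}) = \<integral>\<^sub>C k\<^sub>q d\<rho>\<close>, and membership of \<open>P\<close> in \<open>\<R>(\<rho>)\<close> means that \<open>k\<^sub>q\<close> has an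
  \<open>\<F>\<^sub>q\<close>-measurable version for every \<open>q\<close>. Since \<open>{\<tau> \<le> t}\<close> is the limit of \<open>{\<tau> < s}\<close> as
  \<open>s\<close> decreases to \<open>t\<close>, and \<open>{\<tau> < q}\<close> is the union of the events
  \<open>{\<tau> \<le> s}\<close> with \<open>s < q\<close>, passing to right limits of both filtrations changes nothing.

  Compactness: the set functions \<open>(C, q) \<mapsto> P (C \<times> {\<tau> < q})\<close> form a closed subset of a cube, and
  \<open>P\<close> depends continuously on them. Closedness of \<open>\<R>(\<rho>)\<close> follows by testing the
  conditional independence against continuous functions of \<open>\<tau> \<and> t\<close>.

  Density of \<open>\<R>\<^sub>0(\<rho>)\<close>: a randomised rule on the grid \<open>k T / n\<close> stops once an independent uniform
  variable \<open>U\<close> lies below an adapted threshold. Thresholds are approximated by continuous adapted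
  functions and the indicator by a ramp, which keeps the stopping rule continuous. Finally \<open>U\<close> is
  replaced by transformed increments of \<open>B\<close> over shrinking intervals in \<open>(0, T / n]\<close>;
  they are uniform, observable at the first grid point, and by Bessel's inequality
  asymptotically independent of everything else.\<close>

text \<open>All measures in play share the first marginal \<rho>. A function that is only measurable
  in the input can therefore serve as a test function, provided that time is handled on a grid: a
  continuous f(x, s) is replaced by a telescoping sum over the points k T / n, with an error, the
  integrated oscillation of f in s, that depends on \<rho> and not on the coupling. This one
  estimate yields the continuous dependence on the densities, the identification of a coupling with
  its kernel, and the convergence of the grid rules. In the density part a rule has to be continuous
  in the input and adapted to the raw filtration at once, although \<mu>(C) is not continuous in
  \<mu>. Two devices reconcile these demands: each sigma-algebra of the filtration is generated by
  continuous adapted functionals, among them integrals of stopped continuous functions, and the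
  thresholds are spaced by the width of the ramp, so that at most one ramp is active at a time. No
  rule stops before T / n; this keeps an initial interval free in which B supplies the randomness,
  and there the Wiener property enters.\<close>

section \<open>Borel sets, bounded continuous functions and the weak topology\<close>

lemma space_borel_of [simp]: "space (borel_of X) = topspace X"
  unfolding borel_of_def by (simp add: space_measure_of_conv)

lemma sets_borel_of: "sets (borel_of X) = sigma_sets (topspace X) {U. openin X U}"
  unfolding borel_of_def by (rule sets_measure_of) (auto dest: openin_subset)

lemma openin_borel_of: "openin X U \<Longrightarrow> U \<in> sets (borel_of X)"
  by (simp add: sets_borel_of sigma_sets.Basic)

lemma closedin_borel_of:
  assumes "closedin X U" shows "U \<in> sets (borel_of X)"
proof -
  have "topspace X - (topspace X - U) \<in> sets (borel_of X)"
    using assms by (metis closedin_def openin_borel_of sets.compl_sets space_borel_of)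
  moreover have "topspace X - (topspace X - U) = U" using closedin_subset[OF assms] by blast
  ultimately show ?thesis by simp
qed

lemma continuous_map_measurable_borel_of:
  assumes "continuous_map X Y f" shows "f \<in> measurable (borel_of X) (borel_of Y)"
proof (rule measurable_sigma_sets[OF sets_borel_of])
  show "{U. openin Y U} \<subseteq> Pow (topspace Y)" by (auto dest: openin_subset)
  show "f \<in> space (borel_of X) \<rightarrow> topspace Y" using assms by (auto simp: continuous_map_def)
  show "f -` A \<inter> space (borel_of X) \<in> sets (borel_of X)" if "A \<in> {U. openin Y U}" for A
    using assms that by (auto simp: continuous_map_alt intro!: openin_borel_of)
qed

lemma continuous_map_borel_measurable:
  fixes f :: "'a \<Rightarrow> 'b::topological_space"
  assumes "continuous_map X euclidean f" shows "f \<in> borel_measurable (borel_of X)"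
proof (rule borel_measurableI)
  fix S :: "'b set" assume "open S"
  then show "f -` S \<inter> space (borel_of X) \<in> sets (borel_of X)"
    using assms by (auto simp: continuous_map_alt intro!: openin_borel_of)
qed

lemma Pspace_iff: "M \<in> Pspace X \<longleftrightarrow> prob_space M \<and> sets M = sets (borel_of X)"
  unfolding Pspace_def by (auto simp: space_prob_algebra)

lemma space_Pspace: "M \<in> Pspace X \<Longrightarrow> space M = topspace X"
  using sets_eq_imp_space_eq[of M "borel_of X"] by (simp add: Pspace_iff)

definition Cb :: "'a topology \<Rightarrow> ('a \<Rightarrow> real) set" where
  "Cb X = {f. continuous_map X euclideanreal f \<and> bounded (f ` topspace X)}"

lemma Cb_obtain_bound:
  assumes "f \<in> Cb X" obtains B where "0 < B" "\<And>x. x \<in> topspace X \<Longrightarrow> \<bar>f x\<bar> \<le> B"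
  using assms bounded_pos[of "f ` topspace X"] by (auto simp: Cb_def)

lemma CbI:
  assumes "continuous_map X euclideanreal f" "\<And>x. x \<in> topspace X \<Longrightarrow> \<bar>f x\<bar> \<le> B"
  shows "f \<in> Cb X"
  using assms by (auto simp: Cb_def bounded_iff)

lemma Pspace_borel_measurable:
  "M \<in> Pspace X \<Longrightarrow> borel_measurable M = borel_measurable (borel_of X)"
  by (rule measurable_cong_sets) (auto simp: Pspace_iff)

lemma Pspace_integrable_bounded:
  fixes f :: "'a \<Rightarrow> real"
  assumes "M \<in> Pspace X" "f \<in> borel_measurable (borel_of X)" "\<And>x. x \<in> topspace X \<Longrightarrow> \<bar>f x\<bar> \<le> B"
  shows "integrable M f"
proof -
  interpret prob_space M using assms by (simp add: Pspace_iff)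
  show ?thesis
    by (rule integrable_const_bound[where B=B])
       (use assms space_Pspace[OF assms(1)] Pspace_borel_measurable[OF assms(1)] in auto)
qed

lemma Pspace_integrable_Cb:
  assumes "M \<in> Pspace X" "f \<in> Cb X"
  shows "integrable M f"
  using Cb_obtain_bound[OF assms(2)] Pspace_integrable_bounded[OF assms(1)] assms(2)
  by (metis (no_types, lifting) Cb_def continuous_map_borel_measurable mem_Collect_eq)

lemma topspace_weak_top [simp]: "topspace (weak_top X) = Pspace X"
proof -
  have "{M \<in> Pspace X. (\<integral>x. (\<lambda>_. 0::real) x \<partial>M) \<in> UNIV} \<in> {{M \<in> Pspace X. (\<integral>x. f x \<partial>M) \<in> U} | f U.
        continuous_map X euclideanreal f \<and> bounded (f ` topspace X) \<and> open U}"
    by (intro CollectI exI conjI) (auto simp: image_def bounded_def)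
  then show ?thesis unfolding weak_top_def topology_generated_by_topspace by blast
qed

lemma continuous_map_weak_integral:
  assumes "f \<in> Cb X" shows "continuous_map (weak_top X) euclideanreal (\<lambda>M. \<integral>x. f x \<partial>M)"
  unfolding continuous_map_alt
proof (intro conjI strip)
  fix U :: "real set" assume "openin euclidean U"
  then have "openin (weak_top X) {M \<in> Pspace X. (\<integral>x. f x \<partial>M) \<in> U}"
    unfolding weak_top_def using assms
    by (intro topology_generated_by_Basis) (auto simp: Cb_def)
  moreover have "(\<lambda>M. \<integral>x. f x \<partial>M) -` U \<inter> topspace (weak_top X) = {M \<in> Pspace X. (\<integral>x. f x \<partial>M) \<in> U}" by auto
  ultimately show "openin (weak_top X) ((\<lambda>M. \<integral>x. f x \<partial>M) -` U \<inter> topspace (weak_top X))" by simp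
qed auto

lemma continuous_map_into_weak_top:
  assumes "\<And>x. x \<in> topspace Y \<Longrightarrow> g x \<in> Pspace X"
    and "\<And>f. f \<in> Cb X \<Longrightarrow> continuous_map Y euclideanreal (\<lambda>y. \<integral>x. f x \<partial>g y)"
  shows "continuous_map Y (weak_top X) g"
  unfolding weak_top_def continuous_on_generated_topo_iff
proof (intro conjI allI impI)
  fix U assume "U \<in> {{M \<in> Pspace X. (\<integral>x. f x \<partial>M) \<in> U} | f U.
        continuous_map X euclideanreal f \<and> bounded (f ` topspace X) \<and> open U}"
  then obtain f V where f: "f \<in> Cb X" "open V" and U: "U = {M \<in> Pspace X. (\<integral>x. f x \<partial>M) \<in> V}"
    by (auto simp: Cb_def)
  have "openin Y ((\<lambda>y. \<integral>x. f x \<partial>g y) -` V \<inter> topspace Y)"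
    using assms(2)[OF f(1)] f(2) by (auto simp: continuous_map_alt)
  moreover have "(\<lambda>y. \<integral>x. f x \<partial>g y) -` V \<inter> topspace Y = g -` U \<inter> topspace Y"
    using assms(1) U by auto
  ultimately show "openin Y (g -` U \<inter> topspace Y)" by simp
next
  show "g ` topspace Y \<subseteq> \<Union> {{M \<in> Pspace X. (\<integral>x. f x \<partial>M) \<in> U} | f U.
        continuous_map X euclideanreal f \<and> bounded (f ` topspace X) \<and> open U}"
    using assms(1) topspace_weak_top[of X] unfolding weak_top_def topology_generated_by_topspace by auto
qed

lemma limitin_weak_topI:
  assumes "P \<in> Pspace X" "\<And>m. Q m \<in> Pspace X"
    and "\<And>f. f \<in> Cb X \<Longrightarrow> (\<lambda>m. \<integral>x. f x \<partial>Q m) \<longlonglongrightarrow> (\<integral>x. f x \<partial>P)"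
  shows "limitin (weak_top X) Q P sequentially"
  unfolding limitin_def
proof (intro conjI allI impI)
  show "P \<in> topspace (weak_top X)" using assms by simp
  fix U assume U: "openin (weak_top X) U \<and> P \<in> U"
  have "generate_topology_on {{M \<in> Pspace X. (\<integral>x. f x \<partial>M) \<in> U} | f U.
        continuous_map X euclideanreal f \<and> bounded (f ` topspace X) \<and> open U} U"
    using U unfolding weak_top_def by (simp add: openin_topology_generated_by)
  then show "\<forall>\<^sub>F m in sequentially. Q m \<in> U" using conjunct2[OF U]
  proof induction
    case (Int a b) then show ?case by (auto intro: eventually_conj)
  next
    case (UN K)
    then obtain k where k: "k \<in> K" "P \<in> k" by auto
    show ?case by (rule eventually_mono[OF UN(2)[OF k]]) (use k in auto)
  next
    case (Basis s)
    then obtain f V where f: "f \<in> Cb X" "open V" and s: "s = {M \<in> Pspace X. (\<integral>x. f x \<partial>M) \<in> V}"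
      by (auto simp: Cb_def)
    have "\<forall>\<^sub>F m in sequentially. (\<integral>x. f x \<partial>Q m) \<in> V"
      using topological_tendstoD[OF assms(3)[OF f(1)] f(2)] Basis s by auto
    then show ?case by (rule eventually_mono) (use assms s in auto)
  qed auto
qed

text \<open>The approximants are only asked to lie in the closure, so that limits can be chained:
  graphs of continuous rules approximate ramps with an independent uniform variable, these
  approximate step rules, and step rules approximate the given measure.\<close>

lemma weak_top_closure_sequentially:
  assumes "P \<in> Pspace X" "\<And>m. Q m \<in> (weak_top X) closure_of S"
    and "\<And>f. f \<in> Cb X \<Longrightarrow> (\<lambda>m. \<integral>x. f x \<partial>Q m) \<longlonglongrightarrow> (\<integral>x. f x \<partial>P)"
  shows "P \<in> (weak_top X) closure_of S"
proof -
  have "\<And>m. Q m \<in> Pspace X" using assms(2) closure_of_subset_topspace[of "weak_top X" S] by auto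
  then have "limitin (weak_top X) Q P sequentially" using assms by (intro limitin_weak_topI) auto
  then have "P \<in> (weak_top X) closure_of ((weak_top X) closure_of S)"
    using assms(2) unfolding limitin_def in_closure_of eventually_sequentially by (meson order_refl)
  then show ?thesis by simp
qed

subsection \<open>Topologies pulled back from a metric type\<close>

text \<open>States that \<open>X\<close> carries the initial topology of \<open>e\<close>. Since
  \<open>e\<close> takes values in a metric type, this is pseudometrisability for topologies, such
  as the weak one, that do not belong to a type class.\<close>

definition pullback_map :: "'a topology \<Rightarrow> ('a \<Rightarrow> 'b::metric_space) \<Rightarrow> bool" where
  "pullback_map X e \<longleftrightarrow> continuous_map X euclidean e \<and>
     (\<forall>U x. openin X U \<and> x \<in> U \<longrightarrow> (\<exists>W. open W \<and> e x \<in> W \<and> topspace X \<inter> e -` W \<subseteq> U))"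

lemma pullback_map_id: "pullback_map (subtopology euclidean S) (id :: 'a::metric_space \<Rightarrow> 'a)"
  unfolding pullback_map_def by (auto simp: openin_subtopology intro: continuous_map_from_subtopology)

lemma pullback_map_prod:
  fixes e :: "'a \<Rightarrow> 'c::metric_space" and e' :: "'b \<Rightarrow> 'd::metric_space"
  assumes "pullback_map X e" "pullback_map Y e'"
  shows "pullback_map (prod_topology X Y) (map_prod e e')"
  unfolding pullback_map_def
proof (intro conjI allI impI)
  have "continuous_map (prod_topology X Y) (prod_topology euclidean euclidean) (\<lambda>p. (e (fst p), e' (snd p)))"
    using assms unfolding pullback_map_def
    by (intro continuous_map_pairedI continuous_map_compose[OF continuous_map_fst, unfolded o_def]
        continuous_map_compose[OF continuous_map_snd, unfolded o_def]) auto
  then show "continuous_map (prod_topology X Y) euclidean (map_prod e e')"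
    by (simp add: map_prod_def case_prod_unfold)
  fix U p assume U: "openin (prod_topology X Y) U \<and> p \<in> U"
  obtain x y where p: "p = (x, y)" by force
  then obtain V1 V2 where V: "openin X V1" "openin Y V2" "x \<in> V1" "y \<in> V2" "V1 \<times> V2 \<subseteq> U"
    using U unfolding openin_prod_topology_alt by blast
  obtain W1 where W1: "open W1" "e x \<in> W1" "topspace X \<inter> e -` W1 \<subseteq> V1"
    using assms(1) V unfolding pullback_map_def by blast
  obtain W2 where W2: "open W2" "e' y \<in> W2" "topspace Y \<inter> e' -` W2 \<subseteq> V2"
    using assms(2) V unfolding pullback_map_def by blast
  have "topspace (prod_topology X Y) \<inter> map_prod e e' -` (W1 \<times> W2) \<subseteq> V1 \<times> V2" using W1 W2 by auto
  then show "\<exists>W. open W \<and> map_prod e e' p \<in> W \<and> topspace (prod_topology X Y) \<inter> map_prod e e' -` W \<subseteq> U"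
    by (intro exI[of _ "W1 \<times> W2"]) (use W1 W2 V p in \<open>auto intro!: open_Times simp del: topspace_prod_topology\<close>)
qed

text \<open>Perfect normality in functional form. It makes the Borel sets those generated by
  continuous functions, which is what uniqueness of measures and L1 density of continuous functions
  rest on.\<close>

definition cozero_space :: "'a topology \<Rightarrow> bool" where
  "cozero_space X \<longleftrightarrow> (\<forall>U. openin X U \<longrightarrow> (\<exists>f. continuous_map X euclideanreal f \<and>
     (\<forall>x\<in>topspace X. 0 \<le> f x \<and> f x \<le> 1 \<and> (0 < f x \<longleftrightarrow> x \<in> U))))"

lemma pullback_map_imp_cozero_space:
  fixes e :: "'a \<Rightarrow> 'b::metric_space"
  assumes "pullback_map X e"
  shows "cozero_space X"
  unfolding cozero_space_def
proof (intro allI impI)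
  fix U assume U: "openin X U"
  \<comment> \<open>The largest open set whose preimage lies in \<open>U\<close>; on the carrier its
    preimage is all of \<open>U\<close>.\<close>
  define W where "W = \<Union>{W. open W \<and> topspace X \<inter> e -` W \<subseteq> U}"
  have oW: "open W" unfolding W_def by auto
  have UW: "x \<in> U \<longleftrightarrow> e x \<in> W" if "x \<in> topspace X" for x
    using assms U that unfolding pullback_map_def W_def by blast
  \<comment> \<open>\<open>infdist\<close> to the empty set is 0 by convention, so the case of an
    empty complement is set apart.\<close>
  define f where "f y = (if W = UNIV then 1 else min 1 (infdist y (- W)))" for y
  have "continuous_on UNIV f" unfolding f_def
    by (cases "W = UNIV") (auto intro!: continuous_intros)
  then have c: "continuous_map X euclideanreal (f \<circ> e)"
    using assms unfolding pullback_map_def by (intro continuous_map_compose) auto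
  have f: "0 \<le> f y \<and> f y \<le> 1 \<and> (0 < f y \<longleftrightarrow> y \<in> W)" for y
  proof (cases "W = UNIV")
    case False
    then have "- W \<noteq> {}" by auto
    then have "infdist y (- W) = 0 \<longleftrightarrow> y \<in> - W"
      using oW by (subst in_closed_iff_infdist_zero) auto
    then show ?thesis using False infdist_nonneg[of y "-W"] by (auto simp: f_def)
  qed (auto simp: f_def)
  show "\<exists>f. continuous_map X euclideanreal f \<and>
     (\<forall>x\<in>topspace X. 0 \<le> f x \<and> f x \<le> 1 \<and> (0 < f x \<longleftrightarrow> x \<in> U))"
    by (rule exI[of _ "f \<circ> e"]) (use c f UW in auto)
qed

text \<open>If \<open>U\<close> is the cozero set of f, then min 1 (n f) increases to the indicator
  of \<open>U\<close>. Integrals of \<open>Cb\<close> functions thus fix the measure of every open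
  set, and the open sets are a generator stable under intersection.\<close>

lemma measure_eq_of_Cb:
  assumes X: "cozero_space X" and P: "P \<in> Pspace X" and Q: "Q \<in> Pspace X"
    and eq: "\<And>f. f \<in> Cb X \<Longrightarrow> (\<integral>x. f x \<partial>P) = (\<integral>x. f x \<partial>Q)"
  shows "P = Q"
proof -
  interpret P: prob_space P using P by (simp add: Pspace_iff)
  interpret Q: prob_space Q using Q by (simp add: Pspace_iff)
  have sp: "space P = topspace X" "space Q = topspace X" using P Q space_Pspace by blast+
  have openm: "measure P U = measure Q U" if U: "openin X U" for U
  proof -
    obtain f where f: "continuous_map X euclideanreal f"
      "\<And>x. x \<in> topspace X \<Longrightarrow> 0 \<le> f x \<and> f x \<le> 1 \<and> (0 < f x \<longleftrightarrow> x \<in> U)"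
      using X U unfolding cozero_space_def by metis
    define g where "g n x = min 1 (real n * f x)" for n x
    have bd: "\<bar>g n x\<bar> \<le> 1" if "x \<in> topspace X" for n x
      using f(2)[OF that] by (simp add: g_def abs_le_iff)
    have gC: "g n \<in> Cb X" for n
      by (rule CbI[where B=1])
         (use f bd in \<open>auto intro!: continuous_map_real_min continuous_map_real_mult simp: g_def[abs_def]\<close>)
    have lim: "(\<lambda>n. g n x) \<longlonglongrightarrow> indicator U x" if "x \<in> topspace X" for x
    proof (cases "x \<in> U")
      case True
      then have "0 < f x" using f that by blast
      then obtain N where N: "1 < real N * f x" using reals_Archimedean3 by blast
      have "\<forall>\<^sub>F n in sequentially. g n x = 1"
      proof (rule eventually_sequentiallyI[of N])
        fix n assume "N \<le> n"
        then have "real N * f x \<le> real n * f x" using \<open>0 < f x\<close> by simp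
        then show "g n x = 1" using N by (simp add: g_def)
      qed
      then show ?thesis using True by (simp add: tendsto_eventually)
    next
      case False
      then have "f x = 0" using f(2)[OF that] by auto
      then show ?thesis using False by (simp add: g_def)
    qed
    have "(\<lambda>n. \<integral>x. g n x \<partial>M) \<longlonglongrightarrow> (\<integral>x. indicator U x \<partial>M)" if M: "M \<in> Pspace X" for M
    proof (rule integral_dominated_convergence[where w="\<lambda>_. 1"])
      interpret M: prob_space M using M by (simp add: Pspace_iff)
      show "integrable M (\<lambda>_. 1::real)" by simp
      have "U \<in> sets M" using openin_borel_of[OF U] M by (simp add: Pspace_iff)
      then show "indicator U \<in> borel_measurable M" by simp
      show "g n \<in> borel_measurable M" for n
        using gC[of n] Pspace_borel_measurable[OF M] by (auto simp: Cb_def intro: continuous_map_borel_measurable)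
      show "AE x in M. (\<lambda>i. g i x) \<longlonglongrightarrow> indicat_real U x" using lim space_Pspace[OF M] by auto
      show "AE x in M. norm (g i x) \<le> 1" for i using bd space_Pspace[OF M] by auto
    qed
    from LIMSEQ_unique[OF this[OF P]] this[OF Q] eq[OF gC]
    have "(\<integral>x. indicator U x \<partial>P) = (\<integral>x. indicat_real U x \<partial>Q)" by auto
    then show ?thesis using U openin_borel_of[OF U] P Q by (simp add: Pspace_iff)
  qed
  show ?thesis
  proof (rule measure_eqI_generator_eq[where E="{U. openin X U}" and \<Omega>="topspace X" and A="\<lambda>_. topspace X"])
    show "Int_stable {U. openin X U}" by (auto simp: Int_stable_def)
    show "{U. openin X U} \<subseteq> Pow (topspace X)" by (auto dest: openin_subset)
    show "\<And>U. U \<in> {U. openin X U} \<Longrightarrow> emeasure P U = emeasure Q U"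
      using openm by (auto simp: P.emeasure_eq_measure Q.emeasure_eq_measure)
  qed (use P Q in \<open>auto simp: Pspace_iff sets_borel_of P.emeasure_eq_measure\<close>)
qed

subsection \<open>Staircase approximation and density of continuous functions\<close>

text \<open>For 0 \<le> y \<le> 1 and N > 0 this is floor(N y) / N, written as an average of
  indicators of superlevel sets, so that its integral is a linear expression in the measures of
  these sets.\<close>

definition stair :: "nat \<Rightarrow> real \<Rightarrow> real" where
  "stair N y = (\<Sum>i=1..N. (1 / real N) * of_bool (real i / real N \<le> y))"

lemma stair_approx:
  assumes "0 < N" "0 \<le> y" "y \<le> 1"
  shows "stair N y \<le> y" "y - 1 / real N \<le> stair N y"
proof -
  define k where "k = nat \<lfloor>real N * y\<rfloor>"
  have k1: "real k \<le> real N * y" unfolding k_def using assms by simp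
  have k2: "real N * y < real k + 1" unfolding k_def using assms by simp
  have kN: "k \<le> N"
  proof -
    have "real N * y \<le> real N" using assms by (simp add: mult_left_le)
    then show ?thesis using k1 by linarith
  qed
  have iff: "real i / real N \<le> y \<longleftrightarrow> i \<le> k" for i
  proof -
    have "real i / real N \<le> y \<longleftrightarrow> real i \<le> real N * y" using assms by (simp add: field_simps)
    also have "\<dots> \<longleftrightarrow> i \<le> k" using k1 k2 by (smt (verit) of_nat_1 of_nat_add of_nat_le_iff Suc_eq_plus1 not_less_eq_eq of_nat_less_iff)
    finally show ?thesis .
  qed
  have "stair N y = (\<Sum>i=1..N. (1 / real N) * of_bool (i \<le> k))" unfolding stair_def iff ..
  also have "\<dots> = (\<Sum>i=1..k. 1 / real N)"
    by (rule sum.mono_neutral_cong_right) (use kN in auto)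
  also have "\<dots> = real k / real N" by simp
  finally have eq: "stair N y = real k / real N" .
  show "stair N y \<le> y" using k1 assms unfolding eq by (simp add: field_simps)
  have "y \<le> (real k + 1) / real N" using k2 assms by (simp add: pos_le_divide_eq mult.commute)
  then show "y - 1 / real N \<le> stair N y" unfolding eq by (simp add: add_divide_distrib)
qed

lemma stair_nonneg: "0 \<le> stair N y"
  unfolding stair_def by (auto intro!: sum_nonneg)

lemma stair_tendsto:
  assumes "0 \<le> y" "y \<le> 1"
  shows "(\<lambda>N. stair N y) \<longlonglongrightarrow> y"
proof (rule real_tendsto_sandwich[where f="\<lambda>N. y - 1 / real N" and h="\<lambda>_. y"])
  show "\<forall>\<^sub>F n in sequentially. y - 1 / real n \<le> stair n y"
    using eventually_gt_at_top[of 0] by (rule eventually_mono) (use stair_approx assms in auto)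
  show "\<forall>\<^sub>F n in sequentially. stair n y \<le> y"
    using eventually_gt_at_top[of 0] by (rule eventually_mono) (use stair_approx assms in auto)
  show "(\<lambda>N. y - 1 / real N) \<longlonglongrightarrow> y" by (auto intro!: tendsto_eq_intros lim_1_over_n)
qed simp

text \<open>\<open>M\<close> is meant to be a sigma-algebra of the filtration, smaller than the
  Borel one; the members are continuous and adapted at the same time.\<close>

definition cont01 :: "'a topology \<Rightarrow> 'a measure \<Rightarrow> ('a \<Rightarrow> real) set" where
  "cont01 X M = {f. continuous_map X euclideanreal f \<and> f \<in> borel_measurable M \<and>
      (\<forall>x\<in>topspace X. 0 \<le> f x \<and> f x \<le> 1)}"

text \<open>The condition on \<open>M\<close> under which adapted continuous functions are dense in
  L1: the generating functions are continuous and already \<open>M\<close>-measurable.\<close>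

definition cont_generated :: "'a topology \<Rightarrow> 'a measure \<Rightarrow> bool" where
  "cont_generated X M \<longleftrightarrow> space M = topspace X \<and> sets M = sigma_sets (topspace X)
     {{x \<in> topspace X. a < \<phi> x} | a \<phi>. continuous_map X euclideanreal \<phi> \<and> \<phi> \<in> borel_measurable M}"

lemma cozero_space_cont_generated:
  assumes "cozero_space X" "sets M = sets (borel_of X)"
  shows "cont_generated X M"
proof -
  have sp: "space M = topspace X" using sets_eq_imp_space_eq[OF assms(2)] by simp
  have bm: "borel_measurable M = borel_measurable (borel_of X)" by (rule measurable_cong_sets) (use assms in auto)
  have "sets M = sigma_sets (topspace X)
     {{x \<in> topspace X. a < \<phi> x} | a \<phi>. continuous_map X euclideanreal \<phi> \<and> \<phi> \<in> borel_measurable M}" (is "_ = sigma_sets _ ?G")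
  proof
    have "{U. openin X U} \<subseteq> ?G"
    proof clarify
      fix U assume U: "openin X U"
      then obtain f where f: "continuous_map X euclideanreal f"
        "\<And>x. x \<in> topspace X \<Longrightarrow> (0 < f x \<longleftrightarrow> x \<in> U)"
        using assms(1) unfolding cozero_space_def by metis
      then have "U = {x \<in> topspace X. 0 < f x}" using openin_subset[OF U] by auto
      then show "\<exists>a \<phi>. U = {x \<in> topspace X. a < \<phi> x} \<and> continuous_map X euclideanreal \<phi> \<and> \<phi> \<in> borel_measurable M"
        using f(1) continuous_map_borel_measurable[OF f(1)] bm by auto
    qed
    then show "sets M \<subseteq> sigma_sets (topspace X) ?G"
      unfolding assms(2) sets_borel_of by (rule sigma_sets_mono')
    have "?G \<subseteq> sets M"
    proof clarify
      fix a :: real and \<phi> assume "continuous_map X euclideanreal \<phi>" and [measurable]: "\<phi> \<in> borel_measurable M"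
      have "{x \<in> space M. a < \<phi> x} \<in> sets M" by measurable
      then show "{x \<in> topspace X. a < \<phi> x} \<in> sets M" by (simp add: sp)
    qed
    then show "sigma_sets (topspace X) ?G \<subseteq> sets M"
      using sets.sigma_sets_subset[of ?G M] by (simp add: sp)
  qed
  then show ?thesis using sp by (simp add: cont_generated_def)
qed

text \<open>The sets whose indicator is an L1 limit of \<open>cont01\<close> functions form a
  sigma-algebra: 1 - f serves for complements, the maximum for finite unions, continuity of the
  measure for countable ones. Steeper and steeper ramps reach the generators.\<close>

lemma cont01_dense_indicator:
  assumes rho: "\<rho> \<in> Pspace X" and sub: "subalgebra \<rho> M" and gen: "cont_generated X M" and A: "A \<in> sets M"
    and e: "0 < (e::real)"
  shows "\<exists>f\<in>cont01 X M. (\<integral>x. \<bar>f x - indicator A x\<bar> \<partial>\<rho>) < e"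
proof -
  interpret prob_space \<rho> using rho by (simp add: Pspace_iff)
  have sp: "space \<rho> = topspace X" "space M = topspace X" using space_Pspace[OF rho] sub by (auto simp: subalgebra_def)
  have Mr: "f \<in> borel_measurable \<rho>" if "f \<in> borel_measurable M" for f :: "'a \<Rightarrow> real"
    using measurable_from_subalg[OF sub that] .
  have setsr: "A \<in> sets \<rho>" if "A \<in> sets M" for A using sub that by (auto simp: subalgebra_def)
  have int: "integrable \<rho> (\<lambda>x. \<bar>f x - indicator A x\<bar>)" if "f \<in> cont01 X M" "A \<in> sets M" for f A
  proof (rule integrable_const_bound[where B=1])
    have [measurable]: "f \<in> borel_measurable \<rho>" "A \<in> sets \<rho>" using Mr[of f] setsr[of A] that unfolding cont01_def by blast+
    show "(\<lambda>x. \<bar>f x - indicator A x\<bar>) \<in> borel_measurable \<rho>" by measurable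
    show "AE x in \<rho>. norm \<bar>f x - indicator A x\<bar> \<le> 1"
      by (rule AE_I2) (use that sp in \<open>auto simp: cont01_def indicator_def\<close>)
  qed
  have union2: "\<exists>f\<in>cont01 X M. (\<integral>x. \<bar>f x - indicator (A \<union> B) x\<bar> \<partial>\<rho>) < a + b"
    if "f \<in> cont01 X M" "(\<integral>x. \<bar>f x - indicator A x\<bar> \<partial>\<rho>) < a" "A \<in> sets M"
       "g \<in> cont01 X M" "(\<integral>x. \<bar>g x - indicator B x\<bar> \<partial>\<rho>) < b" "B \<in> sets M" for A B f g a b
  proof (rule bexI[where x="\<lambda>x. max (f x) (g x)"])
    show m: "(\<lambda>x. max (f x) (g x)) \<in> cont01 X M"
      using that by (auto simp: cont01_def max_def intro!: continuous_map_real_max[unfolded max_def])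
    have "(\<integral>x. \<bar>max (f x) (g x) - indicator (A \<union> B) x\<bar> \<partial>\<rho>) \<le> (\<integral>x. \<bar>f x - indicator A x\<bar> + \<bar>g x - indicator B x\<bar> \<partial>\<rho>)"
    proof (rule integral_mono)
      show "integrable \<rho> (\<lambda>x. \<bar>max (f x) (g x) - indicator (A \<union> B) x\<bar>)"
        using int[OF m] that by auto
      show "integrable \<rho> (\<lambda>x. \<bar>f x - indicator A x\<bar> + \<bar>g x - indicator B x\<bar>)" using int that by auto
      show "\<bar>max (f x) (g x) - indicator (A \<union> B) x\<bar> \<le> \<bar>f x - indicator A x\<bar> + \<bar>g x - indicator B x\<bar>"
        if "x \<in> space \<rho>" for x
        using \<open>f \<in> _\<close> \<open>g \<in> _\<close> that sp by (auto simp: cont01_def indicator_def max_def)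
    qed
    also have "\<dots> = (\<integral>x. \<bar>f x - indicator A x\<bar> \<partial>\<rho>) + (\<integral>x. \<bar>g x - indicator B x\<bar> \<partial>\<rho>)"
      using int that by auto
    finally show "(\<integral>x. \<bar>max (f x) (g x) - indicator (A \<union> B) x\<bar> \<partial>\<rho>) < a + b" using that by linarith
  qed
  let ?G = "{{x \<in> topspace X. a < \<phi> x} | a \<phi>. continuous_map X euclideanreal \<phi> \<and> \<phi> \<in> borel_measurable M}"
  have "A \<in> sigma_sets (topspace X) ?G" using A gen by (simp add: cont_generated_def)
  then have "\<forall>e>0. \<exists>f\<in>cont01 X M. (\<integral>x. \<bar>f x - indicator A x\<bar> \<partial>\<rho>) < e"
  proof induction
    case (Basic A)
    then obtain a \<phi> where A: "A = {x \<in> topspace X. a < \<phi> x}" and \<phi>: "continuous_map X euclideanreal \<phi>" "\<phi> \<in> borel_measurable M" by auto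
    define f where "f n x = min 1 (max 0 (real n * (\<phi> x - a)))" for n x
    have fH: "f n \<in> cont01 X M" for n
      using \<phi> unfolding cont01_def f_def
      by (auto intro!: continuous_map_real_max continuous_map_real_min continuous_map_real_mult continuous_map_diff)
    have AM: "A \<in> sets M"
    proof -
      note \<phi>(2)[measurable]
      have "{x \<in> space M. a < \<phi> x} \<in> sets M" by measurable
      then show ?thesis by (simp add: sp A)
    qed
    have "(\<lambda>n. \<integral>x. \<bar>f n x - indicator A x\<bar> \<partial>\<rho>) \<longlonglongrightarrow> (\<integral>x. 0 \<partial>\<rho>)"
    proof (rule integral_dominated_convergence[where w="\<lambda>_. 1"])
      show "AE x in \<rho>. (\<lambda>i. \<bar>f i x - indicator A x\<bar>) \<longlonglongrightarrow> 0"
      proof (rule AE_I2)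
        fix x assume x: "x \<in> space \<rho>"
        show "(\<lambda>i. \<bar>f i x - indicator A x\<bar>) \<longlonglongrightarrow> 0"
        proof (cases "a < \<phi> x")
          case True
          then obtain N where N: "1 < real N * (\<phi> x - a)" using reals_Archimedean3[of "\<phi> x - a"] by auto
          have "\<forall>\<^sub>F n in sequentially. \<bar>f n x - indicator A x\<bar> = 0"
          proof (rule eventually_sequentiallyI[of N])
            fix n assume "N \<le> n"
            then have "real N * (\<phi> x - a) \<le> real n * (\<phi> x - a)" using True by simp
            then have "1 \<le> real n * (\<phi> x - a)" using N by linarith
            then show "\<bar>f n x - indicator A x\<bar> = 0" using True x sp by (simp add: f_def A min_def)
          qed
          then show ?thesis by (simp add: tendsto_eventually)
        next
          case False
          then have le: "real n * (\<phi> x - a) \<le> 0" for n by (simp add: mult_nonneg_nonpos)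
          then have "f n x = 0" for n using le[of n] by (simp add: f_def)
          then show ?thesis using False by (simp add: A)
        qed
      qed
      show "AE x in \<rho>. norm \<bar>f i x - indicator A x\<bar> \<le> 1" for i
        by (rule AE_I2) (use fH[of i] sp in \<open>auto simp: cont01_def indicator_def\<close>)
    qed (use int[OF fH AM] in \<open>auto intro: borel_measurable_integrable\<close>)
    then have L: "(\<lambda>n. \<integral>x. \<bar>f n x - indicator A x\<bar> \<partial>\<rho>) \<longlonglongrightarrow> 0" by simp
    show ?case
    proof (intro allI impI)
      fix e :: real assume "0 < e"
      from order_tendstoD(2)[OF L this] obtain n where "(\<integral>x. \<bar>f n x - indicator A x\<bar> \<partial>\<rho>) < e"
        by (auto simp: eventually_sequentially)
      then show "\<exists>f\<in>cont01 X M. (\<integral>x. \<bar>f x - indicator A x\<bar> \<partial>\<rho>) < e" using fH by blast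
    qed
  next
    case Empty
    show ?case by (intro allI impI bexI[where x="\<lambda>_. 0"]) (auto simp: cont01_def)
  next
    case (Compl A)
    show ?case
    proof (intro allI impI)
      fix e :: real assume "0 < e"
      then obtain f where f: "f \<in> cont01 X M" "(\<integral>x. \<bar>f x - indicator A x\<bar> \<partial>\<rho>) < e" using Compl by blast
      have "(\<integral>x. \<bar>(1 - f x) - indicator (topspace X - A) x\<bar> \<partial>\<rho>) = (\<integral>x. \<bar>f x - indicator A x\<bar> \<partial>\<rho>)"
        by (rule Bochner_Integration.integral_cong) (use sp in \<open>auto simp: indicator_def\<close>)
      then show "\<exists>f\<in>cont01 X M. (\<integral>x. \<bar>f x - indicator (topspace X - A) x\<bar> \<partial>\<rho>) < e"
        by (intro bexI[where x="\<lambda>x. 1 - f x"]) (use f in \<open>auto simp: cont01_def intro!: continuous_map_diff\<close>)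
    qed
  next
    case (Union A)
    have AM: "A i \<in> sets M" for i using Union(1) gen by (simp add: cont_generated_def)
    have fin: "\<forall>e>0. \<exists>f\<in>cont01 X M. (\<integral>x. \<bar>f x - indicator (\<Union>i<n. A i) x\<bar> \<partial>\<rho>) < e" for n
    proof (induction n)
      case 0
      show ?case by (intro allI impI bexI[where x="\<lambda>_. 0"]) (auto simp: cont01_def)
    next
      case (Suc n)
      show ?case
      proof (intro allI impI)
        fix e :: real assume "0 < e"
        then have "0 < e/2" by simp
        obtain f where f: "f \<in> cont01 X M" "(\<integral>x. \<bar>f x - indicator (\<Union>i<n. A i) x\<bar> \<partial>\<rho>) < e/2" using Suc \<open>0 < e/2\<close> by blast
        obtain g where g: "g \<in> cont01 X M" "(\<integral>x. \<bar>g x - indicator (A n) x\<bar> \<partial>\<rho>) < e/2" using Union(2) \<open>0 < e/2\<close> by blast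
        have "(\<Union>i<n. A i) \<union> A n = (\<Union>i<Suc n. A i)" by (auto simp: lessThan_Suc)
        then show "\<exists>f\<in>cont01 X M. (\<integral>x. \<bar>f x - indicator (\<Union>i<Suc n. A i) x\<bar> \<partial>\<rho>) < e"
          using union2[OF f _ g] AM by auto
      qed
    qed
    show ?case
    proof (intro allI impI)
      fix e :: real assume "0 < e"
      have "(\<lambda>n. measure \<rho> (\<Union>i<n. A i)) \<longlonglongrightarrow> measure \<rho> (\<Union>n. \<Union>i<n. A i)"
        by (rule finite_Lim_measure_incseq) (use AM setsr in \<open>auto simp: incseq_def intro!: sets.finite_UN\<close>, meson order_less_le_trans lessThan_iff)
      moreover have "(\<Union>n. \<Union>i<n. A i) = (\<Union>i. A i)" by auto
      ultimately have "\<forall>\<^sub>F n in sequentially. measure \<rho> (\<Union>i. A i) - e/2 < measure \<rho> (\<Union>i<n. A i)"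
        using \<open>0 < e\<close> by (intro order_tendstoD(1)) auto
      then obtain n where n: "measure \<rho> (\<Union>i. A i) - e/2 < measure \<rho> (\<Union>i<n. A i)"
        by (auto simp: eventually_sequentially)
      have s: "(\<Union>i. A i) \<in> sets M" "(\<Union>i<n. A i) \<in> sets M" using AM by auto
      obtain f where f: "f \<in> cont01 X M" "(\<integral>x. \<bar>f x - indicator (\<Union>i<n. A i) x\<bar> \<partial>\<rho>) < e/2" using fin \<open>0 < e\<close> by (meson half_gt_zero)
      have d: "measure \<rho> ((\<Union>i. A i) - (\<Union>i<n. A i)) = measure \<rho> (\<Union>i. A i) - measure \<rho> (\<Union>i<n. A i)"
        by (rule finite_measure_Diff) (use s setsr in auto)
      have "(\<integral>x. \<bar>f x - indicator (\<Union>i. A i) x\<bar> \<partial>\<rho>) \<le> (\<integral>x. \<bar>f x - indicator (\<Union>i<n. A i) x\<bar> + indicator ((\<Union>i. A i) - (\<Union>i<n. A i)) x \<partial>\<rho>)"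
      proof (rule integral_mono)
        have "(\<Union>i. A i) - (\<Union>i<n. A i) \<in> sets \<rho>" using s setsr by auto
        then have "integrable \<rho> (indicat_real ((\<Union>i. A i) - (\<Union>i<n. A i)))" by (simp add: emeasure_eq_measure)
        then show "integrable \<rho> (\<lambda>x. \<bar>f x - indicator (\<Union>i<n. A i) x\<bar> + indicator ((\<Union>i. A i) - (\<Union>i<n. A i)) x)"
          by (intro Bochner_Integration.integrable_add int[OF f(1) s(2)])
      qed (use int[OF f(1) s(1)] in \<open>auto simp: indicator_def\<close>)
      also have "\<dots> = (\<integral>x. \<bar>f x - indicator (\<Union>i<n. A i) x\<bar> \<partial>\<rho>) + measure \<rho> ((\<Union>i. A i) - (\<Union>i<n. A i))"
        using int[OF f(1) s(2)] s setsr by (auto simp: emeasure_eq_measure)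
      finally show "\<exists>f\<in>cont01 X M. (\<integral>x. \<bar>f x - indicator (\<Union> (range A)) x\<bar> \<partial>\<rho>) < e"
        using f n d by (intro bexI[of _ f]) auto
    qed
  qed
  then show ?thesis using e by blast
qed

text \<open>A staircase reduces \<open>k\<close> to its superlevel sets, whose indicators are
  approximated separately. One tolerance e/2 serves all levels, since the weights 1/N add up to 1;
  the other half of e pays for the staircase.\<close>

lemma cont01_dense:
  assumes rho: "\<rho> \<in> Pspace X" and sub: "subalgebra \<rho> M" and gen: "cont_generated X M"
    and k: "k \<in> borel_measurable M" "\<And>x. x \<in> topspace X \<Longrightarrow> 0 \<le> k x \<and> k x \<le> 1" and e: "0 < (e::real)"
  shows "\<exists>f\<in>cont01 X M. (\<integral>x. \<bar>f x - k x\<bar> \<partial>\<rho>) < e"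
proof -
  interpret prob_space \<rho> using rho by (simp add: Pspace_iff)
  have sp: "space \<rho> = topspace X" "space M = topspace X" using space_Pspace[OF rho] sub by (auto simp: subalgebra_def)
  have setsr: "A \<in> sets \<rho>" if "A \<in> sets M" for A using sub that by (auto simp: subalgebra_def)
  obtain N :: nat where N: "0 < N" "1 / real N < e/2"
    using e by (metis half_gt_zero nat_approx_posE zero_less_Suc)
  define A where "A i = {x \<in> topspace X. real i / real N \<le> k x}" for i
  have AM: "A i \<in> sets M" for i
  proof -
    note k(1)[measurable]
    have "{x \<in> space M. real i / real N \<le> k x} \<in> sets M" by measurable
    then show ?thesis by (simp add: sp A_def)
  qed
  have "\<exists>f\<in>cont01 X M. (\<integral>x. \<bar>f x - indicator (A i) x\<bar> \<partial>\<rho>) < e/2" for i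
    by (rule cont01_dense_indicator[OF rho sub gen AM]) (use e in simp)
  then obtain f where f: "\<And>i. f i \<in> cont01 X M" "\<And>i. (\<integral>x. \<bar>f i x - indicator (A i) x\<bar> \<partial>\<rho>) < e/2" by metis
  define g where "g x = (\<Sum>i=1..N. (1 / real N) * f i x)" for x
  have gH: "g \<in> cont01 X M"
  proof -
    have "g x \<le> (\<Sum>i=1..N. (1 / real N) * 1)" if "x \<in> topspace X" for x
      unfolding g_def using f(1) that by (intro sum_mono mult_left_mono) (auto simp: cont01_def)
    moreover have "g \<in> borel_measurable M" unfolding g_def using f(1)
      by (intro borel_measurable_sum borel_measurable_times) (auto simp: cont01_def)
    moreover have "continuous_map X euclideanreal g" unfolding g_def using f(1)
      by (intro continuous_map_sum continuous_map_real_mult) (auto simp: cont01_def)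
    moreover have "0 \<le> g x" if "x \<in> topspace X" for x
      unfolding g_def using f(1) that by (intro sum_nonneg mult_nonneg_nonneg) (auto simp: cont01_def)
    ultimately show ?thesis using N by (simp add: cont01_def)
  qed
  have mf: "f i \<in> borel_measurable \<rho>" for i using f(1)[of i] measurable_from_subalg[OF sub] by (auto simp: cont01_def)
  have int: "integrable \<rho> (\<lambda>x. \<bar>f i x - indicator (A i) x\<bar>)" for i
  proof (rule integrable_const_bound[where B=1])
    note mf[measurable]
    have [measurable]: "A i \<in> sets \<rho>" using setsr AM by blast
    show "(\<lambda>x. \<bar>f i x - indicator (A i) x\<bar>) \<in> borel_measurable \<rho>" by measurable
    show "AE x in \<rho>. norm \<bar>f i x - indicator (A i) x\<bar> \<le> 1"
      by (rule AE_I2) (use f(1)[of i] sp in \<open>auto simp: cont01_def indicator_def\<close>)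
  qed
  have mk: "k \<in> borel_measurable \<rho>" using measurable_from_subalg[OF sub k(1)] .
  have mg: "g \<in> borel_measurable \<rho>" using measurable_from_subalg[OF sub] gH by (auto simp: cont01_def)
  have pt: "\<bar>g x - k x\<bar> \<le> (\<Sum>i=1..N. (1 / real N) * \<bar>f i x - indicator (A i) x\<bar>) + 1 / real N" if "x \<in> topspace X" for x
  proof -
    have "stair N (k x) = (\<Sum>i=1..N. (1 / real N) * indicator (A i) x)"
      unfolding stair_def A_def using that by (auto intro!: sum.cong simp: indicator_def)
    then have "g x - stair N (k x) = (\<Sum>i=1..N. (1 / real N) * (f i x - indicator (A i) x))"
      by (simp add: g_def sum_subtractf[symmetric] right_diff_distrib)
    then have "\<bar>g x - stair N (k x)\<bar> \<le> (\<Sum>i=1..N. (1 / real N) * \<bar>f i x - indicator (A i) x\<bar>)"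
      by (simp add: sum_abs[THEN order_trans] abs_mult)
    then show ?thesis using stair_approx[OF N(1), of "k x"] k(2)[OF that] by linarith
  qed
  have "(\<integral>x. \<bar>g x - k x\<bar> \<partial>\<rho>) \<le> (\<integral>x. (\<Sum>i=1..N. (1 / real N) * \<bar>f i x - indicator (A i) x\<bar>) + 1 / real N \<partial>\<rho>)"
  proof (rule integral_mono)
    show "integrable \<rho> (\<lambda>x. \<bar>g x - k x\<bar>)"
    proof (rule integrable_const_bound[where B=1])
      show "AE x in \<rho>. norm \<bar>g x - k x\<bar> \<le> 1"
        by (rule AE_I2) (use sp k(2) gH in \<open>force simp: cont01_def abs_le_iff\<close>)
    qed (use mk mg in measurable)
    show "integrable \<rho> (\<lambda>x. (\<Sum>i=1..N. (1 / real N) * \<bar>f i x - indicator (A i) x\<bar>) + 1 / real N)"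
      using int by (intro Bochner_Integration.integrable_add Bochner_Integration.integrable_sum integrable_mult_right) auto
  qed (use pt sp in auto)
  also have "\<dots> = (\<Sum>i=1..N. (1 / real N) * (\<integral>x. \<bar>f i x - indicator (A i) x\<bar> \<partial>\<rho>)) + 1 / real N"
    using int by (subst Bochner_Integration.integral_add) (auto simp: prob_space)
  also have "\<dots> \<le> (\<Sum>i=1..N. (1 / real N) * (e/2)) + 1 / real N"
    using f(2) by (intro add_right_mono sum_mono mult_left_mono) (auto simp: less_imp_le)
  also have "\<dots> = e/2 + 1 / real N" using N by simp
  also have "\<dots> < e" using N by simp
  finally show ?thesis using gH by blast
qed

section \<open>Separability of the path space\<close>

lemma clamp_bcontfun:
  fixes h :: "real \<Rightarrow> real"
  assumes "0 \<le> T" "continuous_on {0..T} h"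
  shows "(\<lambda>r. h (max 0 (min T r))) \<in> bcontfun"
proof -
  have "continuous_on UNIV (\<lambda>r. h (max 0 (min T r)))"
    by (rule continuous_on_compose2[OF assms(2)]) (use assms in \<open>auto intro!: continuous_intros\<close>)
  moreover have "bounded (range (\<lambda>r. h (max 0 (min T r))))"
  proof (rule bounded_subset)
    show "bounded (h ` {0..T})" using assms(2) compact_continuous_image compact_imp_bounded by blast
    show "range (\<lambda>r. h (max 0 (min T r))) \<subseteq> h ` {0..T}" using assms by auto
  qed
  ultimately show ?thesis by (simp add: bcontfun_def)
qed

text \<open>The countable dense set consists of Bernstein polynomials with rational coefficients,
  frozen outside [0, T] so that they are elements of \<open>Cpaths T\<close>.\<close>

lemma Cpaths_separable:
  assumes T: "0 < T"
  shows "\<exists>D. countable D \<and> D \<subseteq> Cpaths T \<and> (\<forall>f\<in>Cpaths T. \<forall>e>0. \<exists>d\<in>D. dist f d < e)"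
proof -
  define p where "p n q r = (\<Sum>k\<le>n. q ! k * Bernstein n k (r / T))" for n and q :: "real list" and r
  define pc where "pc n q r = p n q (max 0 (min T r))" for n q r
  have pb: "pc n q \<in> bcontfun" for n q unfolding pc_def
    by (rule clamp_bcontfun) (use T in \<open>auto simp: p_def Bernstein_def intro!: continuous_intros\<close>)
  define D where "D = (\<lambda>(n, q). Bcontfun (pc n q)) ` (UNIV \<times> lists \<rat>)"
  show ?thesis
  proof (intro exI[of _ D] conjI ballI allI impI)
    show "countable D" unfolding D_def by (intro countable_image countable_SIGMA countable_lists countable_rat) auto
    have idem: "max 0 (min T (max 0 (min T r))) = max 0 (min T r)" for r using T by auto
    show "D \<subseteq> Cpaths T"
    proof
      fix d assume "d \<in> D"
      then obtain n q where d: "d = Bcontfun (pc n q)" by (auto simp: D_def)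
      have "apply_bcontfun d r = apply_bcontfun d (max 0 (min T r))" for r
        unfolding d Bcontfun_inverse[OF pb] by (simp only: pc_def idem)
      then show "d \<in> Cpaths T" unfolding Cpaths_def by blast
    qed
    fix f e assume f: "f \<in> Cpaths T" and e: "(0::real) < e"
    \<comment> \<open>Bernstein polynomials live on [0, 1], hence the change of time scale.\<close>
    define F where "F x = f (T * x)" for x
    have "continuous_on {0..1} F" unfolding F_def
      by (rule continuous_on_compose2[where t=UNIV and g="apply_bcontfun f"]) (auto intro!: continuous_intros)
    moreover have "0 < e/3" using e by simp
    ultimately have "\<exists>N. \<forall>n x. N \<le> n \<and> x \<in> {0..1} \<longrightarrow> \<bar>F x - (\<Sum>k\<le>n. F (k/n) * Bernstein n k x)\<bar> < e/3"
      by (rule Bernstein_Weierstrass)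
    then obtain n where n: "\<And>x. x \<in> {0..1} \<Longrightarrow> \<bar>F x - (\<Sum>k\<le>n. F (k/n) * Bernstein n k x)\<bar> < e/3"
      by (meson order_refl)
    have "\<exists>q\<in>\<rat>. \<bar>q - F (k/n)\<bar> < e/3" for k :: nat
    proof -
      obtain q where "q \<in> \<rat>" "F (k/n) - e/3 < q" "q < F (k/n) + e/3"
        using Rats_dense_in_real[of "F (k/n) - e/3" "F (k/n) + e/3"] e by auto
      then have "\<bar>q - F (k/n)\<bar> < e/3" by linarith
      then show ?thesis using \<open>q \<in> \<rat>\<close> by blast
    qed
    then obtain q where q: "\<And>k. q k \<in> \<rat>" "\<And>k :: nat. \<bar>q k - F (k/n)\<bar> < e/3" by metis
    define qs where "qs = map q [0..<Suc n]"
    have "(n, qs) \<in> UNIV \<times> lists \<rat>" using q by (auto simp: qs_def)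
    then have "Bcontfun (pc n qs) \<in> D" unfolding D_def by force
    moreover have "dist f (Bcontfun (pc n qs)) \<le> 2 * e / 3"
    proof (rule dist_bound)
      fix r
      define x where "x = max 0 (min T r) / T"
      have x: "x \<in> {0..1}" using T by (auto simp: x_def field_simps max_def min_def)
      have "f r = f (max 0 (min T r))" using f unfolding Cpaths_def by blast
      then have fx: "f r = F x" using T by (simp add: F_def x_def)
      have "pc n qs r = (\<Sum>k\<le>n. q k * Bernstein n k x)"
        unfolding pc_def p_def x_def by (rule sum.cong) (auto simp: qs_def nth_map simp del: upt_Suc)
      then have "\<bar>(\<Sum>k\<le>n. F (k/n) * Bernstein n k x) - pc n qs r\<bar> = \<bar>\<Sum>k\<le>n. (F (k/n) - q k) * Bernstein n k x\<bar>"
        by (simp add: sum_subtractf[symmetric] left_diff_distrib)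
      also have "\<dots> \<le> (\<Sum>k\<le>n. \<bar>(F (k/n) - q k) * Bernstein n k x\<bar>)" by (rule sum_abs)
      \<comment> \<open>The Bernstein basis is nonnegative with sum 1, so moving every coefficient
        by at most e/3 moves the polynomial by at most e/3.\<close>
      also have "\<dots> \<le> (\<Sum>k\<le>n. e/3 * Bernstein n k x)"
      proof (rule sum_mono)
        fix k
        have "\<bar>F (k/n) - q k\<bar> \<le> e/3" using q(2)[of k] by linarith
        then show "\<bar>(F (k/n) - q k) * Bernstein n k x\<bar> \<le> e/3 * Bernstein n k x"
          using mult_right_mono[OF _ Bernstein_nonneg[of x n k], of "\<bar>F (k/n) - q k\<bar>" "e/3"] Bernstein_nonneg[of x n k] x
          by (simp add: abs_mult)
      qed
      also have "\<dots> = e/3" by (simp only: sum_distrib_left[symmetric] sum_Bernstein mult_1_right)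
      finally have "\<bar>F x - pc n qs r\<bar> \<le> 2 * e / 3" using n[OF x] by linarith
      then show "dist (f r) (Bcontfun (pc n qs) r) \<le> 2 * e / 3"
        using pb fx by (simp add: Bcontfun_inverse dist_real_def)
    qed
    ultimately show "\<exists>d\<in>D. dist f d < e" using e by (intro bexI[of _ "Bcontfun (pc n qs)"]) auto
  qed
qed

subsection \<open>The weak topology is countably generated\<close>

text \<open>A cone of height q that vanishes at distance 1/n from its tip d; for n = 0 it
  degenerates to the constant q.\<close>

definition bump :: "real \<times> nat \<times> 'a::metric_space \<Rightarrow> 'a \<Rightarrow> real" where
  "bump = (\<lambda>(q, n, d) x. q * max 0 (1 - real n * dist x d))"

text \<open>The finite families are lists, so that there are countably many of them over a countable
  set of cones; starting from 0 keeps the maximum nonnegative.\<close>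

definition maxbump :: "(real \<times> nat \<times> 'a::metric_space) list \<Rightarrow> 'a \<Rightarrow> real" where
  "maxbump L x = foldr (\<lambda>b y. max (bump b x) y) L 0"

lemma maxbump_nonneg: "0 \<le> maxbump L x"
  by (induction L) (auto simp: maxbump_def)

lemma maxbump_le_iff: "maxbump L x \<le> y \<longleftrightarrow> 0 \<le> y \<and> (\<forall>b\<in>set L. bump b x \<le> y)"
  by (induction L) (auto simp: maxbump_def)

lemma continuous_on_bump [continuous_intros]: "continuous_on UNIV (bump b)"
  by (auto simp: bump_def case_prod_unfold intro!: continuous_intros)

lemma continuous_on_maxbump: "continuous_on UNIV (maxbump L)"
proof (induction L)
  case (Cons b L)
  have "maxbump (b # L) = (\<lambda>x. max (bump b x) (maxbump L x))" by (auto simp: maxbump_def)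
  then show ?case using Cons by (auto intro!: continuous_intros)
qed (auto simp: maxbump_def)

lemma bump_le: "0 \<le> fst b \<Longrightarrow> bump b x \<le> fst b"
  by (cases b) (auto simp: bump_def intro!: mult_left_le)

lemma maxbump_bounded:
  assumes "\<And>b. b \<in> set L \<Longrightarrow> 0 \<le> fst b" shows "maxbump L x \<le> (\<Sum>b\<leftarrow>L. fst b)"
  using assms
proof (induction L)
  case (Cons b L)
  have "maxbump (b # L) x = max (bump b x) (maxbump L x)" by (auto simp: maxbump_def)
  moreover have "0 \<le> fst b" using Cons by simp
  moreover from this have "bump b x \<le> fst b" by (rule bump_le)
  moreover have "maxbump L x \<le> (\<Sum>b\<leftarrow>L. fst b)" "0 \<le> maxbump L x" using Cons maxbump_nonneg by auto
  ultimately show ?case by auto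
qed (simp add: maxbump_def)

definition bumps :: "'a set \<Rightarrow> (real \<times> nat \<times> 'a::metric_space) set" where
  "bumps D = {q \<in> \<rat>. 0 \<le> q} \<times> UNIV \<times> D"

lemma maxbump_Cb:
  assumes "L \<in> lists (bumps D)" shows "maxbump L \<in> Cb (subtopology euclidean S)"
proof (rule CbI)
  show "continuous_map (subtopology euclidean S) euclideanreal (maxbump L)"
    using continuous_on_maxbump[of L] by (auto intro: continuous_on_subset)
  show "\<bar>maxbump L x\<bar> \<le> (\<Sum>b\<leftarrow>L. fst b)" for x
    using maxbump_nonneg[of L x] maxbump_bounded[of L x] assms by (force simp: bumps_def lists_eq_set)
qed

text \<open>A continuous nonnegative function is at each point the supremum of the countably many
  cones below it: choose the height strictly between \<open>a\<close> and \<open>g x\<close>, and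
  make the cone narrow enough to live where \<open>g\<close> exceeds that height.\<close>

lemma exists_bump_below:
  fixes g :: "'a::metric_space \<Rightarrow> real"
  assumes D: "D \<subseteq> S" "\<And>x e. x \<in> S \<Longrightarrow> 0 < e \<Longrightarrow> \<exists>d\<in>D. dist x d < e"
    and g: "continuous_on S g" "\<And>x. x \<in> S \<Longrightarrow> 0 \<le> g x" and x: "x \<in> S" and a: "0 \<le> a" "a < g x"
  shows "\<exists>b\<in>bumps D. a < bump b x \<and> (\<forall>y\<in>S. bump b y \<le> g y)"
proof -
  obtain q where q: "q \<in> \<rat>" "a < q" "q < g x" using Rats_dense_in_real[OF a(2)] by auto
  obtain \<delta> where \<delta>: "0 < \<delta>" "\<And>y. y \<in> S \<Longrightarrow> dist y x < \<delta> \<Longrightarrow> dist (g y) (g x) < g x - q"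
    using g(1) x q(3) unfolding continuous_on_iff by (metis diff_gt_0_iff_gt)
  \<comment> \<open>The cone vanishes outside radius 1/n < \<delta>/2 about its tip. With the tip
    within \<delta>/2 of \<open>x\<close>, its support stays in the \<delta>-ball about
    \<open>x\<close>, where \<open>g\<close> is above q.\<close>
  obtain n :: nat where n: "2 / \<delta> < real n" using reals_Archimedean2 by blast
  then have n0: "0 < real n" using \<delta>(1) by (smt (verit) divide_pos_pos)
  \<comment> \<open>The second bound on the distance of the tip is what keeps q (1 - n dist x d)
    above \<open>a\<close>.\<close>
  have "0 < min (\<delta>/2) ((q - a) / (q * real n))" using \<delta> q a n0 by auto
  then obtain d where d: "d \<in> D" "dist x d < \<delta>/2" "dist x d < (q - a) / (q * real n)"
    using D(2)[OF x] by (metis min_less_iff_conj)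
  have q0: "0 < q" using q a by linarith
  have "q * (real n * dist x d) < q - a"
    using d(3) q0 n0 by (simp add: pos_less_divide_eq mult.commute mult.left_commute)
  then have "a < q * (1 - real n * dist x d)" by (simp add: right_diff_distrib)
  also have "\<dots> \<le> bump (q, n, d) x" unfolding bump_def using q0 by auto
  finally have 1: "a < bump (q, n, d) x" .
  have 2: "bump (q, n, d) y \<le> g y" if y: "y \<in> S" for y
  proof (cases "dist y x < \<delta>")
    case True
    then have "q \<le> g y" using \<delta>(2)[OF y True] by (auto simp: dist_real_def)
    then show ?thesis using bump_le[of "(q,n,d)" y] q0 by simp
  next
    case False
    have "dist y x \<le> dist y d + dist x d" by (metis dist_commute dist_triangle)
    then have "\<delta>/2 \<le> dist y d" using False d(2) by linarith
    then have "(2/\<delta>) * (\<delta>/2) \<le> real n * dist y d" using n \<delta>(1) by (intro mult_mono) auto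
    then have "1 \<le> real n * dist y d" using \<delta>(1) by simp
    then have "bump (q, n, d) y = 0" by (simp add: bump_def)
    then show ?thesis using g(2)[OF y] by simp
  qed
  show ?thesis by (rule bexI[of _ "(q, n, d)"]) (use 1 2 q q0 d in \<open>auto simp: bumps_def\<close>)
qed

text \<open>Enumerate the countably many cones below \<open>g\<close>. The maxima of the first n of
  them increase to \<open>g\<close>, so by dominated convergence some finite maximum has an integral
  above \<open>a\<close>.\<close>

lemma exists_maxbump_integral:
  fixes g :: "'a::metric_space \<Rightarrow> real"
  assumes D: "countable D" "D \<subseteq> S" "\<And>x e. x \<in> S \<Longrightarrow> 0 < e \<Longrightarrow> \<exists>d\<in>D. dist x d < e"
    and g: "g \<in> Cb (subtopology euclidean S)" "\<And>x. x \<in> S \<Longrightarrow> 0 \<le> g x"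
    and mu: "\<mu> \<in> Pspace (subtopology euclidean S)" and a: "a < (\<integral>x. g x \<partial>\<mu>)"
  shows "\<exists>L\<in>lists (bumps D). (\<forall>x\<in>S. maxbump L x \<le> g x) \<and> a < (\<integral>x. maxbump L x \<partial>\<mu>)"
proof -
  interpret prob_space \<mu> using mu by (simp add: Pspace_iff)
  have sp: "space \<mu> = S" using space_Pspace[OF mu] by simp
  then obtain x0 where "x0 \<in> S" using not_empty by auto
  then obtain d0 where d0: "d0 \<in> D" using D(3)[of x0 1] by auto
  have gc: "continuous_on S g" using g(1) by (simp add: Cb_def)
  define \<B> where "\<B> = {b \<in> bumps D. \<forall>x\<in>S. bump b x \<le> g x}"
  have "countable (bumps D)" unfolding bumps_def
    by (intro countable_SIGMA countable_subset[OF _ countable_rat]) (use D in auto)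
  then have cB: "countable \<B>" unfolding \<B>_def by (rule countable_subset[rotated]) auto
  \<comment> \<open>The zero cone makes the enumerated family nonempty, as
    \<open>from_nat_into\<close> requires.\<close>
  have "(0, 0, d0) \<in> \<B>" using d0 g(2) by (auto simp: \<B>_def bumps_def bump_def)
  then have neB: "\<B> \<noteq> {}" by auto
  define L where "L n = map (from_nat_into \<B>) [0..<n]" for n
  have LB: "set (L n) \<subseteq> \<B>" for n using from_nat_into[OF neB] by (auto simp: L_def)
  then have Ll: "L n \<in> lists (bumps D)" for n by (auto simp: \<B>_def lists_eq_set)
  have Lg: "maxbump (L n) x \<le> g x" if "x \<in> S" for n x
    using LB[of n] that g(2)[OF that] by (auto simp: maxbump_le_iff \<B>_def)
  obtain B where B: "\<And>x. x \<in> S \<Longrightarrow> \<bar>g x\<bar> \<le> B" using Cb_obtain_bound[OF g(1)] by auto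
  have lim: "(\<lambda>n. maxbump (L n) x) \<longlonglongrightarrow> g x" if x: "x \<in> S" for x
  proof (rule order_tendstoI)
    fix y assume y: "y < g x"
    show "\<forall>\<^sub>F n in sequentially. y < maxbump (L n) x"
    proof (cases "0 \<le> y")
      case True
      obtain b where b: "b \<in> bumps D" "y < bump b x" "\<forall>y\<in>S. bump b y \<le> g y"
        using exists_bump_below[OF D(2,3) gc g(2) x True y] by blast
      then have "b \<in> \<B>" by (auto simp: \<B>_def)
      then obtain i where i: "from_nat_into \<B> i = b" using from_nat_into_surj[OF cB] by blast
      show ?thesis
      proof (rule eventually_sequentiallyI[of "Suc i"])
        fix n assume "Suc i \<le> n"
        then have "b \<in> set (L n)" using i by (force simp: L_def)
        then have "bump b x \<le> maxbump (L n) x" using maxbump_le_iff[of "L n" x "maxbump (L n) x"] by auto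
        then show "y < maxbump (L n) x" using b by linarith
      qed
    next
      case False
      then show ?thesis using maxbump_nonneg[of _ x] by (intro always_eventually allI) (smt (verit))
    qed
  next
    fix y assume "g x < y"
    then show "\<forall>\<^sub>F n in sequentially. maxbump (L n) x < y" using Lg[OF x] by (intro always_eventually allI) (smt (verit))
  qed
  have "(\<lambda>n. \<integral>x. maxbump (L n) x \<partial>\<mu>) \<longlonglongrightarrow> (\<integral>x. g x \<partial>\<mu>)"
  proof (rule integral_dominated_convergence[where w="\<lambda>_. B"])
    show "AE x in \<mu>. norm (maxbump (L i) x) \<le> B" for i
    proof (rule AE_I2)
      fix x assume "x \<in> space \<mu>"
      then have "maxbump (L i) x \<le> g x" "\<bar>g x\<bar> \<le> B" using sp Lg B by auto
      then show "norm (maxbump (L i) x) \<le> B" using maxbump_nonneg[of "L i" x] by auto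
    qed
    show "AE x in \<mu>. (\<lambda>i. maxbump (L i) x) \<longlonglongrightarrow> g x" by (rule AE_I2) (use lim sp in auto)
    show "g \<in> borel_measurable \<mu>" using Pspace_integrable_Cb[OF mu g(1)] by simp
    show "maxbump (L n) \<in> borel_measurable \<mu>" for n
      using Pspace_integrable_Cb[OF mu maxbump_Cb[OF Ll]] by simp
  qed simp
  from order_tendstoD(1)[OF this a] obtain n where "a < (\<integral>x. maxbump (L n) x \<partial>\<mu>)"
    by (auto simp: eventually_sequentially)
  then show ?thesis using Ll Lg by blast
qed

text \<open>The integrals of the countably many functions \<open>maxbump L\<close> embed the weak
  topology into a sequence space. An integral of a maximum lying below a test function bounds the
  integral of that function from below; a two-sided bound comes from applying this to f + B and to B
  - f.\<close>

lemma weak_top_pullback_map: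
  fixes S :: "'a::metric_space set"
  assumes D: "countable D" "D \<subseteq> S" "\<And>x e. x \<in> S \<Longrightarrow> 0 < e \<Longrightarrow> \<exists>d\<in>D. dist x d < e"
  shows "\<exists>e :: 'a measure \<Rightarrow> nat \<Rightarrow> real. pullback_map (weak_top (subtopology euclidean S)) e"
proof -
  let ?X = "subtopology euclidean S"
  let ?LL = "lists (bumps D)"
  have "countable (bumps D)" unfolding bumps_def
    by (intro countable_SIGMA countable_subset[OF _ countable_rat]) (use D in auto)
  then have cL: "countable ?LL" by (rule countable_lists)
  have neL: "?LL \<noteq> {}" by blast
  define e where "e \<mu> k = (\<integral>x. maxbump (from_nat_into ?LL k) x \<partial>\<mu>)" for \<mu> :: "'a measure" and k
  have "continuous_map (weak_top ?X) euclidean e"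
    unfolding euclidean_product_topology[symmetric] continuous_map_componentwise_UNIV e_def
    using from_nat_into[OF neL] by (auto intro!: continuous_map_weak_integral maxbump_Cb)
  moreover have "\<exists>W. open W \<and> e \<mu> \<in> W \<and> topspace (weak_top ?X) \<inter> e -` W \<subseteq> U"
    if U: "openin (weak_top ?X) U" "\<mu> \<in> U" for U \<mu>
  proof -
    have mu: "\<mu> \<in> Pspace ?X" using openin_subset[OF U(1)] U(2) by auto
    have "generate_topology_on {{M \<in> Pspace ?X. (\<integral>x. f x \<partial>M) \<in> U} | f U.
        continuous_map ?X euclideanreal f \<and> bounded (f ` topspace ?X) \<and> open U} U"
      using U unfolding weak_top_def by (simp add: openin_topology_generated_by)
    then show ?thesis using U(2)
    proof induction
      case (Int a b)
      then obtain W1 W2 where "open W1 \<and> e \<mu> \<in> W1 \<and> topspace (weak_top ?X) \<inter> e -` W1 \<subseteq> a"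
        "open W2 \<and> e \<mu> \<in> W2 \<and> topspace (weak_top ?X) \<inter> e -` W2 \<subseteq> b" by blast
      then show ?case by (intro exI[of _ "W1 \<inter> W2"]) (auto intro: open_Int)
    next
      case (UN K)
      then obtain k where k: "k \<in> K" "\<mu> \<in> k" by blast
      from UN(2)[OF this] obtain W where "open W" "e \<mu> \<in> W" "topspace (weak_top ?X) \<inter> e -` W \<subseteq> k" by blast
      with k show ?case by (intro exI[of _ W]) blast
    next
      case (Basis s)
      then obtain f V where f: "f \<in> Cb ?X" "open V" and s: "s = {M \<in> Pspace ?X. (\<integral>x. f x \<partial>M) \<in> V}"
        unfolding Cb_def by blast
      then obtain \<epsilon> where \<epsilon>: "0 < \<epsilon>" "ball (\<integral>x. f x \<partial>\<mu>) \<epsilon> \<subseteq> V"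
        using Basis(2) open_contains_ball by blast
      obtain B where B: "\<And>x. x \<in> S \<Longrightarrow> \<bar>f x\<bar> \<le> B" using Cb_obtain_bound[OF f(1)] by auto
      have fc: "continuous_map ?X euclideanreal f" using f(1) by (simp add: Cb_def)
      \<comment> \<open>Both shifts are nonnegative because \<bar>f\<bar> \<le> B; a lower bound for
        the integral of B - f is an upper bound for that of f.\<close>
      have g1: "(\<lambda>x. f x + B) \<in> Cb ?X"
        by (rule CbI[where B="2*B"], intro continuous_map_add fc) (use B in \<open>force simp: abs_le_iff\<close>)+
      have g2: "(\<lambda>x. B - f x) \<in> Cb ?X"
        by (rule CbI[where B="2*B"], intro continuous_map_diff fc) (use B in \<open>force simp: abs_le_iff\<close>)+
      have i1: "(\<integral>x. f x + B \<partial>\<nu>) = (\<integral>x. f x \<partial>\<nu>) + B" and i2: "(\<integral>x. B - f x \<partial>\<nu>) = B - (\<integral>x. f x \<partial>\<nu>)"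
        if "\<nu> \<in> Pspace ?X" for \<nu>
      proof -
        interpret N: prob_space \<nu> using that by (simp add: Pspace_iff)
        show "(\<integral>x. f x + B \<partial>\<nu>) = (\<integral>x. f x \<partial>\<nu>) + B" "(\<integral>x. B - f x \<partial>\<nu>) = B - (\<integral>x. f x \<partial>\<nu>)"
          using Pspace_integrable_Cb[OF that f(1)] by (auto simp: N.prob_space)
      qed
      have n1: "\<And>x. x \<in> S \<Longrightarrow> 0 \<le> f x + B" and n2: "\<And>x. x \<in> S \<Longrightarrow> 0 \<le> B - f x"
        using B by (force simp: abs_le_iff)+
      obtain L1 where L1: "L1 \<in> ?LL" "\<forall>x\<in>S. maxbump L1 x \<le> f x + B" "(\<integral>x. f x \<partial>\<mu>) + B - \<epsilon> < (\<integral>x. maxbump L1 x \<partial>\<mu>)"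
        using exists_maxbump_integral[OF D g1 n1 mu, of "(\<integral>x. f x \<partial>\<mu>) + B - \<epsilon>"] i1[OF mu] \<epsilon> by auto
      obtain L2 where L2: "L2 \<in> ?LL" "\<forall>x\<in>S. maxbump L2 x \<le> B - f x" "B - (\<integral>x. f x \<partial>\<mu>) - \<epsilon> < (\<integral>x. maxbump L2 x \<partial>\<mu>)"
        using exists_maxbump_integral[OF D g2 n2 mu, of "B - (\<integral>x. f x \<partial>\<mu>) - \<epsilon>"] i2[OF mu] \<epsilon> by auto
      obtain k1 k2 where k: "from_nat_into ?LL k1 = L1" "from_nat_into ?LL k2 = L2"
        using from_nat_into_surj[OF cL] L1(1) L2(1) by metis
      define W where "W = {y. (\<integral>x. f x \<partial>\<mu>) + B - \<epsilon> < y k1} \<inter> {y::nat \<Rightarrow> real. B - (\<integral>x. f x \<partial>\<mu>) - \<epsilon> < y k2}"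
      have "open W" unfolding W_def
        by (intro open_Int open_Collect_less continuous_on_const continuous_on_product_coordinates)
      moreover have "e \<mu> \<in> W" using L1(3) L2(3) by (simp add: W_def e_def k)
      moreover have "topspace (weak_top ?X) \<inter> e -` W \<subseteq> s"
      proof
        fix \<nu> assume "\<nu> \<in> topspace (weak_top ?X) \<inter> e -` W"
        then have nu: "\<nu> \<in> Pspace ?X" and W1: "(\<integral>x. f x \<partial>\<mu>) + B - \<epsilon> < (\<integral>x. maxbump L1 x \<partial>\<nu>)"
          and W2: "B - (\<integral>x. f x \<partial>\<mu>) - \<epsilon> < (\<integral>x. maxbump L2 x \<partial>\<nu>)"
          by (auto simp: W_def e_def k)
        have "(\<integral>x. maxbump L1 x \<partial>\<nu>) \<le> (\<integral>x. f x + B \<partial>\<nu>)" "(\<integral>x. maxbump L2 x \<partial>\<nu>) \<le> (\<integral>x. B - f x \<partial>\<nu>)"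
          by (rule integral_mono; use L1 L2 nu g1 g2 space_Pspace[OF nu] in \<open>auto intro!: Pspace_integrable_Cb maxbump_Cb\<close>)+
        then have "(\<integral>x. f x \<partial>\<nu>) \<in> ball (\<integral>x. f x \<partial>\<mu>) \<epsilon>"
          using W1 W2 i1[OF nu] i2[OF nu] by (auto simp: dist_real_def abs_less_iff)
        then show "\<nu> \<in> s" using \<epsilon> s nu by auto
      qed
      ultimately show ?case by blast
    qed auto
  qed
  ultimately show ?thesis unfolding pullback_map_def by blast
qed

section \<open>The input space and its product with [0, T] as pulled-back topologies\<close>

lemma Etop_eq: "Etop T = subtopology euclidean (Cpaths T \<times> {0..T})"
  by (simp add: Etop_def Ctop_def Itop_def)

lemma Intop_pullback_map:
  assumes "0 < T"
  shows "\<exists>e :: inpt \<Rightarrow> path \<times> path \<times> (nat \<Rightarrow> real). pullback_map (Intop T) e"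
proof -
  obtain D where D: "countable D" "D \<subseteq> Cpaths T" "\<And>f e. f \<in> Cpaths T \<Longrightarrow> 0 < e \<Longrightarrow> \<exists>d\<in>D. dist f d < e"
    using Cpaths_separable[OF assms] by metis
  have "\<exists>d\<in>D \<times> (\<rat> \<inter> {0..T}). dist x d < e" if x: "x \<in> Cpaths T \<times> {0..T}" and e: "0 < e" for x e
  proof -
    obtain d where d: "d \<in> D" "dist (fst x) d < e/2" using D(3)[of "fst x" "e/2"] x e by auto
    \<comment> \<open>The rational is sought to the left of the point, so that it cannot leave
      [0, T] at the right end; 0 is its own approximation.\<close>
    have "\<exists>q\<in>\<rat> \<inter> {0..T}. dist (snd x) q < e/2"
    proof (cases "snd x = 0")
      case True then show ?thesis using assms e by (intro bexI[of _ 0]) auto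
    next
      case False
      then have "max 0 (snd x - e/2) < snd x" using e x by auto
      then obtain q where "q \<in> \<rat>" "max 0 (snd x - e/2) < q" "q < snd x" using Rats_dense_in_real by blast
      then show ?thesis using x by (intro bexI[of _ q]) (auto simp: dist_real_def)
    qed
    then obtain q where q: "q \<in> \<rat> \<inter> {0..T}" "dist (snd x) q < e/2" by blast
    have "dist x (d, q) \<le> dist (fst x) d + dist (snd x) q"
      by (cases x) (simp add: dist_Pair_Pair sqrt_sum_squares_le_sum)
    then show ?thesis using d q by (intro bexI[of _ "(d, q)"]) auto
  qed
  moreover have "countable (D \<times> (\<rat> \<inter> {0..T}))" using D(1) countable_rat by (intro countable_SIGMA countable_Int1) auto
  moreover have "D \<times> (\<rat> \<inter> {0..T}) \<subseteq> Cpaths T \<times> {0..T}" using D(2) by auto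
  ultimately have "\<exists>e :: epnt measure \<Rightarrow> nat \<Rightarrow> real. pullback_map (weak_top (Etop T)) e"
    unfolding Etop_eq by (intro weak_top_pullback_map)
  then obtain e where "pullback_map (weak_top (Etop T)) (e :: epnt measure \<Rightarrow> nat \<Rightarrow> real)" ..
  then show ?thesis unfolding Intop_def Ctop_def
    by (intro exI[of _ "map_prod id (map_prod id e)"] pullback_map_prod pullback_map_id)
qed

lemma cozero_space_Intop: "0 < T \<Longrightarrow> cozero_space (Intop T)"
  using Intop_pullback_map pullback_map_imp_cozero_space by blast

lemma cozero_space_Omtop: "0 < T \<Longrightarrow> cozero_space (Omtop T)"
  unfolding Omtop_def Itop_def using Intop_pullback_map pullback_map_imp_cozero_space pullback_map_prod[OF _ pullback_map_id] by metis

subsection \<open>Couplings with a fixed first marginal\<close>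

lemma topspace_Itop [simp]: "topspace (Itop T) = {0..T}"
  by (simp add: Itop_def)

text \<open>The Radon-Nikodym derivative is at most 1 almost everywhere, and it is truncated there
  so that both bounds hold at every point. Later constructions use the density pointwise, as a
  threshold for a uniform variable.\<close>

lemma density_le_one:
  assumes "prob_space \<rho>" and sets: "sets \<nu> = sets \<rho>" and le: "\<And>C. C \<in> sets \<rho> \<Longrightarrow> emeasure \<nu> C \<le> emeasure \<rho> C"
  shows "\<exists>k\<in>borel_measurable \<rho>. (\<forall>x. 0 \<le> k x \<and> k x \<le> (1::real)) \<and> \<nu> = density \<rho> (\<lambda>x. ennreal (k x))"
proof -
  interpret prob_space \<rho> by fact
  have ac: "absolutely_continuous \<rho> \<nu>"
    unfolding absolutely_continuous_def null_sets_def using le sets by force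
  define r where "r = RN_deriv \<rho> \<nu>"
  have r[measurable]: "r \<in> borel_measurable \<rho>" by (simp add: r_def)
  have d: "density \<rho> r = \<nu>" unfolding r_def by (rule density_RN_deriv[OF ac sets])
  \<comment> \<open>On this set domination by \<rho> forces the nonnegative excess r - 1 to have
    integral 0.\<close>
  define C where "C = {x \<in> space \<rho>. 1 < r x}"
  have C[measurable]: "C \<in> sets \<rho>" unfolding C_def by measurable
  have "(\<integral>\<^sup>+x. r x * indicator C x \<partial>\<rho>) \<le> (\<integral>\<^sup>+x. indicator C x \<partial>\<rho>)"
    using le[OF C] d emeasure_density[OF r C] by simp
  moreover have "(\<integral>\<^sup>+x. r x * indicator C x - indicator C x \<partial>\<rho>) = (\<integral>\<^sup>+x. r x * indicator C x \<partial>\<rho>) - (\<integral>\<^sup>+x. indicator C x \<partial>\<rho>)"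
  proof (rule nn_integral_diff)
    show "AE x in \<rho>. indicator C x \<le> r x * indicator C x"
      by (rule AE_I2) (auto simp: C_def indicator_def)
    have "(\<integral>\<^sup>+x. indicator C x \<partial>\<rho>) = emeasure \<rho> C" by simp
    then show "(\<integral>\<^sup>+x. indicator C x \<partial>\<rho>) \<noteq> \<infinity>" by (simp only: emeasure_eq_measure) simp
  qed auto
  moreover have "(\<integral>\<^sup>+x. indicator C x \<partial>\<rho>) < \<top>" by (simp add: emeasure_eq_measure)
  ultimately have "(\<integral>\<^sup>+x. r x * indicator C x - indicator C x \<partial>\<rho>) = 0"
    by (simp add: diff_eq_0_iff_ennreal order_le_less_trans)
  then have "AE x in \<rho>. r x * indicator C x - indicator C x = 0" by (subst (asm) nn_integral_0_iff_AE) auto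
  then have r1: "AE x in \<rho>. r x \<le> 1"
    by (rule AE_mp) (auto simp: C_def indicator_def diff_eq_0_iff_ennreal not_less intro!: AE_I2 split: if_splits)
  define k where "k x = enn2real (min 1 (r x))" for x
  have ek: "ennreal (k x) = min 1 (r x)" for x
    unfolding k_def by (rule ennreal_enn2real) (simp add: min_less_iff_disj)
  have "density \<rho> (\<lambda>x. ennreal (k x)) = density \<rho> r"
    by (rule density_cong) (use r1 in \<open>auto simp: ek min_def\<close>)
  moreover have "k x \<le> 1" for x
    using ek[of x] by (metis ennreal_le_1 min.cobounded1)
  moreover have "k \<in> borel_measurable \<rho>" unfolding k_def by measurable
  ultimately show ?thesis using d by (intro bexI[of _ k]) (auto simp: k_def)
qed

text \<open>The horizon is a parameter because the same theory is also applied at horizon 1, to the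
  joint law of an input and a variable with values in [0, 1].\<close>

locale coupling =
  fixes X :: "'a topology" and T :: real and \<rho> :: "'a measure" and P :: "('a \<times> real) measure"
  assumes T: "0 < T" and rho: "\<rho> \<in> Pspace X" and P: "P \<in> Pspace (prod_topology X (Itop T))"
    and marg: "distr P (borel_of X) fst = \<rho>"
begin

sublocale rho: prob_space \<rho> using rho by (simp add: Pspace_iff)
sublocale P: prob_space P using P by (simp add: Pspace_iff)

lemma sets_rho [measurable_cong, simp]: "sets \<rho> = sets (borel_of X)" using rho by (simp add: Pspace_iff)
lemma space_rho [simp]: "space \<rho> = topspace X" using rho by (rule space_Pspace)
lemma sets_P [measurable_cong]: "sets P = sets (borel_of (prod_topology X (Itop T)))" using P by (simp add: Pspace_iff)
lemma space_P [simp]: "space P = topspace X \<times> {0..T}" using space_Pspace[OF P] by simp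

lemma fst_meas [measurable]: "fst \<in> measurable P (borel_of X)"
  using continuous_map_measurable_borel_of[OF continuous_map_fst] measurable_cong_sets[OF sets_P refl] by blast

lemma fst_meas_rho: "fst \<in> measurable P \<rho>"
  using fst_meas measurable_cong_sets[OF refl sets_rho] by blast

lemma snd_meas [measurable]: "snd \<in> borel_measurable P"
proof -
  have "continuous_map (prod_topology X (Itop T)) (Itop T) snd" by (rule continuous_map_snd)
  then have "continuous_map (prod_topology X (Itop T)) euclideanreal snd"
    unfolding Itop_def by (simp add: continuous_map_in_subtopology)
  then show ?thesis using continuous_map_borel_measurable measurable_cong_sets[OF sets_P refl] by blast
qed

lemma borel_rho: "borel_measurable \<rho> = borel_measurable (borel_of X)"
  by (rule measurable_cong_sets) auto

lemma AE_fst: "AE x in \<rho>. Q x \<Longrightarrow> AE \<omega> in P. Q (fst \<omega>)"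
  using AE_distrD[OF fst_meas, of Q, unfolded marg] .

lemma integral_fst:
  fixes g :: "'a \<Rightarrow> real"
  assumes "g \<in> borel_measurable \<rho>" shows "(\<integral>\<omega>. g (fst \<omega>) \<partial>P) = (\<integral>x. g x \<partial>\<rho>)"
  using integral_distr[OF fst_meas, of g] assms borel_rho by (simp add: marg)

lemma integrable_fst:
  fixes g :: "'a \<Rightarrow> real"
  assumes "integrable \<rho> g" shows "integrable P (\<lambda>\<omega>. g (fst \<omega>))"
  using integrable_distr[OF fst_meas, of g] assms by (simp add: marg)

text \<open>\<open>k\<close> is the conditional probability of \<open>A\<close> given the first
  coordinate, obtained as the density with respect to \<rho> of the set function that sends C to the
  measure of \<open>A\<close> intersected with {first coordinate in C}.\<close>

lemma exists_density:
  assumes A[measurable]: "A \<in> sets P"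
  shows "\<exists>k\<in>borel_measurable \<rho>. (\<forall>x. 0 \<le> k x \<and> k x \<le> (1::real)) \<and>
     (\<forall>g::'a \<Rightarrow> real. integrable \<rho> g \<longrightarrow> (\<integral>\<omega>. indicator A \<omega> * g (fst \<omega>) \<partial>P) = (\<integral>x. k x * g x \<partial>\<rho>))"
proof -
  define \<nu> where "\<nu> = distr (density P (indicator A)) \<rho> fst"
  have m1: "fst \<in> measurable (density P (indicator A)) \<rho>" using fst_meas_rho by simp
  have em: "emeasure \<nu> C = emeasure P (A \<inter> (fst -` C \<inter> space P))" if C: "C \<in> sets \<rho>" for C
  proof -
    have C'[measurable]: "fst -` C \<inter> space P \<in> sets P" using measurable_sets[OF fst_meas_rho C] .
    have "emeasure \<nu> C = emeasure (density P (indicator A)) (fst -` C \<inter> space P)"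
      unfolding \<nu>_def by (subst emeasure_distr[OF m1 C]) simp
    also have "\<dots> = (\<integral>\<^sup>+\<omega>. indicator (A \<inter> (fst -` C \<inter> space P)) \<omega> \<partial>P)"
      by (subst emeasure_density, simp, rule C', rule nn_integral_cong) (auto simp: indicator_def)
    also have "\<dots> = emeasure P (A \<inter> (fst -` C \<inter> space P))"
      by (rule nn_integral_indicator) (use A C' in blast)
    finally show ?thesis .
  qed
  have "emeasure \<nu> C \<le> emeasure \<rho> C" if C: "C \<in> sets \<rho>" for C
  proof -
    have "emeasure \<rho> C = emeasure P (fst -` C \<inter> space P)"
      using emeasure_distr[OF fst_meas, of C] C by (simp add: marg)
    then show ?thesis unfolding em[OF C]
      by (simp only:) (intro emeasure_mono, use measurable_sets[OF fst_meas_rho C] in auto)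
  qed
  then obtain k where k: "k \<in> borel_measurable \<rho>" "\<forall>x. 0 \<le> k x \<and> k x \<le> (1::real)" "\<nu> = density \<rho> (\<lambda>x. ennreal (k x))"
    using density_le_one[OF rho.prob_space_axioms, of \<nu>] by (auto simp: \<nu>_def)
  have "(\<integral>\<omega>. indicator A \<omega> * g (fst \<omega>) \<partial>P) = (\<integral>x. k x * g x \<partial>\<rho>)" if g: "integrable \<rho> g" for g :: "'a \<Rightarrow> real"
  proof -
    have gm: "g \<in> borel_measurable \<rho>" using g by simp
    have gf: "(\<lambda>\<omega>. g (fst \<omega>)) \<in> borel_measurable P" using measurable_compose[OF fst_meas_rho gm] .
    have "density P (indicator A) = density P (\<lambda>\<omega>. ennreal (indicator A \<omega>))"
      by (rule density_cong) (auto simp: indicator_def)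
    then have "(\<integral>\<omega>. indicator A \<omega> * g (fst \<omega>) \<partial>P) = (\<integral>\<omega>. g (fst \<omega>) \<partial>density P (indicator A))"
      using integral_density[OF gf, of "indicator A"] by simp
    also have "\<dots> = (\<integral>x. g x \<partial>\<nu>)" unfolding \<nu>_def using integral_distr[OF m1 gm] by simp
    also have "\<dots> = (\<integral>x. k x * g x \<partial>\<rho>)" unfolding k(3) using integral_density[OF gm k(1)] k(2) by simp
    finally show ?thesis .
  qed
  then show ?thesis using k by blast
qed

section \<open>Conditional independence of an event from the first coordinate\<close>

definition sub_sigma :: "'a set set \<Rightarrow> bool" where
  "sub_sigma G \<longleftrightarrow> sigma_algebra (topspace X) G \<and> G \<subseteq> sets (borel_of X)"

abbreviation sigma_gen :: "'a set set \<Rightarrow> 'a measure" where "sigma_gen G \<equiv> sigma (topspace X) G"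

definition cexp :: "'a set set \<Rightarrow> 'a set \<Rightarrow> 'a \<Rightarrow> real" where
  "cexp G C = real_cond_exp \<rho> (sigma_gen G) (indicator C)"

text \<open>Conditional independence of the single event \<open>A\<close> and the first coordinate given \<open>G\<close>,
  with the conditional expectation moved to the side of \<open>C\<close> and hence taken under \<open>\<rho>\<close>.\<close>

definition indep_given :: "('a \<times> real) set \<Rightarrow> 'a set set \<Rightarrow> bool" where
  "indep_given A G \<longleftrightarrow> (\<forall>C\<in>sets \<rho>. measure P (A \<inter> fst -` C) = (\<integral>\<omega>. indicator A \<omega> * cexp G C (fst \<omega>) \<partial>P))"

lemma space_sigma_gen [simp]: "space (sigma_gen G) = topspace X" by (simp add: space_measure_of_conv)

lemma sets_sigma_gen: "sub_sigma G \<Longrightarrow> sets (sigma_gen G) = G"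
  unfolding sub_sigma_def by (metis sigma_algebra.sets_measure_of_eq)

lemma subalg_sigma_gen: "sub_sigma G \<Longrightarrow> subalgebra \<rho> (sigma_gen G)"
  using sets_sigma_gen[of G] by (auto simp: subalgebra_def sub_sigma_def)

lemma sfs_sigma_gen: "sub_sigma G \<Longrightarrow> sigma_finite_subalgebra \<rho> (sigma_gen G)"
  by (intro finite_measure_subalgebra_is_sigma_finite finite_measure_subalgebra.intro
      finite_measure_subalgebra_axioms.intro rho.finite_measure_axioms subalg_sigma_gen)

lemma cexp_meas [measurable]: "cexp G C \<in> borel_measurable \<rho>" "cexp G C \<in> borel_measurable (sigma_gen G)"
  by (simp_all add: cexp_def)

lemma integrable_ind: "C \<in> sets \<rho> \<Longrightarrow> integrable \<rho> (indicator C :: 'a \<Rightarrow> real)"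
  by (simp add: rho.emeasure_eq_measure)

lemma cexp_integrable: "sub_sigma G \<Longrightarrow> C \<in> sets \<rho> \<Longrightarrow> integrable \<rho> (cexp G C)"
  unfolding cexp_def using sigma_finite_subalgebra.real_cond_exp_int(1)[OF sfs_sigma_gen integrable_ind] .

lemma cexp_bounds: "sub_sigma G \<Longrightarrow> C \<in> sets \<rho> \<Longrightarrow> AE x in \<rho>. 0 \<le> cexp G C x \<and> cexp G C x \<le> 1"
  unfolding cexp_def
  using sigma_finite_subalgebra.real_cond_exp_ge_c[OF sfs_sigma_gen integrable_ind, of G C 0]
    sigma_finite_subalgebra.real_cond_exp_le_c[OF sfs_sigma_gen integrable_ind, of G C 1]
  by (auto simp: indicator_def)

lemma integrable_bounded_mult:
  fixes f g :: "'b \<Rightarrow> real"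
  assumes "integrable M f" "g \<in> borel_measurable M" "AE x in M. \<bar>g x\<bar> \<le> B"
  shows "integrable M (\<lambda>x. g x * f x)" "integrable M (\<lambda>x. f x * g x)"
proof -
  have "integrable M (\<lambda>x. B * f x)" using assms(1) by simp
  then show "integrable M (\<lambda>x. g x * f x)"
  proof (rule Bochner_Integration.integrable_bound)
    show "AE x in M. norm (g x * f x) \<le> norm (B * f x)"
      using assms(3) by eventually_elim (auto simp: abs_mult intro!: mult_right_mono)
  qed (use assms in auto)
  then show "integrable M (\<lambda>x. f x * g x)" by (simp add: mult.commute)
qed

lemma measure_eq_integral:
  assumes A: "A \<in> sets P" and C: "C \<in> sets \<rho>"
  shows "measure P (A \<inter> fst -` C) = (\<integral>\<omega>. indicator A \<omega> * indicator C (fst \<omega>) \<partial>P)"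
proof -
  have "fst -` C \<inter> space P \<in> sets P" using measurable_sets[OF fst_meas_rho C] .
  then have "A \<inter> (fst -` C \<inter> space P) \<in> sets P" using A by blast
  moreover have "A \<inter> (fst -` C \<inter> space P) = A \<inter> fst -` C" using sets.sets_into_space[OF A] by blast
  ultimately have m: "A \<inter> fst -` C \<in> sets P" by simp
  have "(\<integral>\<omega>. indicator A \<omega> * indicator C (fst \<omega>) \<partial>P) = (\<integral>\<omega>. indicat_real (A \<inter> fst -` C) \<omega> \<partial>P)"
    by (rule Bochner_Integration.integral_cong) (auto simp: indicator_def)
  also have "\<dots> = measure P (A \<inter> fst -` C \<inter> space P)" by (rule Bochner_Integration.integral_indicator)
  also have "A \<inter> fst -` C \<inter> space P = A \<inter> fst -` C" using sets.sets_into_space[OF m] by blast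
  finally show ?thesis ..
qed

text \<open>Conditional expectation is self-adjoint: integrating k E[1_C | G] is the same as
  integrating E[k | G] 1_C. Hence \<open>indep_given\<close> for all C says that k and E[k | G] have
  the same integral over every C, that is, that they agree almost everywhere.\<close>

lemma indep_given_iff:
  assumes A: "A \<in> sets P" and G: "sub_sigma G"
    and k: "k \<in> borel_measurable \<rho>" "\<And>x. 0 \<le> k x \<and> k x \<le> (1::real)"
      "\<And>g::'a \<Rightarrow> real. integrable \<rho> g \<Longrightarrow> (\<integral>\<omega>. indicator A \<omega> * g (fst \<omega>) \<partial>P) = (\<integral>x. k x * g x \<partial>\<rho>)"
  shows "indep_given A G \<longleftrightarrow> (\<exists>z\<in>borel_measurable (sigma_gen G). AE x in \<rho>. k x = z x)"
proof -
  interpret G: sigma_finite_subalgebra \<rho> "sigma_gen G" by (rule sfs_sigma_gen[OF G])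
  have kint: "integrable \<rho> k" by (rule rho.integrable_const_bound[where B=1]) (use k in auto)
  have l: "measure P (A \<inter> fst -` C) = (\<integral>x. k x * indicator C x \<partial>\<rho>)" if C: "C \<in> sets \<rho>" for C
    using measure_eq_integral[OF A C] k(3)[OF integrable_ind[OF C]] by simp
  have cb: "AE x in \<rho>. \<bar>cexp G C x\<bar> \<le> 1" if C: "C \<in> sets \<rho>" for C
    using cexp_bounds[OF G C] by eventually_elim auto
  have r: "(\<integral>\<omega>. indicator A \<omega> * cexp G C (fst \<omega>) \<partial>P) = (\<integral>x. real_cond_exp \<rho> (sigma_gen G) k x * indicator C x \<partial>\<rho>)"
    if C: "C \<in> sets \<rho>" for C
  proof -
    have "(\<integral>\<omega>. indicator A \<omega> * cexp G C (fst \<omega>) \<partial>P) = (\<integral>x. cexp G C x * k x \<partial>\<rho>)"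
      using k(3)[OF cexp_integrable[OF G C]] by (simp add: mult.commute)
    also have "\<dots> = (\<integral>x. cexp G C x * real_cond_exp \<rho> (sigma_gen G) k x \<partial>\<rho>)"
      using G.real_cond_exp_intg(2)[of "cexp G C" k] integrable_bounded_mult(1)[OF kint _ cb[OF C]] k(1) by simp
    also have "\<dots> = (\<integral>x. real_cond_exp \<rho> (sigma_gen G) k x * real_cond_exp \<rho> (sigma_gen G) (indicator C) x \<partial>\<rho>)"
      by (simp add: cexp_def mult.commute)
    also have "\<dots> = (\<integral>x. real_cond_exp \<rho> (sigma_gen G) k x * indicator C x \<partial>\<rho>)"
    proof (rule G.real_cond_exp_intg(2))
      show "integrable \<rho> (\<lambda>x. real_cond_exp \<rho> (sigma_gen G) k x * indicator C x)"
        by (rule integrable_bounded_mult(2)[where B=1]) (use G.real_cond_exp_int(1)[OF kint] C in \<open>auto simp: indicator_def\<close>)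
    qed (use C in auto)
    finally show ?thesis .
  qed
  have "indep_given A G \<longleftrightarrow> (\<forall>C\<in>sets \<rho>. (\<integral>x. k x * indicator C x \<partial>\<rho>) = (\<integral>x. real_cond_exp \<rho> (sigma_gen G) k x * indicator C x \<partial>\<rho>))"
    unfolding indep_given_def using l r by auto
  also have "\<dots> \<longleftrightarrow> (AE x in \<rho>. k x = real_cond_exp \<rho> (sigma_gen G) k x)"
  proof
    assume H: "\<forall>C\<in>sets \<rho>. (\<integral>x. k x * indicator C x \<partial>\<rho>) = (\<integral>x. real_cond_exp \<rho> (sigma_gen G) k x * indicator C x \<partial>\<rho>)"
    show "AE x in \<rho>. k x = real_cond_exp \<rho> (sigma_gen G) k x"
      by (rule density_unique_real[OF kint G.real_cond_exp_int(1)[OF kint]])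
         (use H in \<open>simp add: set_lebesgue_integral_def mult.commute\<close>)
  next
    assume H: "AE x in \<rho>. k x = real_cond_exp \<rho> (sigma_gen G) k x"
    show "\<forall>C\<in>sets \<rho>. (\<integral>x. k x * indicator C x \<partial>\<rho>) = (\<integral>x. real_cond_exp \<rho> (sigma_gen G) k x * indicator C x \<partial>\<rho>)"
    proof
      fix C assume "C \<in> sets \<rho>"
      then show "(\<integral>x. k x * indicator C x \<partial>\<rho>) = (\<integral>x. real_cond_exp \<rho> (sigma_gen G) k x * indicator C x \<partial>\<rho>)"
        using H k(1) by (intro integral_cong_AE) (auto elim: AE_mp)
    qed
  qed
  also have "\<dots> \<longleftrightarrow> (\<exists>z\<in>borel_measurable (sigma_gen G). AE x in \<rho>. k x = z x)"
  proof
    assume "AE x in \<rho>. k x = real_cond_exp \<rho> (sigma_gen G) k x"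
    then show "\<exists>z\<in>borel_measurable (sigma_gen G). AE x in \<rho>. k x = z x" by (intro bexI[of _ "real_cond_exp \<rho> (sigma_gen G) k"]) auto
  next
    assume "\<exists>z\<in>borel_measurable (sigma_gen G). AE x in \<rho>. k x = z x"
    then obtain z where z: "z \<in> borel_measurable (sigma_gen G)" "AE x in \<rho>. k x = z x" by blast
    have zr: "z \<in> borel_measurable \<rho>" using measurable_from_subalg[OF subalg_sigma_gen[OF G] z(1)] .
    have zi: "integrable \<rho> z" using integrable_cong_AE_imp[OF kint zr] z(2) by (auto elim: AE_mp)
    have "AE x in \<rho>. real_cond_exp \<rho> (sigma_gen G) k x = real_cond_exp \<rho> (sigma_gen G) z x"
      by (rule G.real_cond_exp_cong[OF z(2) k(1) zr])
    moreover have "AE x in \<rho>. real_cond_exp \<rho> (sigma_gen G) z x = z x" by (rule G.real_cond_exp_F_meas[OF zi z(1)])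
    ultimately show "AE x in \<rho>. k x = real_cond_exp \<rho> (sigma_gen G) k x" using z(2) by eventually_elim simp
  qed
  finally show ?thesis .
qed

text \<open>A version measurable for \<open>G\<close> is measurable for \<open>G'\<close>.
  Conditional independence is not monotone in the conditioning in general; here it is, because
  independence is from the whole first coordinate and both sigma-algebras belong to that
  coordinate.\<close>

lemma indep_given_mono:
  assumes "A \<in> sets P" "sub_sigma G" "sub_sigma G'" "G \<subseteq> G'" "indep_given A G"
  shows "indep_given A G'"
proof -
  obtain k where k: "k \<in> borel_measurable \<rho>" "\<And>x. 0 \<le> k x \<and> k x \<le> (1::real)"
      "\<And>g::'a \<Rightarrow> real. integrable \<rho> g \<Longrightarrow> (\<integral>\<omega>. indicator A \<omega> * g (fst \<omega>) \<partial>P) = (\<integral>x. k x * g x \<partial>\<rho>)"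
    using exists_density[OF assms(1)] by metis
  have "borel_measurable (sigma_gen G) \<subseteq> (borel_measurable (sigma_gen G') :: ('a \<Rightarrow> real) set)"
    by (intro subsetI, erule borel_measurable_subalgebra[rotated 2]; simp only: sets_sigma_gen assms space_sigma_gen)
  then show ?thesis using indep_given_iff[OF assms(1) assms(2) k] indep_given_iff[OF assms(1) assms(3) k] assms(5) by blast
qed

text \<open>The limsup of the versions does not change when its first m terms are dropped, and the
  remaining terms are measurable for \<open>G m\<close>. It is therefore measurable for every
  \<open>G m\<close>, and almost everywhere it equals the density.\<close>

lemma indep_given_INT:
  fixes G :: "nat \<Rightarrow> 'a set set"
  assumes A: "A \<in> sets P" and G: "\<And>n. sub_sigma (G n)" "\<And>n. G (Suc n) \<subseteq> G n" and I: "sub_sigma H" "H = (\<Inter>n. G n)"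
    and indep_given: "\<And>n. indep_given A (G n)"
  shows "indep_given A H"
proof -
  obtain k where k: "k \<in> borel_measurable \<rho>" "\<And>x. 0 \<le> k x \<and> k x \<le> (1::real)"
      "\<And>g::'a \<Rightarrow> real. integrable \<rho> g \<Longrightarrow> (\<integral>\<omega>. indicator A \<omega> * g (fst \<omega>) \<partial>P) = (\<integral>x. k x * g x \<partial>\<rho>)"
    using exists_density[OF A] by metis
  have "\<forall>n. \<exists>z\<in>borel_measurable (sigma_gen (G n)). AE x in \<rho>. k x = z x" using indep_given_iff[OF A G(1) k] indep_given by blast
  then obtain z where z: "\<And>n. z n \<in> borel_measurable (sigma_gen (G n))" "\<And>n. AE x in \<rho>. k x = z n x" by metis
  \<comment> \<open>A limsup exists at every point, also on the null set where the versions differ;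
    \<open>real_of_ereal\<close> turns infinite values into 0.\<close>
  define y where "y x = real_of_ereal (limsup (\<lambda>n. ereal (z n x)))" for x
  have anti: "G n \<subseteq> G m" if "m \<le> n" for m n using lift_Suc_antimono_le[of G] G(2) that by blast
  have y: "y \<in> borel_measurable (sigma_gen (G m))" for m
  proof -
    have "z (n + m) \<in> borel_measurable (sigma_gen (G m))" for n
    proof -
      have "borel_measurable (sigma_gen (G (n + m))) \<subseteq> (borel_measurable (sigma_gen (G m)) :: ('a \<Rightarrow> real) set)"
        by (intro subsetI, erule borel_measurable_subalgebra[rotated 2]; simp only: sets_sigma_gen G space_sigma_gen anti le_add2)
      then show ?thesis using z(1) by blast
    qed
    then have "(\<lambda>x. real_of_ereal (limsup (\<lambda>n. ereal (z (n + m) x)))) \<in> borel_measurable (sigma_gen (G m))"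
      by (intro borel_measurable_real_of_ereal borel_measurable_limsup borel_measurable_ereal)
    then show ?thesis unfolding y_def[abs_def] using limsup_shift_k[of "\<lambda>n. ereal (z n _)" m] by simp
  qed
  have "y \<in> borel_measurable (sigma_gen H)"
  proof (rule measurableI)
    fix U :: "real set" assume "U \<in> sets borel"
    then have "y -` U \<inter> topspace X \<in> G m" for m
      using measurable_sets[OF y[of m]] sets_sigma_gen[OF G(1)[of m]] by auto
    then show "y -` U \<inter> space (sigma_gen H) \<in> sets (sigma_gen H)" using sets_sigma_gen[OF I(1)] I(2) by auto
  qed simp
  moreover have "AE x in \<rho>. k x = y x"
  proof -
    have "AE x in \<rho>. \<forall>n. k x = z n x" using z(2) by (simp add: AE_all_countable)
    then show ?thesis
    proof eventually_elim
      case (elim x)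
      then have "limsup (\<lambda>n. ereal (z n x)) = limsup (\<lambda>n::nat. ereal (k x))" by simp
      also have "\<dots> = ereal (k x)" by (rule Limsup_const) simp
      finally show ?case by (simp add: y_def)
    qed
  qed
  ultimately show ?thesis using indep_given_iff[OF A I(1) k] by blast
qed

lemma integrable_cexp_fst: "sub_sigma G \<Longrightarrow> C \<in> sets \<rho> \<Longrightarrow> integrable P (\<lambda>\<omega>. cexp G C (fst \<omega>))"
  by (intro integrable_fst cexp_integrable)

text \<open>Both sides of the identity in \<open>indep_given\<close>, as functions of the event \<open>{Y \<in> U}\<close>, are finite
  measures on the line.\<close>

lemma indep_given_half_lines:
  fixes Y :: "'a \<times> real \<Rightarrow> real"
  assumes Y[measurable]: "Y \<in> borel_measurable P" and G: "sub_sigma G"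
    and indep_given: "\<And>s. indep_given {\<omega> \<in> space P. Y \<omega> \<le> s} G"
  shows "U \<in> sets borel \<Longrightarrow> indep_given {\<omega> \<in> space P. Y \<omega> \<in> U} G"
    and "C \<in> sets \<rho> \<Longrightarrow> h \<in> borel_measurable borel \<Longrightarrow>
      (\<integral>\<omega>. h (Y \<omega>) * indicator C (fst \<omega>) \<partial>P) = (\<integral>\<omega>. h (Y \<omega>) * cexp G C (fst \<omega>) \<partial>P)"
proof -
  \<comment> \<open>The conditional expectation lies in [0, 1] only almost surely. The truncated
    version is nonnegative everywhere and can serve as the density of a measure.\<close>
  define c where "c C x = min 1 (max 0 (cexp G C x))" for C x
  have c[measurable]: "c C \<in> borel_measurable \<rho>" for C unfolding c_def[abs_def] by measurable
  have cf: "(\<lambda>\<omega>. c C (fst \<omega>)) \<in> borel_measurable P" for C using measurable_compose[OF fst_meas_rho c] .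
  have c01: "0 \<le> c C x" "c C x \<le> 1" for C x by (auto simp: c_def)
  have cc: "AE \<omega> in P. c C (fst \<omega>) = cexp G C (fst \<omega>)" if "C \<in> sets \<rho>" for C
    using AE_fst[OF cexp_bounds[OF G that]] by eventually_elim (auto simp: c_def)
  have if1: "(\<lambda>\<omega>. indicat_real C (fst \<omega>)) \<in> borel_measurable P" if "C \<in> sets \<rho>" for C
    using measurable_compose[OF fst_meas_rho borel_measurable_indicator[OF that]] .
  \<comment> \<open>The law of \<open>Y\<close> under P weighted by f of the first coordinate. The
    hypothesis says that the weights 1_C and c C give the same distribution function.\<close>
  define \<alpha> where "\<alpha> f = distr (density P (\<lambda>\<omega>. ennreal (f (fst \<omega>)))) borel Y" for f :: "'a \<Rightarrow> real"
  have em: "measure (\<alpha> f) U = (\<integral>\<omega>. indicator {\<omega> \<in> space P. Y \<omega> \<in> U} \<omega> * f (fst \<omega>) \<partial>P)"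
    and fin: "finite_borel_measure (\<alpha> f)"
    and ig: "\<And>h::real \<Rightarrow> real. h \<in> borel_measurable borel \<Longrightarrow> (\<integral>y. h y \<partial>\<alpha> f) = (\<integral>\<omega>. f (fst \<omega>) * h (Y \<omega>) \<partial>P)"
    if f: "(\<lambda>\<omega>. f (fst \<omega>)) \<in> borel_measurable P" "\<And>x. 0 \<le> f x" "\<And>x. f x \<le> 1" and U: "U \<in> sets borel" for f U
  proof -
    have Yd: "Y \<in> measurable (density P (\<lambda>\<omega>. ennreal (f (fst \<omega>)))) borel" by simp
    have YU: "{\<omega> \<in> space P. Y \<omega> \<in> U} \<in> sets P" using U by measurable
    have "emeasure (\<alpha> f) U = emeasure (density P (\<lambda>\<omega>. ennreal (f (fst \<omega>)))) {\<omega> \<in> space P. Y \<omega> \<in> U}"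
      unfolding \<alpha>_def by (subst emeasure_distr[OF Yd U]) (auto intro!: arg_cong2[where f=emeasure])
    also have "\<dots> = (\<integral>\<^sup>+\<omega>. ennreal (f (fst \<omega>)) * indicator {\<omega> \<in> space P. Y \<omega> \<in> U} \<omega> \<partial>P)"
      by (rule emeasure_density) (use f YU in auto)
    also have "\<dots> = (\<integral>\<^sup>+\<omega>. ennreal (indicator {\<omega> \<in> space P. Y \<omega> \<in> U} \<omega> * f (fst \<omega>)) \<partial>P)"
      by (rule nn_integral_cong) (auto simp: indicator_def)
    also have "\<dots> = ennreal (\<integral>\<omega>. indicator {\<omega> \<in> space P. Y \<omega> \<in> U} \<omega> * f (fst \<omega>) \<partial>P)"
    proof (rule nn_integral_eq_integral)
      show "integrable P (\<lambda>\<omega>. indicator {\<omega> \<in> space P. Y \<omega> \<in> U} \<omega> * f (fst \<omega>))"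
      proof (rule P.integrable_const_bound[where B=1])
        show "(\<lambda>\<omega>. indicator {\<omega> \<in> space P. Y \<omega> \<in> U} \<omega> * f (fst \<omega>)) \<in> borel_measurable P"
          using f(1) YU by (intro borel_measurable_times borel_measurable_indicator)
      qed (use f in \<open>auto simp: indicator_def\<close>)
    qed (use f in auto)
    finally have e: "emeasure (\<alpha> f) U = ennreal (\<integral>\<omega>. indicator {\<omega> \<in> space P. Y \<omega> \<in> U} \<omega> * f (fst \<omega>) \<partial>P)" .
    then show "measure (\<alpha> f) U = (\<integral>\<omega>. indicator {\<omega> \<in> space P. Y \<omega> \<in> U} \<omega> * f (fst \<omega>) \<partial>P)"
      using f by (simp add: measure_def)
    show "finite_borel_measure (\<alpha> f)"
    proof (intro finite_borel_measure.intro finite_measureI finite_borel_measure_axioms.intro)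
      have "emeasure (\<alpha> f) (space (\<alpha> f)) = emeasure (density P (\<lambda>\<omega>. ennreal (f (fst \<omega>)))) (space P)"
        unfolding \<alpha>_def by (subst emeasure_distr) (auto simp: Yd)
      also have "\<dots> = (\<integral>\<^sup>+\<omega>. ennreal (f (fst \<omega>)) * indicator (space P) \<omega> \<partial>P)"
        by (rule emeasure_density[OF measurable_compose[OF f(1) measurable_ennreal] sets.top])
      also have "\<dots> \<le> (\<integral>\<^sup>+\<omega>. 1 \<partial>P)"
        by (rule nn_integral_mono) (use f in \<open>auto simp: indicator_def\<close>)
      also have "\<dots> = 1" by (simp add: P.emeasure_space_1 del: space_P)
      finally show "emeasure (\<alpha> f) (space (\<alpha> f)) \<noteq> \<infinity>" by (auto simp: top_unique)
      show "sets (\<alpha> f) = sets borel" by (simp add: \<alpha>_def)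
    qed
    show "(\<integral>y. h y \<partial>\<alpha> f) = (\<integral>\<omega>. f (fst \<omega>) * h (Y \<omega>) \<partial>P)" if h: "h \<in> borel_measurable borel" for h :: "real \<Rightarrow> real"
    proof -
      have hY: "(\<lambda>\<omega>. h (Y \<omega>)) \<in> borel_measurable P" using measurable_compose[OF Y h] .
      show ?thesis unfolding \<alpha>_def
        by (subst integral_distr[OF Yd h], subst integral_density[OF hY]) (use f in auto)
    qed
  qed
  have eqc: "(\<integral>\<omega>. g \<omega> * c C (fst \<omega>) \<partial>P) = (\<integral>\<omega>. g \<omega> * cexp G C (fst \<omega>) \<partial>P)"
    if C: "C \<in> sets \<rho>" and g: "g \<in> borel_measurable P" for C and g :: "'a \<times> real \<Rightarrow> real"
  proof (rule integral_cong_AE)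
    show "AE \<omega> in P. g \<omega> * c C (fst \<omega>) = g \<omega> * cexp G C (fst \<omega>)" using cc[OF C] by eventually_elim simp
    show "(\<lambda>\<omega>. g \<omega> * cexp G C (fst \<omega>)) \<in> borel_measurable P"
      using g measurable_compose[OF fst_meas_rho cexp_meas(1)] by simp
  qed (use g cf in auto)
  have eq: "\<alpha> (indicator C) = \<alpha> (c C)" if C: "C \<in> sets \<rho>" for C
  proof (rule cdf_unique')
    show "finite_borel_measure (\<alpha> (indicator C))" by (rule fin[of _ UNIV]) (use if1[OF C] in auto)
    show "finite_borel_measure (\<alpha> (c C))" by (rule fin[of _ UNIV]) (use cf c01 in auto)
    show "cdf (\<alpha> (indicator C)) = cdf (\<alpha> (c C))"
    proof
      fix s
      have As: "{\<omega> \<in> space P. Y \<omega> \<le> s} \<in> sets P" by measurable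
      have "measure (\<alpha> (indicator C)) {..s} = measure P ({\<omega> \<in> space P. Y \<omega> \<le> s} \<inter> fst -` C)"
        using em[of "indicator C" "{..s}"] if1[OF C] measure_eq_integral[OF As C] by simp
      also have "\<dots> = (\<integral>\<omega>. indicator {\<omega> \<in> space P. Y \<omega> \<le> s} \<omega> * cexp G C (fst \<omega>) \<partial>P)"
        using indep_given[of s] C unfolding indep_given_def by blast
      also have "\<dots> = measure (\<alpha> (c C)) {..s}"
        using em[of "c C" "{..s}"] cf c01 eqc[OF C, of "indicator {\<omega> \<in> space P. Y \<omega> \<le> s}"] As by simp
      finally show "cdf (\<alpha> (indicator C)) s = cdf (\<alpha> (c C)) s" by (simp add: cdf_def)
    qed
  qed
  show "indep_given {\<omega> \<in> space P. Y \<omega> \<in> U} G" if U: "U \<in> sets borel"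
    unfolding indep_given_def
  proof
    fix C assume C: "C \<in> sets \<rho>"
    have AU: "{\<omega> \<in> space P. Y \<omega> \<in> U} \<in> sets P" using U by measurable
    show "measure P ({\<omega> \<in> space P. Y \<omega> \<in> U} \<inter> fst -` C) = (\<integral>\<omega>. indicator {\<omega> \<in> space P. Y \<omega> \<in> U} \<omega> * cexp G C (fst \<omega>) \<partial>P)"
      using em[of "c C" U] em[of "indicator C" U] cf c01 if1[OF C] U measure_eq_integral[OF AU C] eq[OF C]
        eqc[OF C, of "indicator {\<omega> \<in> space P. Y \<omega> \<in> U}"] AU by simp
  qed
  show "(\<integral>\<omega>. h (Y \<omega>) * indicator C (fst \<omega>) \<partial>P) = (\<integral>\<omega>. h (Y \<omega>) * cexp G C (fst \<omega>) \<partial>P)"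
    if C: "C \<in> sets \<rho>" and h: "h \<in> borel_measurable borel"
  proof -
    have hY: "(\<lambda>\<omega>. h (Y \<omega>)) \<in> borel_measurable P" using measurable_compose[OF Y h] .
    have "(\<integral>\<omega>. h (Y \<omega>) * indicator C (fst \<omega>) \<partial>P) = (\<integral>y. h y \<partial>\<alpha> (indicator C))"
      using ig[of "indicator C" UNIV h] if1[OF C] h by (simp add: mult.commute)
    also have "\<dots> = (\<integral>\<omega>. h (Y \<omega>) * c C (fst \<omega>) \<partial>P)"
      unfolding eq[OF C] using ig[of "c C" UNIV h] cf c01 h by (simp add: mult.commute)
    finally show ?thesis using eqc[OF C hY] by simp
  qed
qed

text \<open>The converse passage, from continuous functions of \<open>Y\<close> back to half-lines,
  by dominated convergence. It is the form in which the property survives weak limits of P.\<close>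

lemma indep_given_of_continuous:
  fixes Y :: "'a \<times> real \<Rightarrow> real"
  assumes Y[measurable]: "Y \<in> borel_measurable P" and G: "sub_sigma G"
    and H: "\<And>h C. continuous_on UNIV h \<Longrightarrow> (\<And>y. \<bar>h y\<bar> \<le> 1) \<Longrightarrow> C \<in> sets \<rho> \<Longrightarrow>
      (\<integral>\<omega>. h (Y \<omega>) * (indicator C (fst \<omega>) - cexp G C (fst \<omega>)) \<partial>P) = 0"
  shows "indep_given {\<omega> \<in> space P. Y \<omega> \<le> s} G"
  unfolding indep_given_def
proof
  fix C assume C: "C \<in> sets \<rho>"
  define A where "A = {\<omega> \<in> space P. Y \<omega> \<le> s}"
  have A[measurable]: "A \<in> sets P" unfolding A_def by measurable
  define d where "d \<omega> = indicator C (fst \<omega>) - cexp G C (fst \<omega>)" for \<omega> :: "'a \<times> real"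
  have di: "integrable P d" unfolding d_def
    by (intro Bochner_Integration.integrable_diff integrable_cexp_fst G C integrable_fst integrable_ind)
  \<comment> \<open>Equal to 1 up to s and, for n > 0, equal to 0 from s + 1/n on: descending from
    the right of s, the limit is the indicator of the closed half-line.\<close>
  define h where "h n y = max 0 (1 - real n * max 0 (y - s))" for n y
  have hc: "continuous_on UNIV (h n)" for n unfolding h_def by (intro continuous_intros)
  have hb: "\<bar>h n y\<bar> \<le> 1" for n y by (auto simp: h_def)
  have hm: "h n \<in> borel_measurable borel" for n using hc by (rule borel_measurable_continuous_onI)
  have "(\<lambda>n. \<integral>\<omega>. h n (Y \<omega>) * d \<omega> \<partial>P) \<longlonglongrightarrow> (\<integral>\<omega>. indicator A \<omega> * d \<omega> \<partial>P)"
  proof (rule integral_dominated_convergence[where w="\<lambda>\<omega>. \<bar>d \<omega>\<bar>"])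
    show "AE \<omega> in P. (\<lambda>n. h n (Y \<omega>) * d \<omega>) \<longlonglongrightarrow> indicator A \<omega> * d \<omega>"
    proof (rule AE_I2)
      fix \<omega> assume \<omega>: "\<omega> \<in> space P"
      have "(\<lambda>n. h n (Y \<omega>)) \<longlonglongrightarrow> indicator A \<omega>"
      proof (cases "Y \<omega> \<le> s")
        case True then show ?thesis using \<omega> by (simp add: h_def A_def)
      next
        case False
        then obtain N where N: "1 < real N * (Y \<omega> - s)" using reals_Archimedean3[of "Y \<omega> - s"] by auto
        have "\<forall>\<^sub>F n in sequentially. h n (Y \<omega>) = 0"
        proof (rule eventually_sequentiallyI[of N])
          fix n assume "N \<le> n"
          then have "real N * (Y \<omega> - s) \<le> real n * (Y \<omega> - s)" using False by simp
          then have "1 \<le> real n * (Y \<omega> - s)" using N by linarith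
          then show "h n (Y \<omega>) = 0" using False by (simp add: h_def max_def)
        qed
        then show ?thesis using False by (simp add: A_def tendsto_eventually)
      qed
      then show "(\<lambda>n. h n (Y \<omega>) * d \<omega>) \<longlonglongrightarrow> indicator A \<omega> * d \<omega>" by (intro tendsto_intros)
    qed
    show "AE \<omega> in P. norm (h n (Y \<omega>) * d \<omega>) \<le> \<bar>d \<omega>\<bar>" for n
      by (rule AE_I2) (use hb in \<open>auto simp: abs_mult intro!: mult_left_le_one_le\<close>)
    show "(\<lambda>\<omega>. h n (Y \<omega>) * d \<omega>) \<in> borel_measurable P" for n
      using measurable_compose[OF Y hm[of n]] di by simp
  qed (use di in auto)
  moreover have "(\<integral>\<omega>. h n (Y \<omega>) * d \<omega> \<partial>P) = 0" for n
    unfolding d_def by (rule H[OF hc hb C])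
  ultimately have "(\<integral>\<omega>. indicator A \<omega> * d \<omega> \<partial>P) = 0" by (simp add: LIMSEQ_const_iff)
  moreover have "(\<integral>\<omega>. indicator A \<omega> * d \<omega> \<partial>P) = (\<integral>\<omega>. indicator A \<omega> * indicator C (fst \<omega>) \<partial>P) - (\<integral>\<omega>. indicator A \<omega> * cexp G C (fst \<omega>) \<partial>P)"
  proof -
    have "integrable P (\<lambda>\<omega>. indicator A \<omega> * indicator C (fst \<omega>) :: real)" "integrable P (\<lambda>\<omega>. indicator A \<omega> * cexp G C (fst \<omega>))"
      using integrable_mult_indicator[OF A integrable_fst[OF integrable_ind[OF C]]]
        integrable_mult_indicator[OF A integrable_cexp_fst[OF G C]] by auto
    then show ?thesis unfolding d_def by (simp add: right_diff_distrib)
  qed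
  ultimately show "measure P ({\<omega> \<in> space P. Y \<omega> \<le> s} \<inter> fst -` C) = (\<integral>\<omega>. indicator {\<omega> \<in> space P. Y \<omega> \<le> s} \<omega> * cexp G C (fst \<omega>) \<partial>P)"
    using measure_eq_integral[OF A C] by (simp add: A_def)
qed

end

subsection \<open>Discretising the second coordinate\<close>

lemma continuous_map_snd_Itop: "continuous_map (prod_topology X (Itop T)) euclideanreal snd"
  using continuous_map_snd[of X "Itop T"] unfolding Itop_def by (simp add: continuous_map_in_subtopology)

text \<open>Only the time factor has a countable base. For each basic set V the union of all open W
  with W \<times> V inside \<open>U\<close> is again open, so \<open>U\<close> is a countable union
  of open rectangles, whatever the topology \<open>X\<close> is.\<close>

lemma openin_prod_Itop_measurable:
  assumes U: "openin (prod_topology X (Itop T)) U"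
  shows "U \<in> sets (borel_of X \<Otimes>\<^sub>M borel)"
proof -
  obtain B :: "real set set" where B: "countable B" "\<And>C. C \<in> B \<Longrightarrow> open C" "\<And>S. open S \<Longrightarrow> \<exists>U. U \<subseteq> B \<and> S = \<Union>U"
    using univ_second_countable by metis
  define W where "W V = \<Union>{W. openin X W \<and> W \<times> (V \<inter> {0..T}) \<subseteq> U}" for V
  have eq: "U = (\<Union>V\<in>B. W V \<times> (V \<inter> {0..T}))"
  proof
    show "(\<Union>V\<in>B. W V \<times> (V \<inter> {0..T})) \<subseteq> U" by (auto simp: W_def)
    show "U \<subseteq> (\<Union>V\<in>B. W V \<times> (V \<inter> {0..T}))"
    proof
      fix p assume p: "p \<in> U"
      obtain x s where xs: "p = (x, s)" by force
      have "\<exists>W V. openin X W \<and> openin (Itop T) V \<and> x \<in> W \<and> s \<in> V \<and> W \<times> V \<subseteq> U"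
        using U p xs by (simp add: openin_prod_topology_alt)
      then obtain W1 V1 where W1: "openin X W1" "openin (Itop T) V1" "x \<in> W1" "s \<in> V1" "W1 \<times> V1 \<subseteq> U" by auto
      obtain O1 where O1: "open O1" "V1 = O1 \<inter> {0..T}" using W1(2) by (auto simp: Itop_def openin_subtopology)
      obtain B' where B': "B' \<subseteq> B" "O1 = \<Union>B'" using B(3)[OF O1(1)] by auto
      moreover have "s \<in> O1" using W1(4) O1(2) by simp
      ultimately obtain V where V: "V \<in> B" "s \<in> V" "V \<subseteq> O1" by auto
      have "W1 \<times> (V \<inter> {0..T}) \<subseteq> U" using W1(5) V(3) O1(2) by blast
      then have "x \<in> W V" using W1(1,3) unfolding W_def by blast
      then show "p \<in> (\<Union>V\<in>B. W V \<times> (V \<inter> {0..T}))" using V W1(4) O1(2) xs by blast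
    qed
  qed
  have "W V \<in> sets (borel_of X)" for V unfolding W_def by (rule openin_borel_of) (auto intro: openin_Union)
  moreover have "V \<inter> {0..T} \<in> sets borel" if "V \<in> B" for V using B(2)[OF that] by auto
  ultimately have "(\<Union>V\<in>B. W V \<times> (V \<inter> {0..T})) \<in> sets (borel_of X \<Otimes>\<^sub>M borel)"
    by (intro sets.countable_UN' B(1)) auto
  then show ?thesis using eq by simp
qed

lemma measurable_into_prod_Itop:
  assumes \<xi>: "\<xi> \<in> measurable N (borel_of X)" and \<theta>: "\<theta> \<in> borel_measurable N" "\<And>\<omega>. \<omega> \<in> space N \<Longrightarrow> \<theta> \<omega> \<in> {0..T}"
  shows "(\<lambda>\<omega>. (\<xi> \<omega>, \<theta> \<omega>)) \<in> measurable N (borel_of (prod_topology X (Itop T)))"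
proof (rule measurable_sigma_sets[OF sets_borel_of])
  show "{U. openin (prod_topology X (Itop T)) U} \<subseteq> Pow (topspace (prod_topology X (Itop T)))" using openin_subset by blast
  show "(\<lambda>\<omega>. (\<xi> \<omega>, \<theta> \<omega>)) \<in> space N \<rightarrow> topspace (prod_topology X (Itop T))"
    using measurable_space[OF \<xi>] \<theta>(2) by auto
  have "(\<lambda>\<omega>. (\<xi> \<omega>, \<theta> \<omega>)) \<in> measurable N (borel_of X \<Otimes>\<^sub>M borel)" using \<xi> \<theta>(1) by measurable
  then show "(\<lambda>\<omega>. (\<xi> \<omega>, \<theta> \<omega>)) -` U \<inter> space N \<in> sets N" if "U \<in> {U. openin (prod_topology X (Itop T)) U}" for U
    using measurable_sets openin_prod_Itop_measurable that by blast
qed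

lemma coupling_distr:
  assumes "0 < T" and rho: "\<rho> \<in> Pspace X" and N: "prob_space N"
    and \<xi>: "\<xi> \<in> measurable N (borel_of X)" "distr N (borel_of X) \<xi> = \<rho>"
    and \<theta>: "\<theta> \<in> borel_measurable N" "\<And>\<omega>. \<omega> \<in> space N \<Longrightarrow> \<theta> \<omega> \<in> {0..T}"
  shows "coupling X T \<rho> (distr N (borel_of (prod_topology X (Itop T))) (\<lambda>\<omega>. (\<xi> \<omega>, \<theta> \<omega>)))"
    and "f \<in> borel_measurable (borel_of (prod_topology X (Itop T))) \<Longrightarrow>
      (\<integral>p. f p \<partial>distr N (borel_of (prod_topology X (Itop T))) (\<lambda>\<omega>. (\<xi> \<omega>, \<theta> \<omega>))) = (\<integral>\<omega>. (f (\<xi> \<omega>, \<theta> \<omega>) :: real) \<partial>N)"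
proof -
  note m = measurable_into_prod_Itop[OF \<xi>(1) \<theta>]
  show "coupling X T \<rho> (distr N (borel_of (prod_topology X (Itop T))) (\<lambda>\<omega>. (\<xi> \<omega>, \<theta> \<omega>)))"
  proof
    show "distr N (borel_of (prod_topology X (Itop T))) (\<lambda>\<omega>. (\<xi> \<omega>, \<theta> \<omega>)) \<in> Pspace (prod_topology X (Itop T))"
      using prob_space.prob_space_distr[OF N m] by (simp add: Pspace_iff)
    have "fst \<in> measurable (borel_of (prod_topology X (Itop T))) (borel_of X)"
      by (rule continuous_map_measurable_borel_of[OF continuous_map_fst])
    then show "distr (distr N (borel_of (prod_topology X (Itop T))) (\<lambda>\<omega>. (\<xi> \<omega>, \<theta> \<omega>))) (borel_of X) fst = \<rho>"
      using m \<xi>(2) by (simp add: distr_distr comp_def)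
  qed (use assms in auto)
  show "(\<integral>p. f p \<partial>distr N (borel_of (prod_topology X (Itop T))) (\<lambda>\<omega>. (\<xi> \<omega>, \<theta> \<omega>))) = (\<integral>\<omega>. (f (\<xi> \<omega>, \<theta> \<omega>) :: real) \<partial>N)"
    if "f \<in> borel_measurable (borel_of (prod_topology X (Itop T)))"
    using integral_distr[OF m that] .
qed

text \<open>Truth values that can only switch from true to false form an initial segment, so their
  number \<open>j\<close> is the last true index, and the sum of the increments of \<open>F\<close>
  over the true indices telescopes to \<open>F (1 + j)\<close>.\<close>

lemma antimono_count:
  fixes S :: "nat \<Rightarrow> bool"
  assumes "\<forall>k. 1 \<le> k \<longrightarrow> Suc k < n \<longrightarrow> S (Suc k) \<longrightarrow> S k" "1 \<le> n"
  defines "j \<equiv> (\<Sum>k=1..<n. of_bool (S k))"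
  shows "j < n" "k \<in> {1..<n} \<Longrightarrow> S k \<longleftrightarrow> k \<le> j"
    and "F (1 + j) = F 1 + (\<Sum>k=1..<n. (F (k + 1) - F k) * (of_bool (S k) :: real))"
proof -
  define j' where "j' m = (\<Sum>k=1..<m. of_bool (S k) :: nat)" for m
  have "j' m < m \<and> (\<forall>k\<in>{1..<m}. S k \<longleftrightarrow> k \<le> j' m) \<and>
     F (1 + j' m) = F 1 + (\<Sum>k=1..<m. (F (k + 1) - F k) * (of_bool (S k) :: real))" if "1 \<le> m" "m \<le> n" for m
    using that
  proof (induction m rule: nat_induct_at_least)
    case base then show ?case by (simp add: j'_def)
  next
    case (Suc m)
    then have "m \<le> n" by simp
    from Suc.IH[OF this] have IH: "j' m < m" "\<forall>k\<in>{1..<m}. S k \<longleftrightarrow> k \<le> j' m"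
      "F (1 + j' m) = F 1 + (\<Sum>k=1..<m. (F (k + 1) - F k) * (of_bool (S k) :: real))" by blast+
    have step: "j' (Suc m) = j' m + of_bool (S m)" using Suc by (simp add: j'_def)
    show ?case
    proof (cases "S m")
      case True
      \<comment> \<open>If \<open>S m\<close> holds then so does every earlier one and the count
        over {1..<m} is full; for m = 1 both sides are 0.\<close>
      have "j' m = m - 1"
      proof (cases "m = 1")
        case False
        then have "S (m - 1)" using assms(1)[rule_format, of "m - 1"] True Suc by auto
        then have "m - 1 \<le> j' m" using IH(2) Suc False by auto
        then show ?thesis using IH(1) by simp
      qed (use IH in auto)
      then have jm: "j' (Suc m) = m" using step True Suc by auto
      have "\<forall>k\<in>{1..<Suc m}. S k" using True IH(2) \<open>j' m = m - 1\<close> by (auto simp: less_Suc_eq)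
      moreover have "F (1 + j' m) = F m" using \<open>j' m = m - 1\<close> Suc by simp
      ultimately show ?thesis using jm IH(3) True Suc by (simp add: algebra_simps)
    next
      case False
      then have e1: "j' (Suc m) = j' m" using step by simp
      have e2: "(\<Sum>k=1..<Suc m. (F (k + 1) - F k) * (of_bool (S k) :: real)) = (\<Sum>k=1..<m. (F (k + 1) - F k) * (of_bool (S k) :: real))"
        using False Suc by simp
      have e3: "\<forall>k\<in>{1..<Suc m}. S k \<longleftrightarrow> k \<le> j' m" using IH(1,2) False by (auto simp: less_Suc_eq)
      show ?thesis unfolding e1 e2 by (intro conjI e3 IH(3)) (use IH(1) in simp)
    qed
  qed
  note this[of n, unfolded j'_def, folded j_def]
  with assms(2) show "j < n" "k \<in> {1..<n} \<Longrightarrow> S k \<longleftrightarrow> k \<le> j"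
    "F (1 + j) = F 1 + (\<Sum>k=1..<n. (F (k + 1) - F k) * (of_bool (S k) :: real))"
    by blast+
qed

text \<open>The modulus of continuity of s \<mapsto> f (x, s) on [0, T] at scale d, for fixed
  x.\<close>

definition osc :: "real \<Rightarrow> ('a \<times> real \<Rightarrow> real) \<Rightarrow> real \<Rightarrow> 'a \<Rightarrow> real" where
  "osc T f d x = (SUP p\<in>{p \<in> {0..T} \<times> {0..T}. \<bar>fst p - snd p\<bar> \<le> d}. \<bar>f (x, fst p) - f (x, snd p)\<bar>)"

lemma continuous_map_slice:
  assumes "continuous_map (prod_topology X (Itop T)) euclideanreal f"
  shows "x \<in> topspace X \<Longrightarrow> continuous_on {0..T} (\<lambda>s. f (x, s))"
    and "s \<in> {0..T} \<Longrightarrow> continuous_map X euclideanreal (\<lambda>x. f (x, s))"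
proof -
  show "continuous_on {0..T} (\<lambda>s. f (x, s))" if "x \<in> topspace X"
  proof -
    have "continuous_map (Itop T) (prod_topology X (Itop T)) (\<lambda>s. (x, s))"
      using that by (intro continuous_map_pairedI) auto
    from continuous_map_compose[OF this assms] show ?thesis by (simp add: o_def Itop_def)
  qed
  show "continuous_map X euclideanreal (\<lambda>x. f (x, s))" if "s \<in> {0..T}"
  proof -
    have "continuous_map X (prod_topology X (Itop T)) (\<lambda>x. (x, s))"
      using that by (intro continuous_map_pairedI) auto
    from continuous_map_compose[OF this assms] show ?thesis by (simp add: o_def)
  qed
qed

context
  fixes X :: "'a topology" and T :: real and f :: "'a \<times> real \<Rightarrow> real" and B :: real
  assumes T: "0 < T" and f: "continuous_map (prod_topology X (Itop T)) euclideanreal f"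
    and B0: "\<forall>p\<in>topspace (prod_topology X (Itop T)). \<bar>f p\<bar> \<le> B"
begin

private lemma B: "x \<in> topspace X \<Longrightarrow> s \<in> {0..T} \<Longrightarrow> \<bar>f (x, s)\<bar> \<le> B"
  using B0 by auto

lemma osc_bdd:
  assumes "x \<in> topspace X"
  shows "bdd_above ((\<lambda>p. \<bar>f (x, fst p) - f (x, snd p)\<bar>) ` {p \<in> {0..T} \<times> {0..T}. \<bar>fst p - snd p\<bar> \<le> d})"
proof (rule bdd_aboveI2)
  fix p assume "p \<in> {p \<in> {0..T} \<times> {0..T}. \<bar>fst p - snd p\<bar> \<le> d}"
  then have "\<bar>f (x, fst p)\<bar> \<le> B" "\<bar>f (x, snd p)\<bar> \<le> B" using B[OF assms] by auto
  then show "\<bar>f (x, fst p) - f (x, snd p)\<bar> \<le> 2 * B" by linarith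
qed

lemma osc_upper:
  assumes "x \<in> topspace X" "s \<in> {0..T}" "s' \<in> {0..T}" "\<bar>s - s'\<bar> \<le> d"
  shows "\<bar>f (x, s) - f (x, s')\<bar> \<le> osc T f d x"
  unfolding osc_def using cSUP_upper[OF _ osc_bdd[OF assms(1)], of "(s, s')" d] assms by simp

lemma osc_least:
  assumes "x \<in> topspace X" "0 \<le> d" "\<And>s s'. s \<in> {0..T} \<Longrightarrow> s' \<in> {0..T} \<Longrightarrow> \<bar>s - s'\<bar> \<le> d \<Longrightarrow> \<bar>f (x, s) - f (x, s')\<bar> \<le> e"
  shows "osc T f d x \<le> e"
  unfolding osc_def
proof (rule cSUP_least)
  have "(0, 0) \<in> {p \<in> {0..T} \<times> {0..T}. \<bar>fst p - snd p\<bar> \<le> d}" using T assms(2) by simp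
  then show "{p \<in> {0..T} \<times> {0..T}. \<bar>fst p - snd p\<bar> \<le> d} \<noteq> {}" by blast
qed (use assms in auto)

lemma osc_bounds: "x \<in> topspace X \<Longrightarrow> 0 \<le> d \<Longrightarrow> 0 \<le> osc T f d x \<and> osc T f d x \<le> 2 * B"
proof (intro conjI)
  assume x: "x \<in> topspace X" and d: "0 \<le> d"
  show "0 \<le> osc T f d x" using osc_upper[OF x, of 0 0 d] T d by simp
  show "osc T f d x \<le> 2 * B"
  proof (rule osc_least[OF x d])
    fix s s' assume "s \<in> {0..T}" "s' \<in> {0..T}"
    then show "\<bar>f (x, s) - f (x, s')\<bar> \<le> 2 * B" using B[OF x, of s] B[OF x, of s'] by linarith
  qed
qed

text \<open>A supremum of continuous functions is lower semicontinuous: its superlevel sets are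
  unions of open sets, so the uncountable index set does no harm.\<close>

lemma osc_measurable: "0 \<le> d \<Longrightarrow> osc T f d \<in> borel_measurable (borel_of X)"
  unfolding borel_measurable_iff_greater
proof
  fix a assume d: "0 \<le> d"
  let ?I = "{p \<in> {0..T} \<times> {0..T}. \<bar>fst p - snd p\<bar> \<le> d}"
  have "(0, 0) \<in> ?I" using T d by simp
  then have ne: "?I \<noteq> {}" by blast
  have "{x \<in> topspace X. a < osc T f d x} = (\<Union>p\<in>?I. {x \<in> topspace X. a < \<bar>f (x, fst p) - f (x, snd p)\<bar>})"
  proof -
    have "a < osc T f d x \<longleftrightarrow> (\<exists>p\<in>?I. a < \<bar>f (x, fst p) - f (x, snd p)\<bar>)" if "x \<in> topspace X" for x
      unfolding osc_def by (rule less_cSUP_iff[OF ne osc_bdd[OF that]])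
    then show ?thesis by blast
  qed
  moreover have "openin X {x \<in> topspace X. \<bar>f (x, fst p) - f (x, snd p)\<bar> \<in> {a<..}}" if "p \<in> ?I" for p
  proof (rule openin_continuous_map_preimage)
    show "continuous_map X euclideanreal (\<lambda>x. \<bar>f (x, fst p) - f (x, snd p)\<bar>)"
      using that by (intro continuous_map_real_abs continuous_map_diff continuous_map_slice(2)[OF f]) auto
  qed auto
  ultimately have "openin X {x \<in> topspace X. a < osc T f d x}" by (auto intro!: openin_Union)
  then show "{w \<in> space (borel_of X). a < osc T f d w} \<in> sets (borel_of X)" using openin_borel_of by simp
qed

lemma osc_tendsto:
  assumes x: "x \<in> topspace X"
  shows "(\<lambda>n. osc T f (T / real n) x) \<longlonglongrightarrow> 0"
proof (rule LIMSEQ_I)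
  fix e :: real assume e: "0 < e"
  have "uniformly_continuous_on {0..T} (\<lambda>s. f (x, s))"
    by (rule compact_uniformly_continuous[OF continuous_map_slice(1)[OF f x]]) simp
  then obtain d where d: "0 < d" "\<And>s s'. s \<in> {0..T} \<Longrightarrow> s' \<in> {0..T} \<Longrightarrow> dist s' s < d \<Longrightarrow> dist (f (x, s')) (f (x, s)) < e/2"
    unfolding uniformly_continuous_on_def using e by (metis half_gt_zero)
  obtain N :: nat where N: "T / d < real N" using reals_Archimedean2 by blast
  show "\<exists>no. \<forall>n\<ge>no. norm (osc T f (T / real n) x - 0) < e"
  proof (intro exI allI impI)
    fix n assume n: "max 1 N \<le> n"
    then have "T / d < real n" using N by linarith
    then have Tn: "T / real n < d" using d(1) n by (simp add: field_simps)
    have "osc T f (T / real n) x \<le> e/2"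
    proof (rule osc_least[OF x])
      fix s s' assume "s \<in> {0..T}" "s' \<in> {0..T}" "\<bar>s - s'\<bar> \<le> T / real n"
      then show "\<bar>f (x, s) - f (x, s')\<bar> \<le> e/2" using d(2)[of s' s] Tn by (simp add: dist_real_def)
    qed (use T in simp)
    then show "norm (osc T f (T / real n) x - 0) < e" using osc_bounds[OF x, of "T / real n"] T e by simp
  qed
qed

lemma osc_integral_tendsto:
  assumes rho: "\<rho> \<in> Pspace X"
  shows "(\<lambda>n. \<integral>x. osc T f (T / real n) x \<partial>\<rho>) \<longlonglongrightarrow> 0"
proof -
  interpret prob_space \<rho> using rho by (simp add: Pspace_iff)
  have "(\<lambda>n. \<integral>x. osc T f (T / real n) x \<partial>\<rho>) \<longlonglongrightarrow> (\<integral>x. 0 \<partial>\<rho>)"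
  proof (rule integral_dominated_convergence[where w="\<lambda>_. 2 * B"])
    show "AE x in \<rho>. (\<lambda>n. osc T f (T / real n) x) \<longlonglongrightarrow> 0"
      by (rule AE_I2) (use osc_tendsto space_Pspace[OF rho] in auto)
    show "AE x in \<rho>. norm (osc T f (T / real n) x) \<le> 2 * B" for n
      by (rule AE_I2) (use osc_bounds[of _ "T / real n"] T space_Pspace[OF rho] in auto)
    show "osc T f (T / real n) \<in> borel_measurable \<rho>" for n
      unfolding Pspace_borel_measurable[OF rho] using T by (intro osc_measurable) simp
  qed auto
  then show ?thesis by simp
qed

definition grid_diff :: "nat \<Rightarrow> nat \<Rightarrow> 'a \<Rightarrow> real" where
  "grid_diff n k x = f (x, real (k + 1) * (T / real n)) - f (x, real k * (T / real n))"

lemma grid_mem: "k \<le> n \<Longrightarrow> real k * (T / real n) \<in> {0..T}"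
  using T by (cases "n = 0") (auto simp: field_simps)

lemma grid_diff_props:
  assumes "k < n"
  shows "grid_diff n k \<in> borel_measurable (borel_of X)" "x \<in> topspace X \<Longrightarrow> \<bar>grid_diff n k x\<bar> \<le> 2 * B"
proof -
  show "grid_diff n k \<in> borel_measurable (borel_of X)" unfolding grid_diff_def
    by (intro continuous_map_borel_measurable continuous_map_diff continuous_map_slice(2)[OF f] grid_mem) (use assms in auto)
  show "\<bar>grid_diff n k x\<bar> \<le> 2 * B" if "x \<in> topspace X"
    using B[OF that grid_mem[of "k+1" n]] B[OF that grid_mem[of k n]] assms unfolding grid_diff_def by linarith
qed

text \<open>The events \<open>S k\<close> mean "not yet stopped at the k-th grid point". They are
  tied to \<theta> only through \<open>close\<close>, so the lemma applies both to the events {k T /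
  n \<le> \<tau>} and to the threshold events of a randomised rule. The error involves the law of
  \<xi> alone.\<close>

lemma discretisation:
  assumes rho: "\<rho> \<in> Pspace X" and N: "prob_space N"
    and \<xi>: "\<xi> \<in> measurable N (borel_of X)" "distr N (borel_of X) \<xi> = \<rho>"
    and \<theta>: "\<theta> \<in> borel_measurable N" "\<And>\<omega>. \<omega> \<in> space N \<Longrightarrow> \<theta> \<omega> \<in> {0..T}"
    and S: "\<And>k. k \<in> {1..<n} \<Longrightarrow> S k \<in> sets N"
    and anti: "AE \<omega> in N. \<forall>k. 1 \<le> k \<longrightarrow> Suc k < n \<longrightarrow> \<omega> \<in> S (Suc k) \<longrightarrow> \<omega> \<in> S k"
    and close: "AE \<omega> in N. \<bar>\<theta> \<omega> - real (1 + (\<Sum>k=1..<n. of_bool (\<omega> \<in> S k))) * (T / real n)\<bar> \<le> T / real n"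
    and n: "1 \<le> n"
  shows "\<bar>(\<integral>\<omega>. f (\<xi> \<omega>, \<theta> \<omega>) \<partial>N) - ((\<integral>x. f (x, T / real n) \<partial>\<rho>) + (\<Sum>k=1..<n. \<integral>\<omega>. indicator (S k) \<omega> * grid_diff n k (\<xi> \<omega>) \<partial>N))\<bar>
     \<le> (\<integral>x. osc T f (T / real n) x \<partial>\<rho>)"
proof -
  interpret N: prob_space N by fact
  define j where "j \<omega> = (\<Sum>k=1..<n. of_bool (\<omega> \<in> S k) :: nat)" for \<omega>
  define R where "R \<omega> = f (\<xi> \<omega>, T / real n) + (\<Sum>k=1..<n. indicator (S k) \<omega> * grid_diff n k (\<xi> \<omega>))" for \<omega>
  have X: "\<xi> \<omega> \<in> topspace X" if "\<omega> \<in> space N" for \<omega> using measurable_space[OF \<xi>(1) that] by simp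
  have d: "T / real n \<in> {0..T}" using grid_mem[of 1 n] n by simp
  have f1: "(\<lambda>x. f (x, T / real n)) \<in> borel_measurable (borel_of X)"
    by (intro continuous_map_borel_measurable continuous_map_slice(2)[OF f] d)
  have fi: "integrable N (\<lambda>\<omega>. f (\<xi> \<omega>, \<theta> \<omega>))"
  proof (rule N.integrable_const_bound[where B=B])
    show "(\<lambda>\<omega>. f (\<xi> \<omega>, \<theta> \<omega>)) \<in> borel_measurable N"
      by (rule measurable_compose[OF measurable_into_prod_Itop[OF \<xi>(1) \<theta>] continuous_map_borel_measurable[OF f]])
    show "AE \<omega> in N. norm (f (\<xi> \<omega>, \<theta> \<omega>)) \<le> B" by (rule AE_I2) (use B X \<theta> in auto)
  qed
  have i1: "integrable N (\<lambda>\<omega>. f (\<xi> \<omega>, T / real n))"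
  proof (rule N.integrable_const_bound[where B=B])
    show "(\<lambda>\<omega>. f (\<xi> \<omega>, T / real n)) \<in> borel_measurable N" by (rule measurable_compose[OF \<xi>(1) f1])
    show "AE \<omega> in N. norm (f (\<xi> \<omega>, T / real n)) \<le> B" by (rule AE_I2) (use B X d in auto)
  qed
  have i2: "integrable N (\<lambda>\<omega>. indicator (S k) \<omega> * grid_diff n k (\<xi> \<omega>))" if k: "k \<in> {1..<n}" for k
  proof (rule N.integrable_const_bound[where B="2*B"])
    show "(\<lambda>\<omega>. indicator (S k) \<omega> * grid_diff n k (\<xi> \<omega>)) \<in> borel_measurable N"
      using S[OF k] measurable_compose[OF \<xi>(1) grid_diff_props(1)] k by (intro borel_measurable_times borel_measurable_indicator) auto
    have B0: "0 \<le> B" if "x \<in> topspace X" for x using B[OF that d] by linarith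
    show "AE \<omega> in N. norm (indicator (S k) \<omega> * grid_diff n k (\<xi> \<omega>)) \<le> 2*B"
      by (rule AE_I2) (use grid_diff_props(2)[of k n] k X B0 in \<open>auto simp: indicator_def\<close>)
  qed
  have Ri: "integrable N R" unfolding R_def using i1 i2 by (intro Bochner_Integration.integrable_add Bochner_Integration.integrable_sum) auto
  have "(\<integral>\<omega>. R \<omega> \<partial>N) = (\<integral>\<omega>. f (\<xi> \<omega>, T / real n) \<partial>N) + (\<Sum>k=1..<n. \<integral>\<omega>. indicator (S k) \<omega> * grid_diff n k (\<xi> \<omega>) \<partial>N)"
    unfolding R_def
    by (subst Bochner_Integration.integral_add[OF i1 Bochner_Integration.integrable_sum[OF i2]],
        assumption, subst Bochner_Integration.integral_sum[OF i2], assumption, rule refl)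
  also have "(\<integral>\<omega>. f (\<xi> \<omega>, T / real n) \<partial>N) = (\<integral>x. f (x, T / real n) \<partial>\<rho>)"
    using integral_distr[OF \<xi>(1) f1] \<xi>(2) by simp
  finally have Rint: "(\<integral>\<omega>. R \<omega> \<partial>N) = (\<integral>x. f (x, T / real n) \<partial>\<rho>) + (\<Sum>k=1..<n. \<integral>\<omega>. indicator (S k) \<omega> * grid_diff n k (\<xi> \<omega>) \<partial>N)" .
  have om: "osc T f (T / real n) \<in> borel_measurable (borel_of X)" using osc_measurable[of "T / real n"] T by simp
  have oi: "integrable N (\<lambda>\<omega>. osc T f (T / real n) (\<xi> \<omega>))"
  proof (rule N.integrable_const_bound[where B="2*B"])
    show "(\<lambda>\<omega>. osc T f (T / real n) (\<xi> \<omega>)) \<in> borel_measurable N" by (rule measurable_compose[OF \<xi>(1) om])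
    show "AE \<omega> in N. norm (osc T f (T / real n) (\<xi> \<omega>)) \<le> 2*B"
      by (rule AE_I2) (use osc_bounds[OF X, of _ "T / real n"] T in auto)
  qed
  \<comment> \<open>The sum \<open>R\<close> telescopes to the value of f at the grid point 1 + j,
    which is within T / n of \<theta> by \<open>close\<close>.\<close>
  have ptw: "AE \<omega> in N. \<bar>f (\<xi> \<omega>, \<theta> \<omega>) - R \<omega>\<bar> \<le> osc T f (T / real n) (\<xi> \<omega>)"
    using anti close AE_space
  proof eventually_elim
    case (elim \<omega>)
    have "f (\<xi> \<omega>, real (1 + j \<omega>) * (T / real n)) = f (\<xi> \<omega>, real 1 * (T / real n)) +
        (\<Sum>k=1..<n. (f (\<xi> \<omega>, real (k + 1) * (T / real n)) - f (\<xi> \<omega>, real k * (T / real n))) * of_bool (\<omega> \<in> S k))"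
      unfolding j_def by (rule antimono_count(3)[where F="\<lambda>k. f (\<xi> \<omega>, real k * (T / real n))"]) (use elim n in auto)
    then have Req: "R \<omega> = f (\<xi> \<omega>, real (1 + j \<omega>) * (T / real n))"
      unfolding R_def grid_diff_def by (simp add: indicator_def mult.commute)
    have "j \<omega> < n" unfolding j_def by (rule antimono_count(1)) (use elim n in auto)
    then have g: "real (1 + j \<omega>) * (T / real n) \<in> {0..T}" by (intro grid_mem) auto
    show ?case unfolding Req
      by (rule osc_upper[OF X \<theta>(2) g]) (use elim in \<open>auto simp: j_def\<close>)
  qed
  have "\<bar>(\<integral>\<omega>. f (\<xi> \<omega>, \<theta> \<omega>) \<partial>N) - (\<integral>\<omega>. R \<omega> \<partial>N)\<bar> = \<bar>\<integral>\<omega>. f (\<xi> \<omega>, \<theta> \<omega>) - R \<omega> \<partial>N\<bar>" using fi Ri by simp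
  also have "\<dots> \<le> (\<integral>\<omega>. \<bar>f (\<xi> \<omega>, \<theta> \<omega>) - R \<omega>\<bar> \<partial>N)" by (rule integral_abs_bound)
  also have "\<dots> \<le> (\<integral>\<omega>. osc T f (T / real n) (\<xi> \<omega>) \<partial>N)"
    by (rule integral_mono_AE[OF _ oi ptw]) (use fi Ri in auto)
  also have "\<dots> = (\<integral>x. osc T f (T / real n) x \<partial>\<rho>)" using integral_distr[OF \<xi>(1) om] \<xi>(2) by simp
  finally show ?thesis unfolding Rint .
qed

lemma discretisation_coupling:
  assumes "coupling X T \<rho> P" and n: "1 \<le> n"
  shows "\<bar>(\<integral>\<omega>. f \<omega> \<partial>P) - ((\<integral>x. f (x, T / real n) \<partial>\<rho>) +
      (\<Sum>k=1..<n. \<integral>\<omega>. indicator {\<omega> \<in> space P. real k * (T / real n) \<le> snd \<omega>} \<omega> * grid_diff n k (fst \<omega>) \<partial>P))\<bar>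
     \<le> (\<integral>x. osc T f (T / real n) x \<partial>\<rho>)"
proof -
  interpret coupling X T \<rho> P by fact
  define S where "S k = {\<omega> \<in> space P. real k * (T / real n) \<le> snd \<omega>}" for k
  have "\<bar>(\<integral>\<omega>. f (fst \<omega>, snd \<omega>) \<partial>P) - ((\<integral>x. f (x, T / real n) \<partial>\<rho>) + (\<Sum>k=1..<n. \<integral>\<omega>. indicator (S k) \<omega> * grid_diff n k (fst \<omega>) \<partial>P))\<bar>
     \<le> (\<integral>x. osc T f (T / real n) x \<partial>\<rho>)"
  proof (rule discretisation[OF rho P.prob_space_axioms fst_meas marg snd_meas _ _ _ _ n])
    show "S k \<in> sets P" for k unfolding S_def by measurable
    have an: "\<omega> \<in> S (Suc k) \<Longrightarrow> \<omega> \<in> S k" for \<omega> k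
    proof -
      assume "\<omega> \<in> S (Suc k)"
      moreover have "real k * (T / real n) \<le> real (Suc k) * (T / real n)" using T by (intro mult_right_mono) auto
      ultimately show "\<omega> \<in> S k" unfolding S_def by auto
    qed
    then show "AE \<omega> in P. \<forall>k. 1 \<le> k \<longrightarrow> Suc k < n \<longrightarrow> \<omega> \<in> S (Suc k) \<longrightarrow> \<omega> \<in> S k" by simp
    show "AE \<omega> in P. \<bar>snd \<omega> - real (1 + (\<Sum>k=1..<n. of_bool (\<omega> \<in> S k))) * (T / real n)\<bar> \<le> T / real n"
    proof (rule AE_I2)
      fix \<omega> assume \<omega>: "\<omega> \<in> space P"
      \<comment> \<open>The time lies between the grid points j and 1 + j, so the right end of its
        cell is a valid choice.\<close>
      define j where "j = (\<Sum>k=1..<n. of_bool (\<omega> \<in> S k) :: nat)"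
      have "\<forall>k. 1 \<le> k \<longrightarrow> Suc k < n \<longrightarrow> \<omega> \<in> S (Suc k) \<longrightarrow> \<omega> \<in> S k" using an by blast
      note c = antimono_count[where S="\<lambda>k. \<omega> \<in> S k" and n=n, folded j_def, OF this n]
      have s: "0 \<le> snd \<omega>" "snd \<omega> \<le> T" using \<omega> by auto
      have lo: "real j * (T / real n) \<le> snd \<omega>"
        using c(2)[of j] c(1) s \<omega> by (cases "j = 0") (auto simp: S_def)
      have hi: "snd \<omega> \<le> real (1 + j) * (T / real n)"
      proof (cases "Suc j < n")
        case True
        then have "\<omega> \<notin> S (Suc j)" using c(2)[of "Suc j"] by auto
        then show ?thesis using \<omega> by (auto simp: S_def)
      next
        case False
        \<comment> \<open>In the last cell no event bounds the time from above; its right end is T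
          itself.\<close>
        then have "1 + j = n" using c(1) by auto
        then have "real (1 + j) * (T / real n) = T" using n by simp
        then show ?thesis using s by simp
      qed
      have "real (1 + j) * (T / real n) = real j * (T / real n) + T / real n" by (simp add: add_divide_distrib algebra_simps)
      then have "\<bar>snd \<omega> - real (1 + j) * (T / real n)\<bar> \<le> T / real n" using lo hi by (simp only: abs_le_iff) linarith
      then show "\<bar>snd \<omega> - real (1 + (\<Sum>k=1..<n. of_bool (\<omega> \<in> S k))) * (T / real n)\<bar> \<le> T / real n" by (simp only: j_def)
    qed
  qed auto
  then show ?thesis by (simp add: S_def)
qed

end

text \<open>The grid is fixed before m, which is legitimate because the oscillation error is the
  same for all couplings of \<rho>. What remains is a finite sum of integrals of the kind in
  \<open>conv\<close>. The functions g are merely measurable: this is stable convergence rather than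
  weak convergence in the first coordinate.\<close>

lemma coupling_weak_convergence:
  assumes CP: "coupling X T \<rho> P" and CQ: "\<And>m. coupling X T \<rho> (Q m)" and f: "f \<in> Cb (prod_topology X (Itop T))"
    and conv: "\<And>q (g :: 'a \<Rightarrow> real). g \<in> borel_measurable (borel_of X) \<Longrightarrow> (\<exists>B. \<forall>x\<in>topspace X. \<bar>g x\<bar> \<le> B) \<Longrightarrow> 0 < q \<Longrightarrow> q < T \<Longrightarrow>
      (\<lambda>m. \<integral>\<omega>. indicator {\<omega> \<in> space (Q m). q \<le> snd \<omega>} \<omega> * g (fst \<omega>) \<partial>Q m) \<longlonglongrightarrow>
        (\<integral>\<omega>. indicator {\<omega> \<in> space P. q \<le> snd \<omega>} \<omega> * g (fst \<omega>) \<partial>P)"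
  shows "(\<lambda>m. \<integral>\<omega>. f \<omega> \<partial>Q m) \<longlonglongrightarrow> (\<integral>\<omega>. f \<omega> \<partial>P)"
proof -
  interpret coupling X T \<rho> P by fact
  have fc: "continuous_map (prod_topology X (Itop T)) euclideanreal f" using f by (simp add: Cb_def)
  obtain B where B: "\<forall>p\<in>topspace (prod_topology X (Itop T)). \<bar>f p\<bar> \<le> B" using Cb_obtain_bound[OF f] by metis
  note disc = discretisation_coupling[OF T fc B]
  note gdp = grid_diff_props[OF T fc B]
  show ?thesis
  proof (rule LIMSEQ_I)
    fix e :: real assume "0 < e"
    then have e4: "0 < e/4" by simp
    obtain n0 where n0: "\<And>n. n0 \<le> n \<Longrightarrow> \<bar>\<integral>x. osc T f (T / real n) x \<partial>\<rho>\<bar> < e/4"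
      using LIMSEQ_D[OF osc_integral_tendsto[OF T fc B rho] e4] by auto
    define n where "n = max 1 n0"
    have n: "1 \<le> n" "\<bar>\<integral>x. osc T f (T / real n) x \<partial>\<rho>\<bar> < e/4" using n0[of n] by (auto simp: n_def)
    define D where "D R = (\<integral>x. f (x, T / real n) \<partial>\<rho>) +
      (\<Sum>k=1..<n. \<integral>\<omega>. indicator {\<omega> \<in> space R. real k * (T / real n) \<le> snd \<omega>} \<omega> * grid_diff T f n k (fst \<omega>) \<partial>R)" for R
    have "(\<lambda>m. D (Q m)) \<longlonglongrightarrow> D P" unfolding D_def
    proof (rule tendsto_add[OF tendsto_const tendsto_sum])
      fix k assume k: "k \<in> {1..<n}"
      then have 1: "grid_diff T f n k \<in> borel_measurable (borel_of X)" "\<exists>B. \<forall>x\<in>topspace X. \<bar>grid_diff T f n k x\<bar> \<le> B"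
        using gdp(1)[of k n] gdp(2)[of k n] by auto
      have Tn: "0 < T / real n" using T n(1) by simp
      then have 2: "0 < real k * (T / real n)" using k by (intro mult_pos_pos) auto
      have "real k * (T / real n) < real n * (T / real n)" using k Tn by (intro mult_strict_right_mono) auto
      also have "\<dots> = T" using n(1) by simp
      finally have 3: "real k * (T / real n) < T" .
      show "(\<lambda>m. \<integral>\<omega>. indicator {\<omega> \<in> space (Q m). real k * (T / real n) \<le> snd \<omega>} \<omega> * grid_diff T f n k (fst \<omega>) \<partial>Q m)
        \<longlonglongrightarrow> (\<integral>\<omega>. indicator {\<omega> \<in> space P. real k * (T / real n) \<le> snd \<omega>} \<omega> * grid_diff T f n k (fst \<omega>) \<partial>P)"
        by (rule conv[OF 1 2 3])
    qed
    from LIMSEQ_D[OF this e4] obtain M where M: "\<And>m. M \<le> m \<Longrightarrow> \<bar>D (Q m) - D P\<bar> < e/4" by auto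
    show "\<exists>no. \<forall>m\<ge>no. norm ((\<integral>\<omega>. f \<omega> \<partial>Q m) - (\<integral>\<omega>. f \<omega> \<partial>P)) < e"
    proof (intro exI allI impI)
      fix m assume "M \<le> m"
      then have "\<bar>D (Q m) - D P\<bar> < e/4" by (rule M)
      moreover have "\<bar>(\<integral>\<omega>. f \<omega> \<partial>Q m) - D (Q m)\<bar> \<le> (\<integral>x. osc T f (T / real n) x \<partial>\<rho>)" unfolding D_def by (rule disc[OF CQ n(1)])
      moreover have "\<bar>(\<integral>\<omega>. f \<omega> \<partial>P) - D P\<bar> \<le> (\<integral>x. osc T f (T / real n) x \<partial>\<rho>)" unfolding D_def by (rule disc[OF CP n(1)])
      ultimately show "norm ((\<integral>\<omega>. f \<omega> \<partial>Q m) - (\<integral>\<omega>. f \<omega> \<partial>P)) < e" using n(2) by (simp only: real_norm_def)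
    qed
  qed
qed

subsection \<open>Compactness of the set of couplings\<close>

definition U01 :: "real measure" where "U01 = uniform_measure lborel {0..1}"

lemma prob_space_U01: "prob_space U01"
  unfolding U01_def by (rule prob_space_uniform_measure) auto

lemma sets_U01 [measurable_cong, simp]: "sets U01 = sets borel" and space_U01 [simp]: "space U01 = UNIV"
  by (simp_all add: U01_def)

lemma measure_U01_greaterThan:
  assumes "0 \<le> c" "c \<le> 1" shows "measure U01 {c<..} = 1 - c"
proof -
  have "{0..1} \<inter> {c<..} = {c<..1}" using assms by auto
  then show ?thesis using assms unfolding U01_def by (subst measure_uniform_measure) auto
qed

lemma AE_U01_neq: "AE u in U01. u \<noteq> c"
proof -
  have "emeasure U01 {c} = emeasure lborel ({0..1} \<inter> {c}) / emeasure lborel {0..1::real}" unfolding U01_def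
    by (rule emeasure_uniform_measure) auto
  also have "emeasure lborel ({0..1} \<inter> {c}) = 0" by (cases "c \<in> {0..1}") auto
  finally have "{c} \<in> null_sets U01" by (auto simp: null_sets_def)
  then show ?thesis by (rule AE_I') auto
qed

lemma AE_U01_mem: "AE u in U01. 0 \<le> u \<and> u \<le> 1"
proof -
  have "AE u in U01. u \<in> {0..1::real}" unfolding U01_def by (rule AE_uniform_measureI) auto
  then show ?thesis by simp
qed

lemma prob_space_rho_U01: "prob_space \<rho> \<Longrightarrow> prob_space (\<rho> \<Otimes>\<^sub>M U01)"
  using prob_space_U01 by (metis prob_space_imp_sigma_finite pair_prob_space.intro pair_sigma_finite.intro prob_space_pair)

text \<open>Fubini: a uniform variable exceeds the level k x with probability 1 - k x. In this way a
  density is realised by a threshold event.\<close>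

lemma integral_indicator_U01:
  fixes k g :: "'a \<Rightarrow> real"
  assumes "prob_space \<rho>" and k[measurable]: "k \<in> borel_measurable \<rho>" and k01: "\<And>x. 0 \<le> k x \<and> k x \<le> 1"
    and g[measurable]: "g \<in> borel_measurable \<rho>" and B: "\<And>x. x \<in> space \<rho> \<Longrightarrow> \<bar>g x\<bar> \<le> B"
  shows "(\<integral>\<omega>. indicator {\<omega> \<in> space (\<rho> \<Otimes>\<^sub>M U01). k (fst \<omega>) < snd \<omega>} \<omega> * g (fst \<omega>) \<partial>(\<rho> \<Otimes>\<^sub>M U01)) = (\<integral>x. g x * (1 - k x) \<partial>\<rho>)"
proof -
  interpret rho: prob_space \<rho> by fact
  interpret U: prob_space U01 by (rule prob_space_U01)
  interpret pair_prob_space \<rho> U01 ..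
  have m: "{\<omega> \<in> space (\<rho> \<Otimes>\<^sub>M U01). k (fst \<omega>) < snd \<omega>} \<in> sets (\<rho> \<Otimes>\<^sub>M U01)" by measurable
  have int: "integrable (\<rho> \<Otimes>\<^sub>M U01) (\<lambda>\<omega>. indicator {\<omega> \<in> space (\<rho> \<Otimes>\<^sub>M U01). k (fst \<omega>) < snd \<omega>} \<omega> * g (fst \<omega>))"
  proof (rule integrable_const_bound[where B=B])
    show "(\<lambda>\<omega>. indicator {\<omega> \<in> space (\<rho> \<Otimes>\<^sub>M U01). k (fst \<omega>) < snd \<omega>} \<omega> * g (fst \<omega>)) \<in> borel_measurable (\<rho> \<Otimes>\<^sub>M U01)"
      using m by (intro borel_measurable_times borel_measurable_indicator) measurable
    show "AE \<omega> in \<rho> \<Otimes>\<^sub>M U01. norm (indicator {\<omega> \<in> space (\<rho> \<Otimes>\<^sub>M U01). k (fst \<omega>) < snd \<omega>} \<omega> * g (fst \<omega>)) \<le> B"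
    proof (rule AE_I2)
      fix \<omega> assume "\<omega> \<in> space (\<rho> \<Otimes>\<^sub>M U01)"
      then have "\<bar>g (fst \<omega>)\<bar> \<le> B" using B by (auto simp: space_pair_measure)
      then show "norm (indicator {\<omega> \<in> space (\<rho> \<Otimes>\<^sub>M U01). k (fst \<omega>) < snd \<omega>} \<omega> * g (fst \<omega>)) \<le> B" by (auto simp: indicator_def)
    qed
  qed
  have "(\<integral>\<omega>. indicator {\<omega> \<in> space (\<rho> \<Otimes>\<^sub>M U01). k (fst \<omega>) < snd \<omega>} \<omega> * g (fst \<omega>) \<partial>(\<rho> \<Otimes>\<^sub>M U01))
    = (\<integral>x. (\<integral>u. indicator {\<omega> \<in> space (\<rho> \<Otimes>\<^sub>M U01). k (fst \<omega>) < snd \<omega>} (x, u) * g (fst (x, u)) \<partial>U01) \<partial>\<rho>)"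
    by (rule integral_fst'[OF int, symmetric])
  also have "\<dots> = (\<integral>x. g x * (1 - k x) \<partial>\<rho>)"
  proof (rule Bochner_Integration.integral_cong[OF refl])
    fix x assume x: "x \<in> space \<rho>"
    have "(\<integral>u. indicator {\<omega> \<in> space (\<rho> \<Otimes>\<^sub>M U01). k (fst \<omega>) < snd \<omega>} (x, u) * g (fst (x, u)) \<partial>U01) = (\<integral>u. g x * indicator {k x<..} u \<partial>U01)"
      by (rule Bochner_Integration.integral_cong) (use x in \<open>auto simp: indicator_def space_pair_measure\<close>)
    also have "\<dots> = g x * measure U01 {k x<..}" by simp
    finally show "(\<integral>u. indicator {\<omega> \<in> space (\<rho> \<Otimes>\<^sub>M U01). k (fst \<omega>) < snd \<omega>} (x, u) * g (fst (x, u)) \<partial>U01) = g x * (1 - k x)"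
      using measure_U01_greaterThan k01 by simp
  qed
  finally show ?thesis .
qed

text \<open>Integrals that depend on infinitely many coordinates of a kernel are shown to be
  continuous by approximating them, uniformly over all kernels, by expressions in finitely many
  coordinates.\<close>

lemma continuous_map_uniform_approx:
  fixes f :: "'a \<Rightarrow> real"
  assumes "\<And>e. 0 < e \<Longrightarrow> \<exists>g. continuous_map Y euclideanreal g \<and> (\<forall>y\<in>topspace Y. \<bar>f y - g y\<bar> \<le> e)"
  shows "continuous_map Y euclideanreal f"
  unfolding continuous_map_def
proof (intro conjI allI impI)
  fix U :: "real set" assume "openin euclidean U"
  then have U: "open U" by simp
  show "openin Y {x \<in> topspace Y. f x \<in> U}"
  proof (subst openin_subopen, intro ballI)
    fix y assume y: "y \<in> {x \<in> topspace Y. f x \<in> U}"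
    then obtain r where r: "0 < r" "ball (f y) r \<subseteq> U" using U open_contains_ball by blast
    obtain g where g: "continuous_map Y euclideanreal g" "\<forall>y\<in>topspace Y. \<bar>f y - g y\<bar> \<le> r/4"
      using assms[of "r/4"] r by auto
    have W: "openin Y {z \<in> topspace Y. g z \<in> ball (g y) (r/4)}"
      by (rule openin_continuous_map_preimage[OF g(1)]) auto
    moreover have "f z \<in> U" if "z \<in> topspace Y" "g z \<in> ball (g y) (r/4)" for z
    proof -
      have "\<bar>f y - g y\<bar> \<le> r/4" "\<bar>f z - g z\<bar> \<le> r/4" "\<bar>g y - g z\<bar> < r/4"
        using g(2) that y by (auto simp: dist_real_def)
      then have "\<bar>f y - f z\<bar> < r" using r(1) by linarith
      then show ?thesis using r(2) by (auto simp: dist_real_def)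
    qed
    ultimately show "\<exists>V. openin Y V \<and> y \<in> V \<and> V \<subseteq> {x \<in> topspace Y. f x \<in> U}"
      by (intro exI[of _ "{z \<in> topspace Y. g z \<in> ball (g y) (r/4)}"]) (use y r in auto)
  qed
qed simp

locale coupling_compactness =
  fixes X :: "'a topology" and T :: real and \<rho> :: "'a measure"
  assumes T: "0 < T" and rho: "\<rho> \<in> Pspace X"
begin

sublocale prob_space \<rho> using rho by (simp add: Pspace_iff)

lemma sets_rho [measurable_cong, simp]: "sets \<rho> = sets (borel_of X)" using rho by (simp add: Pspace_iff)
lemma space_rho [simp]: "space \<rho> = topspace X" using rho by (rule space_Pspace)

text \<open>Countable, so that almost sure statements hold for all its times at once, and closed
  under passing to any grid: it contains k T / n for 0 < k < n and every n.\<close>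

definition D :: "real set" where "D = (\<lambda>r. T * r) ` (\<rat> \<inter> {0<..<1})"

lemma countable_D: "countable D" unfolding D_def by (intro countable_image countable_Int1 countable_rat)

lemma D_bounds: "q \<in> D \<Longrightarrow> 0 < q \<and> q < T"
  using T by (auto simp: D_def)

lemma grid_D: "k \<in> {1..<n} \<Longrightarrow> real k * (T / real n) \<in> D"
  unfolding D_def by (rule image_eqI[of _ _ "real k / real n"]) (auto simp: Rats_divide)

definition J :: "('a set \<times> real) set" where "J = sets \<rho> \<times> D"

text \<open>A power of the unit interval, compact by Tychonoff's theorem; one coordinate for each
  pair of a measurable set and a time in \<open>D\<close>.\<close>

definition Z :: "('a set \<times> real \<Rightarrow> real) topology" where
  "Z = product_topology (\<lambda>_. subtopology euclideanreal {0..1}) J"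

text \<open>The coordinate \<open>(C, q)\<close> stands for \<open>P (C \<times> {\<tau> < q})\<close>. Finite additivity suffices: being
  dominated by \<open>\<rho>\<close> makes each set function countably additive.\<close>

definition kernels :: "('a set \<times> real \<Rightarrow> real) set" where
  "kernels = {a \<in> topspace Z.
     (\<forall>q\<in>D. \<forall>C1\<in>sets \<rho>. \<forall>C2\<in>sets \<rho>. C1 \<inter> C2 = {} \<longrightarrow> a (C1 \<union> C2, q) = a (C1, q) + a (C2, q)) \<and>
     (\<forall>q\<in>D. \<forall>C\<in>sets \<rho>. a (C, q) \<le> measure \<rho> C) \<and>
     (\<forall>q\<in>D. \<forall>q'\<in>D. q \<le> q' \<longrightarrow> (\<forall>C\<in>sets \<rho>. a (C, q) \<le> a (C, q')))}"

lemma continuous_map_coordinate: "j \<in> J \<Longrightarrow> continuous_map Z euclideanreal (\<lambda>a. a j)"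
  unfolding Z_def using continuous_map_product_projection[of j J "\<lambda>_. subtopology euclideanreal {0..1}"]
  by (simp add: continuous_map_in_subtopology)

text \<open>Each defining condition is an equation or a weak inequality between at most three
  coordinates, hence closed in the cube, and arbitrary intersections of closed sets are
  closed.\<close>

lemma compactin_kernels: "compactin Z kernels"
proof (rule closedin_compact_space)
  show "compact_space Z" unfolding Z_def compact_space_product_topology
    by (intro disjI2 ballI compact_space_subtopology) simp
  have eq: "closedin Z {a \<in> topspace Z. a j1 = a j2 + a j3}" if "j1 \<in> J" "j2 \<in> J" "j3 \<in> J" for j1 j2 j3
  proof -
    have "continuous_map Z euclideanreal (\<lambda>a. a j1 - (a j2 + a j3))"
      by (intro continuous_map_diff continuous_map_add continuous_map_coordinate that)
    from closedin_continuous_map_preimage[OF this, of "{0}"] show ?thesis by (simp add: algebra_simps)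
  qed
  have le: "closedin Z {a \<in> topspace Z. a j1 \<le> a j2}" if "j1 \<in> J" "j2 \<in> J" for j1 j2
  proof -
    have "continuous_map Z euclideanreal (\<lambda>a. a j2 - a j1)"
      by (intro continuous_map_diff continuous_map_coordinate that)
    from closedin_continuous_map_preimage[OF this, of "{0..}"] show ?thesis by simp
  qed
  have lec: "closedin Z {a \<in> topspace Z. a j1 \<le> c}" if "j1 \<in> J" for j1 c
    using closedin_continuous_map_preimage[OF continuous_map_coordinate[OF that], of "{..c}"] by simp
  have k: "kernels = topspace Z \<inter>
     (\<Inter>p\<in>{(q, C1, C2). q \<in> D \<and> C1 \<in> sets \<rho> \<and> C2 \<in> sets \<rho> \<and> C1 \<inter> C2 = {}}.
        {a \<in> topspace Z. a (fst (snd p) \<union> snd (snd p), fst p) = a (fst (snd p), fst p) + a (snd (snd p), fst p)}) \<inter>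
     (\<Inter>p\<in>J. {a \<in> topspace Z. a p \<le> measure \<rho> (fst p)}) \<inter>
     (\<Inter>p\<in>{(q, q', C). q \<in> D \<and> q' \<in> D \<and> q \<le> q' \<and> C \<in> sets \<rho>}. {a \<in> topspace Z. a (snd (snd p), fst p) \<le> a (snd (snd p), fst (snd p))})"
    unfolding kernels_def J_def by auto
  \<comment> \<open>The factor \<open>topspace Z\<close> takes care of an empty index set, whose
    intersection would be the whole type.\<close>
  have c2: "closedin Z (topspace Z \<inter> (\<Inter>p\<in>I. F p))" if "\<And>p. p \<in> I \<Longrightarrow> closedin Z (F p)" for I :: "'c set" and F
  proof (cases "I = {}")
    case False then show ?thesis using that by (intro closedin_Int closedin_Inter closedin_topspace) auto
  qed simp
  have "kernels = (topspace Z \<inter>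
     (\<Inter>p\<in>{(q, C1, C2). q \<in> D \<and> C1 \<in> sets \<rho> \<and> C2 \<in> sets \<rho> \<and> C1 \<inter> C2 = {}}.
        {a \<in> topspace Z. a (fst (snd p) \<union> snd (snd p), fst p) = a (fst (snd p), fst p) + a (snd (snd p), fst p)})) \<inter>
     (topspace Z \<inter> (\<Inter>p\<in>J. {a \<in> topspace Z. a p \<le> measure \<rho> (fst p)})) \<inter>
     (topspace Z \<inter> (\<Inter>p\<in>{(q, q', C). q \<in> D \<and> q' \<in> D \<and> q \<le> q' \<and> C \<in> sets \<rho>}. {a \<in> topspace Z. a (snd (snd p), fst p) \<le> a (snd (snd p), fst (snd p))}))"
    unfolding k by blast
  also have "closedin Z \<dots>"
    by (intro closedin_Int c2) (auto simp del: sets_rho intro!: eq le lec simp: J_def)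
  finally show "closedin Z kernels" .
qed

lemma exists_kernel_density:
  assumes a: "a \<in> kernels" and q: "q \<in> D"
  shows "\<exists>k\<in>borel_measurable \<rho>. (\<forall>x. 0 \<le> k x \<and> k x \<le> (1::real)) \<and> (\<forall>C\<in>sets \<rho>. a (C, q) = (\<integral>x. indicator C x * k x \<partial>\<rho>))"
proof -
  have aZ: "a (C, q) \<in> {0..1}" if "C \<in> sets \<rho>" for C
    using a q that unfolding kernels_def Z_def topspace_product_topology by (auto simp: J_def PiE_def Pi_def simp del: sets_rho)
  have add: "a (C1 \<union> C2, q) = a (C1, q) + a (C2, q)" if "C1 \<in> sets \<rho>" "C2 \<in> sets \<rho>" "C1 \<inter> C2 = {}" for C1 C2
    using a q that unfolding kernels_def by blast
  have le: "a (C, q) \<le> measure \<rho> C" if "C \<in> sets \<rho>" for C using a q that unfolding kernels_def by blast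
  define \<nu> where "\<nu> = measure_of (space \<rho>) (sets \<rho>) (\<lambda>C. ennreal (a (C, q)))"
  have em: "emeasure \<nu> C = ennreal (a (C, q))" if C: "C \<in> sets \<rho>" for C
  proof (rule emeasure_measure_of[OF \<nu>_def sets.space_closed])
    show "C \<in> sets \<nu>" using C by (simp add: \<nu>_def del: sets_rho space_rho)
    \<comment> \<open>Additivity on two empty sets gives a = 2 a, hence the value 0.\<close>
    show pos: "positive (sets \<nu>) (\<lambda>C. ennreal (a (C, q)))"
      using add[of "{}" "{}"] by (simp add: positive_def)
    have s: "sets \<nu> = sets \<rho>" by (simp add: \<nu>_def del: sets_rho space_rho)
    have "countably_additive (sets \<rho>) (\<lambda>C. ennreal (a (C, q)))"
    proof (rule sets.empty_continuous_imp_countably_additive)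
      show "positive (sets \<rho>) (\<lambda>C. ennreal (a (C, q)))" using pos s by simp
      show "additive (sets \<rho>) (\<lambda>C. ennreal (a (C, q)))"
        unfolding additive_def using add aZ by (auto simp: ennreal_plus simp del: sets_rho)
      show "(\<lambda>i. ennreal (a (A i, q))) \<longlonglongrightarrow> 0" if A: "range A \<subseteq> sets \<rho>" "decseq A" "(\<Inter>i. A i) = {}" for A
      proof -
        have "(\<lambda>i. measure \<rho> (A i)) \<longlonglongrightarrow> measure \<rho> (\<Inter>i. A i)" by (rule finite_Lim_measure_decseq[OF A(1,2)])
        then have l: "(\<lambda>i. measure \<rho> (A i)) \<longlonglongrightarrow> 0" using A(3) by simp
        have "(\<lambda>i. a (A i, q)) \<longlonglongrightarrow> 0"
        proof (rule real_tendsto_sandwich[OF _ _ tendsto_const l])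
          show "\<forall>\<^sub>F n in sequentially. 0 \<le> a (A n, q)" using aZ A(1) by (intro always_eventually allI) (auto simp del: sets_rho)
          show "\<forall>\<^sub>F n in sequentially. a (A n, q) \<le> measure \<rho> (A n)" using le A(1) by (intro always_eventually allI) (auto simp del: sets_rho)
        qed
        then show ?thesis using tendsto_ennrealI by fastforce
      qed
    qed simp
    then show "countably_additive (sets \<nu>) (\<lambda>C. ennreal (a (C, q)))" using s by simp
  qed
  have s: "sets \<nu> = sets \<rho>" by (simp add: \<nu>_def del: sets_rho space_rho)
  obtain k where k: "k \<in> borel_measurable \<rho>" "\<forall>x. 0 \<le> k x \<and> k x \<le> (1::real)" "\<nu> = density \<rho> (\<lambda>x. ennreal (k x))"
    using density_le_one[OF prob_space_axioms s] em le by (auto simp: emeasure_eq_measure ennreal_leI simp del: sets_rho)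
  have "a (C, q) = (\<integral>x. indicator C x * k x \<partial>\<rho>)" if C: "C \<in> sets \<rho>" for C
  proof -
    have i: "integrable \<rho> (\<lambda>x. indicator C x * k x)"
    proof (rule integrable_const_bound[where B=1])
      show "(\<lambda>x. indicator C x * k x) \<in> borel_measurable \<rho>"
        by (rule borel_measurable_times[OF borel_measurable_indicator[OF C] k(1)])
    qed (use k in \<open>auto simp: indicator_def\<close>)
    have "ennreal (a (C, q)) = (\<integral>\<^sup>+x. ennreal (k x) * indicator C x \<partial>\<rho>)"
      using em[OF C] emeasure_density[of "\<lambda>x. ennreal (k x)" \<rho> C] k C by simp
    also have "\<dots> = (\<integral>\<^sup>+x. ennreal (indicator C x * k x) \<partial>\<rho>)"
      by (rule nn_integral_cong) (auto simp: indicator_def)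
    also have "\<dots> = ennreal (\<integral>x. indicator C x * k x \<partial>\<rho>)"
      by (rule nn_integral_eq_integral[OF i]) (use k in \<open>auto\<close>)
    finally show ?thesis using aZ[OF C] k(2) by (subst (asm) ennreal_inj) (auto intro!: Bochner_Integration.integral_nonneg)
  qed
  then show ?thesis using k by blast
qed

text \<open>A chosen version: it is bounded everywhere, but monotone in q only almost everywhere,
  with a null set that depends on the two times compared.\<close>

definition dens :: "('a set \<times> real \<Rightarrow> real) \<Rightarrow> real \<Rightarrow> 'a \<Rightarrow> real" where
  "dens a q = (SOME k. k \<in> borel_measurable \<rho> \<and> (\<forall>x. 0 \<le> k x \<and> k x \<le> 1) \<and>
      (\<forall>C\<in>sets \<rho>. a (C, q) = (\<integral>x. indicator C x * k x \<partial>\<rho>)))"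

lemma dens:
  assumes a: "a \<in> kernels" and q: "q \<in> D"
  shows "dens a q \<in> borel_measurable \<rho>" "0 \<le> dens a q x \<and> dens a q x \<le> 1"
    "C \<in> sets \<rho> \<Longrightarrow> a (C, q) = (\<integral>x. indicator C x * dens a q x \<partial>\<rho>)"
proof -
  have "\<exists>k. k \<in> borel_measurable \<rho> \<and> (\<forall>x. 0 \<le> k x \<and> k x \<le> 1) \<and>
      (\<forall>C\<in>sets \<rho>. a (C, q) = (\<integral>x. indicator C x * k x \<partial>\<rho>))" using exists_kernel_density[OF a q] by blast
  from someI_ex[OF this, folded dens_def] show "dens a q \<in> borel_measurable \<rho>" "0 \<le> dens a q x \<and> dens a q x \<le> 1"
    "C \<in> sets \<rho> \<Longrightarrow> a (C, q) = (\<integral>x. indicator C x * dens a q x \<partial>\<rho>)" by blast+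
qed

text \<open>Tested on the set where the inequality fails, on which the difference k - k' is positive
  and has integral at most 0.\<close>

lemma AE_le_of_set_integrals:
  fixes k k' :: "'a \<Rightarrow> real"
  assumes k: "integrable \<rho> k" and k': "integrable \<rho> k'"
    and le: "\<And>C. C \<in> sets \<rho> \<Longrightarrow> (\<integral>x. indicator C x * k x \<partial>\<rho>) \<le> (\<integral>x. indicator C x * k' x \<partial>\<rho>)"
  shows "AE x in \<rho>. k x \<le> k' x"
proof -
  define C where "C = {x \<in> space \<rho>. k' x < k x}"
  have kk[measurable]: "k \<in> borel_measurable \<rho>" "k' \<in> borel_measurable \<rho>" using k k' by auto
  have C: "C \<in> sets \<rho>" unfolding C_def by measurable
  have i: "integrable \<rho> (\<lambda>x. indicator C x * k x)" "integrable \<rho> (\<lambda>x. indicator C x * k' x)"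
    using integrable_mult_indicator[OF C k] integrable_mult_indicator[OF C k'] by auto
  have nn: "AE x in \<rho>. 0 \<le> indicator C x * k x - indicator C x * k' x" by (rule AE_I2) (auto simp: C_def indicator_def)
  have "(\<integral>x. indicator C x * k x - indicator C x * k' x \<partial>\<rho>) \<le> 0" using le[OF C] i by simp
  then have "(\<integral>x. indicator C x * k x - indicator C x * k' x \<partial>\<rho>) = 0"
    using Bochner_Integration.integral_nonneg_AE[OF nn] by linarith
  then have "AE x in \<rho>. indicator C x * k x - indicator C x * k' x = 0"
    using integral_nonneg_eq_0_iff_AE[OF _ nn] i by auto
  then show ?thesis using AE_space
  proof eventually_elim
    case (elim x)
    then show ?case by (cases "x \<in> C") (auto simp: C_def)
  qed
qed

lemma integrable_01:
  fixes k :: "'a \<Rightarrow> real"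
  shows "k \<in> borel_measurable \<rho> \<Longrightarrow> (\<And>x. 0 \<le> k x \<and> k x \<le> 1) \<Longrightarrow> integrable \<rho> k"
  by (rule integrable_const_bound[where B=1]) auto

lemma dens_mono:
  assumes a: "a \<in> kernels" and q: "q \<in> D" "q' \<in> D" "q \<le> q'"
  shows "AE x in \<rho>. dens a q x \<le> dens a q' x"
proof (rule AE_le_of_set_integrals)
  show "integrable \<rho> (dens a q)" "integrable \<rho> (dens a q')" using dens[OF a] q by (auto intro: integrable_01)
  fix C assume C: "C \<in> sets \<rho>"
  have "a (C, q) \<le> a (C, q')" using a q C unfolding kernels_def by blast
  then show "(\<integral>x. indicator C x * dens a q x \<partial>\<rho>) \<le> (\<integral>x. indicator C x * dens a q' x \<partial>\<rho>)"
    using dens(3)[OF a q(1) C] dens(3)[OF a q(2) C] by simp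
qed

text \<open>The quantile transform: for uniform \<open>u\<close> the conditional probability of \<open>quant a (x, u) < q\<close>
  given \<open>x\<close> is the left limit of \<open>dens a\<close> at \<open>q\<close>.\<close>

definition quant :: "('a set \<times> real \<Rightarrow> real) \<Rightarrow> 'a \<times> real \<Rightarrow> real" where
  "quant a = (\<lambda>(x, u). Inf (insert T {q \<in> D. u \<le> dens a q x}))"

text \<open>An infimum is below t exactly when some member is, attained or not; for this reason the
  strict inequality is the one used throughout. It also exhibits {quant < t} as a countable union.
  Inserting T gives a value when no density reaches u.\<close>

lemma quant_less_iff: "quant a (x, u) < t \<longleftrightarrow> T < t \<or> (\<exists>q\<in>D. u \<le> dens a q x \<and> q < t)"
proof -
  have "bdd_below (insert T {q \<in> D. u \<le> dens a q x})"
    using D_bounds by (intro bdd_belowI[of _ "min 0 T"]) (auto, smt (verit))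
  from cInf_less_iff[OF _ this, of t] show ?thesis by (auto simp: quant_def)
qed

lemma quant_bounds: "quant a \<omega> \<in> {0..T}"
proof -
  obtain x u where \<omega>: "\<omega> = (x, u)" by force
  have "0 \<le> Inf (insert T {q \<in> D. u \<le> dens a q x})"
    by (rule cInf_greatest) (use D_bounds T in \<open>auto, fastforce\<close>)
  moreover have "\<not> T < quant a (x, u)"
    using quant_less_iff[of a x u] by (metis less_irrefl dense)
  ultimately show ?thesis by (simp add: quant_def \<omega>)
qed

abbreviation N :: "('a \<times> real) measure" where "N \<equiv> \<rho> \<Otimes>\<^sub>M U01"

lemma prob_N: "prob_space N" by (rule prob_space_rho_U01[OF prob_space_axioms])

lemma space_N: "space N = topspace X \<times> UNIV" by (simp add: space_pair_measure)

lemma fst_N: "fst \<in> measurable N (borel_of X)" "distr N (borel_of X) fst = \<rho>"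
proof -
  have m: "fst \<in> measurable N \<rho>" by simp
  then show "fst \<in> measurable N (borel_of X)" using measurable_cong_sets[OF refl sets_rho] by blast
  have "distr N (borel_of X) fst = distr N \<rho> fst" by (rule distr_cong) auto
  also have "\<dots> = \<rho>" by (rule prob_space.distr_pair_fst[OF prob_space_U01])
  finally show "distr N (borel_of X) fst = \<rho>" .
qed

lemma AE_N_fst: "AE x in \<rho>. Q x \<Longrightarrow> AE \<omega> in N. Q (fst \<omega>)"
  using AE_distrD[OF fst_N(1), of Q, unfolded fst_N(2)] .

lemma quant_measurable:
  assumes a: "a \<in> kernels" shows "quant a \<in> borel_measurable N"
  unfolding borel_measurable_iff_less
proof
  fix t
  have "{\<omega> \<in> space N. quant a \<omega> < t} = (if T < t then space N else (\<Union>q\<in>{q\<in>D. q < t}. {\<omega> \<in> space N. snd \<omega> \<le> dens a q (fst \<omega>)}))"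
    using quant_less_iff[of a _ _ t] by (auto simp: prod_eq_iff)
  moreover have "(\<Union>q\<in>{q\<in>D. q < t}. {\<omega> \<in> space N. snd \<omega> \<le> dens a q (fst \<omega>)}) \<in> sets N"
  proof (rule sets.countable_UN'')
    show "countable {q\<in>D. q < t}" using countable_D by (rule countable_subset[rotated]) auto
    fix q assume "q \<in> {q\<in>D. q < t}"
    then have [measurable]: "dens a q \<in> borel_measurable \<rho>" using dens(1)[OF a] by auto
    show "{\<omega> \<in> space N. snd \<omega> \<le> dens a q (fst \<omega>)} \<in> sets N" by measurable
  qed
  ultimately show "{\<omega> \<in> space N. quant a \<omega> < t} \<in> sets N" using sets.top[of N] by (simp only:) (simp split: if_split)
qed

definition kernel_law :: "('a set \<times> real \<Rightarrow> real) \<Rightarrow> ('a \<times> real) measure" where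
  "kernel_law a = distr N (borel_of (prod_topology X (Itop T))) (\<lambda>\<omega>. (fst \<omega>, quant a \<omega>))"

lemma kernel_law_coupling: "a \<in> kernels \<Longrightarrow> coupling X T \<rho> (kernel_law a)"
  unfolding kernel_law_def by (rule coupling_distr(1)[OF T rho prob_N fst_N quant_measurable quant_bounds])

lemma kernel_law_integral: "a \<in> kernels \<Longrightarrow> f \<in> borel_measurable (borel_of (prod_topology X (Itop T))) \<Longrightarrow>
    (\<integral>p. f p \<partial>kernel_law a) = (\<integral>\<omega>. (f (fst \<omega>, quant a \<omega>) :: real) \<partial>N)"
  unfolding kernel_law_def by (rule coupling_distr(2)[OF T rho prob_N fst_N quant_measurable quant_bounds])

text \<open>The value of the telescoping grid sum when 1 - k q is the conditional probability of not
  having stopped before q. Laws whose densities agree at the grid points share it.\<close>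

definition discretised_integral :: "('a \<times> real \<Rightarrow> real) \<Rightarrow> nat \<Rightarrow> (real \<Rightarrow> 'a \<Rightarrow> real) \<Rightarrow> real" where
  "discretised_integral f n k = (\<integral>x. f (x, T / real n) \<partial>\<rho>) + (\<Sum>i=1..<n. \<integral>x. grid_diff T f n i x * (1 - k (real i * (T / real n)) x) \<partial>\<rho>)"

text \<open>The events are {k i (x) < u}; almost sure monotonicity of the thresholds makes them
  decreasing, and Fubini turns their probabilities into 1 - k i (x).\<close>

lemma discretisation_threshold:
  assumes f: "continuous_map (prod_topology X (Itop T)) euclideanreal f"
    and B: "\<forall>p\<in>topspace (prod_topology X (Itop T)). \<bar>f p\<bar> \<le> B" and n: "1 \<le> n"
    and k: "\<And>i. i \<in> {1..<n} \<Longrightarrow> k (real i * (T / real n)) \<in> borel_measurable \<rho>"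
      "\<And>i x. i \<in> {1..<n} \<Longrightarrow> 0 \<le> k (real i * (T / real n)) x \<and> k (real i * (T / real n)) x \<le> 1"
      "\<And>i. 1 \<le> i \<Longrightarrow> Suc i < n \<Longrightarrow> AE x in \<rho>. k (real i * (T / real n)) x \<le> k (real (Suc i) * (T / real n)) x"
    and \<theta>: "\<theta> \<in> borel_measurable N" "\<And>\<omega>. \<omega> \<in> space N \<Longrightarrow> \<theta> \<omega> \<in> {0..T}"
    and close: "AE \<omega> in N. \<bar>\<theta> \<omega> - real (1 + (\<Sum>i=1..<n. of_bool (k (real i * (T / real n)) (fst \<omega>) < snd \<omega>))) * (T / real n)\<bar> \<le> T / real n"
  shows "\<bar>(\<integral>\<omega>. f (fst \<omega>, \<theta> \<omega>) \<partial>N) - discretised_integral f n k\<bar> \<le> (\<integral>x. osc T f (T / real n) x \<partial>\<rho>)"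
proof -
  define S where "S i = {\<omega> \<in> space N. k (real i * (T / real n)) (fst \<omega>) < snd \<omega>}" for i
  have Si: "S i \<in> sets N" if "i \<in> {1..<n}" for i
  proof -
    note k(1)[OF that, measurable]
    show ?thesis unfolding S_def by measurable
  qed
  have "\<bar>(\<integral>\<omega>. f (fst \<omega>, \<theta> \<omega>) \<partial>N) - ((\<integral>x. f (x, T / real n) \<partial>\<rho>) + (\<Sum>i=1..<n. \<integral>\<omega>. indicator (S i) \<omega> * grid_diff T f n i (fst \<omega>) \<partial>N))\<bar>
     \<le> (\<integral>x. osc T f (T / real n) x \<partial>\<rho>)"
  proof (rule discretisation[OF T f B rho prob_N fst_N \<theta> Si _ _ n])
    have "AE x in \<rho>. \<forall>i\<in>{i. 1 \<le> i \<and> Suc i < n}. k (real i * (T / real n)) x \<le> k (real (Suc i) * (T / real n)) x"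
      by (rule AE_finite_allI) (use k(3) in \<open>auto intro: finite_subset[of _ "{..n}"]\<close>)
    from AE_N_fst[OF this] show "AE \<omega> in N. \<forall>i. 1 \<le> i \<longrightarrow> Suc i < n \<longrightarrow> \<omega> \<in> S (Suc i) \<longrightarrow> \<omega> \<in> S i"
      by eventually_elim (force simp: S_def)
    show "AE \<omega> in N. \<bar>\<theta> \<omega> - real (1 + (\<Sum>i=1..<n. of_bool (\<omega> \<in> S i))) * (T / real n)\<bar> \<le> T / real n"
      using close AE_space by eventually_elim (simp add: S_def)
  qed
  moreover have "(\<integral>\<omega>. indicator (S i) \<omega> * grid_diff T f n i (fst \<omega>) \<partial>N) = (\<integral>x. grid_diff T f n i x * (1 - k (real i * (T / real n)) x) \<partial>\<rho>)"
    if i: "i \<in> {1..<n}" for i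
    unfolding S_def
  proof (rule integral_indicator_U01[OF prob_space_axioms k(1)[OF i] k(2)[OF i]])
    show "grid_diff T f n i \<in> borel_measurable \<rho>"
      unfolding Pspace_borel_measurable[OF rho] by (rule grid_diff_props(1)[OF T f B]) (use i in auto)
    show "x \<in> space \<rho> \<Longrightarrow> \<bar>grid_diff T f n i x\<bar> \<le> 2 * B" for x
      using grid_diff_props(2)[OF T f B, of i n x] i by auto
  qed
  ultimately show ?thesis unfolding discretised_integral_def by simp
qed

lemma quant_close:
  assumes mono: "\<And>q q'. q \<in> D \<Longrightarrow> q' \<in> D \<Longrightarrow> q \<le> q' \<Longrightarrow> dens a q x \<le> dens a q' x" and n: "1 \<le> n"
  shows "\<bar>quant a (x, u) - real (1 + (\<Sum>i=1..<n. of_bool (dens a (real i * (T / real n)) x < u))) * (T / real n)\<bar> \<le> T / real n"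
proof -
  define S where "S i \<longleftrightarrow> dens a (real i * (T / real n)) x < u" for i
  define j where "j = (\<Sum>i=1..<n. of_bool (S i) :: nat)"
  have Tn: "0 < T / real n" using T n by simp
  have "S i" if "1 \<le> i" "Suc i < n" "S (Suc i)" for i
  proof -
    have "real i * (T / real n) \<le> real (Suc i) * (T / real n)" using Tn by (intro mult_right_mono) auto
    then show ?thesis using mono[OF grid_D grid_D, of i n "Suc i" n] that by (auto simp: S_def)
  qed
  then have an: "\<forall>i. 1 \<le> i \<longrightarrow> Suc i < n \<longrightarrow> S (Suc i) \<longrightarrow> S i" by blast
  note c = antimono_count[where S=S and n=n, folded j_def, OF an n]
  have lo: "real j * (T / real n) \<le> quant a (x, u)"
  proof (cases "j = 0")
    case True then show ?thesis using quant_bounds[of a "(x,u)"] by simp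
  next
    case False
    then have "S j" "j \<in> {1..<n}" using c(1) c(2)[of j] by auto
    then have "\<not> (\<exists>q\<in>D. u \<le> dens a q x \<and> q < real j * (T / real n))"
      using mono[OF _ grid_D[of j n]] by (force simp: S_def)
    moreover have "real j * (T / real n) < T" using D_bounds[OF grid_D[OF \<open>j \<in> {1..<n}\<close>]] by simp
    ultimately show ?thesis using quant_less_iff[of a x u "real j * (T / real n)"] by linarith
  qed
  have hi: "quant a (x, u) \<le> real (1 + j) * (T / real n)"
  proof (cases "Suc j < n")
    case True
    then have sj: "Suc j \<in> {1..<n}" by auto
    then have "\<not> S (Suc j)" using c(2)[OF sj] by auto
    then have "u \<le> dens a (real (1 + j) * (T / real n)) x" by (simp add: S_def)
    moreover have "real (1 + j) * (T / real n) \<in> D" using grid_D[OF sj] by simp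
    \<comment> \<open>The infimum is controlled through strict inequalities only, so the bound by
      the grid point is reached from all t above it.\<close>
    ultimately have "quant a (x, u) \<le> t" if "real (1 + j) * (T / real n) < t" for t
      using quant_less_iff[of a x u t] that by (intro less_imp_le) blast
    then show ?thesis by (rule dense_ge)
  next
    case False
    then have "1 + j = n" using c(1) by auto
    then have "real (1 + j) * (T / real n) = T" using n by simp
    then show ?thesis using quant_bounds[of a "(x,u)"] by simp
  qed
  have "real (1 + j) * (T / real n) = real j * (T / real n) + T / real n" by (simp add: add_divide_distrib algebra_simps)
  then have "\<bar>quant a (x, u) - real (1 + j) * (T / real n)\<bar> \<le> T / real n" using lo hi by (simp only: abs_le_iff) linarith
  then show ?thesis by (simp only: j_def S_def)
qed

lemma kernel_law_discretisation:
  assumes a: "a \<in> kernels" and f: "continuous_map (prod_topology X (Itop T)) euclideanreal f"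
    and B: "\<forall>p\<in>topspace (prod_topology X (Itop T)). \<bar>f p\<bar> \<le> B" and n: "1 \<le> n"
  shows "\<bar>(\<integral>p. f p \<partial>kernel_law a) - discretised_integral f n (dens a)\<bar> \<le> (\<integral>x. osc T f (T / real n) x \<partial>\<rho>)"
  unfolding kernel_law_integral[OF a continuous_map_borel_measurable[OF f]]
proof (rule discretisation_threshold[OF f B n])
  show "dens a (real i * (T / real n)) \<in> borel_measurable \<rho>" if "i \<in> {1..<n}" for i using dens(1)[OF a grid_D[OF that]] .
  show "0 \<le> dens a (real i * (T / real n)) x \<and> dens a (real i * (T / real n)) x \<le> 1" if "i \<in> {1..<n}" for i x
    using dens(2)[OF a grid_D[OF that]] .
  show "AE x in \<rho>. dens a (real i * (T / real n)) x \<le> dens a (real (Suc i) * (T / real n)) x" if "1 \<le> i" "Suc i < n" for i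
    by (rule dens_mono[OF a grid_D grid_D]) (use that T in \<open>auto intro!: divide_right_mono mult_right_mono\<close>)
  show "quant a \<in> borel_measurable N" by (rule quant_measurable[OF a])
  show "quant a \<omega> \<in> {0..T}" for \<omega> by (rule quant_bounds)
  \<comment> \<open>Countability of \<open>D\<close> merges the null sets of all pairs of times into
    one.\<close>
  have "AE x in \<rho>. \<forall>q\<in>D. \<forall>q'\<in>D. q \<le> q' \<longrightarrow> dens a q x \<le> dens a q' x"
    using dens_mono[OF a] countable_D by (simp add: AE_ball_countable)
  from AE_N_fst[OF this]
  show "AE \<omega> in N. \<bar>quant a \<omega> - real (1 + (\<Sum>i=1..<n. of_bool (dens a (real i * (T / real n)) (fst \<omega>) < snd \<omega>))) * (T / real n)\<bar> \<le> T / real n"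
  proof eventually_elim
    case (elim \<omega>)
    show ?case using quant_close[OF _ n, of a "fst \<omega>" "snd \<omega>"] elim by simp
  qed
qed

text \<open>A coordinate of a kernel is the integral of the density over one set. A bounded
  measurable \<open>g\<close> is therefore replaced by a staircase, whose integral is a finite
  combination of coordinates, with an error that is uniform since the densities are at most
  1.\<close>

lemma continuous_map_dens_integral:
  fixes g :: "'a \<Rightarrow> real"
  assumes q: "q \<in> D" and g: "g \<in> borel_measurable \<rho>" "\<And>x. x \<in> topspace X \<Longrightarrow> \<bar>g x\<bar> \<le> B"
  shows "continuous_map (subtopology Z kernels) euclideanreal (\<lambda>a. \<integral>x. g x * dens a q x \<partial>\<rho>)"
proof (rule continuous_map_uniform_approx)
  fix e :: real assume e: "0 < e"
  define b where "b = max 1 B"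
  have b: "0 < b" "\<And>x. x \<in> topspace X \<Longrightarrow> \<bar>g x\<bar> \<le> b" using g(2) by (force simp: b_def)+
  \<comment> \<open>Affine rescaling to [0, 1], the range on which the staircase works; b \<ge> 1
    avoids division by 0.\<close>
  define h where "h x = (g x + b) / (2 * b)" for x
  have h: "0 \<le> h x \<and> h x \<le> 1" if "x \<in> topspace X" for x using b(1) b(2)[OF that] by (auto simp: h_def field_simps)
  have hm[measurable]: "h \<in> borel_measurable \<rho>" unfolding h_def using g(1) by measurable
  have gh: "g x = 2 * b * h x - b" for x using b(1) by (simp add: h_def field_simps)
  \<comment> \<open>The staircase error 1/n is magnified by 2 b when \<open>h\<close> is scaled back
    to \<open>g\<close>.\<close>
  obtain n :: nat where n: "2 * b / e < real n" using reals_Archimedean2 by blast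
  have n0: "0 < real n" using n b(1) e by (smt (verit) divide_pos_pos)
  define A where "A i = {x \<in> space \<rho>. real i / real n \<le> h x}" for i
  have A: "A i \<in> sets \<rho>" for i unfolding A_def by measurable
  define G where "G a = 2 * b * (\<Sum>i=1..n. (1 / real n) * a (A i, q)) - b * a (space \<rho>, q)" for a
  show "\<exists>G. continuous_map (subtopology Z kernels) euclideanreal G \<and>
      (\<forall>a\<in>topspace (subtopology Z kernels). \<bar>(\<integral>x. g x * dens a q x \<partial>\<rho>) - G a\<bar> \<le> e)"
  proof (intro exI[of _ G] conjI ballI)
    show "continuous_map (subtopology Z kernels) euclideanreal G" unfolding G_def
      by (intro continuous_map_from_subtopology continuous_map_diff continuous_map_real_mult continuous_map_sum
          continuous_map_coordinate) (use A q in \<open>auto simp: J_def simp del: sets_rho space_rho\<close>)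
    fix a assume "a \<in> topspace (subtopology Z kernels)"
    then have a: "a \<in> kernels" by auto
    note d = dens[OF a q]
    note d(1)[measurable]
    have i: "integrable \<rho> (\<lambda>x. indicator (A i) x * dens a q x)" for i
    proof (rule integrable_const_bound[where B=1])
      show "(\<lambda>x. indicator (A i) x * dens a q x) \<in> borel_measurable \<rho>"
        by (rule borel_measurable_times[OF borel_measurable_indicator[OF A] d(1)])
    qed (use d(2) in \<open>auto simp: indicator_def\<close>)
    have di: "integrable \<rho> (dens a q)" using d by (intro integrable_01) auto
    have hdi: "integrable \<rho> (\<lambda>x. h x * dens a q x)"
      by (rule integrable_const_bound[where B=1]) (use h d(2) in \<open>auto simp: abs_mult intro!: mult_le_one\<close>)
    have s: "(\<Sum>i=1..n. (1 / real n) * indicator (A i) x) = stair n (h x)" if "x \<in> topspace X" for x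
      unfolding stair_def A_def using that by (auto intro!: sum.cong simp: indicator_def)
    have "(\<Sum>i=1..n. (1 / real n) * a (A i, q)) = (\<integral>x. (\<Sum>i=1..n. (1 / real n) * (indicator (A i) x * dens a q x)) \<partial>\<rho>)"
      using d(3)[OF A] i by (subst Bochner_Integration.integral_sum) auto
    also have "\<dots> = (\<integral>x. stair n (h x) * dens a q x \<partial>\<rho>)"
      by (rule Bochner_Integration.integral_cong) (use s in \<open>auto simp: sum_distrib_right mult.assoc simp flip: s\<close>)
    finally have e1: "(\<Sum>i=1..n. (1 / real n) * a (A i, q)) = (\<integral>x. stair n (h x) * dens a q x \<partial>\<rho>)" .
    have sm: "(\<lambda>x. stair n (h x)) \<in> borel_measurable \<rho>"
    proof -
      have "(\<lambda>x. \<Sum>i=1..n. (1 / real n) * indicator (A i) x) \<in> borel_measurable \<rho>" using A by measurable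
      then show ?thesis by (rule measurable_cong[THEN iffD1, rotated]) (use s in auto)
    qed
    have si: "integrable \<rho> (\<lambda>x. stair n (h x) * dens a q x)"
    proof (rule integrable_const_bound[where B=1])
      show "AE x in \<rho>. norm (stair n (h x) * dens a q x) \<le> 1"
      proof (rule AE_I2)
        fix x assume "x \<in> space \<rho>"
        then have "stair n (h x) \<le> 1" "0 \<le> stair n (h x)"
          using stair_approx(1)[of n "h x"] h[of x] n0 stair_nonneg by (auto intro: order_trans)
        then show "norm (stair n (h x) * dens a q x) \<le> 1" using d(2)[of x] by (auto simp: abs_mult intro!: mult_le_one)
      qed
    qed (use sm d(1) in measurable)
    have e2: "a (space \<rho>, q) = (\<integral>x. dens a q x \<partial>\<rho>)"
      using d(3)[OF sets.top] by (auto intro!: Bochner_Integration.integral_cong)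
    have "(\<integral>x. g x * dens a q x \<partial>\<rho>) = (\<integral>x. 2 * b * (h x * dens a q x) - b * dens a q x \<partial>\<rho>)"
      by (simp add: gh left_diff_distrib mult.assoc)
    also have "\<dots> = 2 * b * (\<integral>x. h x * dens a q x \<partial>\<rho>) - b * (\<integral>x. dens a q x \<partial>\<rho>)"
      using hdi di by simp
    finally have "(\<integral>x. g x * dens a q x \<partial>\<rho>) - G a = 2 * b * ((\<integral>x. h x * dens a q x \<partial>\<rho>) - (\<integral>x. stair n (h x) * dens a q x \<partial>\<rho>))"
      unfolding G_def e1 e2 by (simp add: algebra_simps)
    also have "(\<integral>x. h x * dens a q x \<partial>\<rho>) - (\<integral>x. stair n (h x) * dens a q x \<partial>\<rho>) = (\<integral>x. (h x - stair n (h x)) * dens a q x \<partial>\<rho>)"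
      using hdi si by (simp add: left_diff_distrib)
    finally have eq: "\<bar>(\<integral>x. g x * dens a q x \<partial>\<rho>) - G a\<bar> = 2 * b * \<bar>\<integral>x. (h x - stair n (h x)) * dens a q x \<partial>\<rho>\<bar>"
      using b(1) by (simp add: abs_mult)
    have "\<bar>\<integral>x. (h x - stair n (h x)) * dens a q x \<partial>\<rho>\<bar> \<le> (\<integral>x. \<bar>(h x - stair n (h x)) * dens a q x\<bar> \<partial>\<rho>)" by (rule integral_abs_bound)
    also have "\<dots> \<le> (\<integral>x. 1 / real n \<partial>\<rho>)"
    proof (rule integral_mono)
      show "integrable \<rho> (\<lambda>x. \<bar>(h x - stair n (h x)) * dens a q x\<bar>)"
        using hdi si by (simp add: left_diff_distrib)
      fix x assume "x \<in> space \<rho>"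
      then have "\<bar>h x - stair n (h x)\<bar> \<le> 1 / real n" using stair_approx[of n "h x"] h[of x] n0 by auto
      then have "\<bar>h x - stair n (h x)\<bar> * \<bar>dens a q x\<bar> \<le> (1 / real n) * 1" using d(2)[of x] by (intro mult_mono) auto
      then show "\<bar>(h x - stair n (h x)) * dens a q x\<bar> \<le> 1 / real n" by (simp add: abs_mult)
    qed simp
    also have "\<dots> = 1 / real n" using prob_space by simp
    finally have "2 * b * \<bar>\<integral>x. (h x - stair n (h x)) * dens a q x \<partial>\<rho>\<bar> \<le> 2 * b * (1 / real n)" using b(1) by (intro mult_left_mono) auto
    also have "\<dots> \<le> e" using n n0 e by (simp add: field_simps)
    finally show "\<bar>(\<integral>x. g x * dens a q x \<partial>\<rho>) - G a\<bar> \<le> e" unfolding eq .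
  qed
qed

text \<open>The integral of a test function is within the oscillation error of its grid sum,
  uniformly over all kernels, and the grid sum depends continuously on the kernel.\<close>

lemma continuous_map_kernel_law: "continuous_map (subtopology Z kernels) (weak_top (prod_topology X (Itop T))) kernel_law"
proof (rule continuous_map_into_weak_top)
  show "a \<in> topspace (subtopology Z kernels) \<Longrightarrow> kernel_law a \<in> Pspace (prod_topology X (Itop T))" for a
    using kernel_law_coupling[of a] by (auto simp: coupling_def)
  fix f assume fC: "f \<in> Cb (prod_topology X (Itop T))"
  have f: "continuous_map (prod_topology X (Itop T)) euclideanreal f" using fC by (simp add: Cb_def)
  obtain B where B: "\<forall>p\<in>topspace (prod_topology X (Itop T)). \<bar>f p\<bar> \<le> B" using Cb_obtain_bound[OF fC] by metis
  show "continuous_map (subtopology Z kernels) euclideanreal (\<lambda>a. \<integral>p. f p \<partial>kernel_law a)"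
  proof (rule continuous_map_uniform_approx)
    fix e :: real assume "0 < e"
    from LIMSEQ_D[OF osc_integral_tendsto[OF T f B rho] this] obtain n0 where
      n0: "\<And>n. n0 \<le> n \<Longrightarrow> \<bar>\<integral>x. osc T f (T / real n) x \<partial>\<rho>\<bar> < e" by auto
    define n where "n = max 1 n0"
    have n: "1 \<le> n" "\<bar>\<integral>x. osc T f (T / real n) x \<partial>\<rho>\<bar> < e" using n0[of n] by (auto simp: n_def)
    show "\<exists>g. continuous_map (subtopology Z kernels) euclideanreal g \<and> (\<forall>a\<in>topspace (subtopology Z kernels). \<bar>(\<integral>p. f p \<partial>kernel_law a) - g a\<bar> \<le> e)"
    proof (intro exI[of _ "\<lambda>a. discretised_integral f n (dens a)"] conjI ballI)
      fix a assume "a \<in> topspace (subtopology Z kernels)"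
      then show "\<bar>(\<integral>p. f p \<partial>kernel_law a) - discretised_integral f n (dens a)\<bar> \<le> e"
        using kernel_law_discretisation[OF _ f B n(1), of a] n(2) by auto
    next
      have gm: "grid_diff T f n i \<in> borel_measurable \<rho>" if "i \<in> {1..<n}" for i
        unfolding Pspace_borel_measurable[OF rho] by (rule grid_diff_props(1)[OF T f B]) (use that in auto)
      have gb: "\<bar>grid_diff T f n i x\<bar> \<le> 2 * B" if "i \<in> {1..<n}" "x \<in> topspace X" for i x
        using grid_diff_props(2)[OF T f B, of i n x] that by auto
      have eq: "(\<integral>x. grid_diff T f n i x * (1 - dens a (real i * (T / real n)) x) \<partial>\<rho>) =
          (\<integral>x. grid_diff T f n i x \<partial>\<rho>) - (\<integral>x. grid_diff T f n i x * dens a (real i * (T / real n)) x \<partial>\<rho>)"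
        if i: "i \<in> {1..<n}" and a: "a \<in> kernels" for i a
      proof -
        note d = dens[OF a grid_D[OF i]]
        have gi: "integrable \<rho> (grid_diff T f n i)"
          by (rule integrable_const_bound[where B="2*B"]) (use gm[OF i] gb[OF i] in auto)
        have "integrable \<rho> (\<lambda>x. grid_diff T f n i x * dens a (real i * (T / real n)) x)"
        proof (rule Bochner_Integration.integrable_bound[OF gi])
          show "(\<lambda>x. grid_diff T f n i x * dens a (real i * (T / real n)) x) \<in> borel_measurable \<rho>"
            using gm[OF i] d(1) by (rule borel_measurable_times)
          show "AE x in \<rho>. norm (grid_diff T f n i x * dens a (real i * (T / real n)) x) \<le> norm (grid_diff T f n i x)"
            using d(2) by (intro AE_I2) (auto simp: abs_mult intro!: mult_left_le)
        qed
        then show ?thesis using gi by (simp add: right_diff_distrib)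
      qed
      have "continuous_map (subtopology Z kernels) euclideanreal (\<lambda>a. (\<integral>x. f (x, T / real n) \<partial>\<rho>) + (\<Sum>i=1..<n.
          (\<integral>x. grid_diff T f n i x \<partial>\<rho>) - (\<integral>x. grid_diff T f n i x * dens a (real i * (T / real n)) x \<partial>\<rho>)))"
        by (intro continuous_map_add continuous_map_sum continuous_map_diff continuous_map_canonical_const
            continuous_map_dens_integral[where B="2*B"] grid_D gm gb) auto
      then show "continuous_map (subtopology Z kernels) euclideanreal (\<lambda>a. discretised_integral f n (dens a))"
      proof (rule continuous_map_eq)
        fix a assume "a \<in> topspace (subtopology Z kernels)"
        then have a: "a \<in> kernels" by simp
        show "(\<integral>x. f (x, T / real n) \<partial>\<rho>) + (\<Sum>i=1..<n.
          (\<integral>x. grid_diff T f n i x \<partial>\<rho>) - (\<integral>x. grid_diff T f n i x * dens a (real i * (T / real n)) x \<partial>\<rho>)) = discretised_integral f n (dens a)"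
          unfolding discretised_integral_def by (intro arg_cong2[where f="(+)"] sum.cong refl eq[OF _ a, symmetric])
      qed
    qed
  qed
qed

end

section \<open>Every coupling arises from a kernel\<close>

context coupling
begin

sublocale cc: coupling_compactness X T \<rho> using T rho by unfold_locales

lemma integral_indicator_ge:
  fixes g :: "'a \<Rightarrow> real"
  assumes g: "g \<in> borel_measurable \<rho>" "integrable \<rho> g" and k: "k \<in> borel_measurable \<rho>" "\<And>x. 0 \<le> k x \<and> k x \<le> 1"
    and lt: "(\<integral>\<omega>. indicator {\<omega> \<in> space P. snd \<omega> < q} \<omega> * g (fst \<omega>) \<partial>P) = (\<integral>x. k x * g x \<partial>\<rho>)"
  shows "(\<integral>\<omega>. indicator {\<omega> \<in> space P. q \<le> snd \<omega>} \<omega> * g (fst \<omega>) \<partial>P) = (\<integral>x. g x * (1 - k x) \<partial>\<rho>)"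
proof -
  have A: "{\<omega> \<in> space P. snd \<omega> < q} \<in> sets P" by measurable
  have di: "integrable \<rho> (\<lambda>x. k x * g x)"
    by (rule integrable_bounded_mult(1)[OF g(2) k(1), of 1]) (use k(2) in auto)
  have gP: "integrable P (\<lambda>\<omega>. g (fst \<omega>))" by (rule integrable_fst[OF g(2)])
  have "(\<integral>\<omega>. indicator {\<omega> \<in> space P. q \<le> snd \<omega>} \<omega> * g (fst \<omega>) \<partial>P) =
      (\<integral>\<omega>. g (fst \<omega>) - indicator {\<omega> \<in> space P. snd \<omega> < q} \<omega> * g (fst \<omega>) \<partial>P)"
    by (rule Bochner_Integration.integral_cong) (auto simp: indicator_def)
  also have "\<dots> = (\<integral>\<omega>. g (fst \<omega>) \<partial>P) - (\<integral>\<omega>. indicator {\<omega> \<in> space P. snd \<omega> < q} \<omega> * g (fst \<omega>) \<partial>P)"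
    using gP integrable_mult_indicator[OF A gP] by simp
  also have "\<dots> = (\<integral>x. g x \<partial>\<rho>) - (\<integral>x. k x * g x \<partial>\<rho>)"
    using integral_fst[OF g(1)] lt by simp
  also have "\<dots> = (\<integral>x. g x * (1 - k x) \<partial>\<rho>)"
    using g(2) di by (simp add: right_diff_distrib mult.commute)
  finally show ?thesis .
qed

text \<open>Take the kernel read off from P. At every grid point the density of {\<tau> < q} under P
  equals the chosen one almost everywhere, so P and \<open>kernel_law a\<close> are both within the
  oscillation error of the same grid sum. Refining the grid equates all integrals of bounded
  continuous functions.\<close>

lemma exists_kernel:
  assumes coz: "cozero_space (prod_topology X (Itop T))"
  shows "\<exists>a\<in>cc.kernels. P = cc.kernel_law a"
proof -
  have A: "{\<omega> \<in> space P. snd \<omega> < q} \<in> sets P" for q by measurable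
  \<comment> \<open>Restricted to the index set, since points of the product topology are
    extensional functions.\<close>
  define a where "a = (\<lambda>(C, q)\<in>cc.J. measure P ({\<omega> \<in> space P. snd \<omega> < q} \<inter> fst -` C))"
  have av: "a (C, q) = measure P ({\<omega> \<in> space P. snd \<omega> < q} \<inter> fst -` C)" if "C \<in> sets \<rho>" "q \<in> cc.D" for C q
    using that by (simp add: a_def cc.J_def)
  have ms: "{\<omega> \<in> space P. snd \<omega> < q} \<inter> fst -` C \<in> sets P" if "C \<in> sets \<rho>" for q C
  proof -
    have "{\<omega> \<in> space P. snd \<omega> < q} \<inter> fst -` C = {\<omega> \<in> space P. snd \<omega> < q} \<inter> (fst -` C \<inter> space P)" by auto
    then show ?thesis using A measurable_sets[OF fst_meas_rho that] by auto
  qed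
  have ak: "a \<in> cc.kernels"
    unfolding cc.kernels_def
  proof (intro CollectI conjI ballI impI)
    show "a \<in> topspace cc.Z" unfolding cc.Z_def topspace_product_topology
      by (auto simp: a_def P.prob_le_1)
    fix q assume q: "q \<in> cc.D"
    show "a (C1 \<union> C2, q) = a (C1, q) + a (C2, q)" if "C1 \<in> sets \<rho>" "C2 \<in> sets \<rho>" "C1 \<inter> C2 = {}" for C1 C2
    proof -
      have "{\<omega> \<in> space P. snd \<omega> < q} \<inter> fst -` (C1 \<union> C2) = ({\<omega> \<in> space P. snd \<omega> < q} \<inter> fst -` C1) \<union> ({\<omega> \<in> space P. snd \<omega> < q} \<inter> fst -` C2)" by auto
      then show ?thesis unfolding av[OF that(1) q] av[OF that(2) q] av[OF sets.Un[OF that(1,2)] q]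
        using ms[OF that(1), of q] ms[OF that(2), of q] that(3)
        by (simp only:) (subst P.finite_measure_Union, auto)
    qed
    show "a (C, q) \<le> measure \<rho> C" if "C \<in> sets \<rho>" for C
    proof -
      have "measure \<rho> C = measure P (fst -` C \<inter> space P)"
        using measure_distr[OF fst_meas, of C] that by (simp add: marg)
      then show ?thesis unfolding av[OF that q]
        by (simp only:) (intro P.finite_measure_mono, use measurable_sets[OF fst_meas_rho that] in auto)
    qed
    show "a (C, q) \<le> a (C, q')" if "q' \<in> cc.D" "q \<le> q'" "C \<in> sets \<rho>" for q' C
      unfolding av[OF that(3) q] av[OF that(3,1)]
      by (intro P.finite_measure_mono ms that(3)) (use that in auto)
  qed
  have "P = cc.kernel_law a"
  proof (rule measure_eq_of_Cb[OF coz P])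
    show "cc.kernel_law a \<in> Pspace (prod_topology X (Itop T))" using cc.kernel_law_coupling[OF ak] by (simp add: coupling_def)
    fix f assume fC: "f \<in> Cb (prod_topology X (Itop T))"
    have f: "continuous_map (prod_topology X (Itop T)) euclideanreal f" using fC by (simp add: Cb_def)
    obtain B where B: "\<forall>p\<in>topspace (prod_topology X (Itop T)). \<bar>f p\<bar> \<le> B" using Cb_obtain_bound[OF fC] by metis
    have key: "\<bar>(\<integral>\<omega>. f \<omega> \<partial>P) - (\<integral>\<omega>. f \<omega> \<partial>cc.kernel_law a)\<bar> \<le> 2 * (\<integral>x. osc T f (T / real n) x \<partial>\<rho>)" if n: "1 \<le> n" for n
    proof -
      have "(\<integral>\<omega>. indicator {\<omega> \<in> space P. real i * (T / real n) \<le> snd \<omega>} \<omega> * grid_diff T f n i (fst \<omega>) \<partial>P) =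
          (\<integral>x. grid_diff T f n i x * (1 - cc.dens a (real i * (T / real n)) x) \<partial>\<rho>)" if i: "i \<in> {1..<n}" for i
      proof -
        let ?q = "real i * (T / real n)"
        note q = cc.grid_D[OF i]
        note d = cc.dens[OF ak q]
        have gm: "grid_diff T f n i \<in> borel_measurable \<rho>"
          unfolding Pspace_borel_measurable[OF rho] by (rule grid_diff_props(1)[OF T f B]) (use i in auto)
        have gi: "integrable \<rho> (grid_diff T f n i)"
          by (rule rho.integrable_const_bound[where B="2*B"]) (use gm grid_diff_props(2)[OF T f B, of i n] i in auto)
        obtain k where k: "k \<in> borel_measurable \<rho>" "\<And>x. 0 \<le> k x \<and> k x \<le> (1::real)"
          "\<And>g::'a \<Rightarrow> real. integrable \<rho> g \<Longrightarrow> (\<integral>\<omega>. indicator {\<omega> \<in> space P. snd \<omega> < ?q} \<omega> * g (fst \<omega>) \<partial>P) = (\<integral>x. k x * g x \<partial>\<rho>)"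
          using exists_density[OF A[of ?q]] by blast
        have ki: "integrable \<rho> k" "integrable \<rho> (cc.dens a ?q)" using k d by (auto intro: cc.integrable_01)
        have eqC: "(\<integral>x. indicator C x * k x \<partial>\<rho>) = (\<integral>x. indicator C x * cc.dens a ?q x \<partial>\<rho>)" if C: "C \<in> sets \<rho>" for C
          using d(3)[OF C] av[OF C q] measure_eq_integral[OF A C] k(3)[OF integrable_ind[OF C]] by (simp add: mult.commute)
        have "AE x in \<rho>. k x = cc.dens a ?q x"
          by (rule density_unique_real[OF ki]) (use eqC in \<open>simp add: set_lebesgue_integral_def\<close>)
        then have e1: "(\<integral>x. k x * grid_diff T f n i x \<partial>\<rho>) = (\<integral>x. cc.dens a ?q x * grid_diff T f n i x \<partial>\<rho>)"
          using k(1) d(1) gm by (intro integral_cong_AE) auto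
        show ?thesis
          by (rule integral_indicator_ge[OF gm gi d(1)]) (use d(2) k(3)[OF gi] e1 in auto)
      qed
      then have "\<bar>(\<integral>\<omega>. f \<omega> \<partial>P) - cc.discretised_integral f n (cc.dens a)\<bar> \<le> (\<integral>x. osc T f (T / real n) x \<partial>\<rho>)"
        using discretisation_coupling[OF T f B coupling_axioms n] by (simp add: cc.discretised_integral_def)
      then show ?thesis using cc.kernel_law_discretisation[OF ak f B n] by linarith
    qed
    have "(\<lambda>n. 2 * (\<integral>x. osc T f (T / real n) x \<partial>\<rho>)) \<longlonglongrightarrow> 2 * 0"
      by (intro tendsto_intros osc_integral_tendsto[OF T f B rho])
    then have "\<bar>(\<integral>\<omega>. f \<omega> \<partial>P) - (\<integral>\<omega>. f \<omega> \<partial>cc.kernel_law a)\<bar> \<le> 2 * 0"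
      by (rule LIMSEQ_le_const) (use key in blast)
    then show "(\<integral>\<omega>. f \<omega> \<partial>P) = (\<integral>\<omega>. f \<omega> \<partial>cc.kernel_law a)" by simp
  qed
  then show ?thesis using ak by blast
qed

end

text \<open>The compact set is the continuous image of the compact set of kernels; it contains all
  couplings because each of them comes from a kernel.\<close>

lemma couplings_relatively_compact:
  assumes "0 < T" "\<rho> \<in> Pspace X" "cozero_space (prod_topology X (Itop T))"
  shows "\<exists>K. compactin (weak_top (prod_topology X (Itop T))) K \<and> {P. coupling X T \<rho> P} \<subseteq> K"
proof -
  interpret coupling_compactness X T \<rho> using assms by unfold_locales
  have "compactin (subtopology Z kernels) kernels" using compactin_kernels by (simp add: compactin_subtopology)
  from image_compactin[OF this continuous_map_kernel_law]
  have "compactin (weak_top (prod_topology X (Itop T))) (kernel_law ` kernels)" .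
  moreover have "{P. coupling X T \<rho> P} \<subseteq> kernel_law ` kernels"
    using coupling.exists_kernel[OF _ assms(3)] by blast
  ultimately show ?thesis by blast
qed

subsection \<open>The filtration on the input space\<close>

lemma stop_bcontfun: "(\<lambda>r. apply_bcontfun w (min r t)) \<in> bcontfun" for w :: path
proof -
  have "continuous_on UNIV (\<lambda>r. apply_bcontfun w (min r t))"
    by (rule continuous_on_compose2[where t=UNIV and g="apply_bcontfun w"]) (auto intro!: continuous_intros)
  moreover have "bounded (range (\<lambda>r. apply_bcontfun w (min r t)))"
    by (rule bounded_subset[OF bounded_apply_bcontfun[of w]]) auto
  ultimately show ?thesis by (simp add: bcontfun_def)
qed

lemma stopE_simps:
  "apply_bcontfun (fst (stopE t p)) r = apply_bcontfun (fst p) (min r t)" "snd (stopE t p) = min (snd p) t"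
  by (cases p; simp add: stopE_def Bcontfun_inverse[OF stop_bcontfun])+

lemma continuous_on_stopE: "continuous_on UNIV (stopE t)"
proof -
  have "continuous_on UNIV (\<lambda>p. fst (stopE t p))"
    unfolding continuous_on_iff
  proof (intro ballI allI impI)
    fix p :: epnt and e :: real assume "0 < e"
    have "dist (fst (stopE t q)) (fst (stopE t p)) \<le> dist q p" for q
    proof (rule dist_bound)
      fix r show "dist (apply_bcontfun (fst (stopE t q)) r) (apply_bcontfun (fst (stopE t p)) r) \<le> dist q p"
        unfolding stopE_simps by (rule order_trans[OF dist_bounded dist_fst_le])
    qed
    then show "\<exists>d>0. \<forall>q\<in>UNIV. dist q p < d \<longrightarrow> dist (fst (stopE t q)) (fst (stopE t p)) < e"
      using \<open>0 < e\<close> by (intro exI[of _ e]) (auto intro: order_le_less_trans)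
  qed
  moreover have "continuous_on UNIV (\<lambda>p. snd (stopE t p))" unfolding stopE_simps by (intro continuous_intros)
  ultimately have "continuous_on UNIV (\<lambda>p. (fst (stopE t p), snd (stopE t p)))" by (rule continuous_on_Pair)
  then show ?thesis by simp
qed

lemma topspace_Etop: "topspace (Etop T) = Cpaths T \<times> {0..T}"
  by (simp add: Etop_eq)

lemma Cpaths_iff: "f \<in> Cpaths T \<longleftrightarrow> (\<forall>r. apply_bcontfun f r = apply_bcontfun f (max 0 (min T r)))"
  by (simp add: Cpaths_def)

lemma stopE_mem:
  assumes "0 \<le> t" "0 \<le> T" "p \<in> topspace (Etop T)" shows "stopE t p \<in> topspace (Etop T)"
proof -
  have f: "fst p \<in> Cpaths T" and s: "snd p \<in> {0..T}" using assms(3) by (auto simp: topspace_Etop)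
  have "fst (stopE t p) \<in> Cpaths T"
    unfolding Cpaths_iff
  proof
    fix r
    have "max 0 (min T (min r t)) = max 0 (min T (min (max 0 (min T r)) t))" using assms by (auto simp: max_def min_def)
    then have "apply_bcontfun (fst p) (max 0 (min T (min r t))) = apply_bcontfun (fst p) (max 0 (min T (min (max 0 (min T r)) t)))" by (rule arg_cong)
    then have "apply_bcontfun (fst p) (min r t) = apply_bcontfun (fst p) (min (max 0 (min T r)) t)"
      using f unfolding Cpaths_iff by metis
    then show "apply_bcontfun (fst (stopE t p)) r = apply_bcontfun (fst (stopE t p)) (max 0 (min T r))"
      unfolding stopE_simps .
  qed
  moreover have "snd (stopE t p) \<in> {0..T}" using s assms by (auto simp: stopE_simps)
  ultimately show ?thesis unfolding topspace_Etop by (metis mem_Times_iff)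
qed

lemma continuous_map_stopE:
  assumes "0 \<le> t" "0 \<le> T" shows "continuous_map (Etop T) (Etop T) (stopE t)"
proof -
  have "continuous_map (Etop T) euclidean (stopE t)"
    unfolding Etop_eq using continuous_on_subset[OF continuous_on_stopE] by simp
  moreover have "stopE t \<in> topspace (Etop T) \<rightarrow> Cpaths T \<times> {0..T}"
    using stopE_mem[OF assms] by (auto simp: topspace_Etop)
  ultimately show ?thesis by (subst (2) Etop_eq) (auto simp: continuous_map_in_subtopology)
qed

lemma stopE_stopE: "s \<le> t \<Longrightarrow> stopE s (stopE t p) = stopE s p"
  by (intro prod_eqI bcontfun_eqI) (simp_all add: stopE_simps min.assoc min.absorb2 min.absorb1)

lemma FWtau_borel:
  assumes "0 \<le> t" "0 \<le> T" shows "FWtau T t \<subseteq> sets (borel_of (Etop T))"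
  using measurable_sets[OF continuous_map_measurable_borel_of[OF continuous_map_stopE[OF assms]]]
  by (auto simp: FWtau_def)

text \<open>Stopping at s factors through stopping at t \<ge> s, so a preimage under the former is
  its own witness as a preimage under the latter.\<close>

lemma FWtau_mono:
  assumes "0 \<le> s" "s \<le> t" "0 \<le> T" shows "FWtau T s \<subseteq> FWtau T t"
proof
  fix C assume "C \<in> FWtau T s"
  then obtain A where A: "A \<in> sets (borel_of (Etop T))" "C = stopE s -` A \<inter> topspace (Etop T)" by (auto simp: FWtau_def)
  let ?B = "stopE s -` A \<inter> topspace (Etop T)"
  have "?B \<in> sets (borel_of (Etop T))" using FWtau_borel[of s T] A assms by (auto simp: FWtau_def)
  moreover have "C = stopE t -` ?B \<inter> topspace (Etop T)"
    unfolding A(2) using stopE_mem[of t T] assms(1,3) order_trans[OF assms(1,2)]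
    by (intro set_eqI) (simp add: stopE_stopE[OF assms(2)] conj_commute cong: conj_cong)
  ultimately show "C \<in> FWtau T t" unfolding FWtau_def by blast
qed

section \<open>Generators of the filtration, and continuous ones in particular\<close>

definition genF :: "real \<Rightarrow> real \<Rightarrow> inpt set set" where
  "genF T t = {{x \<in> topspace (Intop T). apply_bcontfun (fst x) r \<in> U} | r U. r \<in> {0..t} \<and> U \<in> sets borel}
    \<union> {{x \<in> topspace (Intop T). apply_bcontfun (fst (snd x)) r \<in> U} | r U. r \<in> {0..t} \<and> U \<in> sets borel}
    \<union> {{x \<in> topspace (Intop T). measure (snd (snd x)) C \<in> U} | C U. C \<in> FWtau T t \<and> U \<in> sets borel}"

lemma FBWmu_eq: "FBWmu T t = sigma_sets (topspace (Intop T)) (genF T t)"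
  by (simp add: FBWmu_def genF_def)

lemma genF_Pow: "genF T t \<subseteq> Pow (topspace (Intop T))"
  by (auto simp: genF_def)

lemma sigma_algebra_FBWmu: "sigma_algebra (topspace (Intop T)) (FBWmu T t)"
  unfolding FBWmu_eq by (rule sigma_algebra_sigma_sets[OF genF_Pow])

lemma FBWmu_mono:
  assumes "0 \<le> s" "s \<le> t" "0 \<le> T" shows "FBWmu T s \<subseteq> FBWmu T t"
  unfolding FBWmu_eq
proof (rule sigma_sets_mono')
  show "genF T s \<subseteq> genF T t" unfolding genF_def
    using FWtau_mono[OF assms] assms(2) by (intro Un_mono) (force simp: subset_iff)+
qed

abbreviation MF :: "real \<Rightarrow> real \<Rightarrow> inpt measure" where "MF T t \<equiv> sigma (topspace (Intop T)) (FBWmu T t)"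

lemma space_MF [simp]: "space (MF T t) = topspace (Intop T)" by (simp add: space_measure_of_conv)

lemma sets_MF [simp]: "sets (MF T t) = FBWmu T t"
  using sigma_algebra.sets_measure_of_eq[OF sigma_algebra_FBWmu] .

lemma genF_MF: "A \<in> genF T t \<Longrightarrow> A \<in> sets (MF T t)"
  by (simp only: sets_MF) (simp add: FBWmu_eq sigma_sets.Basic)

lemma evalB_measurable:
  assumes h: "r \<in> {0..t}" shows "(\<lambda>x. apply_bcontfun (fst x) r) \<in> borel_measurable (MF T t)"
proof (rule measurableI)
  fix U :: "real set" assume "U \<in> sets borel"
  then have "{x \<in> topspace (Intop T). apply_bcontfun (fst x) r \<in> U} \<in> genF T t" using h unfolding genF_def by blast
  from genF_MF[OF this] show "(\<lambda>x. apply_bcontfun (fst x) r) -` U \<inter> space (MF T t) \<in> sets (MF T t)"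
    by (simp add: vimage_def Int_def conj_commute)
qed simp

lemma evalW_measurable:
  assumes h: "r \<in> {0..t}" shows "(\<lambda>x. apply_bcontfun (fst (snd x)) r) \<in> borel_measurable (MF T t)"
proof (rule measurableI)
  fix U :: "real set" assume "U \<in> sets borel"
  then have "{x \<in> topspace (Intop T). apply_bcontfun (fst (snd x)) r \<in> U} \<in> genF T t" using h unfolding genF_def by blast
  from genF_MF[OF this] show "(\<lambda>x. apply_bcontfun (fst (snd x)) r) -` U \<inter> space (MF T t) \<in> sets (MF T t)"
    by (simp add: vimage_def Int_def conj_commute)
qed simp

lemma mu_measurable:
  assumes h: "C \<in> FWtau T t" shows "(\<lambda>x. measure (snd (snd x)) C) \<in> borel_measurable (MF T t)"
proof (rule measurableI)
  fix U :: "real set" assume "U \<in> sets borel"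
  then have "{x \<in> topspace (Intop T). measure (snd (snd x)) C \<in> U} \<in> genF T t" using h unfolding genF_def by blast
  from genF_MF[OF this] show "(\<lambda>x. measure (snd (snd x)) C) -` U \<inter> space (MF T t) \<in> sets (MF T t)"
    by (simp add: vimage_def Int_def conj_commute)
qed simp

lemma continuous_eval: "continuous_on UNIV (\<lambda>f :: path. apply_bcontfun f r)"
  unfolding continuous_on_iff using dist_bounded by (metis order_le_less_trans)

lemma Intop_continuous:
  "continuous_map (Intop T) euclideanreal (\<lambda>x. apply_bcontfun (fst x) r)"
  "continuous_map (Intop T) euclideanreal (\<lambda>x. apply_bcontfun (fst (snd x)) r)"
  "\<phi> \<in> Cb (Etop T) \<Longrightarrow> continuous_map (Intop T) euclideanreal (\<lambda>x. \<integral>p. \<phi> p \<partial>(snd (snd x)))"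
proof -
  have ev: "continuous_map (Ctop T) euclideanreal (\<lambda>f. apply_bcontfun f r)"
    unfolding Ctop_def using continuous_on_subset[OF continuous_eval] by simp
  show "continuous_map (Intop T) euclideanreal (\<lambda>x. apply_bcontfun (fst x) r)"
    unfolding Intop_def using continuous_map_compose[OF continuous_map_fst ev] by (simp add: o_def)
  show "continuous_map (Intop T) euclideanreal (\<lambda>x. apply_bcontfun (fst (snd x)) r)"
    unfolding Intop_def using continuous_map_compose[OF continuous_map_compose[OF continuous_map_snd continuous_map_fst] ev]
    by (simp add: o_def)
  show "continuous_map (Intop T) euclideanreal (\<lambda>x. \<integral>p. \<phi> p \<partial>(snd (snd x)))" if "\<phi> \<in> Cb (Etop T)"
    unfolding Intop_def
    using continuous_map_compose[OF continuous_map_compose[OF continuous_map_snd continuous_map_snd] continuous_map_weak_integral[OF that]]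
    by (simp add: o_def)
qed

lemma Intop_mu: "x \<in> topspace (Intop T) \<Longrightarrow> snd (snd x) \<in> Pspace (Etop T)"
  by (auto simp: Intop_def)

lemma cozero_space_Etop: "cozero_space (Etop T)"
  unfolding Etop_eq using pullback_map_imp_cozero_space[OF pullback_map_id] .

text \<open>The filtration provides only the masses of sets determined up to time t. A staircase
  writes the integral of a stopped function as a limit of finite combinations of such
  masses.\<close>

lemma mu_integral_measurable:
  assumes t: "0 \<le> t" and T: "0 \<le> T" and \<psi>: "continuous_map (Etop T) euclideanreal \<psi>"
    and \<psi>01: "\<And>p. p \<in> topspace (Etop T) \<Longrightarrow> 0 \<le> \<psi> p \<and> \<psi> p \<le> 1"
  shows "(\<lambda>x. \<integral>p. \<psi> (stopE t p) \<partial>(snd (snd x))) \<in> borel_measurable (MF T t)"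
proof -
  define A where "A n i = stopE t -` {p \<in> topspace (Etop T). real i / real n \<le> \<psi> p} \<inter> topspace (Etop T)" for n i
  have cb: "{p \<in> topspace (Etop T). real i / real n \<le> \<psi> p} \<in> sets (borel_of (Etop T))" for n i
    using closedin_borel_of[OF closedin_continuous_map_preimage[OF \<psi>, of "{real i / real n..}"]] by simp
  then have A: "A n i \<in> FWtau T t" for n i unfolding A_def FWtau_def by blast
  define I where "I n x = (\<Sum>i=1..n. (1 / real n) * measure (snd (snd x)) (A n i))" for n and x :: inpt
  have "(\<lambda>x. I n x) \<in> borel_measurable (MF T t)" for n unfolding I_def
    by (intro borel_measurable_sum borel_measurable_times borel_measurable_const mu_measurable A)
  moreover have "(\<lambda>n. I n x) \<longlonglongrightarrow> (\<integral>p. \<psi> (stopE t p) \<partial>(snd (snd x)))" if x: "x \<in> space (MF T t)" for x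
  proof -
    let ?\<mu> = "snd (snd x)"
    have mu: "?\<mu> \<in> Pspace (Etop T)" using Intop_mu x by simp
    interpret prob_space ?\<mu> using mu by (simp add: Pspace_iff)
    have sp: "space ?\<mu> = topspace (Etop T)" by (rule space_Pspace[OF mu])
    have As: "A n i \<in> sets ?\<mu>" for n i using A FWtau_borel[OF t T] mu by (auto simp: Pspace_iff)
    have st: "stair n (\<psi> (stopE t p)) = (\<Sum>i=1..n. (1 / real n) * indicator (A n i) p)" if "p \<in> topspace (Etop T)" for n p
      unfolding stair_def A_def using that stopE_mem[OF t T that] by (auto intro!: sum.cong simp: indicator_def)
    have Ieq: "I n x = (\<integral>p. stair n (\<psi> (stopE t p)) \<partial>?\<mu>)" for n
    proof -
      have "(\<integral>p. stair n (\<psi> (stopE t p)) \<partial>?\<mu>) = (\<integral>p. (\<Sum>i=1..n. (1 / real n) * indicator (A n i) p) \<partial>?\<mu>)"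
        by (rule Bochner_Integration.integral_cong) (use st sp in auto)
      also have "\<dots> = (\<Sum>i=1..n. \<integral>p. (1 / real n) * indicator (A n i) p \<partial>?\<mu>)"
        by (rule Bochner_Integration.integral_sum) (use As in \<open>auto simp: emeasure_eq_measure\<close>)
      also have "\<dots> = I n x" unfolding I_def using As by simp
      finally show ?thesis ..
    qed
    have "(\<lambda>n. \<integral>p. stair n (\<psi> (stopE t p)) \<partial>?\<mu>) \<longlonglongrightarrow> (\<integral>p. \<psi> (stopE t p) \<partial>?\<mu>)"
    proof (rule integral_dominated_convergence[where w="\<lambda>_. 1"])
      have b: "0 \<le> \<psi> (stopE t p) \<and> \<psi> (stopE t p) \<le> 1" if "p \<in> space ?\<mu>" for p
        using \<psi>01[OF stopE_mem[OF t T]] that sp by auto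
      show "AE p in ?\<mu>. (\<lambda>n. stair n (\<psi> (stopE t p))) \<longlonglongrightarrow> \<psi> (stopE t p)"
        by (rule AE_I2) (use b stair_tendsto in auto)
      show "AE p in ?\<mu>. norm (stair n (\<psi> (stopE t p))) \<le> 1" for n
      proof (rule AE_I2)
        fix p assume "p \<in> space ?\<mu>"
        note b[OF this]
        then show "norm (stair n (\<psi> (stopE t p))) \<le> 1"
          using stair_approx(1)[of n "\<psi> (stopE t p)"] stair_nonneg[of n "\<psi> (stopE t p)"]
          by (cases "n = 0") (auto simp: stair_def)
      qed
      have "continuous_map (Etop T) euclideanreal (\<psi> \<circ> stopE t)"
        by (rule continuous_map_compose[OF continuous_map_stopE[OF t T] \<psi>])
      then show "(\<lambda>p. \<psi> (stopE t p)) \<in> borel_measurable ?\<mu>"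
        unfolding Pspace_borel_measurable[OF mu] using continuous_map_borel_measurable by (auto simp: o_def)
      show "(\<lambda>p. stair n (\<psi> (stopE t p))) \<in> borel_measurable ?\<mu>" for n
      proof -
        have "(\<lambda>p. \<Sum>i=1..n. (1 / real n) * indicator (A n i) p) \<in> borel_measurable ?\<mu>" using As by measurable
        then show ?thesis by (rule measurable_cong[THEN iffD1, rotated]) (use st sp in auto)
      qed
    qed simp
    then show ?thesis by (simp add: Ieq)
  qed
  ultimately show ?thesis by (rule borel_measurable_LIMSEQ_real[rotated])
qed

text \<open>Evaluations of paths are continuous, but \<mu>(C) is not continuous in \<mu>. Integrals
  of \<psi>(\<open>stopE t\<close> p) with continuous \<psi> are both continuous in \<mu> and
  adapted, and they recover \<mu>(C): for preimages of open sets by monotone approximation, for the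
  rest by a Dynkin argument. Thus the raw filtration itself, without completion, has continuous
  generators.\<close>

lemma cont_generated_MF:
  assumes t: "0 \<le> t" and T: "0 \<le> T"
  shows "cont_generated (Intop T) (MF T t)"
proof -
  let ?X = "Intop T"
  let ?G = "{{x \<in> topspace ?X. a < \<phi> x} | a \<phi>. continuous_map ?X euclideanreal \<phi> \<and> \<phi> \<in> borel_measurable (MF T t)}"
  define N where "N = sigma (topspace ?X) ?G"
  have GP: "?G \<subseteq> Pow (topspace ?X)" by auto
  have sN: "sets N = sigma_sets (topspace ?X) ?G" "space N = topspace ?X"
    using GP by (simp_all add: N_def space_measure_of_conv)
  have cN: "\<phi> \<in> borel_measurable N" if "continuous_map ?X euclideanreal \<phi>" "\<phi> \<in> borel_measurable (MF T t)" for \<phi>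
    unfolding borel_measurable_iff_greater[of \<phi> N] sN
  proof
    fix a
    have "{w \<in> topspace ?X. a < \<phi> w} \<in> ?G" using that by blast
    then show "{w \<in> topspace ?X. a < \<phi> w} \<in> sigma_sets (topspace ?X) ?G" by (rule sigma_sets.Basic)
  qed
  have B: "(\<lambda>x. apply_bcontfun (fst x) r) \<in> borel_measurable N" if "r \<in> {0..t}" for r
    by (rule cN[OF Intop_continuous(1) evalB_measurable[OF that]])
  have W: "(\<lambda>x. apply_bcontfun (fst (snd x)) r) \<in> borel_measurable N" if "r \<in> {0..t}" for r
    by (rule cN[OF Intop_continuous(2) evalW_measurable[OF that]])
  \<comment> \<open>The Dynkin induction runs over the Borel set \<open>A\<close> before stopping,
    where open sets form the generator; taking preimages respects complements and disjoint
    unions.\<close>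
  define S where "S A = stopE t -` A \<inter> topspace (Etop T)" for A
  have Sset: "S A \<in> sets (borel_of (Etop T))" if "A \<in> sets (borel_of (Etop T))" for A
    using FWtau_borel[OF t T] that by (auto simp: FWtau_def S_def)
  have mu: "(\<lambda>x. measure (snd (snd x)) (S A)) \<in> borel_measurable N" if "A \<in> sets (borel_of (Etop T))" for A
  proof -
    have "Int_stable {U. openin (Etop T) U}" by (auto simp: Int_stable_def)
    moreover have "{U. openin (Etop T) U} \<subseteq> Pow (topspace (Etop T))" using openin_subset by blast
    moreover have "A \<in> sigma_sets (topspace (Etop T)) {U. openin (Etop T) U}" using that by (simp add: sets_borel_of)
    ultimately show ?thesis
    proof (induction rule: sigma_sets_induct_disjoint)
      case (basic A)
      then have A: "openin (Etop T) A" by simp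
      obtain f where f: "continuous_map (Etop T) euclideanreal f"
        "\<And>p. p \<in> topspace (Etop T) \<Longrightarrow> 0 \<le> f p \<and> f p \<le> 1 \<and> (0 < f p \<longleftrightarrow> p \<in> A)"
        using cozero_space_Etop[of T] A unfolding cozero_space_def by metis
      \<comment> \<open>Increases to the indicator of \<open>A\<close>, the cozero set of f;
        composed with \<open>stopE t\<close> it increases to that of \<open>S A\<close>.\<close>
      define \<psi> where "\<psi> n p = min 1 (real n * f p)" for n p
      have \<psi>c: "continuous_map (Etop T) euclideanreal (\<psi> n)" for n
        unfolding \<psi>_def by (intro continuous_map_real_min continuous_map_real_mult f(1)) auto
      have \<psi>01: "0 \<le> \<psi> n p \<and> \<psi> n p \<le> 1" if "p \<in> topspace (Etop T)" for n p
        using f(2)[OF that] by (simp add: \<psi>_def)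
      have \<psi>s: "(\<lambda>p. \<psi> n (stopE t p)) \<in> Cb (Etop T)" for n
      proof (rule CbI[where B=1])
        show "continuous_map (Etop T) euclideanreal (\<lambda>p. \<psi> n (stopE t p))"
          using continuous_map_compose[OF continuous_map_stopE[OF t T] \<psi>c] by (simp add: o_def)
      qed (use \<psi>01[OF stopE_mem[OF t T]] in auto)
      have "(\<lambda>x. \<integral>p. \<psi> n (stopE t p) \<partial>(snd (snd x))) \<in> borel_measurable N" for n
        by (rule cN[OF Intop_continuous(3)[OF \<psi>s] mu_integral_measurable[OF t T \<psi>c \<psi>01]])
      moreover have "(\<lambda>n. \<integral>p. \<psi> n (stopE t p) \<partial>(snd (snd x))) \<longlonglongrightarrow> measure (snd (snd x)) (S A)" if x: "x \<in> space N" for x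
      proof -
        let ?\<mu> = "snd (snd x)"
        have m: "?\<mu> \<in> Pspace (Etop T)" using Intop_mu x sN by simp
        interpret prob_space ?\<mu> using m by (simp add: Pspace_iff)
        have sp: "space ?\<mu> = topspace (Etop T)" by (rule space_Pspace[OF m])
        have SA: "S A \<in> sets ?\<mu>" using Sset[OF openin_borel_of[OF A]] m by (simp add: Pspace_iff)
        have "(\<lambda>n. \<integral>p. \<psi> n (stopE t p) \<partial>?\<mu>) \<longlonglongrightarrow> (\<integral>p. indicator (S A) p \<partial>?\<mu>)"
        proof (rule integral_dominated_convergence[where w="\<lambda>_. 1"])
          show "AE p in ?\<mu>. (\<lambda>n. \<psi> n (stopE t p)) \<longlonglongrightarrow> indicator (S A) p"
          proof (rule AE_I2)
            fix p assume "p \<in> space ?\<mu>"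
            then have p: "p \<in> topspace (Etop T)" "stopE t p \<in> topspace (Etop T)" using sp stopE_mem[OF t T] by auto
            show "(\<lambda>n. \<psi> n (stopE t p)) \<longlonglongrightarrow> indicator (S A) p"
            proof (cases "stopE t p \<in> A")
              case True
              then have "0 < f (stopE t p)" using f(2)[OF p(2)] by simp
              then obtain M where M: "1 < real M * f (stopE t p)" using reals_Archimedean3 by blast
              have "\<forall>\<^sub>F n in sequentially. \<psi> n (stopE t p) = 1"
              proof (rule eventually_sequentiallyI[of M])
                fix n assume "M \<le> n"
                then have "real M * f (stopE t p) \<le> real n * f (stopE t p)" using \<open>0 < f (stopE t p)\<close> by simp
                then have "1 \<le> real n * f (stopE t p)" using M by linarith
                then show "\<psi> n (stopE t p) = 1" by (simp add: \<psi>_def)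
              qed
              then show ?thesis using True p by (simp add: S_def tendsto_eventually)
            next
              case False
              then have "f (stopE t p) = 0" using f(2)[OF p(2)] by auto
              then show ?thesis using False by (simp add: S_def \<psi>_def)
            qed
          qed
          show "AE p in ?\<mu>. norm (\<psi> n (stopE t p)) \<le> 1" for n
            by (rule AE_I2) (use \<psi>01[OF stopE_mem[OF t T]] sp in auto)
          show "(\<lambda>p. \<psi> n (stopE t p)) \<in> borel_measurable ?\<mu>" for n
            using Pspace_integrable_Cb[OF m \<psi>s] by simp
        qed (use SA in auto)
        then show ?thesis using SA by simp
      qed
      ultimately show ?case by (rule borel_measurable_LIMSEQ_real[rotated])
    next
      case empty
      show ?case by (simp add: S_def)
    next
      case (compl A)
      have A: "A \<in> sets (borel_of (Etop T))" using compl(1) by (simp add: sets_borel_of)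
      have "measure (snd (snd x)) (S (topspace (Etop T) - A)) = 1 - measure (snd (snd x)) (S A)" if x: "x \<in> space N" for x
      proof -
        let ?\<mu> = "snd (snd x)"
        have m: "?\<mu> \<in> Pspace (Etop T)" using Intop_mu x sN by simp
        interpret prob_space ?\<mu> using m by (simp add: Pspace_iff)
        have sp: "space ?\<mu> = topspace (Etop T)" by (rule space_Pspace[OF m])
        have "S (topspace (Etop T) - A) = space ?\<mu> - S A" using stopE_mem[OF t T] sp by (auto simp: S_def)
        then show ?thesis using prob_compl[of "S A"] Sset[OF A] m by (simp add: Pspace_iff)
      qed
      moreover have "(\<lambda>x. 1 - measure (snd (snd x)) (S A)) \<in> borel_measurable N" using compl(2) by simp
      ultimately show ?case by (subst measurable_cong) auto
    next
      case (union A)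
      have A: "A i \<in> sets (borel_of (Etop T))" for i using union(2) by (auto simp: sets_borel_of)
      have "(\<lambda>x. \<Sum>i<n. measure (snd (snd x)) (S (A i))) \<in> borel_measurable N" for n
        using union(3) by (intro borel_measurable_sum)
      moreover have "(\<lambda>n. \<Sum>i<n. measure (snd (snd x)) (S (A i))) \<longlonglongrightarrow> measure (snd (snd x)) (S (\<Union>i. A i))" if x: "x \<in> space N" for x
      proof -
        let ?\<mu> = "snd (snd x)"
        have m: "?\<mu> \<in> Pspace (Etop T)" using Intop_mu x sN by simp
        interpret prob_space ?\<mu> using m by (simp add: Pspace_iff)
        have "(\<lambda>i. measure ?\<mu> (S (A i))) sums measure ?\<mu> (\<Union>i. S (A i))"
        proof (rule finite_measure_UNION)
          show "range (\<lambda>i. S (A i)) \<subseteq> events" using Sset[OF A] m by (auto simp: Pspace_iff)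
          show "disjoint_family (\<lambda>i. S (A i))" using union(1) unfolding disjoint_family_on_def S_def by blast
        qed
        moreover have "(\<Union>i. S (A i)) = S (\<Union>i. A i)" by (auto simp: S_def)
        ultimately show ?thesis by (simp add: sums_def)
      qed
      ultimately show ?case by (rule borel_measurable_LIMSEQ_real[rotated])
    qed
  qed
  have "genF T t \<subseteq> sets N"
  proof
    fix A assume "A \<in> genF T t"
    then consider (B) r U where "r \<in> {0..t}" "U \<in> sets borel" "A = {x \<in> topspace ?X. apply_bcontfun (fst x) r \<in> U}"
      | (W) r U where "r \<in> {0..t}" "U \<in> sets borel" "A = {x \<in> topspace ?X. apply_bcontfun (fst (snd x)) r \<in> U}"
      | (mu) C U where "C \<in> FWtau T t" "U \<in> sets borel" "A = {x \<in> topspace ?X. measure (snd (snd x)) C \<in> U}"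
      unfolding genF_def by auto
    then show "A \<in> sets N"
    proof cases
      case B
      then show ?thesis using measurable_sets[OF \<open>r \<in> {0..t} \<Longrightarrow> (\<lambda>x. apply_bcontfun (fst x) r) \<in> borel_measurable N\<close>, of U]
        by (auto simp: sN(2) vimage_def Int_def conj_commute)
    next
      case W
      then show ?thesis using measurable_sets[OF \<open>r \<in> {0..t} \<Longrightarrow> (\<lambda>x. apply_bcontfun (fst (snd x)) r) \<in> borel_measurable N\<close>, of U]
        by (auto simp: sN(2) vimage_def Int_def conj_commute)
    next
      case mu
      then obtain A' where "A' \<in> sets (borel_of (Etop T))" "C = S A'" by (auto simp: FWtau_def S_def)
      then have "(\<lambda>x. measure (snd (snd x)) C) \<in> borel_measurable N"
        using \<open>\<And>A. A \<in> sets (borel_of (Etop T)) \<Longrightarrow> (\<lambda>x. measure (snd (snd x)) (S A)) \<in> borel_measurable N\<close> by simp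
      from measurable_sets[OF this mu(2)] show ?thesis
        using mu(3) by (auto simp: sN(2) vimage_def Int_def conj_commute)
    qed
  qed
  from sets.sigma_sets_subset[OF this] have 1: "FBWmu T t \<subseteq> sigma_sets (topspace ?X) ?G"
    unfolding sN(2) sN(1) FBWmu_eq .
  have "?G \<subseteq> sets (MF T t)"
  proof clarify
    fix a :: real and \<phi> :: "inpt \<Rightarrow> real" assume "\<phi> \<in> borel_measurable (MF T t)"
    then have "{x \<in> space (MF T t). a < \<phi> x} \<in> sets (MF T t)" by (simp only: borel_measurable_iff_greater)
    then show "{x \<in> topspace ?X. a < \<phi> x} \<in> sets (MF T t)" by simp
  qed
  then have "sigma_sets (topspace ?X) ?G \<subseteq> sets (MF T t)"
    using sets.sigma_sets_subset[of ?G "MF T t"] by simp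
  then show ?thesis using 1 unfolding cont_generated_def by auto
qed

text \<open>The continuous generators have open superlevel sets.\<close>

lemma FBWmu_borel:
  assumes "0 \<le> t" "0 \<le> T" shows "FBWmu T t \<subseteq> sets (borel_of (Intop T))"
proof -
  let ?G = "{{x \<in> topspace (Intop T). a < \<phi> x} | a \<phi>. continuous_map (Intop T) euclideanreal \<phi> \<and> \<phi> \<in> borel_measurable (MF T t)}"
  have "?G \<subseteq> {U. openin (Intop T) U}"
  proof clarify
    fix a :: real and \<phi> :: "inpt \<Rightarrow> real" assume "continuous_map (Intop T) euclideanreal \<phi>"
    from openin_continuous_map_preimage[OF this, of "{a<..}"]
    show "openin (Intop T) {x \<in> topspace (Intop T). a < \<phi> x}" by simp
  qed
  then have "sigma_sets (topspace (Intop T)) ?G \<subseteq> sets (borel_of (Intop T))"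
    unfolding sets_borel_of by (rule sigma_sets_mono')
  then show ?thesis using cont_generated_MF[OF assms] unfolding cont_generated_def by simp
qed

subsection \<open>Conditional independence in terms of the input filtration\<close>

lemma Omtop_prod: "Omtop T = prod_topology (Intop T) (Itop T)"
  by (simp add: Omtop_def)

lemma has_marginal_iff_coupling:
  assumes "0 < T" "\<rho> \<in> Pspace (Intop T)"
  shows "has_marginal T \<rho> P \<longleftrightarrow> coupling (Intop T) T \<rho> P"
  using assms by (auto simp: has_marginal_def coupling_def Omtop_def)

lemma FBWmu_plus_subset: "t < s \<Longrightarrow> s \<le> T \<Longrightarrow> FBWmu_plus T t \<subseteq> FBWmu T s"
  by (auto simp: FBWmu_plus_def)

lemma sigma_algebra_INT:
  assumes "I \<noteq> {}" "\<And>i. i \<in> I \<Longrightarrow> sigma_algebra \<Omega> (F i)"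
  shows "sigma_algebra \<Omega> (\<Inter>i\<in>I. F i)"
proof -
  note S = assms(2)[unfolded sigma_algebra_iff2]
  have P: "(\<Inter>i\<in>I. F i) \<subseteq> Pow \<Omega>" using assms(1) S by blast
  show ?thesis
    unfolding sigma_algebra_iff2
  proof (intro conjI ballI allI impI P INT_I)
    fix i assume i: "i \<in> I"
    show "{} \<in> F i" using S[OF i] by blast
    show "\<Omega> - s \<in> F i" if "s \<in> (\<Inter>i\<in>I. F i)" for s using S[OF i] that i by blast
    show "\<Union> (range A) \<in> F i" if "range A \<subseteq> (\<Inter>i\<in>I. F i)" for A :: "nat \<Rightarrow> _"
    proof -
      have "range A \<subseteq> F i" using that i by blast
      then show ?thesis using S[OF i] by blast
    qed
  qed
qed

locale input_coupling = coupling "Intop T" T \<rho> P for T \<rho> P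
begin

lemma space_P': "space P = topspace (Omtop T)"
  by (simp add: Omtop_def)

lemma sub_sigma_FBWmu: "0 \<le> t \<Longrightarrow> sub_sigma (FBWmu T t)"
  unfolding sub_sigma_def using sigma_algebra_FBWmu FBWmu_borel T by auto

lemma sub_sigma_FBWmu_plus: "0 \<le> t \<Longrightarrow> t < T \<Longrightarrow> sub_sigma (FBWmu_plus T t)"
  unfolding sub_sigma_def
proof
  assume t: "0 \<le> t" "t < T"
  show "sigma_algebra (topspace (Intop T)) (FBWmu_plus T t)" unfolding FBWmu_plus_def
    by (rule sigma_algebra_INT) (use t sigma_algebra_FBWmu in auto)
  have "FBWmu_plus T t \<subseteq> FBWmu T T" by (rule FBWmu_plus_subset) (use t in auto)
  also have "\<dots> \<subseteq> sets (borel_of (Intop T))" by (rule FBWmu_borel) (use T in auto)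
  finally show "FBWmu_plus T t \<subseteq> sets (borel_of (Intop T))" .
qed

lemma liftF_mem: "A \<in> G \<Longrightarrow> fst -` A \<inter> space P \<in> liftF T G"
  unfolding liftF_def space_P' by blast

lemma sets_lift:
  assumes "sub_sigma G"
  shows "sets (sigma (space P) (liftF T G)) = liftF T G" "subalgebra P (sigma (space P) (liftF T G))"
proof -
  interpret G: sigma_algebra "topspace (Intop T)" G using assms by (simp add: sub_sigma_def)
  have f: "fst \<in> space P \<rightarrow> topspace (Intop T)" by auto
  have "liftF T G = {fst -` A \<inter> space P | A. A \<in> sigma_sets (topspace (Intop T)) G}"
    unfolding liftF_def space_P' G.sigma_sets_eq by simp
  also have "\<dots> = sigma_sets (space P) {fst -` A \<inter> space P | A. A \<in> G}" by (rule sigma_sets_vimage_commute[OF f])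
  finally have e: "liftF T G = sigma_sets (space P) (liftF T G)" unfolding liftF_def space_P' .
  have p: "liftF T G \<subseteq> Pow (space P)" unfolding liftF_def space_P' by auto
  show s: "sets (sigma (space P) (liftF T G)) = liftF T G" using e p by simp
  have "liftF T G \<subseteq> sets P"
    using assms measurable_sets[OF fst_meas] unfolding liftF_def space_P'[symmetric] sub_sigma_def by auto
  then show "subalgebra P (sigma (space P) (liftF T G))"
    unfolding subalgebra_def s by (simp add: space_measure_of_conv)
qed

lemma sfs_lift: "sub_sigma G \<Longrightarrow> sigma_finite_subalgebra P (sigma (space P) (liftF T G))"
  by (intro finite_measure_subalgebra_is_sigma_finite finite_measure_subalgebra.intro
      finite_measure_subalgebra_axioms.intro P.finite_measure_axioms sets_lift)

lemma fst_lift: "sub_sigma G \<Longrightarrow> fst \<in> measurable (sigma (space P) (liftF T G)) (sigma_gen G)"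
proof (rule measurableI)
  assume G: "sub_sigma G"
  show "fst -` A \<inter> space (sigma (space P) (liftF T G)) \<in> sets (sigma (space P) (liftF T G))" if "A \<in> sets (sigma_gen G)" for A
  proof -
    have "A \<in> G" using that sets_sigma_gen[OF G] by simp
    from liftF_mem[OF this] show ?thesis unfolding sets_lift(1)[OF G] by (simp add: space_measure_of_conv)
  qed
qed (auto simp: space_measure_of_conv)

text \<open>By uniqueness of conditional expectations, conditioning under P an event of the input on
  input information amounts to conditioning under \<rho>. The result is then the same function for
  every coupling.\<close>

lemma cond_exp_lift:
  assumes G: "sub_sigma G" and C: "C \<in> sets \<rho>"
  shows "AE \<omega> in P. real_cond_exp P (sigma (space P) (liftF T G)) (indicator (fst -` C \<inter> space P)) \<omega> = cexp G C (fst \<omega>)"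
proof (rule sigma_finite_subalgebra.real_cond_exp_charact[OF sfs_lift[OF G]])
  have C': "fst -` C \<inter> space P \<in> sets P" using measurable_sets[OF fst_meas_rho C] .
  show "integrable P (indicat_real (fst -` C \<inter> space P))" using C' by (simp add: P.emeasure_eq_measure del: space_P)
  show "integrable P (\<lambda>\<omega>. cexp G C (fst \<omega>))" by (rule integrable_cexp_fst[OF G C])
  show "(\<lambda>\<omega>. cexp G C (fst \<omega>)) \<in> borel_measurable (sigma (space P) (liftF T G))"
    by (rule measurable_compose[OF fst_lift[OF G] cexp_meas(2)])
  fix A assume "A \<in> sets (sigma (space P) (liftF T G))"
  then obtain B where B: "B \<in> G" "A = fst -` B \<inter> space P" unfolding sets_lift(1)[OF G] by (auto simp: liftF_def space_P' simp del: space_P)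
  have BG: "B \<in> sets (sigma_gen G)" using B(1) sets_sigma_gen[OF G] by simp
  have Br: "B \<in> sets \<rho>" using B(1) G by (auto simp: sub_sigma_def)
  interpret S: sigma_finite_subalgebra \<rho> "sigma_gen G" by (rule sfs_sigma_gen[OF G])
  have "(\<integral>\<omega>\<in>A. indicat_real (fst -` C \<inter> space P) \<omega> \<partial>P) = (\<integral>\<omega>. indicator B (fst \<omega>) * indicator C (fst \<omega>) \<partial>P)"
    unfolding set_lebesgue_integral_def B(2) by (rule Bochner_Integration.integral_cong) (auto simp: indicator_def)
  also have "\<dots> = (\<integral>x. indicator B x * indicator C x \<partial>\<rho>)"
    by (rule integral_fst) (use Br C in \<open>simp del: sets_rho\<close>)
  also have "\<dots> = (\<integral>x. indicator B x * cexp G C x \<partial>\<rho>)"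
    unfolding cexp_def
  proof (rule S.real_cond_exp_intg(2)[symmetric])
    show "integrable \<rho> (\<lambda>x. indicator B x * indicator C x :: real)"
      using integrable_mult_indicator[OF Br integrable_ind[OF C]] by simp
  qed (use BG C in \<open>simp_all del: sets_rho\<close>)
  also have "\<dots> = (\<integral>\<omega>. indicator B (fst \<omega>) * cexp G C (fst \<omega>) \<partial>P)"
    by (rule integral_fst[symmetric]) (use Br in \<open>simp del: sets_rho\<close>)
  also have "\<dots> = (\<integral>\<omega>\<in>A. cexp G C (fst \<omega>) \<partial>P)"
    unfolding set_lebesgue_integral_def B(2) by (rule Bochner_Integration.integral_cong) (auto simp: indicator_def)
  finally show "(\<integral>\<omega>\<in>A. indicat_real (fst -` C \<inter> space P) \<omega> \<partial>P) = (\<integral>\<omega>\<in>A. cexp G C (fst \<omega>) \<partial>P)" .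
qed

text \<open>Forwards, integrate the product formula and use that the factor of C is measurable for
  \<open>G\<close>. Backwards, the single integral identity is applied to B \<inter> C for every B
  in \<open>G\<close>, which tests it against all of \<open>G\<close>.\<close>

lemma cond_indep_iff_indep_given:
  assumes G: "sub_sigma G" and F1: "F1 \<subseteq> sets P"
  shows "cond_indep P F1 (Finput T) (liftF T G) \<longleftrightarrow> (\<forall>A\<in>F1. indep_given A G)"
proof -
  let ?L = "sigma (space P) (liftF T G)"
  interpret L: sigma_finite_subalgebra P ?L by (rule sfs_lift[OF G])
  interpret S: sigma_finite_subalgebra \<rho> "sigma_gen G" by (rule sfs_sigma_gen[OF G])
  have iP: "integrable P (indicat_real A)" if "A \<in> sets P" for A using that by (simp add: P.emeasure_eq_measure del: space_P)
  show ?thesis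
  proof
    assume H: "cond_indep P F1 (Finput T) (liftF T G)"
    show "\<forall>A\<in>F1. indep_given A G"
      unfolding indep_given_def
    proof (intro ballI)
      fix A C assume A1: "A \<in> F1" and C: "C \<in> sets \<rho>"
      have A: "A \<in> sets P" using A1 F1 by blast
      define C' where "C' = fst -` C \<inter> space P"
      have C': "C' \<in> sets P" unfolding C'_def using measurable_sets[OF fst_meas_rho C] .
      have "C' \<in> Finput T" unfolding Finput_def C'_def using liftF_mem[of C "sets (borel_of (Intop T))"] C by simp
      then have AE1: "AE \<omega> in P. real_cond_exp P ?L (indicator (A \<inter> C')) \<omega> = real_cond_exp P ?L (indicator A) \<omega> * real_cond_exp P ?L (indicator C') \<omega>"
        using H A1 unfolding cond_indep_def by blast
      have AE2: "AE \<omega> in P. real_cond_exp P ?L (indicator C') \<omega> = cexp G C (fst \<omega>)"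
        unfolding C'_def by (rule cond_exp_lift[OF G C])
      have ci: "integrable P (\<lambda>\<omega>. cexp G C (fst \<omega>) * indicator A \<omega>)"
        using integrable_mult_indicator[OF A integrable_cexp_fst[OF G C]] by (simp add: mult.commute)
      have cm: "(\<lambda>\<omega>. cexp G C (fst \<omega>)) \<in> borel_measurable ?L"
        by (rule measurable_compose[OF fst_lift[OF G] cexp_meas(2)])
      have Am: "indicat_real A \<in> borel_measurable P" using A by simp
      have "A \<inter> fst -` C = A \<inter> C'" using sets.sets_into_space[OF A] by (auto simp: C'_def)
      then have "measure P (A \<inter> fst -` C) = (\<integral>\<omega>. indicat_real (A \<inter> C') \<omega> \<partial>P)" using A C' by (simp del: space_P)
      also have "\<dots> = (\<integral>\<omega>. real_cond_exp P ?L (indicator (A \<inter> C')) \<omega> \<partial>P)"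
        by (rule L.real_cond_exp_int(2)[symmetric]) (use A C' iP in blast)
      also have "\<dots> = (\<integral>\<omega>. cexp G C (fst \<omega>) * real_cond_exp P ?L (indicator A) \<omega> \<partial>P)"
      proof (rule integral_cong_AE)
        show "AE \<omega> in P. real_cond_exp P ?L (indicator (A \<inter> C')) \<omega> = cexp G C (fst \<omega>) * real_cond_exp P ?L (indicator A) \<omega>"
          using AE1 AE2 by eventually_elim simp
        show "(\<lambda>\<omega>. cexp G C (fst \<omega>) * real_cond_exp P ?L (indicator A) \<omega>) \<in> borel_measurable P"
          using measurable_from_subalg[OF L.subalg cm] by simp
      qed simp
      also have "\<dots> = (\<integral>\<omega>. cexp G C (fst \<omega>) * indicator A \<omega> \<partial>P)"
        by (rule L.real_cond_exp_intg(2)[OF ci cm Am])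
      finally show "measure P (A \<inter> fst -` C) = (\<integral>\<omega>. indicator A \<omega> * cexp G C (fst \<omega>) \<partial>P)" by (simp add: mult.commute)
    qed
  next
    assume H: "\<forall>A\<in>F1. indep_given A G"
    show "cond_indep P F1 (Finput T) (liftF T G)"
      unfolding cond_indep_def
    proof (intro ballI)
      fix A C' assume A1: "A \<in> F1" and "C' \<in> Finput T"
      then obtain C where C: "C \<in> sets \<rho>" and C'_def: "C' = fst -` C \<inter> space P"
        by (auto simp: Finput_def liftF_def space_P' simp del: space_P)
      have A: "A \<in> sets P" using A1 F1 by blast
      have C': "C' \<in> sets P" unfolding C'_def using measurable_sets[OF fst_meas_rho C] .
      have AE2: "AE \<omega> in P. real_cond_exp P ?L (indicator C') \<omega> = cexp G C (fst \<omega>)"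
        unfolding C'_def by (rule cond_exp_lift[OF G C])
      have ci: "integrable P (\<lambda>\<omega>. cexp G C (fst \<omega>) * indicator A \<omega>)"
        using integrable_mult_indicator[OF A integrable_cexp_fst[OF G C]] by (simp add: mult.commute)
      have cm: "(\<lambda>\<omega>. cexp G C (fst \<omega>)) \<in> borel_measurable ?L"
        by (rule measurable_compose[OF fst_lift[OF G] cexp_meas(2)])
      have Am: "indicat_real A \<in> borel_measurable P" using A by simp
      have "AE \<omega> in P. real_cond_exp P ?L (indicator (A \<inter> C')) \<omega> = cexp G C (fst \<omega>) * real_cond_exp P ?L (indicator A) \<omega>"
      proof (rule L.real_cond_exp_charact)
        show "integrable P (indicat_real (A \<inter> C'))" using A C' iP by blast
        show "integrable P (\<lambda>\<omega>. cexp G C (fst \<omega>) * real_cond_exp P ?L (indicator A) \<omega>)"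
          by (rule L.real_cond_exp_intg(1)[OF ci cm Am])
        show "(\<lambda>\<omega>. cexp G C (fst \<omega>) * real_cond_exp P ?L (indicator A) \<omega>) \<in> borel_measurable ?L"
          using cm by simp
        fix B' assume B'L: "B' \<in> sets ?L"
        then obtain B where B: "B \<in> G" "B' = fst -` B \<inter> space P" unfolding sets_lift(1)[OF G] by (auto simp: liftF_def space_P' simp del: space_P)
        have BG: "B \<in> sets (sigma_gen G)" using B(1) sets_sigma_gen[OF G] by simp
        have Br: "B \<in> sets \<rho>" using B(1) G by (auto simp: sub_sigma_def)
        have BC: "B \<inter> C \<in> sets \<rho>" using Br C by blast
        \<comment> \<open>The indicator of B is measurable for \<open>G\<close> and leaves the
          conditional expectation.\<close>
        have "AE x in \<rho>. cexp G (B \<inter> C) x = indicator B x * cexp G C x"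
        proof -
          have "AE x in \<rho>. real_cond_exp \<rho> (sigma_gen G) (\<lambda>x. indicat_real B x * indicator C x) x = indicator B x * real_cond_exp \<rho> (sigma_gen G) (indicator C) x"
          proof (rule S.real_cond_exp_mult)
            show "integrable \<rho> (\<lambda>x. indicat_real B x * indicator C x)"
              using integrable_mult_indicator[OF Br integrable_ind[OF C]] by simp
          qed (use BG C in \<open>simp_all del: sets_rho\<close>)
          moreover have "(\<lambda>x. indicat_real B x * indicator C x) = indicator (B \<inter> C)" by (auto simp: indicator_def)
          ultimately show ?thesis by (simp add: cexp_def)
        qed
        from AE_fst[OF this] have AEb: "AE \<omega> in P. cexp G (B \<inter> C) (fst \<omega>) = indicator B (fst \<omega>) * cexp G C (fst \<omega>)" .
        have "(\<integral>\<omega>\<in>B'. indicat_real (A \<inter> C') \<omega> \<partial>P) = (\<integral>\<omega>. indicator A \<omega> * indicator (B \<inter> C) (fst \<omega>) \<partial>P)"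
          unfolding set_lebesgue_integral_def B(2) C'_def by (rule Bochner_Integration.integral_cong) (auto simp: indicator_def)
        also have "\<dots> = (\<integral>\<omega>. indicator A \<omega> * cexp G (B \<inter> C) (fst \<omega>) \<partial>P)"
        proof -
          have "measure P (A \<inter> fst -` (B \<inter> C)) = (\<integral>\<omega>. indicator A \<omega> * cexp G (B \<inter> C) (fst \<omega>) \<partial>P)"
            using H A1 BC unfolding indep_given_def by blast
          then show ?thesis unfolding measure_eq_integral[OF A BC] .
        qed
        also have "\<dots> = (\<integral>\<omega>. (indicator B (fst \<omega>) * cexp G C (fst \<omega>)) * indicator A \<omega> \<partial>P)"
        proof (rule integral_cong_AE)
          show "AE \<omega> in P. indicator A \<omega> * cexp G (B \<inter> C) (fst \<omega>) = indicator B (fst \<omega>) * cexp G C (fst \<omega>) * indicator A \<omega>"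
            using AEb by eventually_elim simp
          show "(\<lambda>\<omega>. indicator A \<omega> * cexp G (B \<inter> C) (fst \<omega>)) \<in> borel_measurable P"
            by (intro borel_measurable_times Am measurable_compose[OF fst_meas_rho cexp_meas(1)])
          show "(\<lambda>\<omega>. indicator B (fst \<omega>) * cexp G C (fst \<omega>) * indicator A \<omega>) \<in> borel_measurable P"
            by (intro borel_measurable_times Am measurable_compose[OF fst_meas_rho cexp_meas(1)]
                measurable_compose[OF fst_meas_rho borel_measurable_indicator[OF Br]])
        qed
        also have "\<dots> = (\<integral>\<omega>. (indicator B (fst \<omega>) * cexp G C (fst \<omega>)) * real_cond_exp P ?L (indicator A) \<omega> \<partial>P)"
        proof (rule L.real_cond_exp_intg(2)[symmetric])
          have B'P: "B' \<in> sets P" using B'L L.subalg by (auto simp: subalgebra_def)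
          have "integrable P (\<lambda>\<omega>. indicator B' \<omega> * (cexp G C (fst \<omega>) * indicator A \<omega>))"
            using integrable_mult_indicator[OF B'P ci] by simp
          then show "integrable P (\<lambda>\<omega>. (indicator B (fst \<omega>) * cexp G C (fst \<omega>)) * indicator A \<omega>)"
            by (rule Bochner_Integration.integrable_cong[THEN iffD1, rotated 2]) (auto simp: B(2) indicator_def)
          show "(\<lambda>\<omega>. indicator B (fst \<omega>) * cexp G C (fst \<omega>)) \<in> borel_measurable ?L"
            by (intro borel_measurable_times cm measurable_compose[OF fst_lift[OF G] borel_measurable_indicator[OF BG]])
        qed (rule Am)
        also have "\<dots> = (\<integral>\<omega>\<in>B'. cexp G C (fst \<omega>) * real_cond_exp P ?L (indicator A) \<omega> \<partial>P)"
          unfolding set_lebesgue_integral_def B(2) by (rule Bochner_Integration.integral_cong) (auto simp: indicator_def)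
        finally show "(\<integral>\<omega>\<in>B'. indicat_real (A \<inter> C') \<omega> \<partial>P) = (\<integral>\<omega>\<in>B'. cexp G C (fst \<omega>) * real_cond_exp P ?L (indicator A) \<omega> \<partial>P)" .
      qed
      then show "AE \<omega> in P. real_cond_exp P ?L (indicator (A \<inter> C')) \<omega> = real_cond_exp P ?L (indicator A) \<omega> * real_cond_exp P ?L (indicator C') \<omega>"
        using AE2 by eventually_elim simp
    qed
  qed
qed

section \<open>Membership in \<R>(\<rho>) and in its right-limit version through events of
  \<tau>\<close>

definition tau_event :: "real \<Rightarrow> real set \<Rightarrow> opnt set" where
  "tau_event t U = {\<omega> \<in> space P. min (snd \<omega>) t \<in> U}"

lemma tau_event_sets: "U \<in> sets borel \<Longrightarrow> tau_event t U \<in> sets P"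
proof -
  assume "U \<in> sets borel"
  moreover have "(\<lambda>\<omega>. min (snd \<omega>) t) \<in> borel_measurable P" by measurable
  ultimately have "(\<lambda>\<omega>. min (snd \<omega>) t) -` U \<inter> space P \<in> sets P" by (rule measurable_sets[rotated])
  moreover have "(\<lambda>\<omega>. min (snd \<omega>) t) -` U \<inter> space P = tau_event t U" by (auto simp: tau_event_def)
  ultimately show ?thesis by simp
qed

lemma Ftau_tau_event: "Ftau T t = tau_event t ` sets borel"
  unfolding Ftau_def tau_event_def space_P' by auto

lemma Ftau_sets: "Ftau T t \<subseteq> sets P"
  unfolding Ftau_tau_event using tau_event_sets by blast

lemma Ftau_plus_sets: "t < T \<Longrightarrow> Ftau_plus T t \<subseteq> sets P"
  unfolding Ftau_plus_def using Ftau_sets[of T] by force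

lemma indep_given_trivial: "sub_sigma G \<Longrightarrow> indep_given {} G" "sub_sigma G \<Longrightarrow> indep_given (space P) G"
proof -
  show "indep_given {} G" by (simp add: indep_given_def)
  assume G: "sub_sigma G"
  show "indep_given (space P) G"
    unfolding indep_given_def
  proof
    fix C assume C: "C \<in> sets \<rho>"
    have "(\<integral>\<omega>. indicator (space P) \<omega> * cexp G C (fst \<omega>) \<partial>P) = (\<integral>\<omega>. cexp G C (fst \<omega>) \<partial>P)"
      by (rule Bochner_Integration.integral_cong) (auto simp del: space_P)
    also have "\<dots> = (\<integral>x. cexp G C x \<partial>\<rho>)" by (rule integral_fst[OF cexp_meas(1)])
    also have "\<dots> = (\<integral>x. indicat_real C x \<partial>\<rho>)"
      unfolding cexp_def by (rule sigma_finite_subalgebra.real_cond_exp_int(2)[OF sfs_sigma_gen[OF G] integrable_ind[OF C]])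
    also have "\<dots> = (\<integral>\<omega>. indicator C (fst \<omega>) \<partial>P)" using C by (intro integral_fst[symmetric]) simp
    also have "\<dots> = (\<integral>\<omega>. indicator (space P) \<omega> * indicator C (fst \<omega>) \<partial>P)"
      by (rule Bochner_Integration.integral_cong) (auto simp del: space_P)
    finally show "measure P (space P \<inter> fst -` C) = (\<integral>\<omega>. indicator (space P) \<omega> * cexp G C (fst \<omega>) \<partial>P)"
      using measure_eq_integral[OF sets.top C] by simp
  qed
qed

lemma Rset_iff: "P \<in> Rset T \<rho> \<longleftrightarrow> (\<forall>t\<in>{0..<T}. \<forall>U\<in>sets borel. indep_given (tau_event t U) (FBWmu T t))"
proof -
  have "has_marginal T \<rho> P" using has_marginal_iff_coupling[OF T rho] coupling_axioms by simp
  then show ?thesis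
    unfolding Rset_def using cond_indep_iff_indep_given[OF sub_sigma_FBWmu Ftau_sets] by (auto simp: Ftau_tau_event)
qed

lemma Rplus_iff: "P \<in> Rplus T \<rho> \<longleftrightarrow> (\<forall>t\<in>{0..<T}. \<forall>A\<in>Ftau_plus T t. indep_given A (FBWmu_plus T t))"
proof -
  have "has_marginal T \<rho> P" using has_marginal_iff_coupling[OF T rho] coupling_axioms by simp
  then show ?thesis
    unfolding Rplus_def using cond_indep_iff_indep_given[OF sub_sigma_FBWmu_plus Ftau_plus_sets] by auto
qed

text \<open>The half-lines {\<tau> \<and> t \<le> s} generate the information of \<tau> up to t and
  are trivial for s \<ge> t and s < 0. The strict gap s < t in the hypothesis is what later
  arguments can exploit.\<close>

lemma Rset_of_half_lines:
  assumes "\<And>s t. 0 \<le> s \<Longrightarrow> s < t \<Longrightarrow> t < T \<Longrightarrow> indep_given {\<omega> \<in> space P. snd \<omega> \<le> s} (FBWmu T t)"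
  shows "P \<in> Rset T \<rho>"
  unfolding Rset_iff tau_event_def
proof (intro ballI indep_given_half_lines(1))
  fix t assume t: "t \<in> {0..<T}"
  show G: "sub_sigma (FBWmu T t)" using sub_sigma_FBWmu t by simp
  show "(\<lambda>\<omega>. min (snd \<omega>) t) \<in> borel_measurable P" by measurable
  show "indep_given {\<omega> \<in> space P. min (snd \<omega>) t \<le> s} (FBWmu T t)" for s
  proof -
    consider "t \<le> s" | "s < 0" | "0 \<le> s" "s < t" by linarith
    then show ?thesis
    proof cases
      case 1
      then have e: "{\<omega> \<in> space P. min (snd \<omega>) t \<le> s} = space P" by auto
      show ?thesis unfolding e by (rule indep_given_trivial(2)[OF G])
    next
      case 2
      then have e: "{\<omega> \<in> space P. min (snd \<omega>) t \<le> s} = {}" using t by auto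
      show ?thesis unfolding e by (rule indep_given_trivial(1)[OF G])
    next
      case 3
      then have e: "{\<omega> \<in> space P. min (snd \<omega>) t \<le> s} = {\<omega> \<in> space P. snd \<omega> \<le> s}" by auto
      show ?thesis unfolding e by (rule assms) (use 3 t in auto)
    qed
  qed
qed

text \<open>The event {\<tau> \<le> s} is known immediately after s, and the right limit of the
  input filtration at s is contained in its value at any t > s.\<close>

lemma Rplus_imp_Rset:
  assumes "P \<in> Rplus T \<rho>" shows "P \<in> Rset T \<rho>"
proof (rule Rset_of_half_lines)
  fix s t assume st: "0 \<le> s" "s < t" "t < T"
  have "{\<omega> \<in> space P. snd \<omega> \<le> s} \<in> Ftau T s'" if "s < s'" for s'
  proof -
    have e: "{\<omega> \<in> space P. snd \<omega> \<le> s} = tau_event s' {..s}" using that by (auto simp: tau_event_def)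
    show ?thesis unfolding Ftau_tau_event e by (rule imageI) simp
  qed
  then have "{\<omega> \<in> space P. snd \<omega> \<le> s} \<in> Ftau_plus T s" by (simp add: Ftau_plus_def)
  then have "indep_given {\<omega> \<in> space P. snd \<omega> \<le> s} (FBWmu_plus T s)" using assms st unfolding Rplus_iff by auto
  moreover have "{\<omega> \<in> space P. snd \<omega> \<le> s} \<in> sets P" by measurable
  ultimately show "indep_given {\<omega> \<in> space P. snd \<omega> \<le> s} (FBWmu T t)"
    using indep_given_mono[OF _ sub_sigma_FBWmu_plus[of s] sub_sigma_FBWmu[of t]] FBWmu_plus_subset[of s t T] st by auto
qed

text \<open>An event known immediately after t is known at every later time, so its density has a
  version measurable for each of a decreasing sequence of sigma-algebras with intersection
  \<open>FBWmu_plus T t\<close>.\<close>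

lemma Rset_imp_Rplus:
  assumes "P \<in> Rset T \<rho>" shows "P \<in> Rplus T \<rho>"
  unfolding Rplus_iff
proof (intro ballI)
  fix t A assume t: "t \<in> {0..<T}" and A: "A \<in> Ftau_plus T t"
  \<comment> \<open>The 2 keeps every term strictly below T, also for n = 0: membership in
    \<open>Rset\<close> speaks only of times before T.\<close>
  define s where "s n = t + (T - t) / (real n + 2)" for n :: nat
  have s: "t < s n" "s n < T" "s (Suc n) \<le> s n" for n
  proof -
    have p: "0 < T - t" using t by simp
    then show "t < s n" by (simp add: s_def)
    have "(T - t) / (real n + 2) < (T - t) / 1" using p by (intro divide_strict_left_mono) auto
    then show "s n < T" by (simp add: s_def)
    show "s (Suc n) \<le> s n" unfolding s_def using p by (intro add_left_mono divide_left_mono) auto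
  qed
  have s0: "0 \<le> s n" for n using s(1)[of n] t by simp
  have H: "FBWmu_plus T t = (\<Inter>n. FBWmu T (s n))"
  proof
    show "FBWmu_plus T t \<subseteq> (\<Inter>n. FBWmu T (s n))" by (intro INT_greatest FBWmu_plus_subset less_imp_le s)
    show "(\<Inter>n. FBWmu T (s n)) \<subseteq> FBWmu_plus T t" unfolding FBWmu_plus_def
    proof (rule INT_greatest)
      fix r assume r: "r \<in> {t<..T}"
      obtain n :: nat where n: "(T - t) / (r - t) < real n" using reals_Archimedean2 by blast
      then have "(T - t) < (r - t) * (real n + 2)" using r by (simp add: field_simps)
      then have "s n \<le> r" unfolding s_def by (simp add: field_simps)
      then have "FBWmu T (s n) \<subseteq> FBWmu T r" using FBWmu_mono[OF s0] T by simp
      then show "(\<Inter>n. FBWmu T (s n)) \<subseteq> FBWmu T r" by blast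
    qed
  qed
  show "indep_given A (FBWmu_plus T t)"
  proof (rule indep_given_INT[OF _ sub_sigma_FBWmu[OF s0] FBWmu_mono[OF s0 s(3)] sub_sigma_FBWmu_plus H])
    show "A \<in> sets P" using Ftau_plus_sets A t by auto
    fix n
    have "A \<in> Ftau T (s n)" using A s[of n] by (auto simp: Ftau_plus_def)
    then show "indep_given A (FBWmu T (s n))" using assms s(2)[of n] s0[of n] unfolding Rset_iff Ftau_tau_event by auto
  qed (use t T in auto)
qed

text \<open>Up to a null set {\<tau> \<le> s} is an event A of the input known at time s. Its
  density is then the indicator of A, which is already adapted.\<close>

lemma stopping_completed_imp_Rset:
  assumes "stopping_completed T P" shows "P \<in> Rset T \<rho>"
proof (rule Rset_of_half_lines)
  fix s t assume st: "0 \<le> s" "s < t" "t < T"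
  have ms: "{\<omega> \<in> space P. snd \<omega> \<le> s} \<in> sets P" by measurable
  obtain A' N where A': "A' \<in> liftF T (FBWmu T s)" and N: "N \<in> null_sets P"
    "({\<omega> \<in> space P. snd \<omega> \<le> s} - A') \<union> (A' - {\<omega> \<in> space P. snd \<omega> \<le> s}) \<subseteq> N"
    using assms st unfolding stopping_completed_def by force
  obtain A where A: "A \<in> FBWmu T s" "A' = fst -` A \<inter> space P" using A' by (auto simp: liftF_def space_P' simp del: space_P)
  have At: "A \<in> FBWmu T t" using FBWmu_mono[of s t T] A(1) st T by auto
  have Ar: "A \<in> sets \<rho>" using FBWmu_borel[of s T] A(1) st T by auto
  have ae: "AE \<omega> in P. indicat_real {\<omega> \<in> space P. snd \<omega> \<le> s} \<omega> = indicator A (fst \<omega>)"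
  proof (rule AE_I'[OF N(1)])
    show "{\<omega> \<in> space P. indicat_real {\<omega> \<in> space P. snd \<omega> \<le> s} \<omega> \<noteq> indicator A (fst \<omega>)} \<subseteq> N"
      using N(2) unfolding A(2) by (auto simp: indicator_def split: if_splits)
  qed
  have Am: "indicat_real A \<in> borel_measurable \<rho>" using Ar by simp
  have i: "(\<integral>\<omega>. indicator {\<omega> \<in> space P. snd \<omega> \<le> s} \<omega> * g (fst \<omega>) \<partial>P) = (\<integral>x. indicator A x * g x \<partial>\<rho>)"
    if g: "integrable \<rho> g" for g :: "inpt \<Rightarrow> real"
  proof -
    have gm: "g \<in> borel_measurable \<rho>" using g by simp
    have "(\<integral>\<omega>. indicator {\<omega> \<in> space P. snd \<omega> \<le> s} \<omega> * g (fst \<omega>) \<partial>P) = (\<integral>\<omega>. indicator A (fst \<omega>) * g (fst \<omega>) \<partial>P)"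
    proof (rule integral_cong_AE)
      show "AE \<omega> in P. indicator {\<omega> \<in> space P. snd \<omega> \<le> s} \<omega> * g (fst \<omega>) = indicator A (fst \<omega>) * g (fst \<omega>)"
        using ae by eventually_elim simp
    qed (intro borel_measurable_times borel_measurable_indicator ms measurable_compose[OF fst_meas_rho gm]
          measurable_compose[OF fst_meas_rho Am])+
    also have "\<dots> = (\<integral>x. indicator A x * g x \<partial>\<rho>)" by (rule integral_fst) (intro borel_measurable_times Am gm)
    finally show ?thesis .
  qed
  show "indep_given {\<omega> \<in> space P. snd \<omega> \<le> s} (FBWmu T t)"
  proof (subst indep_given_iff[OF ms sub_sigma_FBWmu Am _ i])
    show "0 \<le> indicat_real A x \<and> indicat_real A x \<le> 1" for x by (simp add: indicator_def)
    have "indicat_real A \<in> borel_measurable (sigma_gen (FBWmu T t))" using At by (intro borel_measurable_indicator) simp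
    then show "\<exists>z\<in>borel_measurable (sigma_gen (FBWmu T t)). AE x in \<rho>. indicat_real A x = z x" by (intro bexI[of _ "indicat_real A"]) auto
  qed (use st in auto)
qed

end

lemma Rset_coupling: "0 < T \<Longrightarrow> \<rho> \<in> Pspace (Intop T) \<Longrightarrow> P \<in> Rset T \<rho> \<Longrightarrow> input_coupling T \<rho> P"
  by (simp add: Rset_def has_marginal_iff_coupling input_coupling_def)

lemma Rplus_coupling: "0 < T \<Longrightarrow> \<rho> \<in> Pspace (Intop T) \<Longrightarrow> P \<in> Rplus T \<rho> \<Longrightarrow> input_coupling T \<rho> P"
  by (simp add: Rplus_def has_marginal_iff_coupling input_coupling_def)

lemma Rplus_eq_Rset: "0 < T \<Longrightarrow> \<rho> \<in> Pspace (Intop T) \<Longrightarrow> Rplus T \<rho> = Rset T \<rho>"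
  using Rset_coupling Rplus_coupling input_coupling.Rplus_imp_Rset input_coupling.Rset_imp_Rplus by blast

lemma R0_subset_Rset:
  assumes "0 < T" "\<rho> \<in> Pspace (Intop T)" shows "R0 T \<rho> \<subseteq> Rset T \<rho>"
proof
  fix P assume PR: "P \<in> R0 T \<rho>"
  then interpret input_coupling T \<rho> P
    using has_marginal_iff_coupling[OF assms] by (simp add: R0_def input_coupling_def)
  show "P \<in> Rset T \<rho>" using PR by (intro stopping_completed_imp_Rset) (simp add: R0_def)
qed

subsection \<open>Convexity\<close>

lemma emeasure_mix:
  assumes PQ: "sets Q = sets P" and A: "A \<in> sets P"
  shows "emeasure (mix p P Q) A = ennreal p * emeasure P A + ennreal (1 - p) * emeasure Q A"
proof (rule emeasure_measure_of[OF mix_def sets.space_closed])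
  show "A \<in> sets (mix p P Q)" using A by (simp add: mix_def)
  have s: "sets (mix p P Q) = sets P" by (simp add: mix_def)
  show "positive (sets (mix p P Q)) (\<lambda>A. ennreal p * emeasure P A + ennreal (1 - p) * emeasure Q A)"
    by (simp add: positive_def)
  show "countably_additive (sets (mix p P Q)) (\<lambda>A. ennreal p * emeasure P A + ennreal (1 - p) * emeasure Q A)"
    unfolding s
  proof (rule countably_additiveI)
    fix A :: "nat \<Rightarrow> _" assume A: "range A \<subseteq> sets P" "disjoint_family A"
    have "(\<Sum>i. ennreal p * emeasure P (A i) + ennreal (1 - p) * emeasure Q (A i))
      = (\<Sum>i. ennreal p * emeasure P (A i)) + (\<Sum>i. ennreal (1 - p) * emeasure Q (A i))"
      by (rule suminf_add[symmetric]) auto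
    also have "\<dots> = ennreal p * emeasure P (\<Union>i. A i) + ennreal (1 - p) * emeasure Q (\<Union>i. A i)"
      using suminf_emeasure[OF A] suminf_emeasure[of A Q] A PQ by simp
    finally show "(\<Sum>i. ennreal p * emeasure P (A i) + ennreal (1 - p) * emeasure Q (A i)) =
      ennreal p * emeasure P (\<Union> (range A)) + ennreal (1 - p) * emeasure Q (\<Union> (range A))" .
  qed
qed

lemma sets_mix [simp]: "sets (mix p P Q) = sets P" and space_mix [simp]: "space (mix p P Q) = space P"
  by (simp_all add: mix_def space_measure_of_conv)

lemma measure_mix:
  assumes "prob_space P" "prob_space Q" "sets Q = sets P" "A \<in> sets P" "p \<in> {0..1}"
  shows "measure (mix p P Q) A = p * measure P A + (1 - p) * measure Q A"
proof -
  interpret P: prob_space P by fact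
  interpret Q: prob_space Q by fact
  have "emeasure (mix p P Q) A = ennreal (p * measure P A + (1 - p) * measure Q A)"
    unfolding emeasure_mix[OF assms(3,4)] P.emeasure_eq_measure Q.emeasure_eq_measure
    using assms(5) by (simp add: ennreal_mult'' ennreal_plus mult.commute)
  then have "measure (mix p P Q) A = enn2real (ennreal (p * measure P A + (1 - p) * measure Q A))"
    by (simp only: measure_def)
  also have "\<dots> = p * measure P A + (1 - p) * measure Q A"
    by (rule enn2real_ennreal) (use assms(5) in simp)
  finally show ?thesis .
qed

text \<open>Since the marginal is fixed, the density of an event under a mixture is the mixture of
  the densities, and adapted versions combine linearly. The product formula for conditional
  probabilities is not linear in the measure; its reformulation by densities is.\<close>

lemma convex_Rset:
  assumes T: "0 < T" and rho: "\<rho> \<in> Pspace (Intop T)"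
  shows "convex_meas (Rset T \<rho>)"
  unfolding convex_meas_def
proof (intro ballI)
  fix P Q p assume PR: "P \<in> Rset T \<rho>" and QR: "Q \<in> Rset T \<rho>" and p: "p \<in> {0..1::real}"
  interpret P: input_coupling T \<rho> P by (rule Rset_coupling[OF T rho PR])
  interpret Q: input_coupling T \<rho> Q by (rule Rset_coupling[OF T rho QR])
  have QP: "sets Q = sets P" using P.sets_P Q.sets_P by simp
  have m: "measure (mix p P Q) A = p * measure P A + (1 - p) * measure Q A" if "A \<in> sets P" for A
    by (rule measure_mix[OF P.P.prob_space_axioms Q.P.prob_space_axioms QP that p])
  have em1: "emeasure (mix p P Q) (space P) = 1"
  proof -
    have "emeasure Q (space P) = 1" using Q.P.emeasure_space_1 by simp
    moreover have "emeasure P (space P) = 1" by (rule P.P.emeasure_space_1)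
    ultimately have "emeasure (mix p P Q) (space P) = ennreal p + ennreal (1 - p)"
      using emeasure_mix[OF QP sets.top] by simp
    also have "\<dots> = 1" using p by (simp flip: ennreal_plus)
    finally show ?thesis .
  qed
  have fm: "fst \<in> measurable (mix p P Q) (borel_of (Intop T))"
    using P.fst_meas measurable_cong_sets[OF sets_mix[of p P Q] refl] by blast
  have "distr (mix p P Q) (borel_of (Intop T)) fst = \<rho>"
  proof (rule measure_eqI)
    fix C assume "C \<in> sets (distr (mix p P Q) (borel_of (Intop T)) fst)"
    then have C: "C \<in> sets (borel_of (Intop T))" by simp
    have C': "fst -` C \<inter> space P \<in> sets P" using measurable_sets[OF P.fst_meas C] .
    have e1: "emeasure P (fst -` C \<inter> space P) = emeasure \<rho> C" using emeasure_distr[OF P.fst_meas C] by (simp add: P.marg)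
    have e2: "emeasure Q (fst -` C \<inter> space P) = emeasure \<rho> C" using emeasure_distr[OF Q.fst_meas C] by (simp add: Q.marg)
    have "emeasure (distr (mix p P Q) (borel_of (Intop T)) fst) C = emeasure (mix p P Q) (fst -` C \<inter> space P)"
      using emeasure_distr[OF fm C] by simp
    also have "\<dots> = ennreal p * emeasure \<rho> C + ennreal (1 - p) * emeasure \<rho> C"
      unfolding emeasure_mix[OF QP C'] e1 e2 ..
    also have "\<dots> = (ennreal p + ennreal (1 - p)) * emeasure \<rho> C" by (simp add: distrib_right)
    also have "ennreal p + ennreal (1 - p) = 1" using p by (simp flip: ennreal_plus)
    finally show "emeasure (distr (mix p P Q) (borel_of (Intop T)) fst) C = emeasure \<rho> C" by simp
  qed (use P.sets_rho in simp)
  moreover have "mix p P Q \<in> Pspace (prod_topology (Intop T) (Itop T))"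
    unfolding Pspace_iff using em1 P.sets_P by (auto intro!: prob_spaceI simp del: P.space_P)
  ultimately interpret R: input_coupling T \<rho> "mix p P Q"
    using T rho by (simp add: input_coupling_def coupling_def)
  have sp: "space (mix p P Q) = space P" "space Q = space P" by simp_all
  show "mix p P Q \<in> Rset T \<rho>"
    unfolding R.Rset_iff
  proof (intro ballI)
    fix t :: real and U :: "real set" assume t: "t \<in> {0..<T}" and U: "U \<in> sets borel"
    define A where "A = P.tau_event t U"
    have Aeq: "R.tau_event t U = A" "Q.tau_event t U = A" unfolding A_def R.tau_event_def Q.tau_event_def P.tau_event_def by simp_all
    have AP: "A \<in> sets P" using P.tau_event_sets[OF U] by (simp add: A_def)
    have AQ: "A \<in> sets Q" and AR: "A \<in> sets (mix p P Q)" using AP QP by simp_all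
    note G = P.sub_sigma_FBWmu[of t]
    obtain k1 where k1: "k1 \<in> borel_measurable \<rho>" "\<And>x. 0 \<le> k1 x \<and> k1 x \<le> (1::real)"
      "\<And>g::inpt \<Rightarrow> real. integrable \<rho> g \<Longrightarrow> (\<integral>\<omega>. indicator A \<omega> * g (fst \<omega>) \<partial>P) = (\<integral>x. k1 x * g x \<partial>\<rho>)"
      using P.exists_density[OF AP] by blast
    obtain k2 where k2: "k2 \<in> borel_measurable \<rho>" "\<And>x. 0 \<le> k2 x \<and> k2 x \<le> (1::real)"
      "\<And>g::inpt \<Rightarrow> real. integrable \<rho> g \<Longrightarrow> (\<integral>\<omega>. indicator A \<omega> * g (fst \<omega>) \<partial>Q) = (\<integral>x. k2 x * g x \<partial>\<rho>)"
      using Q.exists_density[OF AQ] by blast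
    obtain k where k: "k \<in> borel_measurable \<rho>" "\<And>x. 0 \<le> k x \<and> k x \<le> (1::real)"
      "\<And>g::inpt \<Rightarrow> real. integrable \<rho> g \<Longrightarrow> (\<integral>\<omega>. indicator A \<omega> * g (fst \<omega>) \<partial>(mix p P Q)) = (\<integral>x. k x * g x \<partial>\<rho>)"
      using R.exists_density[OF AR] by blast
    have i01: "integrable \<rho> f" if "f \<in> borel_measurable \<rho>" "\<And>x. 0 \<le> f x \<and> f x \<le> (1::real)" for f
      by (rule P.rho.integrable_const_bound[where B=1]) (use that in auto)
    have ki: "integrable \<rho> k" "integrable \<rho> k1" "integrable \<rho> k2" using i01 k k1 k2 by blast+
    have "AE x in \<rho>. k x = p * k1 x + (1 - p) * k2 x"
    proof (rule density_unique_real)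
      fix C assume C: "C \<in> sets \<rho>"
      have C1: "A \<inter> fst -` C \<in> sets P"
      proof -
        have "A \<inter> fst -` C = A \<inter> (fst -` C \<inter> space P)" using sets.sets_into_space[OF AP] by blast
        then show ?thesis using AP measurable_sets[OF P.fst_meas_rho C] by auto
      qed
      note ind = P.integrable_ind[OF C]
      have "(\<integral>x. k x * indicator C x \<partial>\<rho>) = measure (mix p P Q) (A \<inter> fst -` C)"
        using R.measure_eq_integral[OF AR C] k(3)[OF ind] by simp
      also have "\<dots> = p * (\<integral>x. k1 x * indicator C x \<partial>\<rho>) + (1 - p) * (\<integral>x. k2 x * indicator C x \<partial>\<rho>)"
        unfolding m[OF C1] using P.measure_eq_integral[OF AP C] Q.measure_eq_integral[OF AQ C] k1(3)[OF ind] k2(3)[OF ind] by simp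
      also have "\<dots> = (\<integral>x. p * (k1 x * indicator C x) + (1 - p) * (k2 x * indicator C x) \<partial>\<rho>)"
        using integrable_mult_indicator[OF C ki(2)] integrable_mult_indicator[OF C ki(3)] by (simp add: mult.commute)
      finally show "(\<integral>x\<in>C. k x \<partial>\<rho>) = (\<integral>x\<in>C. p * k1 x + (1 - p) * k2 x \<partial>\<rho>)"
        unfolding set_lebesgue_integral_def by (simp add: algebra_simps)
    qed (use ki in auto)
    moreover obtain z1 where z1: "z1 \<in> borel_measurable (P.sigma_gen (FBWmu T t))" "AE x in \<rho>. k1 x = z1 x"
      using P.indep_given_iff[OF AP G k1] PR t U unfolding P.Rset_iff A_def by auto
    moreover obtain z2 where z2: "z2 \<in> borel_measurable (P.sigma_gen (FBWmu T t))" "AE x in \<rho>. k2 x = z2 x"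
    proof -
      have "Q.indep_given A (FBWmu T t)" using QR t U unfolding Q.Rset_iff Aeq(2)[symmetric] by blast
      then show ?thesis using Q.indep_given_iff[OF AQ G k2] t that by auto
    qed
    ultimately have "AE x in \<rho>. k x = p * z1 x + (1 - p) * z2 x" by (elim AE_mp) (auto intro!: AE_I2)
    moreover have "(\<lambda>x. p * z1 x + (1 - p) * z2 x) \<in> borel_measurable (P.sigma_gen (FBWmu T t))" using z1(1) z2(1) by simp
    ultimately show "R.indep_given (R.tau_event t U) (FBWmu T t)"
      unfolding Aeq using R.indep_given_iff[OF AR G k] t by auto
  qed
qed

subsection \<open>Closedness\<close>

text \<open>1_C minus its conditional expectation lies in [-1, 1] almost surely; rescaled to [0, 1]
  it falls under the density of continuous functions.\<close>

lemma (in coupling) exists_Cb_approximation: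
  assumes coz: "cozero_space X" and G: "sub_sigma G" and C: "C \<in> sets \<rho>" and e: "0 < (e::real)"
  shows "\<exists>g\<in>Cb X. (\<integral>x. \<bar>g x - (indicator C x - cexp G C x)\<bar> \<partial>\<rho>) < e"
proof -
  \<comment> \<open>The truncation makes the bounds hold everywhere. Undoing the scaling doubles the
    error, so the tolerance below is e/2.\<close>
  define k where "k x = (min 1 (max (-1) (indicator C x - cexp G C x)) + 1) / 2" for x
  have Cm: "indicat_real C \<in> borel_measurable \<rho>" using C by simp
  have km: "k \<in> borel_measurable \<rho>" unfolding k_def using Cm by simp
  have "cont_generated X \<rho>" by (rule cozero_space_cont_generated[OF coz sets_rho])
  moreover have "subalgebra \<rho> \<rho>" by (simp add: subalgebra_def)
  moreover have "0 \<le> k x \<and> k x \<le> 1" for x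
  proof -
    have "0 \<le> (min 1 (max (-1) y) + 1) / 2 \<and> (min 1 (max (-1) y) + 1) / 2 \<le> 1" for y :: real
      by (auto simp: min_def max_def)
    then show ?thesis unfolding k_def .
  qed
  moreover have "0 < e/2" using e by simp
  ultimately have "\<exists>f\<in>cont01 X \<rho>. (\<integral>x. \<bar>f x - k x\<bar> \<partial>\<rho>) < e/2" by (intro cont01_dense[OF rho _ _ km]) auto
  then obtain f where f: "f \<in> cont01 X \<rho>" "(\<integral>x. \<bar>f x - k x\<bar> \<partial>\<rho>) < e/2" by blast
  have "(\<lambda>x. 2 * f x - 1) \<in> Cb X"
  proof (rule CbI[where B=1])
    show "continuous_map X euclideanreal (\<lambda>x. 2 * f x - 1)"
      using f(1) by (intro continuous_map_diff continuous_map_real_mult) (auto simp: cont01_def)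
  qed (use f(1) in \<open>auto simp: cont01_def abs_le_iff\<close>)
  moreover have "(\<integral>x. \<bar>(2 * f x - 1) - (indicator C x - cexp G C x)\<bar> \<partial>\<rho>) < e"
  proof -
    have fm: "f \<in> borel_measurable \<rho>" using f(1) by (simp add: cont01_def)
    have "(\<integral>x. \<bar>(2 * f x - 1) - (indicator C x - cexp G C x)\<bar> \<partial>\<rho>) = (\<integral>x. 2 * \<bar>f x - k x\<bar> \<partial>\<rho>)"
    proof (rule integral_cong_AE)
      show "AE x in \<rho>. \<bar>(2 * f x - 1) - (indicator C x - cexp G C x)\<bar> = 2 * \<bar>f x - k x\<bar>"
        using cexp_bounds[OF G C]
      proof eventually_elim
        case (elim x)
        then have "-1 \<le> indicator C x - cexp G C x" "indicator C x - cexp G C x \<le> 1" by (auto simp: indicator_def)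
        then have "k x = (indicator C x - cexp G C x + 1) / 2" by (simp add: k_def)
        then show ?case by (simp add: abs_if field_simps)
      qed
    qed (use fm km Cm in auto)
    also have "\<dots> = 2 * (\<integral>x. \<bar>f x - k x\<bar> \<partial>\<rho>)" by simp
    finally show ?thesis using f(2) by simp
  qed
  ultimately show ?thesis by (intro bexI[of _ "\<lambda>x. 2 * f x - 1"])
qed

text \<open>Conditional independence is expressed by vanishing integrals of h(\<tau> \<and> t) (1_C
  - E[1_C | F_t]). The first factor is continuous, and the second depends on the coupling neither as
  a function nor in law, so one continuous approximation of it in L1(\<rho>) is good for all
  couplings simultaneously.\<close>

lemma closedin_Rset:
  assumes T: "0 < T" and rho: "\<rho> \<in> Pspace (Intop T)"
  shows "closedin (weak_top (Omtop T)) (Rset T \<rho>)"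
proof -
  let ?X = "Intop T" and ?O = "prod_topology (Intop T) (Itop T)"
  define d where "d t C x = indicator C x - coupling.cexp ?X \<rho> (FBWmu T t) C x" for t C x
  have fstC: "(\<lambda>\<omega>. g (fst \<omega>)) \<in> Cb ?O" if g: "g \<in> Cb ?X" for g
  proof -
    have c: "continuous_map ?X euclideanreal g" using g by (simp add: Cb_def)
    obtain B where "\<And>x. x \<in> topspace ?X \<Longrightarrow> \<bar>g x\<bar> \<le> B" using Cb_obtain_bound[OF g] by blast
    then show ?thesis
      using continuous_map_compose[OF continuous_map_fst c] by (intro CbI[where B=B]) (auto simp: o_def)
  qed
  have sndC: "(\<lambda>\<omega>. h (min (snd \<omega>) t) * g (fst \<omega>)) \<in> Cb ?O"
    if g: "g \<in> Cb ?X" and h: "continuous_on UNIV h" "\<And>y. \<bar>h y\<bar> \<le> 1" for g h and t :: real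
  proof -
    obtain B where B: "0 < B" "\<And>x. x \<in> topspace ?X \<Longrightarrow> \<bar>g x\<bar> \<le> B" using Cb_obtain_bound[OF g] by blast
    have hc: "continuous_map euclideanreal euclideanreal (\<lambda>y. h (min y t))"
    proof -
      have "continuous_on UNIV (\<lambda>y :: real. min y t)" by (intro continuous_intros)
      from continuous_on_compose2[OF h(1) this] show ?thesis by simp
    qed
    show ?thesis
    proof (rule CbI[where B="1 * B"])
      show "continuous_map ?O euclideanreal (\<lambda>\<omega>. h (min (snd \<omega>) t) * g (fst \<omega>))"
        using continuous_map_compose[OF continuous_map_snd_Itop hc] fstC[OF g]
        by (intro continuous_map_real_mult) (auto simp: o_def Cb_def)
      fix \<omega> assume "\<omega> \<in> topspace ?O"
      then have "\<bar>g (fst \<omega>)\<bar> \<le> B" using B(2) by auto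
      then show "\<bar>h (min (snd \<omega>) t) * g (fst \<omega>)\<bar> \<le> 1 * B"
        unfolding abs_mult using h(2) by (intro mult_mono) auto
    qed
  qed
  \<comment> \<open>A constraint of the form "the integral of F lies in a closed set" passes to the
    closure, as integration of a \<open>Cb\<close> function is weakly continuous.\<close>
  have closure_le: "P \<in> Pspace ?O \<and> (\<integral>\<omega>. F \<omega> \<partial>P) \<in> S"
    if P: "P \<in> weak_top ?O closure_of Rset T \<rho>" and F: "F \<in> Cb ?O" and S: "closed S"
      and le: "\<And>Q. Q \<in> Rset T \<rho> \<Longrightarrow> (\<integral>\<omega>. F \<omega> \<partial>Q) \<in> S" for P F S
  proof -
    have "closedin (weak_top ?O) {P \<in> topspace (weak_top ?O). (\<integral>\<omega>. F \<omega> \<partial>P) \<in> S}"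
      using S by (intro closedin_continuous_map_preimage[OF continuous_map_weak_integral[OF F]]) simp
    moreover have "Rset T \<rho> \<subseteq> {P \<in> topspace (weak_top ?O). (\<integral>\<omega>. F \<omega> \<partial>P) \<in> S}"
    proof
      fix Q assume Q: "Q \<in> Rset T \<rho>"
      interpret Q: input_coupling T \<rho> Q by (rule Rset_coupling[OF T rho Q])
      show "Q \<in> {P \<in> topspace (weak_top ?O). (\<integral>\<omega>. F \<omega> \<partial>P) \<in> S}" using Q.P le[OF Q] by simp
    qed
    ultimately have "weak_top ?O closure_of Rset T \<rho> \<subseteq> {P \<in> topspace (weak_top ?O). (\<integral>\<omega>. F \<omega> \<partial>P) \<in> S}"
      by (rule closure_of_minimal[rotated])
    then show ?thesis using P by auto
  qed
  have "weak_top ?O closure_of Rset T \<rho> \<subseteq> Rset T \<rho>"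
  proof
    fix P assume P: "P \<in> weak_top ?O closure_of Rset T \<rho>"
    have PP: "P \<in> Pspace ?O" using P closure_of_subset_topspace[of "weak_top ?O"] by auto
    interpret PP: prob_space P using PP by (simp add: Pspace_iff)
    have fm: "fst \<in> measurable P (borel_of ?X)"
      using continuous_map_measurable_borel_of[OF continuous_map_fst[of ?X "Itop T"]]
        measurable_cong_sets[of P "borel_of ?O" "borel_of ?X" "borel_of ?X"] PP by (auto simp: Pspace_iff)
    have "distr P (borel_of ?X) fst = \<rho>"
    proof (rule measure_eq_of_Cb[OF cozero_space_Intop[OF T] _ rho])
      show "distr P (borel_of ?X) fst \<in> Pspace ?X" using PP.prob_space_distr[OF fm] by (simp add: Pspace_iff)
      fix g assume g: "g \<in> Cb ?X"
      have gm: "g \<in> borel_measurable (borel_of ?X)" using g by (auto simp: Cb_def intro: continuous_map_borel_measurable)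
      have "(\<integral>\<omega>. g (fst \<omega>) \<partial>P) \<in> {\<integral>x. g x \<partial>\<rho>}"
      proof (rule conjunct2[OF closure_le[OF P fstC[OF g]]])
        fix Q assume Q: "Q \<in> Rset T \<rho>"
        interpret Q: input_coupling T \<rho> Q by (rule Rset_coupling[OF T rho Q])
        show "(\<integral>\<omega>. g (fst \<omega>) \<partial>Q) \<in> {\<integral>x. g x \<partial>\<rho>}" using Q.integral_fst gm Q.borel_rho by simp
      qed simp
      then show "(\<integral>x. g x \<partial>distr P (borel_of ?X) fst) = (\<integral>x. g x \<partial>\<rho>)" using integral_distr[OF fm gm] by simp
    qed
    then interpret R: input_coupling T \<rho> P using T rho PP by (simp add: input_coupling_def coupling_def)
    show "P \<in> Rset T \<rho>"
    proof (rule R.Rset_of_half_lines)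
      fix s t assume st: "0 \<le> s" "s < t" "t < T"
      note G = R.sub_sigma_FBWmu[of t]
      have "R.indep_given {\<omega> \<in> space P. min (snd \<omega>) t \<le> s} (FBWmu T t)"
      proof (rule R.indep_given_of_continuous)
        show "(\<lambda>\<omega>. min (snd \<omega>) t) \<in> borel_measurable P" by measurable
        fix h :: "real \<Rightarrow> real" and C assume h: "continuous_on UNIV h" "\<And>y. \<bar>h y\<bar> \<le> 1" and C: "C \<in> sets \<rho>"
        have hm: "h \<in> borel_measurable borel" using h(1) by (rule borel_measurable_continuous_onI)
        have Ge: "R.sub_sigma (FBWmu T t)" using G st by simp
        have di: "integrable \<rho> (d t C)" unfolding d_def
          by (intro Bochner_Integration.integrable_diff R.integrable_ind C R.cexp_integrable Ge)
        \<comment> \<open>The bound is the same for all Q, because \<bar>h\<bar> \<le> 1 and the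
          rest is integrated against the common marginal.\<close>
        have split: "\<bar>(\<integral>\<omega>. h (min (snd \<omega>) t) * g (fst \<omega>) \<partial>Q) - (\<integral>\<omega>. h (min (snd \<omega>) t) * d t C (fst \<omega>) \<partial>Q)\<bar> \<le> (\<integral>x. \<bar>g x - d t C x\<bar> \<partial>\<rho>)"
          if Q: "input_coupling T \<rho> Q" and g: "g \<in> Cb ?X" for Q g
        proof -
          interpret Q: input_coupling T \<rho> Q by (rule Q)
          have gi: "integrable \<rho> g" by (rule Pspace_integrable_Cb[OF rho g])
          have hQ: "(\<lambda>\<omega>. h (min (snd \<omega>) t)) \<in> borel_measurable Q" by (rule measurable_compose[OF _ hm]) measurable
          have i1: "integrable Q (\<lambda>\<omega>. h (min (snd \<omega>) t) * g (fst \<omega>))"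
            by (rule Q.integrable_bounded_mult(1)[OF Q.integrable_fst[OF gi] hQ, of 1]) (use h in auto)
          have i2: "integrable Q (\<lambda>\<omega>. h (min (snd \<omega>) t) * d t C (fst \<omega>))"
            by (rule Q.integrable_bounded_mult(1)[OF Q.integrable_fst[OF di] hQ, of 1]) (use h in auto)
          have ai: "integrable \<rho> (\<lambda>x. \<bar>g x - d t C x\<bar>)" using gi di by auto
          have "\<bar>(\<integral>\<omega>. h (min (snd \<omega>) t) * g (fst \<omega>) \<partial>Q) - (\<integral>\<omega>. h (min (snd \<omega>) t) * d t C (fst \<omega>) \<partial>Q)\<bar>
            = \<bar>\<integral>\<omega>. h (min (snd \<omega>) t) * g (fst \<omega>) - h (min (snd \<omega>) t) * d t C (fst \<omega>) \<partial>Q\<bar>" using i1 i2 by simp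
          also have "\<dots> \<le> (\<integral>\<omega>. \<bar>h (min (snd \<omega>) t) * g (fst \<omega>) - h (min (snd \<omega>) t) * d t C (fst \<omega>)\<bar> \<partial>Q)" by (rule integral_abs_bound)
          also have "\<dots> \<le> (\<integral>\<omega>. \<bar>g (fst \<omega>) - d t C (fst \<omega>)\<bar> \<partial>Q)"
          proof (rule integral_mono)
            show "integrable Q (\<lambda>\<omega>. \<bar>h (min (snd \<omega>) t) * g (fst \<omega>) - h (min (snd \<omega>) t) * d t C (fst \<omega>)\<bar>)" using i1 i2 by auto
            show "integrable Q (\<lambda>\<omega>. \<bar>g (fst \<omega>) - d t C (fst \<omega>)\<bar>)" using Q.integrable_fst[OF ai] by simp
            fix \<omega>
            have "\<bar>h (min (snd \<omega>) t)\<bar> * \<bar>g (fst \<omega>) - d t C (fst \<omega>)\<bar> \<le> 1 * \<bar>g (fst \<omega>) - d t C (fst \<omega>)\<bar>"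
              using h(2) by (intro mult_right_mono) auto
            then show "\<bar>h (min (snd \<omega>) t) * g (fst \<omega>) - h (min (snd \<omega>) t) * d t C (fst \<omega>)\<bar> \<le> \<bar>g (fst \<omega>) - d t C (fst \<omega>)\<bar>"
              by (simp add: abs_mult right_diff_distrib[symmetric])
          qed
          also have "\<dots> = (\<integral>x. \<bar>g x - d t C x\<bar> \<partial>\<rho>)" by (rule Q.integral_fst) (use ai in simp)
          finally show ?thesis .
        qed
        have zero: "(\<integral>\<omega>. h (min (snd \<omega>) t) * d t C (fst \<omega>) \<partial>Q) = 0" if Q: "Q \<in> Rset T \<rho>" for Q
        proof -
          interpret Q: input_coupling T \<rho> Q by (rule Rset_coupling[OF T rho Q])
          have hQ: "(\<lambda>\<omega>. h (min (snd \<omega>) t)) \<in> borel_measurable Q" by (rule measurable_compose[OF _ hm]) measurable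
          have i1: "integrable Q (\<lambda>\<omega>. h (min (snd \<omega>) t) * indicator C (fst \<omega>))"
            by (rule Q.integrable_bounded_mult(1)[OF Q.integrable_fst[OF Q.integrable_ind[OF C]] hQ, of 1]) (use h in auto)
          have i2: "integrable Q (\<lambda>\<omega>. h (min (snd \<omega>) t) * Q.cexp (FBWmu T t) C (fst \<omega>))"
            by (rule Q.integrable_bounded_mult(1)[OF Q.integrable_cexp_fst[OF Ge C] hQ, of 1]) (use h in auto)
          have "(\<integral>\<omega>. h (min (snd \<omega>) t) * indicator C (fst \<omega>) \<partial>Q) = (\<integral>\<omega>. h (min (snd \<omega>) t) * Q.cexp (FBWmu T t) C (fst \<omega>) \<partial>Q)"
          proof (rule Q.indep_given_half_lines(2)[OF _ Ge _ C hm])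
            show "(\<lambda>\<omega>. min (snd \<omega>) t) \<in> borel_measurable Q" by measurable
            show "Q.indep_given {\<omega> \<in> space Q. min (snd \<omega>) t \<le> r} (FBWmu T t)" for r
              using Q st unfolding Q.Rset_iff Q.tau_event_def by (auto dest!: bspec[of _ _ t] bspec[of _ _ "{..r}"])
          qed
          then show ?thesis unfolding d_def using i1 i2 by (simp add: right_diff_distrib)
        qed
        have "\<bar>\<integral>\<omega>. h (min (snd \<omega>) t) * d t C (fst \<omega>) \<partial>P\<bar> \<le> 0"
        proof (rule field_le_epsilon)
          fix e :: real assume "0 < e"
          \<comment> \<open>The approximation error is paid twice: to replace the limit function by
            g under members of \<open>Rset\<close>, and to return from g under P.\<close>
          then have "0 < e/2" by simp
          from R.exists_Cb_approximation[OF cozero_space_Intop[OF T] Ge C this]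
          obtain g where g: "g \<in> Cb ?X" "(\<integral>x. \<bar>g x - d t C x\<bar> \<partial>\<rho>) < e/2" by (auto simp: d_def)
          let ?c = "\<integral>x. \<bar>g x - d t C x\<bar> \<partial>\<rho>"
          have "(\<integral>\<omega>. h (min (snd \<omega>) t) * g (fst \<omega>) \<partial>P) \<in> {-?c..?c}"
          proof (rule conjunct2[OF closure_le[OF P sndC[OF g(1) h]]])
            fix Q assume Q: "Q \<in> Rset T \<rho>"
            show "(\<integral>\<omega>. h (min (snd \<omega>) t) * g (fst \<omega>) \<partial>Q) \<in> {-?c..?c}"
              using split[OF Rset_coupling[OF T rho Q] g(1)] zero[OF Q] by (simp add: abs_le_iff)
          qed simp
          then show "\<bar>\<integral>\<omega>. h (min (snd \<omega>) t) * d t C (fst \<omega>) \<partial>P\<bar> \<le> 0 + e"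
            using split[OF R.input_coupling_axioms g(1)] g(2) by simp linarith
        qed
        then show "(\<integral>\<omega>. h (min (snd \<omega>) t) * (indicator C (fst \<omega>) - R.cexp (FBWmu T t) C (fst \<omega>)) \<partial>P) = 0"
          by (simp add: d_def)
      qed (use G st in simp)
      moreover have "{\<omega> \<in> space P. min (snd \<omega>) t \<le> s} = {\<omega> \<in> space P. snd \<omega> \<le> s}" using st by auto
      ultimately show "R.indep_given {\<omega> \<in> space P. snd \<omega> \<le> s} (FBWmu T t)" by simp
    qed
  qed
  moreover have "Rset T \<rho> \<subseteq> topspace (weak_top ?O)"
  proof
    fix Q assume Q: "Q \<in> Rset T \<rho>"
    interpret Q: input_coupling T \<rho> Q by (rule Rset_coupling[OF T rho Q])
    show "Q \<in> topspace (weak_top ?O)" using Q.P by simp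
  qed
  ultimately show ?thesis unfolding Omtop_prod using closure_of_subset_eq by blast
qed

lemma compactin_Rset:
  assumes T: "0 < T" and rho: "\<rho> \<in> Pspace (Intop T)"
  shows "compactin (weak_top (Omtop T)) (Rset T \<rho>)"
proof -
  obtain K where K: "compactin (weak_top (Omtop T)) K" "{P. coupling (Intop T) T \<rho> P} \<subseteq> K"
    using couplings_relatively_compact[OF T rho] cozero_space_Omtop[OF T] unfolding Omtop_prod by blast
  have "Rset T \<rho> \<subseteq> K" using K(2) Rset_coupling[OF T rho] by (auto simp: input_coupling_def)
  then show ?thesis by (rule closed_compactin[OF K(1) _ closedin_Rset[OF T rho]])
qed

subsection \<open>Asymptotically independent uniform variables\<close>

text \<open>The probability integral transform: without atoms the distribution function is
  continuous, and {cdf < q} is the open half-line below the smallest q-quantile.\<close>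

lemma measure_cdf_less:
  assumes "real_distribution M" and na: "\<And>x. measure M {x} = 0" and q: "0 < q" "q < 1"
  shows "measure M {y. cdf M y < q} = q"
proof -
  interpret real_distribution M by fact
  have c: "continuous_on UNIV (cdf M)" using na isCont_cdf by (intro continuous_at_imp_continuous_on) auto
  have "\<forall>\<^sub>F y in at_bot. cdf M y < q" by (rule order_tendstoD(2)[OF cdf_lim_at_bot q(1)])
  then obtain b where b: "cdf M b < q" by (auto simp: eventually_at_bot_linorder)
  have "\<forall>\<^sub>F y in at_top. q < cdf M y" by (rule order_tendstoD(1)[OF cdf_lim_at_top_prob q(2)])
  then obtain b' where b': "q < cdf M b'" by (auto simp: eventually_at_top_linorder)
  have bb: "b \<le> b'" using b b' cdf_nondecreasing[of b' b] by linarith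
  \<comment> \<open>The level set may be an interval; it is closed and bounded below, so its infimum
    is a member.\<close>
  define Z where "Z = {y. cdf M y = q}"
  have "\<exists>x\<ge>b. x \<le> b' \<and> cdf M x = q"
    by (rule IVT') (use b b' bb c in \<open>auto intro: continuous_on_subset\<close>)
  then have Zne: "Z \<noteq> {}" by (auto simp: Z_def)
  have Zbd: "bdd_below Z"
  proof (rule bdd_belowI)
    fix y assume "y \<in> Z" then show "b \<le> y" using b cdf_nondecreasing[of y b] by (auto simp: Z_def intro: leI)
  qed
  have "closed Z" unfolding Z_def by (rule closed_Collect_eq) (use c in auto)
  then have sZ: "Inf Z \<in> Z" by (rule closed_contains_Inf[OF Zne Zbd])
  have "{y. cdf M y < q} = {..<Inf Z}"
  proof (intro set_eqI iffI)
    fix y assume "y \<in> {y. cdf M y < q}"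
    then show "y \<in> {..<Inf Z}" using sZ cdf_nondecreasing[of "Inf Z" y] by (auto simp: Z_def intro: leI)
  next
    fix y assume y: "y \<in> {..<Inf Z}"
    then have "cdf M y \<le> q" using sZ cdf_nondecreasing[of y "Inf Z"] by (auto simp: Z_def)
    moreover have "y \<notin> Z" using y cInf_lower[OF _ Zbd, of y] by auto
    ultimately show "y \<in> {y. cdf M y < q}" by (auto simp: Z_def)
  qed
  moreover have "measure M {..<Inf Z} = measure M {..Inf Z} - measure M {Inf Z}"
  proof -
    have "{..<Inf Z} = {..Inf Z} - {Inf Z}" by auto
    then show ?thesis by (simp add: finite_measure_Diff)
  qed
  ultimately show ?thesis using na sZ by (simp add: cdf_def Z_def)
qed

abbreviation gaussM :: "real \<Rightarrow> real measure" where "gaussM v \<equiv> density lborel (normal_density 0 (sqrt v))"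

lemma gaussM:
  assumes "0 < v"
  shows "real_distribution (gaussM v)" "measure (gaussM v) {x} = 0" "gauss v UNIV = 1"
proof -
  interpret prob_space "gaussM v" by (rule prob_space_normal_density) (use assms in simp)
  show "real_distribution (gaussM v)" by (rule real_distribution.intro) (auto simp: prob_space_axioms real_distribution_axioms_def)
  have "emeasure (gaussM v) {x} = (\<integral>\<^sup>+y. ennreal (normal_density 0 (sqrt v) y) * indicator {x} y \<partial>lborel)"
    by (rule emeasure_density) auto
  also have "\<dots> = (\<integral>\<^sup>+y. 0 \<partial>(lborel :: real measure))"
  proof (rule nn_integral_cong_AE)
    have "AE y in lborel. y \<noteq> x" by (rule AE_lborel_singleton)
    then show "AE y in lborel. ennreal (normal_density 0 (sqrt v) y) * indicator {x} y = 0"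
      by eventually_elim (simp add: indicator_def)
  qed
  finally show "measure (gaussM v) {x} = 0" by (simp add: measure_def)
  show "gauss v UNIV = 1" unfolding gauss_def using prob_space by simp
qed

text \<open>The centred indicators are orthogonal, so Bessel's inequality makes their inner products
  with any bounded function vanish in the limit.\<close>

lemma pairwise_independent_mixing:
  fixes A :: "nat \<Rightarrow> 'a set" and g :: "'a \<Rightarrow> real"
  assumes "prob_space M" and A: "\<And>m. A m \<in> sets M" "\<And>m. measure M (A m) = q"
    and ind: "\<And>m l. m < l \<Longrightarrow> measure M (A l \<inter> A m) = q * q"
    and g: "g \<in> borel_measurable M" "\<And>x. x \<in> space M \<Longrightarrow> \<bar>g x\<bar> \<le> B"
  shows "(\<lambda>m. \<integral>x. indicator (A m) x * g x \<partial>M) \<longlonglongrightarrow> q * (\<integral>x. g x \<partial>M)"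
proof -
  interpret prob_space M by fact
  have q: "0 \<le> q" "q \<le> 1" using A(2)[of 0] measure_nonneg[of M "A 0"] prob_le_1[of "A 0"] by auto
  define \<epsilon> where "\<epsilon> m x = indicator (A m) x - q" for m x
  define b where "b m = (\<integral>x. \<epsilon> m x * g x \<partial>M)" for m
  \<comment> \<open>The coefficients are not divided by the squared norms of the
    \<open>\<epsilon> m\<close>, so this is not the exact projection residual. As these norms are at
    most 1, each term still lowers the squared norm by at least b m * b m.\<close>
  define R where "R n x = g x - (\<Sum>m<n. b m * \<epsilon> m x)" for n x
  have em: "\<epsilon> m \<in> borel_measurable M" for m unfolding \<epsilon>_def using A(1)[of m] by measurable
  have eb: "\<bar>\<epsilon> m x\<bar> \<le> 1" for m x using q by (auto simp: \<epsilon>_def indicator_def)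
  have bm: "\<exists>C. \<forall>x\<in>space M. \<bar>f x * h x\<bar> \<le> C" if "\<exists>C. \<forall>x\<in>space M. \<bar>f x\<bar> \<le> C" "\<exists>C. \<forall>x\<in>space M. \<bar>h x\<bar> \<le> C" for f h :: "'a \<Rightarrow> real"
  proof -
    from that obtain C D where CD: "\<forall>x\<in>space M. \<bar>f x\<bar> \<le> C" "\<forall>x\<in>space M. \<bar>h x\<bar> \<le> D" by blast
    have "\<bar>f x * h x\<bar> \<le> \<bar>C\<bar> * \<bar>D\<bar>" if "x \<in> space M" for x
      unfolding abs_mult using CD that by (intro mult_mono) (auto intro: order_trans)
    then show ?thesis by blast
  qed
  have gb: "\<exists>C. \<forall>x\<in>space M. \<bar>g x\<bar> \<le> C" using g(2) by blast
  have eb': "\<exists>C. \<forall>x\<in>space M. \<bar>\<epsilon> m x\<bar> \<le> C" for m using eb by blast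
  have Rm: "R n \<in> borel_measurable M" for n unfolding R_def using g(1) em by measurable
  have Rb: "\<exists>C. \<forall>x\<in>space M. \<bar>R n x\<bar> \<le> C" for n
  proof (induction n)
    case 0 then show ?case using gb by (simp add: R_def)
  next
    case (Suc n)
    then obtain C where C: "\<forall>x\<in>space M. \<bar>R n x\<bar> \<le> C" by blast
    have "\<bar>R (Suc n) x\<bar> \<le> C + \<bar>b n\<bar>" if "x \<in> space M" for x
    proof -
      have "R (Suc n) x = R n x - b n * \<epsilon> n x" by (simp add: R_def)
      moreover have "\<bar>b n * \<epsilon> n x\<bar> \<le> \<bar>b n\<bar> * 1" unfolding abs_mult by (intro mult_left_mono eb) auto
      moreover have "\<bar>R n x\<bar> \<le> C" using C that by blast
      ultimately show ?thesis by linarith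
    qed
    then show ?case by blast
  qed
  have int: "integrable M (\<lambda>x. f x * h x)" if "f \<in> borel_measurable M" "h \<in> borel_measurable M"
      "\<exists>C. \<forall>x\<in>space M. \<bar>f x\<bar> \<le> C" "\<exists>C. \<forall>x\<in>space M. \<bar>h x\<bar> \<le> C" for f h :: "'a \<Rightarrow> real"
  proof -
    from bm[OF that(3,4)] obtain C where "\<forall>x\<in>space M. \<bar>f x * h x\<bar> \<le> C" by blast
    then show ?thesis by (intro integrable_const_bound[where B=C]) (use that in auto)
  qed
  have iA: "(\<integral>x. indicat_real (A m) x \<partial>M) = q" for m using A by simp
  have iAint: "integrable M (indicat_real (A m))" for m using A(1) by (simp add: emeasure_eq_measure)
  have orth: "(\<integral>x. \<epsilon> l x * \<epsilon> m x \<partial>M) = 0" if "m < l" for m l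
  proof -
    have "A l \<inter> A m \<in> sets M" using A(1) by blast
    then have i3: "integrable M (indicat_real (A l \<inter> A m))" by (simp add: emeasure_eq_measure)
    have "(\<integral>x. \<epsilon> l x * \<epsilon> m x \<partial>M) = (\<integral>x. indicator (A l \<inter> A m) x - q * indicator (A l) x - q * indicator (A m) x + q * q \<partial>M)"
      by (rule Bochner_Integration.integral_cong) (auto simp: \<epsilon>_def indicator_def algebra_simps)
    also have "\<dots> = measure M (A l \<inter> A m) - q * q - q * q + q * q"
      using iAint i3 iA \<open>A l \<inter> A m \<in> sets M\<close> by (simp add: prob_space del: Bochner_Integration.integral_indicator) (simp)
    finally show ?thesis using ind[OF that] by simp
  qed
  have sq: "(\<integral>x. \<epsilon> m x * \<epsilon> m x \<partial>M) \<le> 1" for m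
  proof -
    have "(\<integral>x. \<epsilon> m x * \<epsilon> m x \<partial>M) \<le> (\<integral>x. 1 \<partial>M)"
    proof (rule integral_mono)
      show "integrable M (\<lambda>x. \<epsilon> m x * \<epsilon> m x)" by (rule int[OF em em eb' eb'])
      show "\<epsilon> m x * \<epsilon> m x \<le> 1" for x using eb[of m x] by (simp add: abs_le_square_iff[of "\<epsilon> m x" 1, simplified, THEN iffD1] flip: power2_eq_square)
    qed simp
    then show ?thesis by (simp add: prob_space)
  qed
  have eR: "(\<integral>x. \<epsilon> l x * R n x \<partial>M) = b l" if "n \<le> l" for n l
    using that
  proof (induction n)
    case 0 then show ?case by (simp add: R_def b_def)
  next
    case (Suc n)
    have "(\<integral>x. \<epsilon> l x * R (Suc n) x \<partial>M) = (\<integral>x. \<epsilon> l x * R n x - b n * (\<epsilon> l x * \<epsilon> n x) \<partial>M)"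
      by (rule Bochner_Integration.integral_cong) (auto simp: R_def algebra_simps)
    also have "\<dots> = (\<integral>x. \<epsilon> l x * R n x \<partial>M) - b n * (\<integral>x. \<epsilon> l x * \<epsilon> n x \<partial>M)"
      using int[OF em Rm eb' Rb] int[OF em em eb' eb'] by simp
    finally show ?case using Suc orth[of n l] by simp
  qed
  have R2: "(\<integral>x. R n x * R n x \<partial>M) \<le> (\<integral>x. g x * g x \<partial>M) - (\<Sum>m<n. b m * b m)" for n
  proof (induction n)
    case 0 then show ?case by (simp add: R_def)
  next
    case (Suc n)
    have "(\<integral>x. R (Suc n) x * R (Suc n) x \<partial>M) = (\<integral>x. R n x * R n x - (2 * b n) * (\<epsilon> n x * R n x) + (b n * b n) * (\<epsilon> n x * \<epsilon> n x) \<partial>M)"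
      by (rule Bochner_Integration.integral_cong) (auto simp: R_def algebra_simps)
    also have "\<dots> = (\<integral>x. R n x * R n x \<partial>M) - (2 * b n) * (\<integral>x. \<epsilon> n x * R n x \<partial>M) + (b n * b n) * (\<integral>x. \<epsilon> n x * \<epsilon> n x \<partial>M)"
      using int[OF em Rm eb' Rb] int[OF em em eb' eb'] int[OF Rm Rm Rb Rb] by simp
    also have "\<dots> \<le> (\<integral>x. R n x * R n x \<partial>M) - (2 * b n) * b n + (b n * b n) * 1"
      unfolding eR[OF order_refl] by (intro add_left_mono mult_left_mono sq) auto
    also have "\<dots> = (\<integral>x. R n x * R n x \<partial>M) - b n * b n" by simp
    finally show ?case using Suc by simp
  qed
  have "summable (\<lambda>m. b m * b m)"
  proof (rule summableI_nonneg_bounded)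
    fix n
    have "0 \<le> (\<integral>x. R n x * R n x \<partial>M)" by (rule Bochner_Integration.integral_nonneg) simp
    then show "(\<Sum>m<n. b m * b m) \<le> (\<integral>x. g x * g x \<partial>M)" using R2[of n] by linarith
  qed simp
  then have "(\<lambda>m. b m * b m) \<longlonglongrightarrow> 0" by (rule summable_LIMSEQ_zero)
  then have "(\<lambda>m. sqrt (b m * b m)) \<longlonglongrightarrow> sqrt 0" by (rule tendsto_real_sqrt)
  then have b0: "b \<longlonglongrightarrow> 0" by (simp add: tendsto_rabs_zero_iff)
  have gi: "integrable M g" by (rule integrable_const_bound[where B=B]) (use g in auto)
  have "(\<integral>x. indicator (A m) x * g x \<partial>M) = b m + q * (\<integral>x. g x \<partial>M)" for m
  proof -
    have "integrable M (\<lambda>x. indicator (A m) x * g x)" using integrable_mult_indicator[OF A(1) gi] by simp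
    then show ?thesis unfolding b_def \<epsilon>_def using gi by (simp add: left_diff_distrib)
  qed
  then show ?thesis using tendsto_add[OF b0 tendsto_const[of "q * (\<integral>x. g x \<partial>M)"]] by simp
qed

text \<open>Uniform variables read off from the increments of \<open>B\<close> over the disjoint intervals
  \<open>(\<delta> / (m + 2), \<delta> / (m + 1)]\<close>; all of them are known at time \<open>\<delta>\<close>.\<close>

definition inc_time :: "real \<Rightarrow> nat \<Rightarrow> real" where "inc_time \<delta> m = \<delta> / (real m + 1)"

definition Vunif :: "real \<Rightarrow> nat \<Rightarrow> inpt \<Rightarrow> real" where
  "Vunif \<delta> m x = cdf (gaussM (inc_time \<delta> m - inc_time \<delta> (Suc m)))
     (apply_bcontfun (fst x) (inc_time \<delta> m) - apply_bcontfun (fst x) (inc_time \<delta> (Suc m)))"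

lemma inc_time:
  assumes "0 < \<delta>"
  shows "0 < inc_time \<delta> m" "inc_time \<delta> (Suc m) < inc_time \<delta> m" "inc_time \<delta> m \<le> \<delta>"
    "m < l \<Longrightarrow> inc_time \<delta> l \<le> inc_time \<delta> (Suc m)"
proof -
  show "0 < inc_time \<delta> m" using assms by (simp add: inc_time_def)
  show "inc_time \<delta> (Suc m) < inc_time \<delta> m" unfolding inc_time_def using assms by (intro divide_strict_left_mono) auto
  have "\<delta> / (real m + 1) \<le> \<delta> / 1" using assms by (intro divide_left_mono) auto
  then show "inc_time \<delta> m \<le> \<delta>" by (simp add: inc_time_def)
  show "inc_time \<delta> l \<le> inc_time \<delta> (Suc m)" if "m < l" unfolding inc_time_def using assms that by (intro divide_left_mono) auto
qed

lemma Vunif_bounds: "0 < \<delta> \<Longrightarrow> 0 \<le> Vunif \<delta> m x \<and> Vunif \<delta> m x \<le> 1"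
proof -
  assume "0 < \<delta>"
  then interpret real_distribution "gaussM (inc_time \<delta> m - inc_time \<delta> (Suc m))" using gaussM(1) inc_time(2) by simp
  show ?thesis unfolding Vunif_def using cdf_nonneg cdf_bounded_prob by auto
qed

lemma continuous_cdf_gaussM: "0 < v \<Longrightarrow> continuous_on UNIV (cdf (gaussM v))"
proof -
  assume v: "0 < v"
  interpret real_distribution "gaussM v" by (rule gaussM(1)[OF v])
  show ?thesis using gaussM(2)[OF v] isCont_cdf by (intro continuous_at_imp_continuous_on) auto
qed

lemma Vunif_continuous: "0 < \<delta> \<Longrightarrow> continuous_map (Intop T) euclideanreal (Vunif \<delta> m)"
proof -
  assume d: "0 < \<delta>"
  have "continuous_map euclideanreal euclideanreal (cdf (gaussM (inc_time \<delta> m - inc_time \<delta> (Suc m))))"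
    using continuous_cdf_gaussM inc_time(2)[OF d] by simp
  from continuous_map_compose[OF continuous_map_diff[OF Intop_continuous(1) Intop_continuous(1)] this]
  show ?thesis unfolding Vunif_def o_def .
qed

lemma Vunif_measurable:
  assumes "0 < \<delta>" shows "Vunif \<delta> m \<in> borel_measurable (MF T (inc_time \<delta> m))"
proof -
  have "cdf (gaussM (inc_time \<delta> m - inc_time \<delta> (Suc m))) \<in> borel_measurable borel"
    using continuous_cdf_gaussM inc_time(2)[OF assms] by (intro borel_measurable_continuous_onI) simp
  moreover have "(\<lambda>x. apply_bcontfun (fst x) (inc_time \<delta> m) - apply_bcontfun (fst x) (inc_time \<delta> (Suc m))) \<in> borel_measurable (MF T (inc_time \<delta> m))"
    using inc_time[OF assms] by (intro borel_measurable_diff evalB_measurable) (auto intro: less_imp_le)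
  ultimately show ?thesis unfolding Vunif_def by (rule measurable_compose[rotated])
qed

lemma MF_mono:
  fixes f :: "inpt \<Rightarrow> 'b::topological_space"
  assumes "f \<in> borel_measurable (MF T s)" "0 \<le> s" "s \<le> t" "0 \<le> T"
  shows "f \<in> borel_measurable (MF T t)"
  by (rule borel_measurable_subalgebra[OF _ _ assms(1)]) (use FBWmu_mono[OF assms(2-4)] in auto)

text \<open>Larger indices belong to earlier intervals. Hence for m < l the event of index l is
  known at \<open>inc_time \<delta> (Suc m)\<close>, where the increment of index m begins, and the
  Wiener property makes the two events independent with probability q each.\<close>

lemma Vunif_mixing:
  assumes T: "0 < T" and rho: "\<rho> \<in> Pspace (Intop T)" and W: "wiener2 T \<rho>" and d: "0 < \<delta>" "\<delta> \<le> T"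
    and q: "0 < q" "q < 1" and g: "g \<in> borel_measurable \<rho>" "\<And>x. x \<in> space \<rho> \<Longrightarrow> \<bar>g x\<bar> \<le> B"
  shows "(\<lambda>m. \<integral>x. indicator {x \<in> topspace (Intop T). Vunif \<delta> m x < q} x * g x \<partial>\<rho>) \<longlonglongrightarrow> q * (\<integral>x. g x \<partial>\<rho>)"
proof -
  interpret prob_space \<rho> using rho by (simp add: Pspace_iff)
  have sp: "space \<rho> = topspace (Intop T)" by (rule space_Pspace[OF rho])
  define A where "A m = {x \<in> topspace (Intop T). Vunif \<delta> m x < q}" for m
  define v where "v m = inc_time \<delta> m - inc_time \<delta> (Suc m)" for m
  define U where "U m = {y. cdf (gaussM (v m)) y < q}" for m
  have v: "0 < v m" for m using inc_time(2)[OF d(1)] by (simp add: v_def)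
  have Um: "U m \<in> sets borel" for m
    unfolding U_def by (intro borel_open open_Collect_less continuous_cdf_gaussM v continuous_on_const)
  have gU: "gauss (v m) (U m) = q" for m
    unfolding gauss_def U_def by (rule measure_cdf_less[OF gaussM(1)[OF v] gaussM(2)[OF v] q])
  have AF: "A m \<in> FBWmu T (inc_time \<delta> m)" for m
  proof -
    have "{x \<in> space (MF T (inc_time \<delta> m)). Vunif \<delta> m x < q} \<in> sets (MF T (inc_time \<delta> m))"
      using Vunif_measurable[OF d(1)] by (simp only: borel_measurable_iff_less)
    then show ?thesis by (simp add: A_def)
  qed
  have wien: "measure \<rho> (C \<inter> A m) = measure \<rho> C * q" if C: "C \<in> FBWmu T (inc_time \<delta> (Suc m))" for C m
  proof -
    \<comment> \<open>\<open>wiener2\<close> speaks of both increments; the event for W is chosen to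
      be everything, with Gaussian mass 1.\<close>
    have "measure \<rho> (C \<inter> {x \<in> space \<rho>. apply_bcontfun (fst x) (inc_time \<delta> m) - apply_bcontfun (fst x) (inc_time \<delta> (Suc m)) \<in> U m \<and>
              apply_bcontfun (fst (snd x)) (inc_time \<delta> m) - apply_bcontfun (fst (snd x)) (inc_time \<delta> (Suc m)) \<in> UNIV})
          = measure \<rho> C * gauss (inc_time \<delta> m - inc_time \<delta> (Suc m)) (U m) * gauss (inc_time \<delta> m - inc_time \<delta> (Suc m)) UNIV"
      using W C Um[of m] inc_time[OF d(1)] d(2) unfolding wiener2_def
      by (meson less_imp_le order_trans sets.top space_borel UNIV_I borel_open open_UNIV)
    also have "{x \<in> space \<rho>. apply_bcontfun (fst x) (inc_time \<delta> m) - apply_bcontfun (fst x) (inc_time \<delta> (Suc m)) \<in> U m \<and>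
              apply_bcontfun (fst (snd x)) (inc_time \<delta> m) - apply_bcontfun (fst (snd x)) (inc_time \<delta> (Suc m)) \<in> UNIV} = A m"
      unfolding A_def U_def v_def Vunif_def sp by simp
    finally show ?thesis using gU[of m] gaussM(3)[OF v[of m]] by (simp add: v_def)
  qed
  have F0: "0 \<le> inc_time \<delta> m" for m using inc_time(1)[OF d(1)] by (simp add: less_imp_le)
  show ?thesis unfolding A_def[symmetric]
  proof (rule pairwise_independent_mixing[OF prob_space_axioms _ _ _ g])
    show "A m \<in> sets \<rho>" for m using AF FBWmu_borel[OF F0, of T] T rho by (auto simp: Pspace_iff)
    show m1: "measure \<rho> (A m) = q" for m
    proof -
      have "topspace (Intop T) \<in> FBWmu T (inc_time \<delta> (Suc m))" using sigma_algebra_FBWmu sigma_algebra.sigma_sets_eq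
        by (metis sigma_sets_top)
      from wien[OF this, of] have "measure \<rho> (topspace (Intop T) \<inter> A m) = measure \<rho> (space \<rho>) * q" by (simp add: sp)
      moreover have "topspace (Intop T) \<inter> A m = A m" by (auto simp: A_def)
      ultimately show ?thesis by (simp add: prob_space)
    qed
    show "measure \<rho> (A l \<inter> A m) = q * q" if "m < l" for m l
    proof -
      have "A l \<in> FBWmu T (inc_time \<delta> (Suc m))"
        using AF[of l] FBWmu_mono[OF F0 inc_time(4)[OF d(1) that], of T] T by auto
      from wien[OF this] show ?thesis using m1 by simp
    qed
  qed
qed

subsection \<open>Continuous stopping times\<close>

definition ramp :: "real \<Rightarrow> real" where "ramp y = min 1 (max 0 y)"

lemma ramp: "0 \<le> ramp y" "ramp y \<le> 1" "y \<le> 0 \<Longrightarrow> ramp y = 0" "1 \<le> y \<Longrightarrow> ramp y = 1"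
  "ramp y < 1 \<longleftrightarrow> y < 1" "0 < ramp y \<longleftrightarrow> 0 < y"
  by (auto simp: ramp_def)

text \<open>If the thresholds \<open>c k\<close> increase by at least \<open>\<eta>\<close> from one grid point to the next, at most one
  summand is fractional; whether the value is at most \<open>t\<close> can then be decided from the
  threshold at the last grid point before \<open>t\<close>.\<close>

definition ramp_stop :: "real \<Rightarrow> nat \<Rightarrow> real \<Rightarrow> (nat \<Rightarrow> real) \<Rightarrow> real \<Rightarrow> real" where
  "ramp_stop T n \<eta> c u = T / real n + (T / real n) * (\<Sum>k=1..<n. ramp ((u - c k) / \<eta>))"

lemma step_bounds:
  fixes r :: "nat \<Rightarrow> real"
  assumes "0 < T" "1 \<le> n" "\<And>k. 0 \<le> r k" "\<And>k. r k \<le> 1"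
  shows "T / real n + (T / real n) * (\<Sum>k=1..<n. r k) \<in> {T / real n..T}"
proof -
  have s: "0 \<le> (\<Sum>k=1..<n. r k)" using assms by (intro sum_nonneg) auto
  have "(\<Sum>k=1..<n. r k) \<le> (\<Sum>k=1..<n. 1)" by (rule sum_mono) (use assms in auto)
  also have "\<dots> = real n - 1" using assms by simp
  finally have s2: "(\<Sum>k=1..<n. r k) \<le> real n - 1" .
  have "T / real n + (T / real n) * (\<Sum>k=1..<n. r k) \<le> T / real n + (T / real n) * (real n - 1)"
    using assms s2 by (intro add_left_mono mult_left_mono) auto
  also have "\<dots> = T" using assms by (simp add: field_simps)
  finally show ?thesis using s assms by simp
qed

lemma ramp_stop_bounds: "0 < T \<Longrightarrow> 1 \<le> n \<Longrightarrow> ramp_stop T n \<eta> c u \<in> {T / real n..T}"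
  unfolding ramp_stop_def by (rule step_bounds) (auto simp: ramp)

lemma ramp_stop_mem: "0 < T \<Longrightarrow> 1 \<le> n \<Longrightarrow> ramp_stop T n \<eta> c u \<in> {0..T}"
  using ramp_stop_bounds[of T n \<eta> c u] by (auto intro: order_trans[rotated])

text \<open>If r j > 0 then all earlier summands are 1, and if r j < 1 then all later ones are 0. A
  fractional r j thus gives the value (j + r j) T / n. For r j = 0 the value is at most j T / n
  \<le> t, for r j = 1 at least (j + 1) T / n > t, so both sides agree there too.\<close>

lemma ramp_stop_le_iff:
  assumes T: "0 < T" and \<eta>: "0 < \<eta>" and c: "\<And>k. 1 \<le> k \<Longrightarrow> Suc k < n \<Longrightarrow> c k + \<eta> \<le> c (Suc k)"
    and j: "1 \<le> j" "j < n" and t: "real j * (T / real n) \<le> t" "t < real (Suc j) * (T / real n)"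
  shows "ramp_stop T n \<eta> c u \<le> t \<longleftrightarrow> (T / real n) * ramp ((u - c j) / \<eta>) \<le> t - real j * (T / real n)"
proof -
  define d where "d = T / real n"
  have d: "0 < d" using T j by (simp add: d_def)
  define r where "r k = ramp ((u - c k) / \<eta>)" for k
  have r01: "0 \<le> r k" "r k \<le> 1" for k by (auto simp: r_def ramp)
  have cmono: "c k + \<eta> \<le> c l" if "1 \<le> k" "k < l" "l < n" for k l
    using that(2,3)
  proof (induction l)
    case (Suc m)
    show ?case
    proof (cases "k = m")
      case True then show ?thesis using c[of k] that(1) Suc by auto
    next
      case False then show ?thesis using Suc c[of m] that(1) \<eta> by force
    qed
  qed simp
  have r0: "r l = 0" if "1 \<le> k" "k < l" "l < n" "r k < 1" for k l
  proof -
    have "(u - c k) / \<eta> < 1" using that(4) by (simp add: r_def ramp)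
    then have "u - c k < \<eta>" using \<eta> by (simp add: field_simps)
    then have "(u - c l) / \<eta> \<le> 0" using cmono[OF that(1-3)] \<eta> by (simp add: divide_nonpos_pos)
    then show ?thesis by (simp add: r_def ramp)
  qed
  have split: "(\<Sum>k=1..<n. r k) = (\<Sum>k=1..<j. r k) + r j + (\<Sum>k=Suc j..<n. r k)"
  proof -
    have "(\<Sum>k=1..<n. r k) = (\<Sum>k=1..<j. r k) + (\<Sum>k=j..<n. r k)"
      using j by (intro sum.atLeastLessThan_concat[symmetric]) auto
    also have "(\<Sum>k=j..<n. r k) = r j + (\<Sum>k=Suc j..<n. r k)" using j by (intro sum.atLeast_Suc_lessThan) auto
    finally show ?thesis by simp
  qed
  have ramp_stop: "ramp_stop T n \<eta> c u = d + d * (\<Sum>k=1..<n. r k)" by (simp add: ramp_stop_def d_def r_def)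
  have le: "(\<Sum>k=1..<j. r k) \<le> real j - 1"
  proof -
    have "(\<Sum>k=1..<j. r k) \<le> (\<Sum>k=1..<j. 1)" by (rule sum_mono) (simp add: r01)
    then show ?thesis using j by simp
  qed
  have late: "0 \<le> (\<Sum>k=Suc j..<n. r k)" by (intro sum_nonneg r01)
  have late0: "(\<Sum>k=Suc j..<n. r k) = 0" if "r j < 1"
    by (rule sum.neutral) (use r0[OF j(1) _ _ that] in auto)
  have goal: "d + d * (\<Sum>k=1..<n. r k) \<le> t \<longleftrightarrow> d * r j \<le> t - real j * d"
  proof (cases "r j = 0")
    case True
    have "d * (\<Sum>k=1..<n. r k) \<le> d * (real j - 1)" using split le True late0 d by (intro mult_left_mono) auto
    then have "d + d * (\<Sum>k=1..<n. r k) \<le> real j * d" by (simp add: algebra_simps)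
    then show ?thesis using t True by (simp add: d_def)
  next
    case False
    have r1: "r k = 1" if "k \<in> {1..<j}" for k
    proof (rule ccontr)
      assume "r k \<noteq> 1"
      then have "r k < 1" using r01(2)[of k] by simp
      then show False using r0[of k j] that j False by auto
    qed
    have "(\<Sum>k=1..<j. r k) = real j - 1" using r1 j by simp
    then have S: "(\<Sum>k=1..<n. r k) = real j - 1 + r j + (\<Sum>k=Suc j..<n. r k)" using split by simp
    show ?thesis
    proof (cases "r j < 1")
      case True
      show ?thesis unfolding S late0[OF True] by (simp add: algebra_simps)
    next
      case F: False
      then have "r j = 1" using r01(2)[of j] by simp
      moreover from this have "d * real j \<le> d * (\<Sum>k=1..<n. r k)" using S late d by (intro mult_left_mono) auto
      ultimately show ?thesis using t(2) by (simp add: d_def[symmetric] algebra_simps)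
    qed
  qed
  then show ?thesis unfolding ramp_stop by (simp add: d_def r_def)
qed

lemma continuous_map_ramp:
  "continuous_map Y euclideanreal f \<Longrightarrow> continuous_map Y euclideanreal (\<lambda>y. ramp (f y))"
  unfolding ramp_def by (intro continuous_map_real_min continuous_map_real_max continuous_map_canonical_const)

lemma continuous_map_ramp_stop:
  assumes "0 < T" "1 \<le> n" and c: "\<And>k. k \<in> {1..<n} \<Longrightarrow> continuous_map Y euclideanreal (c k)"
    and V: "continuous_map Y euclideanreal V"
  shows "continuous_map Y (Itop T) (\<lambda>y. ramp_stop T n \<eta> (\<lambda>k. c k y) (V y))"
  unfolding Itop_def continuous_map_in_subtopology
proof
  show "continuous_map Y euclideanreal (\<lambda>y. ramp_stop T n \<eta> (\<lambda>k. c k y) (V y))"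
    unfolding ramp_stop_def divide_inverse
    by (intro continuous_map_add continuous_map_real_mult continuous_map_sum continuous_map_ramp continuous_map_diff
        continuous_map_canonical_const c V) auto
qed (use ramp_stop_mem[OF assms(1,2)] in auto)

lemma ramp_measurable [measurable]: "ramp \<in> borel_measurable borel"
  unfolding ramp_def[abs_def] by measurable

lemma ramp_stop_measurable:
  assumes c: "\<And>k. k \<in> {1..<n} \<Longrightarrow> c k \<in> borel_measurable M" and V: "V \<in> borel_measurable M"
  shows "(\<lambda>y. ramp_stop T n \<eta> (\<lambda>k. c k y) (V y)) \<in> borel_measurable M"
  unfolding ramp_stop_def
  by (intro borel_measurable_add borel_measurable_times borel_measurable_const borel_measurable_sum
      measurable_compose[OF _ ramp_measurable] borel_measurable_divide borel_measurable_diff c V)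

text \<open>Deciding whether the rule has stopped by t takes only the threshold at the last grid
  point up to t and the variable \<open>V\<close>, which is known from T / n on. Every
  \<open>{rule \<le> t}\<close> is thereby exactly in the raw filtration.\<close>

lemma ramp_stop_stopping:
  assumes T: "0 < T" and n: "1 \<le> n" and \<eta>: "0 < \<eta>"
    and c: "\<And>k. k \<in> {1..<n} \<Longrightarrow> c k \<in> borel_measurable (MF T (real k * (T / real n)))"
    and sp: "\<And>k x. 1 \<le> k \<Longrightarrow> Suc k < n \<Longrightarrow> c k x + \<eta> \<le> c (Suc k) x"
    and V: "V \<in> borel_measurable (MF T (T / real n))" and t: "t \<in> {0..T}"
  shows "{x \<in> topspace (Intop T). ramp_stop T n \<eta> (\<lambda>k. c k x) (V x) \<le> t} \<in> FBWmu T t"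
proof -
  have d: "0 < T / real n" using T n by simp
  \<comment> \<open>Before T / n the rule never stops and at T it has surely stopped, so the event
    is empty or everything.\<close>
  consider "t = T" | "t < T / real n" "t < T" | "T / real n \<le> t" "t < T" using t by fastforce
  then show ?thesis
  proof cases
    case 1
    then have e: "{x \<in> topspace (Intop T). ramp_stop T n \<eta> (\<lambda>k. c k x) (V x) \<le> t} = space (MF T t)"
      using ramp_stop_bounds[OF T n] by auto
    show ?thesis unfolding e using sets.top[of "MF T t"] by simp
  next
    case 2
    have "\<not> ramp_stop T n \<eta> (\<lambda>k. c k x) (V x) \<le> t" for x
      using ramp_stop_bounds[OF T n, of \<eta> "\<lambda>k. c k x" "V x"] 2(1) by auto
    then have e: "{x \<in> topspace (Intop T). ramp_stop T n \<eta> (\<lambda>k. c k x) (V x) \<le> t} = {}" by simp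
    show ?thesis unfolding e using sets.empty_sets[of "MF T t"] by simp
  next
    case 3
    \<comment> \<open>The index of the last grid point not after t; it lies in {1..<n} since T / n
      \<le> t < T.\<close>
    define j where "j = nat \<lfloor>t / (T / real n)\<rfloor>"
    have q1: "1 \<le> t / (T / real n)" unfolding pos_le_divide_eq[OF d] using 3(1) by simp
    then have fl: "1 \<le> \<lfloor>t / (T / real n)\<rfloor>" by simp
    have j1: "1 \<le> j" unfolding j_def using fl by linarith
    have rj: "real j = of_int \<lfloor>t / (T / real n)\<rfloor>" using fl by (simp add: j_def)
    have jt: "real j * (T / real n) \<le> t"
      using of_int_floor_le[of "t / (T / real n)"] d unfolding rj by (simp only: pos_le_divide_eq)
    have "t / (T / real n) < real j + 1" unfolding rj by linarith
    then have tj: "t < real (Suc j) * (T / real n)" using d by (simp only: pos_divide_less_eq) (simp add: add.commute)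
    have "real j * (T / real n) < real n * (T / real n)" using jt 3(2) n by simp
    then have jn: "j < n" using d by (simp only: mult_less_cancel_right_pos of_nat_less_iff)
    have t0: "0 \<le> T / real n" "T / real n \<le> t" using d 3 by auto
    have cj: "c j \<in> borel_measurable (MF T t)"
      by (rule MF_mono[OF c _ jt]) (use j1 jn d T in auto)
    have Vt: "V \<in> borel_measurable (MF T t)" by (rule MF_mono[OF V t0]) (use T in simp)
    have m: "(\<lambda>x. (T / real n) * ramp ((V x - c j x) / \<eta>)) \<in> borel_measurable (MF T t)"
      by (intro borel_measurable_times borel_measurable_const measurable_compose[OF _ ramp_measurable]
          borel_measurable_divide borel_measurable_diff cj Vt)
    have "{x \<in> topspace (Intop T). ramp_stop T n \<eta> (\<lambda>k. c k x) (V x) \<le> t} =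
        {x \<in> space (MF T t). (T / real n) * ramp ((V x - c j x) / \<eta>) \<le> t - real j * (T / real n)}"
    proof -
      have "ramp_stop T n \<eta> (\<lambda>k. c k x) (V x) \<le> t \<longleftrightarrow> (T / real n) * ramp ((V x - c j x) / \<eta>) \<le> t - real j * (T / real n)" for x
        by (rule ramp_stop_le_iff[OF T \<eta> _ j1 jn jt tj]) (rule sp)
      then show ?thesis by (simp only: space_MF)
    qed
    also have "\<dots> \<in> sets (MF T t)" using m by (simp only: borel_measurable_iff_le)
    finally show ?thesis by simp
  qed
qed

text \<open>The law of the graph of a continuous adapted rule. The null set demanded by
  \<open>stopping_completed\<close> is the complement of the graph.\<close>

lemma distr_graph_R0:
  assumes T: "0 < T" and rho: "\<rho> \<in> Pspace (Intop T)"
    and th: "continuous_map (Intop T) (Itop T) \<tau>"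
    and st: "\<And>t. t \<in> {0..T} \<Longrightarrow> {x \<in> topspace (Intop T). \<tau> x \<le> t} \<in> FBWmu T t"
  shows "distr \<rho> (borel_of (prod_topology (Intop T) (Itop T))) (\<lambda>x. (x, \<tau> x)) \<in> R0 T \<rho>"
    and "coupling (Intop T) T \<rho> (distr \<rho> (borel_of (prod_topology (Intop T) (Itop T))) (\<lambda>x. (x, \<tau> x)))"
proof -
  let ?P = "distr \<rho> (borel_of (prod_topology (Intop T) (Itop T))) (\<lambda>x. (x, \<tau> x))"
  interpret rho: prob_space \<rho> using rho by (simp add: Pspace_iff)
  have sr: "sets \<rho> = sets (borel_of (Intop T))" using rho by (simp add: Pspace_iff)
  have spr: "space \<rho> = topspace (Intop T)" by (rule space_Pspace[OF rho])
  have idm: "(\<lambda>x. x) \<in> measurable \<rho> (borel_of (Intop T))" by (rule measurable_ident_sets[OF sr])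
  have idd: "distr \<rho> (borel_of (Intop T)) (\<lambda>x. x) = \<rho>" by (rule distr_id2) (simp add: sr)
  have tc: "continuous_map (Intop T) euclideanreal \<tau>" using th by (simp add: Itop_def continuous_map_in_subtopology)
  have tm: "\<tau> \<in> borel_measurable \<rho>" unfolding Pspace_borel_measurable[OF rho] by (rule continuous_map_borel_measurable[OF tc])
  have t01: "\<tau> x \<in> {0..T}" if "x \<in> space \<rho>" for x
    using th that spr by (auto simp: Itop_def continuous_map_in_subtopology)
  show C: "coupling (Intop T) T \<rho> ?P"
    by (rule coupling_distr(1)[OF T rho rho.prob_space_axioms idm idd tm t01])
  interpret input_coupling T \<rho> ?P using C by (simp add: input_coupling_def)
  have pm: "(\<lambda>x. (x, \<tau> x)) \<in> measurable \<rho> (borel_of (prod_topology (Intop T) (Itop T)))"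
    by (rule measurable_into_prod_Itop[OF idm tm t01])
  have tmf: "(\<lambda>\<omega>. \<tau> (fst \<omega>)) \<in> borel_measurable ?P" by (rule measurable_compose[OF fst_meas_rho tm])
  define N where "N = {\<omega> \<in> space ?P. snd \<omega> \<noteq> \<tau> (fst \<omega>)}"
  have Nm: "N \<in> sets ?P" unfolding N_def by (rule borel_measurable_neq[OF snd_meas tmf])
  have "emeasure ?P N = emeasure \<rho> ((\<lambda>x. (x, \<tau> x)) -` N \<inter> space \<rho>)"
    by (rule emeasure_distr[OF pm]) (use Nm in simp)
  also have "(\<lambda>x. (x, \<tau> x)) -` N \<inter> space \<rho> = {}" by (auto simp: N_def)
  finally have N0: "N \<in> null_sets ?P" using Nm by (auto simp: null_sets_def)
  have AE: "AE \<omega> in ?P. snd \<omega> = \<tau> (fst \<omega>)" by (rule AE_I'[OF N0]) (simp only: N_def order_refl)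
  have "stopping_completed T ?P"
    unfolding stopping_completed_def
  proof
    fix t assume t: "t \<in> {0..T}"
    show "\<exists>A\<in>liftF T (FBWmu T t). \<exists>N\<in>null_sets ?P.
      ({\<omega> \<in> space ?P. snd \<omega> \<le> t} - A) \<union> (A - {\<omega> \<in> space ?P. snd \<omega> \<le> t}) \<subseteq> N"
    proof (intro bexI)
      show "fst -` {x \<in> topspace (Intop T). \<tau> x \<le> t} \<inter> space ?P \<in> liftF T (FBWmu T t)" by (rule liftF_mem[OF st[OF t]])
      show "({\<omega> \<in> space ?P. snd \<omega> \<le> t} - (fst -` {x \<in> topspace (Intop T). \<tau> x \<le> t} \<inter> space ?P)) \<union>
        (fst -` {x \<in> topspace (Intop T). \<tau> x \<le> t} \<inter> space ?P - {\<omega> \<in> space ?P. snd \<omega> \<le> t}) \<subseteq> N"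
      proof
        fix \<omega> assume "\<omega> \<in> ({\<omega> \<in> space ?P. snd \<omega> \<le> t} - (fst -` {x \<in> topspace (Intop T). \<tau> x \<le> t} \<inter> space ?P)) \<union>
          (fst -` {x \<in> topspace (Intop T). \<tau> x \<le> t} \<inter> space ?P - {\<omega> \<in> space ?P. snd \<omega> \<le> t})"
        moreover from this have "fst \<omega> \<in> topspace (Intop T)" by (auto simp: mem_Times_iff)
        ultimately show "\<omega> \<in> N" unfolding N_def by (cases "\<tau> (fst \<omega>) \<le> t") auto
      qed
      show "N \<in> null_sets ?P" by (rule N0)
    qed
  qed
  moreover have "has_marginal T \<rho> ?P" using has_marginal_iff_coupling[OF T rho] C by simp
  ultimately show "?P \<in> R0 T \<rho>" unfolding R0_def using th AE by blast
qed

subsection \<open>Randomised stopping rules lie in the closure\<close>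

context coupling_compactness
begin

definition Law :: "('a \<times> real \<Rightarrow> real) \<Rightarrow> ('a \<times> real) measure" where
  "Law \<theta> = distr N (borel_of (prod_topology X (Itop T))) (\<lambda>\<omega>. (fst \<omega>, \<theta> \<omega>))"

lemma Law_coupling: "\<theta> \<in> borel_measurable N \<Longrightarrow> (\<And>\<omega>. \<theta> \<omega> \<in> {0..T}) \<Longrightarrow> coupling X T \<rho> (Law \<theta>)"
  unfolding Law_def by (rule coupling_distr(1)[OF T rho prob_N fst_N])

lemma Law_integral:
  fixes f :: "'a \<times> real \<Rightarrow> real"
  assumes "\<theta> \<in> borel_measurable N" "\<And>\<omega>. \<theta> \<omega> \<in> {0..T}" "f \<in> Cb (prod_topology X (Itop T))"
  shows "(\<integral>p. f p \<partial>Law \<theta>) = (\<integral>\<omega>. f (fst \<omega>, \<theta> \<omega>) \<partial>N)"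
  unfolding Law_def
  by (rule coupling_distr(2)[OF T rho prob_N fst_N assms(1,2)]) (use assms(3) in \<open>auto simp: Cb_def intro: continuous_map_borel_measurable\<close>)

lemma Law_tendsto:
  assumes m: "\<And>j. \<theta>' j \<in> borel_measurable N" "\<And>j \<omega>. \<theta>' j \<omega> \<in> {0..T}" "\<theta> \<in> borel_measurable N" "\<And>\<omega>. \<theta> \<omega> \<in> {0..T}"
    and lim: "AE \<omega> in N. (\<lambda>j. \<theta>' j \<omega>) \<longlonglongrightarrow> \<theta> \<omega>" and f: "f \<in> Cb (prod_topology X (Itop T))"
  shows "(\<lambda>j. \<integral>p. f p \<partial>Law (\<theta>' j)) \<longlonglongrightarrow> (\<integral>p. f p \<partial>Law \<theta>)"
  unfolding Law_integral[OF m(1,2) f] Law_integral[OF m(3,4) f]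
proof -
  interpret N: prob_space N by (rule prob_N)
  obtain B where B: "\<And>p. p \<in> topspace (prod_topology X (Itop T)) \<Longrightarrow> \<bar>f p\<bar> \<le> B" using Cb_obtain_bound[OF f] by blast
  have fc: "continuous_map (prod_topology X (Itop T)) euclideanreal f" using f by (simp add: Cb_def)
  show "(\<lambda>j. \<integral>\<omega>. f (fst \<omega>, \<theta>' j \<omega>) \<partial>N) \<longlonglongrightarrow> (\<integral>\<omega>. f (fst \<omega>, \<theta> \<omega>) \<partial>N)"
  proof (rule integral_dominated_convergence[where w="\<lambda>_. B"])
    show "(\<lambda>\<omega>. f (fst \<omega>, \<theta> \<omega>)) \<in> borel_measurable N"
      by (rule measurable_compose[OF measurable_into_prod_Itop[OF fst_N(1) m(3,4)] continuous_map_borel_measurable[OF fc]])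
    show "(\<lambda>\<omega>. f (fst \<omega>, \<theta>' j \<omega>)) \<in> borel_measurable N" for j
      by (rule measurable_compose[OF measurable_into_prod_Itop[OF fst_N(1) m(1,2)] continuous_map_borel_measurable[OF fc]])
    show "AE \<omega> in N. norm (f (fst \<omega>, \<theta>' j \<omega>)) \<le> B" for j
    proof (rule AE_I2)
      fix \<omega> assume "\<omega> \<in> space N"
      then have "(fst \<omega>, \<theta>' j \<omega>) \<in> topspace (prod_topology X (Itop T))" using m(2)[of j \<omega>] by (auto simp: space_N)
      from B[OF this] show "norm (f (fst \<omega>, \<theta>' j \<omega>)) \<le> B" by simp
    qed
    show "AE \<omega> in N. (\<lambda>j. f (fst \<omega>, \<theta>' j \<omega>)) \<longlonglongrightarrow> f (fst \<omega>, \<theta> \<omega>)"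
      using lim AE_space
    proof eventually_elim
      case (elim \<omega>)
      then have "fst \<omega> \<in> topspace X" by (auto simp: space_N)
      from continuous_map_slice(1)[OF fc this] show ?case
        by (rule continuous_on_tendsto_compose[OF _ elim(1) m(4)]) (use m(2) in auto)
    qed
  qed simp
qed

text \<open>A uniform variable almost surely misses a threshold that depends only on the input. This
  removes the points where indicators of threshold events are discontinuous in the
  threshold.\<close>

lemma AE_N_neq:
  assumes k: "k \<in> borel_measurable \<rho>" shows "AE \<omega> in N. snd \<omega> \<noteq> k (fst \<omega>)"
proof -
  interpret U: prob_space U01 by (rule prob_space_U01)
  interpret pair_prob_space \<rho> U01 ..
  note k[measurable]
  have "{\<omega> \<in> space N. snd \<omega> \<noteq> k (fst \<omega>)} \<in> sets N" by measurable
  then show ?thesis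
    by (rule AE_pair_measure) (use AE_U01_neq in auto)
qed

lemma AE_N_mem: "AE \<omega> in N. 0 \<le> snd \<omega> \<and> snd \<omega> \<le> 1"
proof -
  interpret U: prob_space U01 by (rule prob_space_U01)
  interpret pair_prob_space \<rho> U01 ..
  have "{\<omega> \<in> space N. 0 \<le> snd \<omega> \<and> snd \<omega> \<le> 1} \<in> sets N" by measurable
  then show ?thesis
    by (rule AE_pair_measure) (use AE_U01_mem in auto)
qed

end

lemma distr_integral_indicator:
  fixes g :: "'a \<Rightarrow> real"
  assumes T: "0 < T" and rho: "\<rho> \<in> Pspace X" and M: "prob_space M"
    and \<xi>: "\<xi> \<in> measurable M (borel_of X)" "distr M (borel_of X) \<xi> = \<rho>"
    and \<theta>: "\<theta> \<in> borel_measurable M" "\<And>\<omega>. \<omega> \<in> space M \<Longrightarrow> \<theta> \<omega> \<in> {0..T}" and g: "g \<in> borel_measurable (borel_of X)"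
  defines "L \<equiv> distr M (borel_of (prod_topology X (Itop T))) (\<lambda>\<omega>. (\<xi> \<omega>, \<theta> \<omega>))"
  shows "(\<integral>\<omega>. indicator {\<omega> \<in> space L. q \<le> snd \<omega>} \<omega> * g (fst \<omega>) \<partial>L) = (\<integral>\<omega>. of_bool (q \<le> \<theta> \<omega>) * g (\<xi> \<omega>) \<partial>M)"
proof -
  interpret C: coupling X T \<rho> L unfolding L_def by (rule coupling_distr(1)[OF T rho M \<xi> \<theta>])
  have A: "{\<omega> \<in> space L. q \<le> snd \<omega>} \<in> sets L" by measurable
  have "(\<lambda>\<omega>. indicator {\<omega> \<in> space L. q \<le> snd \<omega>} \<omega> * g (fst \<omega>)) \<in> borel_measurable L"
    by (intro borel_measurable_times borel_measurable_indicator A measurable_compose[OF C.fst_meas g])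
  then have m: "(\<lambda>\<omega>. indicator {\<omega> \<in> space L. q \<le> snd \<omega>} \<omega> * g (fst \<omega>)) \<in> borel_measurable (borel_of (prod_topology X (Itop T)))"
    using measurable_cong_sets[OF C.sets_P refl] by blast
  define F :: "'a \<times> real \<Rightarrow> real" where "F = (\<lambda>\<omega>. indicator {\<omega> \<in> space L. q \<le> snd \<omega>} \<omega> * g (fst \<omega>))"
  have Fm: "F \<in> borel_measurable (borel_of (prod_topology X (Itop T)))" unfolding F_def by (rule m)
  have "(\<integral>\<omega>. F \<omega> \<partial>L) = (\<integral>\<omega>. F (\<xi> \<omega>, \<theta> \<omega>) \<partial>M)"
    unfolding L_def by (rule coupling_distr(2)[OF T rho M \<xi> \<theta> Fm])
  then have "(\<integral>\<omega>. indicator {\<omega> \<in> space L. q \<le> snd \<omega>} \<omega> * g (fst \<omega>) \<partial>L) =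
      (\<integral>\<omega>. indicator {\<omega> \<in> space L. q \<le> snd \<omega>} (\<xi> \<omega>, \<theta> \<omega>) * g (fst (\<xi> \<omega>, \<theta> \<omega>)) \<partial>M)"
    unfolding F_def .
  also have "\<dots> = (\<integral>\<omega>. of_bool (q \<le> \<theta> \<omega>) * g (\<xi> \<omega>) \<partial>M)"
    by (rule Bochner_Integration.integral_cong)
       (use \<theta>(2) measurable_space[OF \<xi>(1)] in \<open>auto simp: indicator_def C.space_P simp del: sets_measure_of\<close>)
  finally show ?thesis .
qed

locale wiener_input = coupling_compactness "Intop T" T \<rho> for T \<rho> +
  assumes W: "wiener2 T \<rho>"
begin

abbreviation Om :: "opnt topology" where "Om \<equiv> prod_topology (Intop T) (Itop T)"
abbreviation clR0 :: "opnt measure set" where "clR0 \<equiv> weak_top Om closure_of R0 T \<rho>"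

lemma borel_rho: "borel_measurable \<rho> = borel_measurable (borel_of (Intop T))"
  by (rule Pspace_borel_measurable[OF rho])

lemma MF_rho: "0 \<le> t \<Longrightarrow> f \<in> borel_measurable (MF T t) \<Longrightarrow> f \<in> borel_measurable \<rho>" for f :: "inpt \<Rightarrow> real"
  by (erule borel_measurable_subalgebra[rotated 2]) (use FBWmu_borel[of t T] T in auto)

text \<open>For fixed n, \<eta> and thresholds the rule is one continuous function of the pair (x,
  u). Feeding in \<open>Vunif \<delta> m\<close> for u gives elements of \<open>R0 T \<rho>\<close>,
  and by mixing the pairs (x, \<open>Vunif \<delta> m x\<close>) converge in law to an input with an
  independent uniform variable.\<close>

lemma ramp_stop_Law_closure:
  assumes n: "1 \<le> n" and \<eta>: "0 < \<eta>"
    and c: "\<And>k. k \<in> {1..<n} \<Longrightarrow> c k \<in> borel_measurable (MF T (real k * (T / real n)))"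
    and cc: "\<And>k. k \<in> {1..<n} \<Longrightarrow> continuous_map (Intop T) euclideanreal (c k)"
    and sp: "\<And>k x. 1 \<le> k \<Longrightarrow> Suc k < n \<Longrightarrow> c k x + \<eta> \<le> c (Suc k) x"
  shows "Law (\<lambda>\<omega>. ramp_stop T n \<eta> (\<lambda>k. c k (fst \<omega>)) (snd \<omega>)) \<in> clR0"
proof -
  define \<delta> where "\<delta> = T / real n"
  have \<delta>: "0 < \<delta>" "\<delta> \<le> T" using T n by (simp_all add: \<delta>_def divide_le_eq mult_left_le[of 1 "real n"])
  define \<tau> where "\<tau> m x = ramp_stop T n \<eta> (\<lambda>k. c k x) (Vunif \<delta> m x)" for m x
  define Q where "Q m = distr \<rho> (borel_of Om) (\<lambda>x. (x, \<tau> m x))" for m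
  have Vm: "Vunif \<delta> m \<in> borel_measurable (MF T (T / real n))" for m
    using MF_mono[OF Vunif_measurable[OF \<delta>(1)], of m "T / real n"] inc_time(1,3)[OF \<delta>(1), of m] T
    by (simp add: \<delta>_def less_imp_le)
  have \<tau>c: "continuous_map (Intop T) (Itop T) (\<tau> m)" for m
    unfolding \<tau>_def by (rule continuous_map_ramp_stop[OF T n cc Vunif_continuous[OF \<delta>(1)]])
  have \<tau>s: "{x \<in> topspace (Intop T). \<tau> m x \<le> t} \<in> FBWmu T t" if "t \<in> {0..T}" for m t
    unfolding \<tau>_def by (rule ramp_stop_stopping[OF T n \<eta> c sp Vm that])
  have QR: "Q m \<in> R0 T \<rho>" for m unfolding Q_def by (rule distr_graph_R0(1)[OF T rho \<tau>c \<tau>s])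
  have cr: "c k \<in> borel_measurable \<rho>" if "k \<in> {1..<n}" for k
    by (rule MF_rho[OF _ c[OF that]]) (use T in simp)
  have cN: "(\<lambda>\<omega>. c k (fst \<omega>)) \<in> borel_measurable N" if "k \<in> {1..<n}" for k
    by (rule measurable_compose[OF measurable_fst cr[OF that]])
  have \<theta>m: "(\<lambda>\<omega>. ramp_stop T n \<eta> (\<lambda>k. c k (fst \<omega>)) (snd \<omega>)) \<in> borel_measurable N"
    by (rule ramp_stop_measurable[OF cN]) measurable
  have \<theta>b: "ramp_stop T n \<eta> (\<lambda>k. c k (fst \<omega>)) (snd \<omega>) \<in> {0..T}" for \<omega> by (rule ramp_stop_mem[OF T n])
  have sr: "sets \<rho> = sets (borel_of (Intop T))" by (rule sets_rho)
  have idm: "(\<lambda>x. x) \<in> measurable \<rho> (borel_of (Intop T))" by (rule measurable_ident_sets[OF sr])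
  have idd: "distr \<rho> (borel_of (Intop T)) (\<lambda>x. x) = \<rho>" by (rule distr_id2) (simp add: sr)
  have Vr: "Vunif \<delta> m \<in> borel_measurable \<rho>" for m by (rule MF_rho[OF _ Vm]) (use T in simp)
  have Vb: "Vunif \<delta> m x \<in> {0..1}" for m x using Vunif_bounds[OF \<delta>(1)] by simp
  show ?thesis
  proof (rule weak_top_closure_sequentially)
    show "Law (\<lambda>\<omega>. ramp_stop T n \<eta> (\<lambda>k. c k (fst \<omega>)) (snd \<omega>)) \<in> Pspace Om"
      using Law_coupling[OF \<theta>m \<theta>b] by (simp add: coupling_def)
    show "Q m \<in> clR0" for m
      using QR closure_of_subset[of "R0 T \<rho>" "weak_top Om"] R0_subset_Rset[OF T rho]
        closedin_subset[OF closedin_Rset[OF T rho]] by (auto simp: Omtop_prod)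
    fix f assume f: "f \<in> Cb Om"
    have fc: "continuous_map Om euclideanreal f" using f by (simp add: Cb_def)
    obtain B where B: "\<And>p. p \<in> topspace Om \<Longrightarrow> \<bar>f p\<bar> \<le> B" using Cb_obtain_bound[OF f] by blast
    \<comment> \<open>The test function pulled back to pairs of an input and a level in [0, 1];
      continuity of the ramps makes it a bounded continuous function.\<close>
    define Hf where "Hf p = f (fst p, ramp_stop T n \<eta> (\<lambda>k. c k (fst p)) (snd p))" for p
    let ?O1 = "prod_topology (Intop T) (Itop 1)"
    have Hc: "Hf \<in> Cb ?O1"
    proof (rule CbI[where B=B])
      have cf: "continuous_map ?O1 euclideanreal (\<lambda>p. c k (fst p))" if "k \<in> {1..<n}" for k
        using continuous_map_compose[OF continuous_map_fst cc[OF that]] by (simp add: o_def)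
      have "continuous_map ?O1 Om (\<lambda>p. (fst p, ramp_stop T n \<eta> (\<lambda>k. c k (fst p)) (snd p)))"
        by (intro continuous_map_pairedI continuous_map_fst continuous_map_ramp_stop[OF T n cf continuous_map_snd_Itop])
      from continuous_map_compose[OF this fc] show "continuous_map ?O1 euclideanreal Hf" by (simp add: Hf_def[abs_def] o_def)
      show "\<bar>Hf p\<bar> \<le> B" if "p \<in> topspace ?O1" for p
        unfolding Hf_def by (rule B) (use that ramp_stop_mem[OF T n] in auto)
    qed
    define Q1 where "Q1 m = distr \<rho> (borel_of ?O1) (\<lambda>x. (x, Vunif \<delta> m x))" for m
    \<comment> \<open>\<open>U01\<close> is a measure on the whole line; clamping alters the
      variable only on a null set and brings its values into [0, 1].\<close>
    define cl where "cl u = max 0 (min 1 u)" for u :: real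
    have clm: "(\<lambda>\<omega>. cl (snd \<omega>)) \<in> borel_measurable N" unfolding cl_def by measurable
    have clb: "cl u \<in> {0..1}" for u by (auto simp: cl_def)
    define P1 where "P1 = distr N (borel_of ?O1) (\<lambda>\<omega>. (fst \<omega>, cl (snd \<omega>)))"
    have Hm: "Hf \<in> borel_measurable (borel_of ?O1)" using Hc by (auto simp: Cb_def intro: continuous_map_borel_measurable)
    note cd1 = coupling_distr[OF zero_less_one rho prob_space_axioms idm idd Vr Vb]
    note cd2 = coupling_distr[OF zero_less_one rho prob_N fst_N clm clb]
    \<comment> \<open>Convergence of couplings at horizon 1: the second coordinate is the uniform
      level, not time.\<close>
    have "(\<lambda>m. \<integral>p. Hf p \<partial>Q1 m) \<longlonglongrightarrow> (\<integral>p. Hf p \<partial>P1)"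
    proof (rule coupling_weak_convergence[OF _ _ Hc])
      show "coupling (Intop T) 1 \<rho> P1" unfolding P1_def by (rule cd2(1))
      show "coupling (Intop T) 1 \<rho> (Q1 m)" for m unfolding Q1_def by (rule cd1(1))
      fix q :: real and g :: "inpt \<Rightarrow> real" assume g: "g \<in> borel_measurable (borel_of (Intop T))"
        and gb: "\<exists>B. \<forall>x\<in>topspace (Intop T). \<bar>g x\<bar> \<le> B" and q: "0 < q" "q < 1"
      have gr: "g \<in> borel_measurable \<rho>" using g borel_rho by simp
      from gb obtain C where C: "\<And>x. x \<in> space \<rho> \<Longrightarrow> \<bar>g x\<bar> \<le> C" by auto
      have gi: "integrable \<rho> g" by (rule integrable_const_bound[where B=C]) (use gr C in auto)
      have L: "(\<integral>\<omega>. indicator {\<omega> \<in> space (Q1 m). q \<le> snd \<omega>} \<omega> * g (fst \<omega>) \<partial>Q1 m) =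
          (\<integral>x. g x \<partial>\<rho>) - (\<integral>x. indicator {x \<in> topspace (Intop T). Vunif \<delta> m x < q} x * g x \<partial>\<rho>)" for m
      proof -
        have VA: "{x \<in> topspace (Intop T). Vunif \<delta> m x < q} \<in> sets \<rho>"
        proof -
          have "{x \<in> space \<rho>. Vunif \<delta> m x < q} \<in> sets \<rho>" using Vr[of m] by (simp only: borel_measurable_iff_less)
          then show ?thesis by simp
        qed
        have "(\<integral>\<omega>. indicator {\<omega> \<in> space (Q1 m). q \<le> snd \<omega>} \<omega> * g (fst \<omega>) \<partial>Q1 m) = (\<integral>x. of_bool (q \<le> Vunif \<delta> m x) * g x \<partial>\<rho>)"
          unfolding Q1_def by (rule distr_integral_indicator[OF zero_less_one rho prob_space_axioms idm idd Vr Vb g])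
        also have "\<dots> = (\<integral>x. g x - indicator {x \<in> topspace (Intop T). Vunif \<delta> m x < q} x * g x \<partial>\<rho>)"
          by (rule Bochner_Integration.integral_cong) (auto simp: indicator_def)
        also have "\<dots> = (\<integral>x. g x \<partial>\<rho>) - (\<integral>x. indicator {x \<in> topspace (Intop T). Vunif \<delta> m x < q} x * g x \<partial>\<rho>)"
          using gi integrable_mult_indicator[OF VA gi] by simp
        finally show ?thesis .
      qed
      have R: "(\<integral>\<omega>. indicator {\<omega> \<in> space P1. q \<le> snd \<omega>} \<omega> * g (fst \<omega>) \<partial>P1) = (\<integral>x. g x \<partial>\<rho>) - q * (\<integral>x. g x \<partial>\<rho>)"
      proof -
        have "(\<integral>\<omega>. indicator {\<omega> \<in> space P1. q \<le> snd \<omega>} \<omega> * g (fst \<omega>) \<partial>P1) = (\<integral>\<omega>. of_bool (q \<le> cl (snd \<omega>)) * g (fst \<omega>) \<partial>N)"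
          unfolding P1_def by (rule distr_integral_indicator[OF zero_less_one rho prob_N fst_N clm clb g])
        also have "\<dots> = (\<integral>\<omega>. indicator {\<omega> \<in> space N. (\<lambda>_. q) (fst \<omega>) < snd \<omega>} \<omega> * g (fst \<omega>) \<partial>N)"
        proof (rule integral_cong_AE)
          have gN: "(\<lambda>\<omega>. g (fst \<omega>)) \<in> borel_measurable N" by (rule measurable_compose[OF fst_N(1) g])
          have "{\<omega> \<in> space N. q \<le> cl (snd \<omega>)} \<in> sets N" using clm by (simp only: borel_measurable_iff_ge)
          then have "(\<lambda>\<omega>. indicator {\<omega> \<in> space N. q \<le> cl (snd \<omega>)} \<omega> * g (fst \<omega>)) \<in> borel_measurable N"
            by (intro borel_measurable_times borel_measurable_indicator gN)
          then show "(\<lambda>\<omega>. of_bool (q \<le> cl (snd \<omega>)) * g (fst \<omega>)) \<in> borel_measurable N"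
            by (rule measurable_cong[THEN iffD1, rotated]) (simp add: indicator_def)
          have "{\<omega> \<in> space N. (\<lambda>_. q) (fst \<omega>) < snd \<omega>} \<in> sets N" by measurable
          then show "(\<lambda>\<omega>. indicator {\<omega> \<in> space N. (\<lambda>_. q) (fst \<omega>) < snd \<omega>} \<omega> * g (fst \<omega>)) \<in> borel_measurable N"
            by (intro borel_measurable_times borel_measurable_indicator gN)
          have "AE \<omega> in N. snd \<omega> \<noteq> q" by (rule AE_N_neq[of "\<lambda>_. q"]) simp
          then show "AE \<omega> in N. of_bool (q \<le> cl (snd \<omega>)) * g (fst \<omega>) = indicator {\<omega> \<in> space N. (\<lambda>_. q) (fst \<omega>) < snd \<omega>} \<omega> * g (fst \<omega>)"
            using AE_space by eventually_elim (use q in \<open>auto simp: cl_def indicator_def\<close>)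
        qed
        also have "\<dots> = (\<integral>x. g x * (1 - (\<lambda>_. q) x) \<partial>\<rho>)"
          by (rule integral_indicator_U01[OF prob_space_axioms _ _ gr C]) (use q in auto)
        also have "\<dots> = (\<integral>x. g x \<partial>\<rho>) - q * (\<integral>x. g x \<partial>\<rho>)" using gi by (simp add: right_diff_distrib mult.commute)
        finally show ?thesis .
      qed
      show "(\<lambda>m. \<integral>\<omega>. indicator {\<omega> \<in> space (Q1 m). q \<le> snd \<omega>} \<omega> * g (fst \<omega>) \<partial>Q1 m)
        \<longlonglongrightarrow> (\<integral>\<omega>. indicator {\<omega> \<in> space P1. q \<le> snd \<omega>} \<omega> * g (fst \<omega>) \<partial>P1)"
        unfolding L R by (intro tendsto_intros Vunif_mixing[OF T rho W \<delta> q gr C])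
    qed
    moreover have "(\<integral>p. Hf p \<partial>Q1 m) = (\<integral>p. f p \<partial>Q m)" for m
    proof -
      have fm: "f \<in> borel_measurable (borel_of Om)" by (rule continuous_map_borel_measurable[OF fc])
      have tm: "\<tau> m \<in> borel_measurable \<rho>" unfolding \<tau>_def by (rule ramp_stop_measurable[OF cr Vr])
      have "(\<integral>p. Hf p \<partial>Q1 m) = (\<integral>x. Hf (x, Vunif \<delta> m x) \<partial>\<rho>)" unfolding Q1_def by (rule cd1(2)[OF Hm])
      also have "\<dots> = (\<integral>x. f (x, \<tau> m x) \<partial>\<rho>)" by (simp add: Hf_def \<tau>_def)
      also have "\<dots> = (\<integral>p. f p \<partial>Q m)" unfolding Q_def
        by (rule coupling_distr(2)[OF T rho prob_space_axioms idm idd tm _ fm, symmetric]) (simp only: \<tau>_def ramp_stop_mem[OF T n])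
      finally show ?thesis .
    qed
    moreover have "(\<integral>p. Hf p \<partial>P1) = (\<integral>p. f p \<partial>Law (\<lambda>\<omega>. ramp_stop T n \<eta> (\<lambda>k. c k (fst \<omega>)) (snd \<omega>)))"
    proof -
      have "(\<integral>p. Hf p \<partial>P1) = (\<integral>\<omega>. Hf (fst \<omega>, cl (snd \<omega>)) \<partial>N)" unfolding P1_def by (rule cd2(2)[OF Hm])
      also have "\<dots> = (\<integral>\<omega>. f (fst \<omega>, ramp_stop T n \<eta> (\<lambda>k. c k (fst \<omega>)) (snd \<omega>)) \<partial>N)"
      proof (rule integral_cong_AE)
        show "(\<lambda>\<omega>. Hf (fst \<omega>, cl (snd \<omega>))) \<in> borel_measurable N"
          by (rule measurable_compose[OF measurable_into_prod_Itop[OF fst_N(1) clm clb] Hm])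
        show "(\<lambda>\<omega>. f (fst \<omega>, ramp_stop T n \<eta> (\<lambda>k. c k (fst \<omega>)) (snd \<omega>))) \<in> borel_measurable N"
          by (rule measurable_compose[OF measurable_into_prod_Itop[OF fst_N(1) \<theta>m \<theta>b] continuous_map_borel_measurable[OF fc]])
        show "AE \<omega> in N. Hf (fst \<omega>, cl (snd \<omega>)) = f (fst \<omega>, ramp_stop T n \<eta> (\<lambda>k. c k (fst \<omega>)) (snd \<omega>))"
          using AE_N_mem by eventually_elim (simp add: Hf_def cl_def)
      qed
      also have "\<dots> = (\<integral>p. f p \<partial>Law (\<lambda>\<omega>. ramp_stop T n \<eta> (\<lambda>k. c k (fst \<omega>)) (snd \<omega>)))" by (rule Law_integral[OF \<theta>m \<theta>b f, symmetric])
      finally show ?thesis .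
    qed
    ultimately show "(\<lambda>m. \<integral>p. f p \<partial>Q m) \<longlonglongrightarrow> (\<integral>p. f p \<partial>Law (\<lambda>\<omega>. ramp_stop T n \<eta> (\<lambda>k. c k (fst \<omega>)) (snd \<omega>)))" by simp
  qed
qed

end

section \<open>From ramps to step rules and to arbitrary laws\<close>

text \<open>Separately approximated thresholds need not be ordered. Running maxima order them
  everywhere and remain continuous and adapted; the limiting thresholds, being ordered almost
  surely, are left unchanged.\<close>

primrec runmax :: "(nat \<Rightarrow> real) \<Rightarrow> nat \<Rightarrow> real" where
  "runmax f 0 = 0"
| "runmax f (Suc k) = max (runmax f k) (f (Suc k))"

lemma runmax_eq:
  assumes "\<And>k. 1 \<le> k \<Longrightarrow> k < n \<Longrightarrow> 0 \<le> f k" "\<And>k. 1 \<le> k \<Longrightarrow> Suc k < n \<Longrightarrow> f k \<le> f (Suc k)" "1 \<le> k" "k < n"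
  shows "runmax f k = f k"
  using assms(3,4)
proof (induction k)
  case (Suc k)
  show ?case
  proof (cases "k = 0")
    case True then show ?thesis using assms(1)[of 1] Suc by auto
  next
    case False then show ?thesis using Suc assms(2)[of k] by auto
  qed
qed simp

lemma runmax_tendsto:
  assumes "\<And>i. 1 \<le> i \<Longrightarrow> i \<le> k \<Longrightarrow> (\<lambda>j. f j i) \<longlonglongrightarrow> g i"
  shows "(\<lambda>j. runmax (f j) k) \<longlonglongrightarrow> runmax g k"
  using assms by (induction k) (auto intro!: tendsto_max)

lemma runmax_continuous:
  assumes "\<And>i. 1 \<le> i \<Longrightarrow> i \<le> k \<Longrightarrow> continuous_map Y euclideanreal (f i)"
  shows "continuous_map Y euclideanreal (\<lambda>x. runmax (\<lambda>i. f i x) k)"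
  using assms by (induction k) (auto intro!: continuous_map_real_max)

lemma runmax_measurable:
  assumes "\<And>i. 1 \<le> i \<Longrightarrow> i \<le> k \<Longrightarrow> f i \<in> borel_measurable M"
  shows "(\<lambda>x. runmax (\<lambda>i. f i x) k) \<in> borel_measurable M"
  using assms by (induction k) auto

text \<open>L1 approximations with error 1 / (j + 1) converge in L1, and a subsequence converges
  almost everywhere.\<close>

lemma cont01_AE_approximation:
  assumes rho: "\<rho> \<in> Pspace X" and sub: "subalgebra \<rho> M" and gen: "cont_generated X M"
    and k: "k \<in> borel_measurable M" "\<And>x. x \<in> topspace X \<Longrightarrow> 0 \<le> k x \<and> k x \<le> 1"
  shows "\<exists>f. (\<forall>j. f j \<in> cont01 X M) \<and> (AE x in \<rho>. (\<lambda>j. f j x) \<longlonglongrightarrow> k x)"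
proof -
  interpret prob_space \<rho> using rho by (simp add: Pspace_iff)
  have sp: "space \<rho> = topspace X" by (rule space_Pspace[OF rho])
  have "\<forall>j. \<exists>f\<in>cont01 X M. (\<integral>x. \<bar>f x - k x\<bar> \<partial>\<rho>) < 1 / (real j + 1)"
    by (intro allI cont01_dense[OF rho sub gen k]) auto
  then obtain f where f: "\<And>j. f j \<in> cont01 X M" "\<And>j. (\<integral>x. \<bar>f j x - k x\<bar> \<partial>\<rho>) < 1 / (real j + 1)" by metis
  have fm: "f j \<in> borel_measurable \<rho>" for j using measurable_from_subalg[OF sub] f(1) by (auto simp: cont01_def)
  have km: "k \<in> borel_measurable \<rho>" using measurable_from_subalg[OF sub k(1)] .
  have i: "integrable \<rho> (\<lambda>x. f j x - k x)" for j
  proof (rule integrable_const_bound[where B=1])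
    show "AE x in \<rho>. norm (f j x - k x) \<le> 1"
    proof (rule AE_I2)
      fix x assume "x \<in> space \<rho>"
      then have "0 \<le> f j x" "f j x \<le> 1" "0 \<le> k x" "k x \<le> 1" using f(1)[of j] k(2)[of x] sp by (auto simp: cont01_def)
      then show "norm (f j x - k x) \<le> 1" by (simp add: abs_le_iff)
    qed
  qed (use fm km in measurable)
  have "(\<lambda>j. \<integral>x. norm (f j x - k x) \<partial>\<rho>) \<longlonglongrightarrow> 0"
  proof (rule real_tendsto_sandwich[where f="\<lambda>_. 0" and h="\<lambda>j. 1 / (real j + 1)"])
    show "(\<lambda>j. 1 / (real j + 1)) \<longlonglongrightarrow> 0" using LIMSEQ_inverse_real_of_nat by (simp add: inverse_eq_divide add.commute)
  qed (use f(2) in \<open>auto intro!: always_eventually less_imp_le\<close>)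
  from tendsto_L1_AE_subseq[OF i this] obtain r where "strict_mono r" "AE x in \<rho>. (\<lambda>j. f (r j) x - k x) \<longlonglongrightarrow> 0" by auto
  from this(2) have "AE x in \<rho>. (\<lambda>j. f (r j) x) \<longlonglongrightarrow> k x" by eventually_elim (simp add: Lim_null[symmetric])
  then show ?thesis using f(1) by (intro exI[of _ "\<lambda>j. f (r j)"]) auto
qed

context wiener_input
begin

text \<open>Continuous thresholds converge to \<kappa> while the ramps steepen, so the rules driven
  by the same uniform variable converge at every point where that variable meets none of the
  thresholds, hence almost surely, and the laws follow.\<close>

lemma step_Law_closure:
  assumes n: "1 \<le> n"
    and \<kappa>: "\<And>k. k \<in> {1..<n} \<Longrightarrow> \<kappa> k \<in> borel_measurable (MF T (real k * (T / real n)))"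
      "\<And>k x. k \<in> {1..<n} \<Longrightarrow> 0 \<le> \<kappa> k x \<and> \<kappa> k x \<le> 1"
      "\<And>k. 1 \<le> k \<Longrightarrow> Suc k < n \<Longrightarrow> AE x in \<rho>. \<kappa> k x \<le> \<kappa> (Suc k) x"
  shows "Law (\<lambda>\<omega>. T / real n + (T / real n) * (\<Sum>k=1..<n. of_bool (\<kappa> k (fst \<omega>) < snd \<omega>))) \<in> clR0"
proof -
  have d: "0 < T / real n" using T n by simp
  have "\<exists>f. k \<in> {1..<n} \<longrightarrow> (\<forall>j. f j \<in> cont01 (Intop T) (MF T (real k * (T / real n)))) \<and> (AE x in \<rho>. (\<lambda>j. f j x) \<longlonglongrightarrow> \<kappa> k x)" for k
  proof (cases "k \<in> {1..<n}")
    case True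
    have t0: "0 \<le> real k * (T / real n)" "0 \<le> T" using d T by simp_all
    have "subalgebra \<rho> (MF T (real k * (T / real n)))"
      using FBWmu_borel[OF t0] by (simp add: subalgebra_def)
    from cont01_AE_approximation[OF rho this cont_generated_MF[OF t0] \<kappa>(1)[OF True] \<kappa>(2)[OF True]] show ?thesis by blast
  qed blast
  then have "\<exists>f. \<forall>k. k \<in> {1..<n} \<longrightarrow> (\<forall>j. f k j \<in> cont01 (Intop T) (MF T (real k * (T / real n)))) \<and> (AE x in \<rho>. (\<lambda>j. f k j x) \<longlonglongrightarrow> \<kappa> k x)"
    by (intro choice allI)
  then obtain f where f: "\<And>k j. k \<in> {1..<n} \<Longrightarrow> f k j \<in> cont01 (Intop T) (MF T (real k * (T / real n)))"
    "\<And>k. k \<in> {1..<n} \<Longrightarrow> AE x in \<rho>. (\<lambda>j. f k j x) \<longlonglongrightarrow> \<kappa> k x" by blast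
  \<comment> \<open>At once the width of the ramps and the gap between consecutive thresholds, as
    \<open>ramp_stop_Law_closure\<close> demands; it vanishes in the limit.\<close>
  define \<eta> where "\<eta> j = 1 / (real j + 1)" for j
  have \<eta>: "0 < \<eta> j" for j by (simp add: \<eta>_def)
  have \<eta>0: "\<eta> \<longlonglongrightarrow> 0" unfolding \<eta>_def using LIMSEQ_inverse_real_of_nat by (simp add: inverse_eq_divide add.commute)
  \<comment> \<open>The running maximum orders the thresholds, and the term linear in k opens a gap
    \<open>\<eta> j\<close> between neighbours.\<close>
  define c where "c j k x = runmax (\<lambda>i. f i j x) k + real k * \<eta> j" for j k x
  have cm: "c j k \<in> borel_measurable (MF T (real k * (T / real n)))" if k: "k \<in> {1..<n}" for j k
    unfolding c_def
  proof (intro borel_measurable_add borel_measurable_const runmax_measurable)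
    fix i assume i: "1 \<le> i" "i \<le> k"
    then have "f i j \<in> borel_measurable (MF T (real i * (T / real n)))" using f(1)[of i j] k by (auto simp: cont01_def)
    then show "f i j \<in> borel_measurable (MF T (real k * (T / real n)))"
      by (rule MF_mono) (use i d T in \<open>auto intro!: divide_right_mono mult_right_mono\<close>)
  qed
  have ccont: "continuous_map (Intop T) euclideanreal (c j k)" if k: "k \<in> {1..<n}" for j k
    unfolding c_def
    by (intro continuous_map_add continuous_map_canonical_const runmax_continuous) (use f(1) k in \<open>auto simp: cont01_def\<close>)
  have csp: "c j k x + \<eta> j \<le> c j (Suc k) x" for j k x unfolding c_def by (simp add: algebra_simps)
  define \<theta>' where "\<theta>' j \<omega> = ramp_stop T n (\<eta> j) (\<lambda>k. c j k (fst \<omega>)) (snd \<omega>)" for j and \<omega> :: "inpt \<times> real"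
  define \<theta> where "\<theta> \<omega> = T / real n + (T / real n) * (\<Sum>k=1..<n. of_bool (\<kappa> k (fst \<omega>) < snd \<omega>))" for \<omega> :: "inpt \<times> real"
  have \<kappa>r: "\<kappa> k \<in> borel_measurable \<rho>" if "k \<in> {1..<n}" for k
    by (rule MF_rho[OF _ \<kappa>(1)[OF that]]) (use T in simp)
  have cr: "c j k \<in> borel_measurable \<rho>" if "k \<in> {1..<n}" for j k
    by (rule MF_rho[OF _ cm[OF that]]) (use T in simp)
  have m1: "\<theta>' j \<in> borel_measurable N" for j unfolding \<theta>'_def
    by (rule ramp_stop_measurable[OF measurable_compose[OF measurable_fst cr]]) measurable
  have b1: "\<theta>' j \<omega> \<in> {0..T}" for j \<omega> unfolding \<theta>'_def by (rule ramp_stop_mem[OF T n])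
  have m2: "\<theta> \<in> borel_measurable N"
  proof -
    have "(\<lambda>\<omega>. of_bool (\<kappa> k (fst \<omega>) < snd \<omega>) :: real) \<in> borel_measurable N" if "k \<in> {1..<n}" for k
    proof -
      note \<kappa>r[OF that, measurable]
      show ?thesis by measurable
    qed
    then show ?thesis unfolding \<theta>_def by (intro borel_measurable_add borel_measurable_times borel_measurable_const borel_measurable_sum)
  qed
  have b2: "\<theta> \<omega> \<in> {0..T}" for \<omega>
    using step_bounds[OF T n, of "\<lambda>k. of_bool (\<kappa> k (fst \<omega>) < snd \<omega>)"] d unfolding \<theta>_def by (auto intro: order_trans[rotated])
  have AE1: "AE x in \<rho>. \<forall>k\<in>{1..<n}. (\<lambda>j. f k j x) \<longlonglongrightarrow> \<kappa> k x" by (rule AE_finite_allI) (use f(2) in auto)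
  have AE2: "AE x in \<rho>. \<forall>k\<in>{k. 1 \<le> k \<and> Suc k < n}. \<kappa> k x \<le> \<kappa> (Suc k) x"
    by (rule AE_finite_allI) (use \<kappa>(3) in \<open>auto intro: finite_subset[of _ "{..n}"]\<close>)
  have AE3: "AE \<omega> in N. \<forall>k\<in>{1..<n}. snd \<omega> \<noteq> \<kappa> k (fst \<omega>)" by (rule AE_finite_allI) (use AE_N_neq[OF \<kappa>r] in auto)
  have lim: "AE \<omega> in N. (\<lambda>j. \<theta>' j \<omega>) \<longlonglongrightarrow> \<theta> \<omega>"
    using AE_N_fst[OF AE1] AE_N_fst[OF AE2] AE3
  proof eventually_elim
    case (elim \<omega>)
    have "(\<lambda>j. ramp ((snd \<omega> - c j k (fst \<omega>)) / \<eta> j)) \<longlonglongrightarrow> of_bool (\<kappa> k (fst \<omega>) < snd \<omega>)" if k: "k \<in> {1..<n}" for k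
    proof -
      have "(\<lambda>j. runmax (\<lambda>i. f i j (fst \<omega>)) k) \<longlonglongrightarrow> runmax (\<lambda>i. \<kappa> i (fst \<omega>)) k"
        by (rule runmax_tendsto) (use elim(1) k in auto)
      also have "runmax (\<lambda>i. \<kappa> i (fst \<omega>)) k = \<kappa> k (fst \<omega>)"
        by (rule runmax_eq[where n=n]) (use \<kappa>(2) elim(2) k in auto)
      finally have "(\<lambda>j. c j k (fst \<omega>)) \<longlonglongrightarrow> \<kappa> k (fst \<omega>) + real k * 0"
        unfolding c_def by (intro tendsto_intros \<eta>0)
      then have L: "(\<lambda>j. snd \<omega> - c j k (fst \<omega>)) \<longlonglongrightarrow> snd \<omega> - \<kappa> k (fst \<omega>)" by (intro tendsto_intros) simp
      show ?thesis
      proof (cases "\<kappa> k (fst \<omega>) < snd \<omega>")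
        case True
        \<comment> \<open>The ramp is completed only a width \<open>\<eta> j\<close> above the
          threshold, so that width is subtracted before comparing with 0.\<close>
        have "(\<lambda>j. (snd \<omega> - c j k (fst \<omega>)) - \<eta> j) \<longlonglongrightarrow> (snd \<omega> - \<kappa> k (fst \<omega>)) - 0" by (intro tendsto_diff L \<eta>0)
        then have "\<forall>\<^sub>F j in sequentially. 0 < (snd \<omega> - c j k (fst \<omega>)) - \<eta> j" by (rule order_tendstoD) (use True in simp)
        then have "\<forall>\<^sub>F j in sequentially. ramp ((snd \<omega> - c j k (fst \<omega>)) / \<eta> j) = of_bool (\<kappa> k (fst \<omega>) < snd \<omega>)"
        proof eventually_elim
          case (elim j)
          then have "1 \<le> (snd \<omega> - c j k (fst \<omega>)) / \<eta> j" using \<eta>[of j] by (simp add: pos_le_divide_eq)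
          then show ?case using True by (simp add: ramp)
        qed
        then show ?thesis by (rule tendsto_eventually)
      next
        case False
        then have "snd \<omega> - \<kappa> k (fst \<omega>) < 0" using elim(3) k by force
        from order_tendstoD(2)[OF L this]
        have "\<forall>\<^sub>F j in sequentially. ramp ((snd \<omega> - c j k (fst \<omega>)) / \<eta> j) = of_bool (\<kappa> k (fst \<omega>) < snd \<omega>)"
        proof eventually_elim
          case (elim j)
          then have "(snd \<omega> - c j k (fst \<omega>)) / \<eta> j \<le> 0" using \<eta>[of j] by (simp add: divide_nonpos_pos)
          then show ?case using False by (simp add: ramp)
        qed
        then show ?thesis by (rule tendsto_eventually)
      qed
    qed
    then show ?case unfolding \<theta>'_def \<theta>_def ramp_stop_def by (intro tendsto_intros)
  qed
  have "Law \<theta> \<in> clR0"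
  proof (rule weak_top_closure_sequentially)
    show "Law \<theta> \<in> Pspace Om" using Law_coupling[OF m2 b2] by (simp add: coupling_def)
    show "Law (\<theta>' j) \<in> clR0" for j unfolding \<theta>'_def
      by (rule ramp_stop_Law_closure[OF n \<eta>]) (use cm ccont csp in auto)
    show "(\<lambda>j. \<integral>p. f p \<partial>Law (\<theta>' j)) \<longlonglongrightarrow> (\<integral>p. f p \<partial>Law \<theta>)" if "f \<in> Cb Om" for f
      by (rule Law_tendsto[OF m1 b1 m2 b2 lim that])
  qed
  then show ?thesis unfolding \<theta>_def .
qed

text \<open>Stop at the first grid point after T / n whose predecessor threshold, an adapted density
  of {\<tau> < q}, is not exceeded by the uniform variable. This rule has the same grid sum as P, so
  the integrals differ by at most twice the oscillation error.\<close>

lemma Rset_subset_closure: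
  assumes PR: "P \<in> Rset T \<rho>" shows "P \<in> clR0"
proof -
  interpret R: input_coupling T \<rho> P by (rule Rset_coupling[OF T rho PR])
  have A: "{\<omega> \<in> space P. snd \<omega> < q} \<in> sets P" for q by measurable
  have "\<exists>k. 0 < q \<and> q < T \<longrightarrow> k \<in> borel_measurable (MF T q) \<and> (\<forall>x. 0 \<le> k x \<and> k x \<le> 1) \<and>
     (\<forall>g::inpt \<Rightarrow> real. integrable \<rho> g \<longrightarrow> (\<integral>\<omega>. indicator {\<omega> \<in> space P. snd \<omega> < q} \<omega> * g (fst \<omega>) \<partial>P) = (\<integral>x. k x * g x \<partial>\<rho>))" for q
  proof (cases "0 < q \<and> q < T")
    case True
    obtain k where k: "k \<in> borel_measurable \<rho>" "\<And>x. 0 \<le> k x \<and> k x \<le> (1::real)"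
      "\<And>g::inpt \<Rightarrow> real. integrable \<rho> g \<Longrightarrow> (\<integral>\<omega>. indicator {\<omega> \<in> space P. snd \<omega> < q} \<omega> * g (fst \<omega>) \<partial>P) = (\<integral>x. k x * g x \<partial>\<rho>)"
      using R.exists_density[OF A[of q]] by blast
    \<comment> \<open>Whether \<tau> < q is visible in \<tau> \<and> q, unlike whether \<tau> \<le>
      q; hence densities of strict events are adapted exactly at their own time.\<close>
    have e: "R.tau_event q {..<q} = {\<omega> \<in> space P. snd \<omega> < q}" by (auto simp: R.tau_event_def)
    have G: "R.sub_sigma (FBWmu T q)" by (rule R.sub_sigma_FBWmu) (use True in simp)
    have "R.indep_given {\<omega> \<in> space P. snd \<omega> < q} (FBWmu T q)"
      unfolding e[symmetric] using PR True unfolding R.Rset_iff by simp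
    then have "\<exists>z\<in>borel_measurable (MF T q). AE x in \<rho>. k x = z x" using R.indep_given_iff[OF A G k] by simp
    then obtain z where z: "z \<in> borel_measurable (MF T q)" "AE x in \<rho>. k x = z x" by blast
    \<comment> \<open>The adapted version agrees with the density only almost everywhere and may
      leave [0, 1]; truncation preserves adaptedness.\<close>
    define z' where "z' x = min 1 (max 0 (z x))" for x
    have z'm: "z' \<in> borel_measurable (MF T q)" unfolding z'_def using z(1) by measurable
    have z'r: "z' \<in> borel_measurable \<rho>" by (rule MF_rho[OF _ z'm]) (use True in simp)
    have z'eq: "AE x in \<rho>. k x = z' x" using z(2) by eventually_elim (use k(2) in \<open>simp add: z'_def min_def max_def\<close>, metis antisym)
    have "(\<integral>x. k x * g x \<partial>\<rho>) = (\<integral>x. z' x * g x \<partial>\<rho>)" if g: "integrable \<rho> g" for g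
    proof (rule integral_cong_AE)
      show "AE x in \<rho>. k x * g x = z' x * g x" using z'eq by eventually_elim simp
    qed (use k(1) z'r g in auto)
    then show ?thesis using k(3) z'm by (intro exI[of _ z']) (auto simp: z'_def)
  qed blast
  then have "\<exists>\<kappa>. \<forall>q. 0 < q \<and> q < T \<longrightarrow> \<kappa> q \<in> borel_measurable (MF T q) \<and> (\<forall>x. 0 \<le> \<kappa> q x \<and> \<kappa> q x \<le> 1) \<and>
     (\<forall>g::inpt \<Rightarrow> real. integrable \<rho> g \<longrightarrow> (\<integral>\<omega>. indicator {\<omega> \<in> space P. snd \<omega> < q} \<omega> * g (fst \<omega>) \<partial>P) = (\<integral>x. \<kappa> q x * g x \<partial>\<rho>))"
    by (intro choice allI)
  then obtain \<kappa> where H: "\<forall>q. 0 < q \<and> q < T \<longrightarrow> \<kappa> q \<in> borel_measurable (MF T q) \<and> (\<forall>x. 0 \<le> \<kappa> q x \<and> \<kappa> q x \<le> 1) \<and>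
     (\<forall>g::inpt \<Rightarrow> real. integrable \<rho> g \<longrightarrow> (\<integral>\<omega>. indicator {\<omega> \<in> space P. snd \<omega> < q} \<omega> * g (fst \<omega>) \<partial>P) = (\<integral>x. \<kappa> q x * g x \<partial>\<rho>))"
    by (rule exE)
  have \<kappa>: "\<kappa> q \<in> borel_measurable (MF T q)" "0 \<le> \<kappa> q x \<and> \<kappa> q x \<le> 1"
    "integrable \<rho> g \<Longrightarrow> (\<integral>\<omega>. indicator {\<omega> \<in> space P. snd \<omega> < q} \<omega> * g (fst \<omega>) \<partial>P) = (\<integral>x. \<kappa> q x * g x \<partial>\<rho>)"
    if "0 < q" "q < T" for q x and g :: "inpt \<Rightarrow> real"
  proof -
    note h = H[rule_format, OF conjI[OF that]]
    show "\<kappa> q \<in> borel_measurable (MF T q)" by (rule conjunct1[OF h])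
    show "0 \<le> \<kappa> q x \<and> \<kappa> q x \<le> 1" by (rule spec[OF conjunct1[OF conjunct2[OF h]]])
    show "integrable \<rho> g \<Longrightarrow> (\<integral>\<omega>. indicator {\<omega> \<in> space P. snd \<omega> < q} \<omega> * g (fst \<omega>) \<partial>P) = (\<integral>x. \<kappa> q x * g x \<partial>\<rho>)"
      by (rule mp[OF spec[OF conjunct2[OF conjunct2[OF h]]]])
  qed
  have \<kappa>r: "\<kappa> q \<in> borel_measurable \<rho>" if "0 < q" "q < T" for q by (rule MF_rho[OF _ \<kappa>(1)[OF that]]) (use that in simp)
  have \<kappa>i: "integrable \<rho> (\<kappa> q)" if "0 < q" "q < T" for q using \<kappa>r[OF that] \<kappa>(2)[OF that] by (rule integrable_01)
  have \<kappa>mono: "AE x in \<rho>. \<kappa> q x \<le> \<kappa> q' x" if q: "0 < q" "q \<le> q'" "q' < T" for q q'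
  proof (rule AE_le_of_set_integrals)
    show "integrable \<rho> (\<kappa> q)" "integrable \<rho> (\<kappa> q')" using \<kappa>i q by auto
    fix C assume C: "C \<in> sets \<rho>"
    have "(\<integral>x. indicator C x * \<kappa> q x \<partial>\<rho>) = measure P ({\<omega> \<in> space P. snd \<omega> < q} \<inter> fst -` C)" if "0 < q" "q < T" for q
      using R.measure_eq_integral[OF A C] \<kappa>(3)[OF that R.integrable_ind[OF C]] by (simp add: mult.commute)
    then have e: "(\<integral>x. indicator C x * \<kappa> q x \<partial>\<rho>) = measure P ({\<omega> \<in> space P. snd \<omega> < q} \<inter> fst -` C)"
      "(\<integral>x. indicator C x * \<kappa> q' x \<partial>\<rho>) = measure P ({\<omega> \<in> space P. snd \<omega> < q'} \<inter> fst -` C)" using q by auto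
    have "{\<omega> \<in> space P. snd \<omega> < q'} \<inter> fst -` C = {\<omega> \<in> space P. snd \<omega> < q'} \<inter> (fst -` C \<inter> space P)" by auto
    then have "{\<omega> \<in> space P. snd \<omega> < q'} \<inter> fst -` C \<in> sets P" using A measurable_sets[OF R.fst_meas_rho C] by auto
    then show "(\<integral>x. indicator C x * \<kappa> q x \<partial>\<rho>) \<le> (\<integral>x. indicator C x * \<kappa> q' x \<partial>\<rho>)"
      unfolding e by (rule R.P.finite_measure_mono[rotated]) (use q in auto)
  qed
  define \<theta> where "\<theta> n \<omega> = T / real n + (T / real n) * (\<Sum>k=1..<n. of_bool (\<kappa> (real k * (T / real n)) (fst \<omega>) < snd \<omega>))" for n and \<omega> :: "inpt \<times> real"
  have grid: "0 < real k * (T / real n)" "real k * (T / real n) < T" if "k \<in> {1..<n}" for k n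
    using D_bounds[OF grid_D[OF that]] by auto
  have gridle: "real k * (T / real n) \<le> real (Suc k) * (T / real n)" for k n using T by (intro mult_right_mono) auto
  have cl: "Law (\<theta> n) \<in> clR0" if n: "1 \<le> n" for n
    unfolding \<theta>_def
  proof (rule step_Law_closure[OF n])
    show "\<kappa> (real k * (T / real n)) \<in> borel_measurable (MF T (real k * (T / real n)))" if "k \<in> {1..<n}" for k
      using \<kappa>(1) grid[OF that] by blast
    show "0 \<le> \<kappa> (real k * (T / real n)) x \<and> \<kappa> (real k * (T / real n)) x \<le> 1" if "k \<in> {1..<n}" for k x
      using \<kappa>(2) grid[OF that] by blast
    show "AE x in \<rho>. \<kappa> (real k * (T / real n)) x \<le> \<kappa> (real (Suc k) * (T / real n)) x" if "1 \<le> k" "Suc k < n" for k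
      by (rule \<kappa>mono[OF grid(1) gridle grid(2)]) (use that in auto)
  qed
  have m: "\<theta> n \<in> borel_measurable N" for n
  proof -
    have "(\<lambda>\<omega>. of_bool (\<kappa> (real k * (T / real n)) (fst \<omega>) < snd \<omega>) :: real) \<in> borel_measurable N" if "k \<in> {1..<n}" for k
    proof -
      note \<kappa>r[OF grid[OF that], measurable]
      show ?thesis by measurable
    qed
    then show ?thesis unfolding \<theta>_def by (intro borel_measurable_add borel_measurable_times borel_measurable_const borel_measurable_sum)
  qed
  have b: "\<theta> n \<omega> \<in> {0..T}" if n: "1 \<le> n" for n \<omega>
  proof -
    have "0 \<le> T / real n" using T by simp
    then show ?thesis
      using step_bounds[OF T n, of "\<lambda>k. of_bool (\<kappa> (real k * (T / real n)) (fst \<omega>) < snd \<omega>)"] unfolding \<theta>_def by (auto intro: order_trans[rotated])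
  qed
  show ?thesis
  \<comment> \<open>The shift to \<open>Suc i\<close> leaves out the grid with n = 0.\<close>
  proof (rule weak_top_closure_sequentially[where Q="\<lambda>i. Law (\<theta> (Suc i))"])
    show "P \<in> Pspace Om" by (rule R.P)
    show "Law (\<theta> (Suc i)) \<in> clR0" for i by (rule cl) simp
    fix f assume fC: "f \<in> Cb Om"
    have f: "continuous_map Om euclideanreal f" using fC by (simp add: Cb_def)
    obtain B where B: "\<forall>p\<in>topspace Om. \<bar>f p\<bar> \<le> B" using Cb_obtain_bound[OF fC] by metis
    have key: "\<bar>(\<integral>p. f p \<partial>Law (\<theta> n)) - (\<integral>p. f p \<partial>P)\<bar> \<le> 2 * (\<integral>x. osc T f (T / real n) x \<partial>\<rho>)" if n: "1 \<le> n" for n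
    proof -
      have "\<bar>(\<integral>\<omega>. f (fst \<omega>, \<theta> n \<omega>) \<partial>N) - discretised_integral f n \<kappa>\<bar> \<le> (\<integral>x. osc T f (T / real n) x \<partial>\<rho>)"
      proof (rule discretisation_threshold[OF f B n])
        show "\<kappa> (real k * (T / real n)) \<in> borel_measurable \<rho>" if "k \<in> {1..<n}" for k using \<kappa>r grid[OF that] by blast
        show "0 \<le> \<kappa> (real k * (T / real n)) x \<and> \<kappa> (real k * (T / real n)) x \<le> 1" if "k \<in> {1..<n}" for k x
          using \<kappa>(2) grid[OF that] by blast
        show "AE x in \<rho>. \<kappa> (real k * (T / real n)) x \<le> \<kappa> (real (Suc k) * (T / real n)) x" if "1 \<le> k" "Suc k < n" for k
          by (rule \<kappa>mono[OF grid(1) gridle grid(2)]) (use that in auto)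
        \<comment> \<open>The rule takes its values on the grid, so the distance to be bounded is
          0.\<close>
        show "AE \<omega> in N. \<bar>\<theta> n \<omega> - real (1 + (\<Sum>i=1..<n. of_bool (\<kappa> (real i * (T / real n)) (fst \<omega>) < snd \<omega>))) * (T / real n)\<bar> \<le> T / real n"
        proof (rule AE_I2)
          fix \<omega>
          have "\<theta> n \<omega> = real (1 + (\<Sum>i=1..<n. of_bool (\<kappa> (real i * (T / real n)) (fst \<omega>) < snd \<omega>))) * (T / real n)"
            unfolding \<theta>_def by (simp only: of_nat_add of_nat_sum of_nat_1 of_nat_of_bool distrib_right mult_1 mult.commute[of "T / real n"])
          then show "\<bar>\<theta> n \<omega> - real (1 + (\<Sum>i=1..<n. of_bool (\<kappa> (real i * (T / real n)) (fst \<omega>) < snd \<omega>))) * (T / real n)\<bar> \<le> T / real n"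
            using T by (simp only: diff_self abs_zero) simp
        qed
      qed (use m b[OF n] in auto)
      moreover have "\<bar>(\<integral>p. f p \<partial>P) - discretised_integral f n \<kappa>\<bar> \<le> (\<integral>x. osc T f (T / real n) x \<partial>\<rho>)"
      proof -
        have "(\<integral>\<omega>. indicator {\<omega> \<in> space P. real i * (T / real n) \<le> snd \<omega>} \<omega> * grid_diff T f n i (fst \<omega>) \<partial>P) =
            (\<integral>x. grid_diff T f n i x * (1 - \<kappa> (real i * (T / real n)) x) \<partial>\<rho>)" if i: "i \<in> {1..<n}" for i
        proof (rule R.integral_indicator_ge)
          show gm: "grid_diff T f n i \<in> borel_measurable \<rho>" unfolding borel_rho by (rule grid_diff_props(1)[OF T f B]) (use i in auto)
          show gi: "integrable \<rho> (grid_diff T f n i)"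
            by (rule integrable_const_bound[where B="2*B"]) (use gm grid_diff_props(2)[OF T f B, of i n] i in auto)
          show "(\<integral>\<omega>. indicator {\<omega> \<in> space P. snd \<omega> < real i * (T / real n)} \<omega> * grid_diff T f n i (fst \<omega>) \<partial>P) =
            (\<integral>x. \<kappa> (real i * (T / real n)) x * grid_diff T f n i x \<partial>\<rho>)"
            by (rule \<kappa>(3)[OF grid[OF i] gi])
        qed (rule \<kappa>r[OF grid[OF i]] \<kappa>(2)[OF grid[OF i]])+
        then show ?thesis using discretisation_coupling[OF T f B R.coupling_axioms n] by (simp add: discretised_integral_def)
      qed
      ultimately show ?thesis unfolding Law_integral[OF m b[OF n] fC] by linarith
    qed
    have "(\<lambda>n. 2 * (\<integral>x. osc T f (T / real n) x \<partial>\<rho>)) \<longlonglongrightarrow> 2 * 0"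
      by (intro tendsto_intros osc_integral_tendsto[OF T f B rho])
    then have "(\<lambda>i. 2 * (\<integral>x. osc T f (T / real (Suc i)) x \<partial>\<rho>)) \<longlonglongrightarrow> 0" by (auto dest: LIMSEQ_Suc)
    then have "(\<lambda>i. (\<integral>p. f p \<partial>Law (\<theta> (Suc i))) - (\<integral>p. f p \<partial>P)) \<longlonglongrightarrow> 0"
      by (rule Lim_null_comparison[rotated]) (intro always_eventually allI, simp only: real_norm_def, rule key, simp)
    then show "(\<lambda>i. \<integral>p. f p \<partial>Law (\<theta> (Suc i))) \<longlonglongrightarrow> (\<integral>p. f p \<partial>P)" by (simp add: Lim_null[symmetric])
  qed
qed

end

theorem mainTheorem11:
  fixes T :: real and \<rho> :: "inpt measure"
  assumes "0 < T"
    and "\<rho> \<in> Pspace (Intop T)"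
    and "wiener2 T \<rho>"
  shows "convex_meas (Rplus T \<rho>)
       \<and> compactin (weak_top (Omtop T)) (Rplus T \<rho>)
       \<and> (weak_top (Omtop T)) closure_of (R0 T \<rho>) = Rplus T \<rho>
       \<and> Rplus T \<rho> = Rset T \<rho>"
proof -
  interpret wiener_input T \<rho> by unfold_locales fact+
  have "(weak_top (Omtop T)) closure_of (R0 T \<rho>) \<subseteq> Rset T \<rho>"
    by (rule closure_of_minimal[OF R0_subset_Rset closedin_Rset]) fact+
  moreover have "Rset T \<rho> \<subseteq> (weak_top (Omtop T)) closure_of (R0 T \<rho>)"
    using Rset_subset_closure unfolding Omtop_prod by blast
  ultimately show ?thesis
    unfolding Rplus_eq_Rset[OF assms(1,2)] using convex_Rset[OF assms(1,2)] compactin_Rset[OF assms(1,2)] by blast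
qed

end
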